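(* Let $(N^n,g)$ be a closed Riemannian manifold with average scalar curvature $\overline R$. Then the average over $SN$ of the mean curvature of the geodesic spheres of radius $r$ in $N$ satisfies $$\frac{1}{\mu_{SN}(SN)}\int_{SN}H(p,r,\theta)\,d\mu_{SN}(p,\theta)\le\frac{n-1}{r}-\frac{\overline R}{3n}\,r$$ for any $r>0$ which is smaller than the injectivity radius of $N$. If the equality holds for some $r$, then $(N,g)$ is flat.
   Context: All Riemannian manifolds are complete, smooth and oriented, with smooth metric. $SN$ is the unit sphere bundle of $N$ with canonical measure $d\mu_{SN}=d\theta\,d\mu_N$, where $d\theta$ is the standard measure on $S_pN\cong\mathbb S^{n-1}$. $H(p,r,\theta)$ is the mean curvature (sum of the principal curvatures, with sign such that Euclidean spheres of radius $r$ have mean curvature $\frac{n-1}{r}$) at the point $\exp_p(r\theta)$ of the geodesic sphere of radius $r$ centered at $p$. $\overline R=\frac1{|N|}\int_N R\,d\mu_N$, where $R$ is the scalar curvature and $|N|$ the volume of $N$. *)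

theory Defs
  imports "HOL-Analysis.Analysis"
begin

section \<open>Oriented smooth manifolds\<close>

text \<open>
  A chart is a pair of its domain and its coordinate map.  The manifold is the whole carrier
  type, and its dimension is the cardinality of the index type \<open>'n\<close> of the coordinates.
\<close>

type_synonym ('a, 'n) chart = "'a set \<times> ('a \<Rightarrow> (real, 'n) vec)"

definition chart_inv :: "('a, 'n::finite) chart \<Rightarrow> real^'n \<Rightarrow> 'a" where
  "chart_inv c = inv_into (fst c) (snd c)"

text \<open>Functions of class \<open>C\<^sup>k\<close> and \<open>C\<^sup>\<infinity>\<close>; used for open subsets of Euclidean spaces only.\<close>

primrec Ck_on :: "nat \<Rightarrow> 'a::euclidean_space set \<Rightarrow> ('a \<Rightarrow> 'b::euclidean_space) \<Rightarrow> bool" where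
  "Ck_on 0 S f \<longleftrightarrow> continuous_on S f"
| "Ck_on (Suc k) S f \<longleftrightarrow> (\<forall>x\<in>S. f differentiable at x) \<and>
     (\<forall>v. Ck_on k S (\<lambda>x. frechet_derivative f (at x) v))"

definition smooth_on :: "'a::euclidean_space set \<Rightarrow> ('a \<Rightarrow> 'b::euclidean_space) \<Rightarrow> bool" where
  "smooth_on S f \<longleftrightarrow> (\<forall>k. Ck_on k S f)"

definition oriented_smooth_atlas ::
    "('a::{t2_space,second_countable_topology}, 'n::finite) chart set \<Rightarrow> bool" where
  "oriented_smooth_atlas A \<longleftrightarrow>
     (\<Union>c\<in>A. fst c) = UNIV \<and>
     (\<forall>c\<in>A. open (fst c) \<and> open (snd c ` fst c) \<and>
        homeomorphism (fst c) (snd c ` fst c) (snd c) (chart_inv c)) \<and>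
     (\<forall>c\<in>A. \<forall>d\<in>A. smooth_on (snd c ` (fst c \<inter> fst d)) (snd d \<circ> chart_inv c) \<and>
        (\<forall>x\<in>snd c ` (fst c \<inter> fst d).
           det (matrix (frechet_derivative (snd d \<circ> chart_inv c) (at x))) > 0))"

section \<open>Tangent vectors\<close>

text \<open>
  A tangent vector at \<open>p\<close> is the family of its coordinate vectors in all charts of the atlas
  around \<open>p\<close>; these are related by the differentials of the transition maps.  The entries at
  all other charts are set to \<open>0\<close> to make the representation unique.
\<close>

type_synonym ('a, 'n) tangent_vector = "('a, 'n) chart \<Rightarrow> (real, 'n) vec"

definition tangent_space ::
    "('a, 'n::finite) chart set \<Rightarrow> 'a \<Rightarrow> ('a, 'n) tangent_vector set" where
  "tangent_space A p = {v.
     (\<forall>c. \<not> (c \<in> A \<and> p \<in> fst c) \<longrightarrow> v c = 0) \<and>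
     (\<forall>c\<in>A. \<forall>d\<in>A. p \<in> fst c \<inter> fst d \<longrightarrow>
        v d = frechet_derivative (snd d \<circ> chart_inv c) (at (snd c p)) (v c))}"

text \<open>The differential at \<open>x\<close> of a map \<open>F\<close> from a vector space into the manifold.\<close>

definition tangent_map ::
    "('a, 'n::finite) chart set \<Rightarrow> ('m::real_normed_vector \<Rightarrow> 'a) \<Rightarrow> 'm \<Rightarrow> 'm \<Rightarrow>
     ('a, 'n) tangent_vector" where
  "tangent_map A F x w =
     (\<lambda>c. if c \<in> A \<and> F x \<in> fst c then frechet_derivative (snd c \<circ> F) (at x) w else 0)"

text \<open>The tangent vector at \<open>chart_inv c x\<close> with coordinate vector \<open>u\<close> in the chart \<open>c\<close>.\<close>

definition coord_vector ::
    "('a, 'n::finite) chart set \<Rightarrow> ('a, 'n) chart \<Rightarrow> real^'n \<Rightarrow> real^'n \<Rightarrow>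
     ('a, 'n) tangent_vector" where
  "coord_vector A c x u = tangent_map A (chart_inv c) x u"

definition velocity ::
    "('a, 'n::finite) chart set \<Rightarrow> (real \<Rightarrow> 'a) \<Rightarrow> real \<Rightarrow> ('a, 'n) tangent_vector" where
  "velocity A \<gamma> t = tangent_map A \<gamma> t 1"

section \<open>Riemannian metrics\<close>

type_synonym ('a, 'n) metric_tensor =
  "'a \<Rightarrow> ('a, 'n) tangent_vector \<Rightarrow> ('a, 'n) tangent_vector \<Rightarrow> real"

definition metric_matrix ::
    "('a, 'n::finite) chart set \<Rightarrow> ('a, 'n) metric_tensor \<Rightarrow> ('a, 'n) chart \<Rightarrow> real^'n \<Rightarrow>
     real^'n^'n" where
  "metric_matrix A g c x =
     (\<chi> i j. g (chart_inv c x) (coord_vector A c x (axis i 1)) (coord_vector A c x (axis j 1)))"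

text \<open>Only the values of \<open>g p\<close> on the tangent space at \<open>p\<close> matter.\<close>

definition riemannian_metric ::
    "('a, 'n::finite) chart set \<Rightarrow> ('a, 'n) metric_tensor \<Rightarrow> bool" where
  "riemannian_metric A g \<longleftrightarrow>
     (\<forall>c\<in>A. \<forall>x\<in>snd c ` fst c.
        bilinear (\<lambda>u w. g (chart_inv c x) (coord_vector A c x u) (coord_vector A c x w))) \<and>
     (\<forall>p. \<forall>v\<in>tangent_space A p. \<forall>w\<in>tangent_space A p. g p v w = g p w v) \<and>
     (\<forall>p. \<forall>v\<in>tangent_space A p. v \<noteq> (\<lambda>_. 0) \<longrightarrow> g p v v > 0) \<and>
     (\<forall>c\<in>A. smooth_on (snd c ` fst c) (metric_matrix A g c))"

text \<open>
  A linear isometry of Euclidean space onto the tangent space at \<open>p\<close> (a \<open>g\<close>-orthonormal basis).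
  Nothing below depends on which one is chosen.
\<close>

definition frame ::
    "('a, 'n::finite) chart set \<Rightarrow> ('a, 'n) metric_tensor \<Rightarrow> 'a \<Rightarrow> real^'n \<Rightarrow>
     ('a, 'n) tangent_vector" where
  "frame A g p = (SOME L.
     (\<forall>x. L x \<in> tangent_space A p) \<and> (\<forall>c. linear (\<lambda>x. L x c)) \<and>
     (\<forall>x y. g p (L x) (L y) = x \<bullet> y))"

section \<open>Levi-Civita connection and curvature\<close>

definition partial :: "'n::finite \<Rightarrow> (real^'n \<Rightarrow> real) \<Rightarrow> real^'n \<Rightarrow> real" where
  "partial i f x = frechet_derivative f (at x) (axis i 1)"

text \<open>
  \<open>christoffel A g c k i j\<close> is the Christoffel symbol with upper index \<open>k\<close> and lower indices
  \<open>i\<close>, \<open>j\<close>, as a function of the coordinates of the chart \<open>c\<close>.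
\<close>

definition christoffel ::
    "('a, 'n::finite) chart set \<Rightarrow> ('a, 'n) metric_tensor \<Rightarrow> ('a, 'n) chart \<Rightarrow>
     'n \<Rightarrow> 'n \<Rightarrow> 'n \<Rightarrow> real^'n \<Rightarrow> real" where
  "christoffel A g c k i j x = (1/2) * (\<Sum>l\<in>UNIV. matrix_inv (metric_matrix A g c x) $ k $ l *
     (partial i (\<lambda>y. metric_matrix A g c y $ j $ l) x +
      partial j (\<lambda>y. metric_matrix A g c y $ i $ l) x -
      partial l (\<lambda>y. metric_matrix A g c y $ i $ j) x))"

text \<open>
  The covariant derivative at \<open>x\<close>, in the direction \<open>w\<close>, of a vector field \<open>V\<close> along a map \<open>F\<close>
  into the manifold.
\<close>

definition covariant_derivative ::
    "('a, 'n::finite) chart set \<Rightarrow> ('a, 'n) metric_tensor \<Rightarrow> ('m::real_normed_vector \<Rightarrow> 'a) \<Rightarrow>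
     ('m \<Rightarrow> ('a, 'n) tangent_vector) \<Rightarrow> 'm \<Rightarrow> 'm \<Rightarrow> ('a, 'n) tangent_vector" where
  "covariant_derivative A g F V x w =
     (\<lambda>c. if c \<in> A \<and> F x \<in> fst c
        then frechet_derivative (\<lambda>y. V y c) (at x) w +
          (\<chi> k. \<Sum>i\<in>UNIV. \<Sum>j\<in>UNIV. christoffel A g c k i j (snd c (F x)) *
             tangent_map A F x w c $ i * V x c $ j)
        else 0)"

text \<open>
  \<open>riemann A g c l i j k\<close> is the coefficient of the \<open>l\<close>-th coordinate field in
  \<open>R(\<partial>\<^sub>i, \<partial>\<^sub>j)\<partial>\<^sub>k\<close>, where
  \<open>R(X, Y)Z = \<nabla>\<^sub>X\<nabla>\<^sub>YZ - \<nabla>\<^sub>Y\<nabla>\<^sub>XZ - \<nabla>\<^bsub>[X,Y]\<^esub>Z\<close>.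
\<close>

definition riemann ::
    "('a, 'n::finite) chart set \<Rightarrow> ('a, 'n) metric_tensor \<Rightarrow> ('a, 'n) chart \<Rightarrow>
     'n \<Rightarrow> 'n \<Rightarrow> 'n \<Rightarrow> 'n \<Rightarrow> real^'n \<Rightarrow> real" where
  "riemann A g c l i j k x =
     partial i (christoffel A g c l j k) x - partial j (christoffel A g c l i k) x +
     (\<Sum>m\<in>UNIV. christoffel A g c l i m x * christoffel A g c m j k x -
                christoffel A g c l j m x * christoffel A g c m i k x)"

definition ricci ::
    "('a, 'n::finite) chart set \<Rightarrow> ('a, 'n) metric_tensor \<Rightarrow> ('a, 'n) chart \<Rightarrow>
     'n \<Rightarrow> 'n \<Rightarrow> real^'n \<Rightarrow> real" where
  "ricci A g c j k x = (\<Sum>i\<in>UNIV. riemann A g c i i j k x)"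

definition scalar_curvature ::
    "('a, 'n::finite) chart set \<Rightarrow> ('a, 'n) metric_tensor \<Rightarrow> 'a \<Rightarrow> real" where
  "scalar_curvature A g p =
     (let c = (SOME c. c \<in> A \<and> p \<in> fst c); x = snd c p
      in \<Sum>j\<in>UNIV. \<Sum>k\<in>UNIV. matrix_inv (metric_matrix A g c x) $ j $ k * ricci A g c j k x)"

definition flat :: "('a, 'n::finite) chart set \<Rightarrow> ('a, 'n) metric_tensor \<Rightarrow> bool" where
  "flat A g \<longleftrightarrow> (\<forall>c\<in>A. \<forall>x\<in>snd c ` fst c. \<forall>l i j k. riemann A g c l i j k x = 0)"

section \<open>Geodesics, exponential map and injectivity radius\<close>

definition geodesic ::
    "('a::topological_space, 'n::finite) chart set \<Rightarrow> ('a, 'n) metric_tensor \<Rightarrow>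
     (real \<Rightarrow> 'a) \<Rightarrow> bool" where
  "geodesic A g \<gamma> \<longleftrightarrow> continuous_on UNIV \<gamma> \<and>
     (\<forall>t. \<forall>c\<in>A. \<gamma> t \<in> fst c \<longrightarrow>
        (snd c \<circ> \<gamma>) differentiable at t \<and> (\<lambda>s. velocity A \<gamma> s c) differentiable at t) \<and>
     (\<forall>t. covariant_derivative A g \<gamma> (velocity A \<gamma>) t 1 = (\<lambda>_. 0))"

definition geodesically_complete ::
    "('a::topological_space, 'n::finite) chart set \<Rightarrow> ('a, 'n) metric_tensor \<Rightarrow> bool" where
  "geodesically_complete A g \<longleftrightarrow>
     (\<forall>p. \<forall>v\<in>tangent_space A p. \<exists>\<gamma>. geodesic A g \<gamma> \<and> \<gamma> 0 = p \<and> velocity A \<gamma> 0 = v)"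

definition exp_map ::
    "('a::topological_space, 'n::finite) chart set \<Rightarrow> ('a, 'n) metric_tensor \<Rightarrow>
     'a \<Rightarrow> ('a, 'n) tangent_vector \<Rightarrow> 'a" where
  "exp_map A g p v = (THE \<gamma>. geodesic A g \<gamma> \<and> \<gamma> 0 = p \<and> velocity A \<gamma> 0 = v) 1"

text \<open>
  The exponential map at \<open>p\<close> is a diffeomorphism of the open ball of radius \<open>\<rho>\<close> in the tangent
  space onto an open subset of the manifold.
\<close>

definition exp_diffeomorphism ::
    "('a::topological_space, 'n::finite) chart set \<Rightarrow> ('a, 'n) metric_tensor \<Rightarrow>
     'a \<Rightarrow> real \<Rightarrow> bool" where
  "exp_diffeomorphism A g p \<rho> \<longleftrightarrow>
     (let B = ball 0 \<rho>; E = (\<lambda>x. exp_map A g p (frame A g p x))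
      in inj_on E B \<and> continuous_on B E \<and> open (E ` B) \<and>
         (\<forall>c\<in>A. smooth_on {x\<in>B. E x \<in> fst c} (snd c \<circ> E) \<and>
                smooth_on (snd c ` (fst c \<inter> E ` B)) (inv_into B E \<circ> chart_inv c)))"

definition injectivity_radius ::
    "('a::topological_space, 'n::finite) chart set \<Rightarrow> ('a, 'n) metric_tensor \<Rightarrow> ereal" where
  "injectivity_radius A g = (INF p. Sup {ereal \<rho> | \<rho>. \<rho> > 0 \<and> exp_diffeomorphism A g p \<rho>})"

section \<open>Mean curvature of geodesic spheres\<close>

text \<open>
  The geodesic sphere of radius \<open>r\<close> about \<open>p\<close> is parametrized by the Euclidean unit sphere; the
  parametrization is extended to all nonzero \<open>x\<close> so as to be constant along rays.  Its
  differential at a unit vector \<open>x\<close> therefore has to be restricted to the vectors orthogonal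
  to \<open>x\<close>.
\<close>

definition geodesic_sphere_param ::
    "('a::topological_space, 'n::finite) chart set \<Rightarrow> ('a, 'n) metric_tensor \<Rightarrow>
     'a \<Rightarrow> real \<Rightarrow> real^'n \<Rightarrow> 'a" where
  "geodesic_sphere_param A g p r x = exp_map A g p (frame A g p ((r / norm x) *\<^sub>R x))"

text \<open>
  The unit normal that makes an acute angle with the radial geodesic.  The shape operator is
  taken to be the covariant derivative of this normal, so that Euclidean spheres of radius \<open>r\<close>
  have all principal curvatures equal to \<open>1/r\<close>.
\<close>

definition outer_unit_normal ::
    "('a::topological_space, 'n::finite) chart set \<Rightarrow> ('a, 'n) metric_tensor \<Rightarrow>
     'a \<Rightarrow> real \<Rightarrow> real^'n \<Rightarrow> ('a, 'n) tangent_vector" where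
  "outer_unit_normal A g p r x =
     (let F = geodesic_sphere_param A g p r; q = F x
      in THE \<nu>. \<nu> \<in> tangent_space A q \<and> g q \<nu> \<nu> = 1 \<and>
           (\<forall>w. w \<bullet> x = 0 \<longrightarrow> g q \<nu> (tangent_map A F x w) = 0) \<and>
           g q \<nu> (velocity A (\<lambda>s. exp_map A g p (frame A g p (s *\<^sub>R x))) (r / norm x)) > 0)"

text \<open>
  The eigenspace of the shape operator for \<open>\<kappa>\<close>, pulled back to the tangent space of the
  Euclidean unit sphere at \<open>x\<close>.
\<close>

definition principal_space ::
    "('a::topological_space, 'n::finite) chart set \<Rightarrow> ('a, 'n) metric_tensor \<Rightarrow>
     'a \<Rightarrow> real \<Rightarrow> real^'n \<Rightarrow> real \<Rightarrow> (real^'n) set" where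
  "principal_space A g p r x \<kappa> =
     (let F = geodesic_sphere_param A g p r
      in {w. w \<bullet> x = 0 \<and>
           covariant_derivative A g F (outer_unit_normal A g p r) x w =
             (\<lambda>c. \<kappa> *\<^sub>R tangent_map A F x w c)})"

text \<open>
  The sum of the principal curvatures, counted with multiplicity, of the geodesic sphere of
  radius \<open>r\<close> about \<open>p\<close> at its point in the direction of the unit tangent vector \<open>\<theta>\<close>.
\<close>

definition mean_curvature ::
    "('a::topological_space, 'n::finite) chart set \<Rightarrow> ('a, 'n) metric_tensor \<Rightarrow>
     'a \<Rightarrow> real \<Rightarrow> ('a, 'n) tangent_vector \<Rightarrow> real" where
  "mean_curvature A g p r \<theta> =
     (let x = inv (frame A g p) \<theta>
      in \<Sum>\<kappa> | \<exists>w\<in>principal_space A g p r x \<kappa>. w \<noteq> 0.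
           real (dim (principal_space A g p r x \<kappa>)) * \<kappa>)"

section \<open>The canonical measures\<close>

text \<open>
  The Riemannian volume measure: the Borel measure with density \<open>sqrt (det g)\<close> in every chart.
\<close>

definition volume_measure ::
    "('a::topological_space, 'n::finite) chart set \<Rightarrow> ('a, 'n) metric_tensor \<Rightarrow> 'a measure" where
  "volume_measure A g = (THE \<mu>. sets \<mu> = sets borel \<and>
     (\<forall>c\<in>A. \<forall>S\<in>sets borel. S \<subseteq> fst c \<longrightarrow>
        emeasure \<mu> S =
          (\<integral>\<^sup>+x. ennreal (sqrt (det (metric_matrix A g c x))) * indicator (snd c ` S) x \<partial>lborel)))"

text \<open>
  The surface measure of the Euclidean unit sphere.  Polar coordinates give it as \<open>n\<close> times the
  Lebesgue measure of the cone \<open>{t x | 0 < t < 1}\<close> over a set of unit vectors \<open>x\<close>.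
\<close>

definition unit_sphere_measure :: "(real^'n::finite) measure" where
  "unit_sphere_measure = scale_measure (of_nat CARD('n))
     (distr (restrict_space lborel (ball 0 1 - {0})) (restrict_space borel (sphere 0 1)) sgn)"

definition unit_sphere_bundle ::
    "('a, 'n::finite) chart set \<Rightarrow> ('a, 'n) metric_tensor \<Rightarrow>
     ('a \<times> ('a, 'n) tangent_vector) set" where
  "unit_sphere_bundle A g = {(p, v). v \<in> tangent_space A p \<and> g p v v = 1}"

text \<open>
  The product of the volume measure with the surface measures of the unit tangent spheres, on
  the Borel sets of the unit sphere bundle; the generators are the open sets over the charts.
\<close>

definition sphere_bundle_measure ::
    "('a::topological_space, 'n::finite) chart set \<Rightarrow> ('a, 'n) metric_tensor \<Rightarrow>
     ('a \<times> ('a, 'n) tangent_vector) measure" where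
  "sphere_bundle_measure A g = measure_of (unit_sphere_bundle A g)
     {{(p, v) \<in> unit_sphere_bundle A g. p \<in> fst c \<and> (snd c p, v c) \<in> W} | c W.
        c \<in> A \<and> open (W :: ((real^'n) \<times> (real^'n)) set)}
     (\<lambda>E. \<integral>\<^sup>+p. emeasure unit_sphere_measure {x \<in> sphere 0 1. (p, frame A g p x) \<in> E}
        \<partial>volume_measure A g)"

definition average_scalar_curvature ::
    "('a::topological_space, 'n::finite) chart set \<Rightarrow> ('a, 'n) metric_tensor \<Rightarrow> real" where
  "average_scalar_curvature A g =
     1 / measure (volume_measure A g) UNIV *
     (LINT p|volume_measure A g. scalar_curvature A g p)"

definition average_mean_curvature ::
    "('a::topological_space, 'n::finite) chart set \<Rightarrow> ('a, 'n) metric_tensor \<Rightarrow> real \<Rightarrow> real" where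
  "average_mean_curvature A g r =
     1 / measure (sphere_bundle_measure A g) (unit_sphere_bundle A g) *
     (LINT (p, \<theta>)|sphere_bundle_measure A g. mean_curvature A g p r \<theta>)"

end

theory Submission
  imports Defs
begin

text \<open>
  Let \<open>E\<close> be the shape operator of a geodesic sphere minus \<open>1/s\<close> times the identity, along a unit
  speed geodesic from \<open>p\<close> in direction \<open>\<theta>\<close>.  The trace of the Riccati equation is
  \<open>(s^2 tr E)' = - s^2 |E|^2 - s^2 Ric(\<gamma>'(s))\<close>, hence
  \<open>H(p, r, \<theta>) \<le> (n - 1)/r - r^{-2} \<integral> s^2 Ric(\<gamma>'(s)) ds\<close>, integrated over \<open>0 < s < r\<close>.  The geodesic flow preserves
  the measure of the sphere bundle, so the average of \<open>Ric(\<gamma>'(s))\<close> does not depend on \<open>s\<close>; it is the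
  average of \<open>R/n\<close>, and \<open>\<integral> s^2 ds = r^3/3\<close>.  For equality \<open>E\<close> vanishes, so \<open>R(\<theta>', \<theta>)\<theta> = 0\<close> for all
  \<open>\<theta>\<close>, and polarisation with the Bianchi identity gives \<open>R = 0\<close>.

  Below the injectivity radius, invariance under the flow needs no symplectic geometry: in normal
  coordinates about \<open>p\<close> the integrals over the bundle become integrals over pairs \<open>(p, q)\<close>, and the
  volume density of these coordinates is symmetric in \<open>p\<close> and \<open>q\<close>.
\<close>

text \<open>Shape operators of spheres enter through \<open>shp\<close>, which is \<open>s E\<close>
  at distance \<open>s\<close> and extends smoothly over the centre, so that integrals along rays
  start at 0 without boundary terms. A radius \<open>r'\<close> strictly between \<open>r\<close>
  and the injectivity radius stays fixed: as the normal coordinates reach beyond \<open>r\<close>,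
  comparison bounds \<open>H\<close> from below as well, which makes \<open>H\<close> integrable;
  otherwise its Bochner integral would be 0 by convention. Adding a Ricci bound \<open>C\<close>
  makes all integrands nonnegative, so Tonelli's theorem applies at once.

  The main obstacle is measurability. Orthonormal frames are chosen by \<open>SOME\<close> and vary
  with the point without control, and the exponential map is shown to depend continuously, not
  smoothly, on its base point. Hence functions on the bundle are rewritten in the coordinates of a
  Borel choice \<open>ch\<close> of charts, derivatives become limits of difference quotients, and
  only quantities invariant under change of basis are formed: lengths, determinant ratios, traces.
  In the equality case the identities hold almost everywhere first; continuity in direction and
  point removes the null sets.\<close>

lemmas mv_scaleR = matrix_vector_mult_scaleR

notation scaleR (infixr "*R" 75)

abbreviation nn_lborel :: "('a::euclidean_space => ennreal) => ennreal" (binder "LBNN " 10) where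
 "nn_lborel f \<equiv> nn_integral lborel f"

abbreviation dd :: "('a::euclidean_space => 'b::euclidean_space) => 'a => 'a => 'b" where
 "dd f x \<equiv> frechet_derivative f (at x)"

section \<open>Calculus of smooth maps\<close>

lemma dd_eqI: "(f has_derivative f') (at x) ==> dd f x = f'"
 using frechet_derivative_at by metis

lemma dd_cong_open:
 assumes "open S" "x \<in> S" "\<And>y. y \<in> S ==> f y = g y"
 shows "dd f x = dd g x"
proof -
 have "(f has_derivative D) (at x) \<longleftrightarrow> (g has_derivative D) (at x)" for D
  using has_derivative_transform_within_open[OF _ assms(1,2)] assms(3) by metis
 thus ?thesis
  unfolding frechet_derivative_def by simp
qed

lemma differentiable_cong_open:
 assumes "open S" "x \<in> S" "\<And>y. y \<in> S ==> f y = g y"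
 shows "f differentiable at x \<longleftrightarrow> g differentiable at x"
 using has_derivative_transform_within_open[OF _ assms(1,2)] assms(3)
 unfolding differentiable_def by metis

lemma Ck_on_cong:
 assumes "open S" "\<And>y. y \<in> S ==> f y = g y"
 shows "Ck_on k S f \<longleftrightarrow> Ck_on k S g"
 using assms(2)
proof (induction k arbitrary: f g)
 case 0
 thus ?case by (simp cong: continuous_on_cong)
next
 case (Suc k)
 have "Ck_on k S (\<lambda>x. dd f x v) \<longleftrightarrow> Ck_on k S (\<lambda>x. dd g x v)" for v
  using dd_cong_open[OF assms(1) _ Suc.prems] by (intro Suc.IH) simp
 thus ?case
  using differentiable_cong_open[OF assms(1) _ Suc.prems] by simp
qed

lemma smooth_on_cong:
 assumes "open S" "\<And>y. y \<in> S ==> f y = g y"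
 shows "smooth_on S f \<longleftrightarrow> smooth_on S g"
 unfolding smooth_on_def using Ck_on_cong[OF assms] by simp

lemma Ck_on_subset: "Ck_on k S f ==> T \<subseteq> S ==> Ck_on k T f"
 by (induction k arbitrary: f) (auto intro: continuous_on_subset)

lemma smooth_on_subset: "smooth_on S f ==> T \<subseteq> S ==> smooth_on T f"
 unfolding smooth_on_def using Ck_on_subset by blast

lemma Ck_on_SucD: "Ck_on (Suc k) S f ==> Ck_on k S f"
proof (induction k arbitrary: f)
 case 0
 thus ?case
  by (auto intro!: continuous_at_imp_continuous_on differentiable_imp_continuous_within)
next
 case (Suc k)
 thus ?case by simp
qed

lemma smooth_on_dd: "smooth_on S f ==> smooth_on S (\<lambda>x. dd f x v)"
 unfolding smooth_on_def by (metis Ck_on.simps(2))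

lemma smooth_on_differentiable: "smooth_on S f ==> x \<in> S ==> f differentiable at x"
 unfolding smooth_on_def by (metis Ck_on.simps(2))

lemma smooth_on_has_derivative: "smooth_on S f ==> x \<in> S ==> (f has_derivative dd f x) (at x)"
 using smooth_on_differentiable frechet_derivative_works by blast

lemma smooth_on_linear_dd: "smooth_on S f ==> x \<in> S ==> linear (dd f x)"
 using has_derivative_linear smooth_on_has_derivative by blast

lemma smooth_on_continuous_on: "smooth_on S f ==> continuous_on S f"
 unfolding smooth_on_def by (metis Ck_on.simps(1))

lemma smooth_on_UN: "(\<And>i. i \<in> I ==> open (S i)) ==> (\<And>i. i \<in> I ==> smooth_on (S i) f) ==> smooth_on (\<Union>i\<in>I. S i) f"
proof -
 have "(\<forall>i\<in>I. Ck_on k (S i) f) ==> Ck_on k (\<Union>i\<in>I. S i) f" if "\<And>i. i \<in> I ==> open (S i)" for k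
 proof (induction k arbitrary: f)
  case 0
  thus ?case using that by (simp add: continuous_on_open_UN)
 qed auto
 thus "(\<And>i. i \<in> I ==> open (S i)) ==> (\<And>i. i \<in> I ==> smooth_on (S i) f) ==> smooth_on (\<Union>i\<in>I. S i) f"
  unfolding smooth_on_def by blast
qed

lemma smooth_on_local:
 assumes "\<And>x. x \<in> S ==> \<exists>T. open T \<and> x \<in> T \<and> smooth_on T f"
 shows "smooth_on S f"
proof -
 obtain T where T: "\<And>x. x \<in> S ==> open (T x) \<and> x \<in> T x \<and> smooth_on (T x) f"
  using assms by metis
 have "smooth_on (\<Union>x\<in>S. T x) f"
  by (rule smooth_on_UN) (use T in auto)
 thus ?thesis
  by (rule smooth_on_subset) (use T in auto)
qed

lemma Ck_on_const: "Ck_on k S (\<lambda>x. c)"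
 by (induction k arbitrary: c) (auto simp: frechet_derivative_const)

lemma smooth_on_const [intro]: "smooth_on S (\<lambda>x. c)"
 by (simp add: smooth_on_def Ck_on_const)

lemma smooth_on_bounded_linear: "bounded_linear f ==> smooth_on S f"
proof -
 assume f: "bounded_linear f"
 have "dd f x = f" for x
  using f bounded_linear_imp_has_derivative dd_eqI by blast
 hence "Ck_on k S f" for k
  using f by (cases k) (auto simp: Ck_on_const linear_continuous_on bounded_linear_imp_differentiable)
 thus ?thesis by (simp add: smooth_on_def)
qed

lemma smooth_on_id [intro]: "smooth_on S (\<lambda>x. x)"
 by (simp add: smooth_on_bounded_linear bounded_linear_ident)

lemma Ck_on_add:
 assumes "open S" "Ck_on k S f" "Ck_on k S g"
 shows "Ck_on k S (\<lambda>x. f x + g x)"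
 using assms(2,3)
proof (induction k arbitrary: f g)
 case 0
 thus ?case by (auto intro: continuous_intros)
next
 case (Suc k)
 have "dd (\<lambda>x. f x + g x) x v = dd f x v + dd g x v" if "x \<in> S" for x v
  using dd_eqI[OF has_derivative_add[OF frechet_derivative_works[THEN iffD1] frechet_derivative_works[THEN iffD1]], of f x g]
   that Suc.prems by simp
 hence "Ck_on k S (\<lambda>x. dd (\<lambda>x. f x + g x) x v)" for v
  using Suc.prems by (subst Ck_on_cong[OF assms(1)]) (auto intro!: Suc.IH)
 thus ?case using Suc.prems by auto
qed

lemma smooth_on_add [intro]:
 "open S ==> smooth_on S f ==> smooth_on S g ==> smooth_on S (\<lambda>x. f x + g x)"
 by (simp add: smooth_on_def Ck_on_add)

lemma Ck_on_bilinear: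
 fixes f :: "'d::euclidean_space => 'a::euclidean_space" and g :: "'d => 'b::euclidean_space"
  and B :: "'a => 'b => 'c::euclidean_space"
 assumes "bounded_bilinear B" "open S" "Ck_on k S f" "Ck_on k S g"
 shows "Ck_on k S (\<lambda>x. B (f x) (g x))"
 using assms(3,4)
proof (induction k arbitrary: f g)
 case 0
 thus ?case using assms(1) by (auto intro: bounded_bilinear.continuous_on)
next
 case (Suc k)
 have der: "((\<lambda>x. B (f x) (g x)) has_derivative (\<lambda>v. B (f x) (dd g x v) + B (dd f x v) (g x))) (at x)"
  if "x \<in> S" for x
  using Suc.prems that
  by (intro bounded_bilinear.FDERIV[OF assms(1)]) (simp_all add: frechet_derivative_works[symmetric])
 have "Ck_on k S (\<lambda>x. dd (\<lambda>x. B (f x) (g x)) x v)" for v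
 proof (subst Ck_on_cong[OF assms(2)])
  show "dd (\<lambda>x. B (f x) (g x)) x v = B (f x) (dd g x v) + B (dd f x v) (g x)" if "x \<in> S" for x
   using dd_eqI[OF der[OF that]] by simp
  show "Ck_on k S (\<lambda>x. B (f x) (dd g x v) + B (dd f x v) (g x))"
   using Suc.prems Ck_on_SucD[OF Suc.prems(1)] Ck_on_SucD[OF Suc.prems(2)]
   by (intro Ck_on_add[OF assms(2)] Suc.IH) auto
 qed
 moreover have "\<forall>x\<in>S. (\<lambda>x. B (f x) (g x)) differentiable at x"
  using der differentiable_def by blast
 ultimately show ?case by simp
qed

lemma smooth_on_bilinear:
 "bounded_bilinear B ==> open S ==> smooth_on S f ==> smooth_on S g ==> smooth_on S (\<lambda>x. B (f x) (g x))"
 by (simp add: smooth_on_def Ck_on_bilinear)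

lemmas smooth_on_scaleR [intro] = smooth_on_bilinear[OF bounded_bilinear_scaleR]
 and smooth_on_inner [intro] = smooth_on_bilinear[OF bounded_bilinear_inner]

lemma smooth_on_mult [intro]:
 fixes f g :: "'a::euclidean_space => real"
 shows "open S ==> smooth_on S f ==> smooth_on S g ==> smooth_on S (\<lambda>x. f x * g x)"
 by (rule smooth_on_bilinear[OF bounded_bilinear_mult])

lemma smooth_on_sum [intro]:
 assumes "open S" "\<And>i. i \<in> I ==> smooth_on S (f i)"
 shows "smooth_on S (\<lambda>x. \<Sum>i\<in>I. f i x)"
proof (cases "finite I")
 case True
 thus ?thesis
  using assms(2)
 proof induction
  case (insert i I)
  thus ?case using smooth_on_add[OF assms(1), of "f i" "\<lambda>x. \<Sum>i\<in>I. f i x"] by simp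
 qed (simp add: smooth_on_const)
qed (simp add: smooth_on_const)

text \<open>\<open>Ck_on\<close> speaks of derivatives in fixed directions, whereas the chain rule
  evaluates \<open>dd g\<close> in the moving direction \<open>dd f x v\<close>. Expanding that
  direction in \<open>Basis\<close> leaves sums of products of functions to which the induction
  hypothesis and the bilinear case apply.\<close>

lemma Ck_on_compose:
 assumes "open S" "open T" "Ck_on k S f" "Ck_on k T g" "f ` S \<subseteq> T"
 shows "Ck_on k S (\<lambda>x. g (f x))"
 using assms(3,4)
proof (induction k arbitrary: g)
 case 0
 thus ?case using assms(5) by (auto intro: continuous_on_compose2)
next
 case (Suc k)
 have der: "((\<lambda>x. g (f x)) has_derivative (\<lambda>v. dd g (f x) (dd f x v))) (at x)" if "x \<in> S" for x
 proof (rule has_derivative_compose[where f' = "dd f x" and g' = "dd g (f x)"])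
  show "(f has_derivative dd f x) (at x)"
   using Suc.prems(1) that frechet_derivative_works by auto
  have "f x \<in> T" using that assms(5) by blast
  thus "(g has_derivative dd g (f x)) (at (f x))"
   using Suc.prems(2) frechet_derivative_works by auto
 qed
 have eq: "dd (\<lambda>x. g (f x)) x v = (\<Sum>b\<in>Basis. (dd f x v \<bullet> b) *R dd g (f x) b)" if "x \<in> S" for x v
 proof -
  have "linear (dd g (f x))"
   using Suc.prems(2) that assms(5) by (intro linear_frechet_derivative) auto
  hence "dd g (f x) (\<Sum>b\<in>Basis. (dd f x v \<bullet> b) *R b) = (\<Sum>b\<in>Basis. (dd f x v \<bullet> b) *R dd g (f x) b)"
   by (simp add: linear_sum linear_scale)
  thus ?thesis
   using dd_eqI[OF der[OF that]] by (simp add: euclidean_representation)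
 qed
 have *: "Ck_on k S (\<lambda>x. dd g (f x) b)" for b
  using Suc.prems Ck_on_SucD[OF Suc.prems(1)] by (intro Suc.IH) auto
 have "Ck_on k S (\<lambda>x. \<Sum>b\<in>Basis. (dd f x v \<bullet> b) *R dd g (f x) b)" for v
 proof -
  have "Ck_on k S (\<lambda>x. \<Sum>b\<in>I. (dd f x v \<bullet> b) *R dd g (f x) b)" if "finite I" for I
   using that
  proof induction
   case empty
   thus ?case by (simp add: Ck_on_const)
  next
   case (insert b I)
   have "Ck_on k S (\<lambda>x. dd f x v \<bullet> b)"
    using Suc.prems by (intro Ck_on_bilinear[OF bounded_bilinear_inner assms(1)] Ck_on_const) auto
   thus ?case
    using insert * by (auto intro!: Ck_on_add[OF assms(1)] Ck_on_bilinear[OF bounded_bilinear_scaleR assms(1)])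
  qed
  thus ?thesis by simp
 qed
 hence "Ck_on k S (\<lambda>x. dd (\<lambda>x. g (f x)) x v)" for v
  using eq by (subst Ck_on_cong[OF assms(1)]) auto
 moreover have "\<forall>x\<in>S. (\<lambda>x. g (f x)) differentiable at x"
  using der differentiable_def by blast
 ultimately show ?case by simp
qed

lemma smooth_on_compose:
 assumes "smooth_on T g" "smooth_on S f" "open S" "open T" "f ` S \<subseteq> T"
 shows "smooth_on S (\<lambda>x. g (f x))"
 using assms Ck_on_compose unfolding smooth_on_def by blast

lemma smooth_on_linear_compose:
 "bounded_linear L ==> open S ==> smooth_on S f ==> smooth_on S (\<lambda>x. L (f x))"
 using smooth_on_compose[OF smooth_on_bounded_linear[of L UNIV]] by auto

lemma smooth_on_uminus [intro]: "open S ==> smooth_on S f ==> smooth_on S (\<lambda>x. - f x)"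
 by (rule smooth_on_linear_compose[OF bounded_linear_minus[OF bounded_linear_ident]])

lemma smooth_on_diff [intro]:
 "open S ==> smooth_on S f ==> smooth_on S g ==> smooth_on S (\<lambda>x. f x - g x)"
 using smooth_on_add[of S f "\<lambda>x. - g x"] by auto

lemma smooth_on_prod [intro]:
 fixes f :: "'i => 'a::euclidean_space => real"
 assumes "open S" "\<And>i. i \<in> I ==> smooth_on S (f i)"
 shows "smooth_on S (\<lambda>x. \<Prod>i\<in>I. f i x)"
proof (cases "finite I")
 case True
 thus ?thesis
  using assms(2)
 proof induction
  case (insert i I)
  thus ?case using smooth_on_mult[OF assms(1), of "f i" "\<lambda>x. \<Prod>i\<in>I. f i x"] by simp
 qed (simp add: smooth_on_const)
qed (simp add: smooth_on_const)

lemma smooth_on_nth [intro]: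
 fixes f :: "'a::euclidean_space => ('b::euclidean_space)^'n"
 shows "open S ==> smooth_on S f ==> smooth_on S (\<lambda>x. f x $ i)"
 by (rule smooth_on_linear_compose[OF bounded_linear_vec_nth])

lemma bounded_linear_axis: "bounded_linear (axis i :: 'b::euclidean_space => 'b^'n)"
 unfolding linear_conv_bounded_linear[symmetric]
 by (rule linearI) (auto simp: axis_def vec_eq_iff)

lemma vec_lambda_eq_sum_axis: "(\<chi> i. f i) = (\<Sum>i\<in>UNIV. axis i (f i :: 'b::euclidean_space))"
 by (simp add: vec_eq_iff axis_def if_distrib sum.delta' cong: if_cong)

lemma smooth_on_vec_lambda [intro]:
 fixes f :: "'n::finite => 'a::euclidean_space => 'b::euclidean_space"
 assumes "open S" "\<And>i. smooth_on S (f i)"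
 shows "smooth_on S (\<lambda>x. \<chi> i. f i x)"
 unfolding vec_lambda_eq_sum_axis
 using assms by (intro smooth_on_sum smooth_on_linear_compose[OF bounded_linear_axis]) auto

lemma smooth_on_inverse_real: "smooth_on (- {0::real}) inverse"
proof -
 have "Ck_on k (- {0::real}) inverse" for k
 proof (induction k)
  case 0
  thus ?case by (auto intro!: continuous_intros)
 next
  case (Suc k)
  have der: "(inverse has_derivative (\<lambda>v. - (inverse x * v * inverse x))) (at x)" if "x \<noteq> 0" for x :: real
   using has_derivative_inverse'[OF that] .
  have "Ck_on k (- {0::real}) (\<lambda>x. dd inverse x v)" for v
  proof (subst Ck_on_cong)
   show "dd inverse x v = - v * (inverse x * inverse x)" if "x \<in> - {0}" for x :: real
    using dd_eqI[OF der] that by auto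
   show "Ck_on k (- {0}) (\<lambda>x. - v * (inverse x * inverse x))"
    using Suc.IH by (intro Ck_on_bilinear[OF bounded_bilinear_mult] Ck_on_const) auto
  qed auto
  moreover have "\<forall>x\<in>- {0::real}. inverse differentiable at x"
   using der differentiable_def by blast
  ultimately show ?case by simp
 qed
 thus ?thesis by (simp add: smooth_on_def)
qed

lemma smooth_on_divide [intro]:
 fixes f g :: "'a::euclidean_space => real"
 assumes "open S" "smooth_on S f" "smooth_on S g" "\<And>x. x \<in> S ==> g x \<noteq> 0"
 shows "smooth_on S (\<lambda>x. f x / g x)"
 unfolding divide_inverse
 using assms by (intro smooth_on_mult smooth_on_compose[OF smooth_on_inverse_real]) auto

lemma smooth_on_det [intro]:
 fixes M :: "'a::euclidean_space => real^'n^'n"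
 shows "open S ==> smooth_on S M ==> smooth_on S (\<lambda>x. det (M x))"
 unfolding det_def by (intro smooth_on_sum smooth_on_mult smooth_on_const smooth_on_prod smooth_on_nth) auto

lemma matrix_inv_inverse:
 fixes A :: "'a::semiring_1^'n^'m"
 assumes "invertible A"
 shows "A ** matrix_inv A = mat 1" "matrix_inv A ** A = mat 1"
 using someI_ex[OF assms[unfolded invertible_def]] unfolding matrix_inv_def by auto

text \<open>By Cramer's rule the entries of the inverse are quotients of polynomials in the entries.
  Smoothness of the inverse follows, and later the measurability of a trace that contains an
  inverse.\<close>

lemma matrix_inv_cramer:
 fixes A :: "real^'n^'n"
 assumes "det A \<noteq> 0"
 shows "matrix_inv A $ k $ l = det (\<chi> i j. if j = k then axis l 1 $ i else A $ i $ j) / det A"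
proof -
 have "invertible A" using assms invertible_det_nz by blast
 hence "A *v (matrix_inv A *v axis l 1) = axis l 1"
  by (simp add: matrix_vector_mul_assoc matrix_inv_inverse)
 hence "matrix_inv A *v axis l 1 = (\<chi> k. det (\<chi> i j. if j = k then axis l 1 $ i else A $ i $ j) / det A)"
  using cramer[OF assms] by blast
 thus ?thesis
  by (simp add: matrix_vector_mul_component vec_eq_iff inner_axis)
qed

lemma smooth_on_matrix_inv [intro]:
 fixes M :: "'a::euclidean_space => real^'n^'n"
 assumes "open S" "smooth_on S M" "\<And>x. x \<in> S ==> det (M x) \<noteq> 0"
 shows "smooth_on S (\<lambda>x. matrix_inv (M x))"
proof -
 have "smooth_on S (\<lambda>x. \<chi> k l. det (\<chi> i j. if j = k then axis l 1 $ i else M x $ i $ j) / det (M x))"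
 proof (intro smooth_on_vec_lambda assms(1) smooth_on_divide smooth_on_det assms)
  fix k l i j
  show "smooth_on S (\<lambda>x. if j = k then axis l 1 $ i else M x $ i $ j)"
   using assms by (cases "j = k") auto
 qed
 thus ?thesis
  using assms(3) matrix_inv_cramer
  by (subst smooth_on_cong[OF assms(1), of _ "\<lambda>x. \<chi> k l. det (\<chi> i j. if j = k then axis l 1 $ i else M x $ i $ j) / det (M x)"])
   (auto simp: vec_eq_iff)
qed

section \<open>Expansion of differentials in a basis, and symmetry of second derivatives\<close>

lemma dd_apply_sum:
 assumes "smooth_on S f" "x \<in> S"
 shows "dd f x w = (\<Sum>b\<in>Basis. (w \<bullet> b) *R dd f x b)"
proof -
 have "dd f x (\<Sum>b\<in>Basis. (w \<bullet> b) *R b) = (\<Sum>b\<in>Basis. (w \<bullet> b) *R dd f x b)"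
  using smooth_on_linear_dd[OF assms] by (simp add: linear_sum linear_scale)
 thus ?thesis by (simp add: euclidean_representation)
qed

lemma smooth_on_dd_apply:
 assumes "open S" "smooth_on S f" "smooth_on S w"
 shows "smooth_on S (\<lambda>x. dd f x (w x))"
 using assms dd_apply_sum[OF assms(2)]
 by (subst smooth_on_cong[OF assms(1), of _ "\<lambda>x. \<Sum>b\<in>Basis. (w x \<bullet> b) *R dd f x b"])
  (auto intro!: smooth_on_sum smooth_on_scaleR smooth_on_inner smooth_on_dd)

lemma dd_compose:
 assumes "smooth_on S f" "x \<in> S" "smooth_on T g" "f x \<in> T"
 shows "dd (\<lambda>x. g (f x)) x v = dd g (f x) (dd f x v)"
 using dd_eqI[OF has_derivative_compose[OF smooth_on_has_derivative[OF assms(1,2)]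
  smooth_on_has_derivative[OF assms(3,4)]]] by simp

text \<open>The mean value theorem is applied twice: in direction \<open>u\<close> to the difference
  of \<open>f\<close> shifted by \<open>s *R v\<close> and \<open>f\<close> itself, then in
  direction \<open>v\<close>. The second difference is symmetric in \<open>u\<close> and
  \<open>v\<close>, the mixed derivative not visibly so; this is the source of Schwarz's
  theorem.\<close>

lemma second_difference_mean_value:
 fixes f :: "'a::euclidean_space => real"
 assumes "Ck_on 2 (ball x r) f" "0 < s" "s * (norm u + norm v) < r"
 obtains y where "dist x y \<le> s * (norm u + norm v)"
  "f (x + s *R u + s *R v) - f (x + s *R u) - f (x + s *R v) + f x = s^2 * dd (\<lambda>y. dd f y u) y v"
proof -
 have in_ball: "x + a *R u + b *R v \<in> ball x r \<and> dist x (x + a *R u + b *R v) \<le> s * (norm u + norm v)"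
  if "0 \<le> a" "a \<le> s" "0 \<le> b" "b \<le> s" for a b
 proof -
  have "dist x (x + a *R u + b *R v) = norm (a *R u + b *R v)"
   by (simp add: dist_norm norm_minus_commute algebra_simps)
  also have "\<dots> \<le> a * norm u + b * norm v"
   using norm_triangle_ineq[of "a *R u" "b *R v"] that by simp
  also have "\<dots> \<le> s * (norm u + norm v)"
   using that by (simp add: distrib_left add_mono mult_right_mono)
  finally show ?thesis using assms(3) by simp
 qed
 have d1: "(f has_derivative dd f y) (at y)" if "y \<in> ball x r" for y
  using assms(1) that by (auto simp: numeral_2_eq_2 simp flip: frechet_derivative_works)
 have d2: "((\<lambda>y. dd f y u) has_derivative dd (\<lambda>y. dd f y u) y) (at y)" if "y \<in> ball x r" for y
  using assms(1) that by (auto simp: numeral_2_eq_2 simp flip: frechet_derivative_works)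
 define ph where "ph a = f (x + a *R u + s *R v) - f (x + a *R u)" for a
 have "\<exists>a>0. a < s \<and> ph s - ph 0 = (s - 0) * (dd f (x + a *R u + s *R v) u - dd f (x + a *R u) u)"
 proof (rule MVT2[OF assms(2)])
  fix a assume a: "0 \<le> a" "a \<le> s"
  have A: "((\<lambda>a. x + a *R u + s *R v) has_derivative (\<lambda>h. h *R u)) (at a)"
   and B: "((\<lambda>a. x + a *R u) has_derivative (\<lambda>h. h *R u)) (at a)"
   by (auto intro!: derivative_eq_intros)
  have y: "x + a *R u + s *R v \<in> ball x r" "x + a *R u \<in> ball x r"
   using in_ball[OF a, of s] in_ball[OF a, of 0] assms(2) by auto
  have "(ph has_derivative (\<lambda>h. dd f (x + a *R u + s *R v) (h *R u) - dd f (x + a *R u) (h *R u))) (at a)"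
   unfolding ph_def using has_derivative_compose[OF A d1[OF y(1)]] has_derivative_compose[OF B d1[OF y(2)]]
   by (rule has_derivative_diff)
  moreover have "dd f y (h *R u) = dd f y u * h" if "y \<in> ball x r" for y h
   using has_derivative_linear[OF d1[OF that]] by (simp add: linear_scale)
  ultimately show "(ph has_real_derivative dd f (x + a *R u + s *R v) u - dd f (x + a *R u) u) (at a)"
   using y by (simp add: has_field_derivative_def left_diff_distrib[abs_def] algebra_simps)
 qed
 then obtain a where a: "0 < a" "a < s"
  and eq: "ph s - ph 0 = s * (dd f (x + a *R u + s *R v) u - dd f (x + a *R u) u)"
  by auto
 define ps where "ps b = dd f (x + a *R u + b *R v) u" for b
 have "\<exists>b>0. b < s \<and> ps s - ps 0 = (s - 0) * dd (\<lambda>y. dd f y u) (x + a *R u + b *R v) v"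
 proof (rule MVT2[OF assms(2)])
  fix b assume b: "0 \<le> b" "b \<le> s"
  have A: "((\<lambda>b. x + a *R u + b *R v) has_derivative (\<lambda>h. h *R v)) (at b)"
   by (auto intro!: derivative_eq_intros)
  have y: "x + a *R u + b *R v \<in> ball x r"
   using in_ball[of a b] a b by auto
  show "(ps has_real_derivative dd (\<lambda>y. dd f y u) (x + a *R u + b *R v) v) (at b)"
   unfolding ps_def has_field_derivative_def
   using has_derivative_compose[OF A d2[OF y]] has_derivative_linear[OF d2[OF y]]
   by (simp add: linear_scale mult_commute_abs)
 qed
 then obtain b where b: "0 < b" "b < s"
  and eq2: "ps s - ps 0 = s * dd (\<lambda>y. dd f y u) (x + a *R u + b *R v) v"
  by auto
 show thesis
 proof (rule that)
  show "dist x (x + a *R u + b *R v) \<le> s * (norm u + norm v)"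
   using in_ball[of a b] a b by simp
  show "f (x + s *R u + s *R v) - f (x + s *R u) - f (x + s *R v) + f x =
    s^2 * dd (\<lambda>y. dd f y u) (x + a *R u + b *R v) v"
   using eq eq2 by (simp add: ph_def ps_def power2_eq_square)
 qed
qed

text \<open>If the two continuous mixed derivatives differed at \<open>x\<close>, they would differ
  at all pairs of nearby points, while one and the same second difference is \<open>s^2\<close>
  times either of them at such points.\<close>

lemma Ck_on_dd_commute_real:
 fixes f :: "'a::euclidean_space => real"
 assumes "open S" "Ck_on 2 S f" "x \<in> S"
 shows "dd (\<lambda>y. dd f y u) x v = dd (\<lambda>y. dd f y v) x u"
proof (rule ccontr)
 define p where "p y = dd (\<lambda>y. dd f y u) y v" for y
 define q where "q y = dd (\<lambda>y. dd f y v) y u" for y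
 assume "\<not> ?thesis"
 hence pq: "p x \<noteq> q x" by (simp add: p_def q_def)
 obtain r where r: "r > 0" "ball x r \<subseteq> S" using assms openE by blast
 have C: "Ck_on 2 (ball x r) f" using assms r Ck_on_subset by blast
 have "continuous_on (ball x r) p" "continuous_on (ball x r) q"
  using C by (auto simp: numeral_2_eq_2 p_def q_def)
 hence "isCont p x" "isCont q x"
  using r by (auto simp: continuous_on_eq_continuous_at)
 moreover define e where "e = dist (p x) (q x) / 2"
 ultimately obtain d1 d2 where d: "d1 > 0" "d2 > 0"
  "\<And>y. dist y x < d1 ==> dist (p y) (p x) < e" "\<And>y. dist y x < d2 ==> dist (q y) (q x) < e"
  using pq unfolding continuous_at_eps_delta by (metis half_gt_zero zero_less_dist_iff)
 define m where "m = min r (min d1 d2)"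
 \<comment> \<open>The summand 1 keeps the denominator positive when \<open>u\<close> and
   \<open>v\<close> both vanish; the step is short enough for both intermediate points to lie within
   \<open>m\<close> of \<open>x\<close>.\<close>
 define s where "s = m / (2 * (norm u + norm v + 1))"
 have m: "m > 0" using d r by (simp add: m_def)
 have n: "norm u + norm v + 1 > 0" by (simp add: add_nonneg_pos)
 have s: "s > 0" using m n by (simp add: s_def)
 have "s * (norm u + norm v) \<le> s * (norm u + norm v + 1)"
  using s by simp
 also have "\<dots> = m / 2" using n by (simp add: s_def field_simps)
 also have "\<dots> < m" using m by simp
 finally have sm: "s * (norm u + norm v) < m" .
 hence sr: "s * (norm u + norm v) < r" by (simp add: m_def)
 obtain y where y: "dist x y \<le> s * (norm u + norm v)"
  "f (x + s *R u + s *R v) - f (x + s *R u) - f (x + s *R v) + f x = s^2 * p y"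
  using second_difference_mean_value[OF C s sr] unfolding p_def by blast
 have sr': "s * (norm v + norm u) < r" using sr by (simp add: add.commute)
 obtain z where z: "dist x z \<le> s * (norm v + norm u)"
  "f (x + s *R v + s *R u) - f (x + s *R v) - f (x + s *R u) + f x = s^2 * q z"
  using second_difference_mean_value[OF C s sr'] unfolding q_def by blast
 have "s^2 * p y = s^2 * q z" using y z by (simp add: algebra_simps)
 hence "p y = q z" using s by simp
 moreover have "dist (p y) (p x) < e" "dist (q z) (q x) < e"
  using y(1) z(1) sm d(3)[of y] d(4)[of z] by (auto simp: m_def dist_commute add.commute)
 ultimately have "dist (p x) (q x) < 2 * e"
  by (metis dist_commute dist_triangle_less_add mult_2)
 thus False by (simp add: e_def)
qed

lemma dd_commute:
 fixes f :: "'a::euclidean_space => 'b::euclidean_space"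
 assumes "open S" "smooth_on S f" "x \<in> S"
 shows "dd (\<lambda>y. dd f y u) x v = dd (\<lambda>y. dd f y v) x u"
proof (rule euclidean_eqI)
 fix b :: 'b assume "b \<in> Basis"
 have *: "dd (\<lambda>y. dd (\<lambda>y. f y \<bullet> b) y u) x v = dd (\<lambda>y. dd f y u) x v \<bullet> b" for u v
 proof -
  have "dd (\<lambda>y. f y \<bullet> b) y u = dd f y u \<bullet> b" if "y \<in> S" for y
   using dd_eqI[OF has_derivative_inner_left[OF smooth_on_has_derivative[OF assms(2) that]]] by simp
  hence "dd (\<lambda>y. dd (\<lambda>y. f y \<bullet> b) y u) x = dd (\<lambda>y. dd f y u \<bullet> b) x"
   by (intro dd_cong_open[OF assms(1,3)])
  also have "\<dots> = (\<lambda>v. dd (\<lambda>y. dd f y u) x v \<bullet> b)"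
   by (intro dd_eqI has_derivative_inner_left smooth_on_has_derivative[OF smooth_on_dd[OF assms(2)] assms(3)])
  finally show ?thesis by simp
 qed
 have "smooth_on S (\<lambda>y. f y \<bullet> b)" using assms by auto
 thus "dd (\<lambda>y. dd f y u) x v \<bullet> b = dd (\<lambda>y. dd f y v) x u \<bullet> b"
  using Ck_on_dd_commute_real[OF assms(1) _ assms(3), of "\<lambda>y. f y \<bullet> b"] unfolding smooth_on_def *[symmetric] by blast
qed

section \<open>Metrics on open subsets of Euclidean space\<close>

abbreviation form :: "real^'n^'m => real^'m => real^'n => real" where
 "form P u w \<equiv> u \<bullet> (P *v w)"

lemma linear_axis_expand:
 fixes f :: "real^'n => 'b::real_vector"
 assumes "linear f"
 shows "f u = (\<Sum>i\<in>UNIV. u $ i *R f (axis i 1))"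
proof -
 have "f u = f (\<Sum>i\<in>UNIV. u $ i *R axis i 1)"
  using basis_expansion[of u] by (simp add: scalar_mult_eq_scaleR)
 thus ?thesis using assms by (simp add: linear_sum linear_scale)
qed

lemma bounded_bilinear_matrix_vector:
 "bounded_bilinear ((*v) :: real^'n^'m => real^'n => real^'m)"
proof -
 have "bilinear ((*v) :: real^'n^'m => real^'n => real^'m)"
  unfolding bilinear_def linear_iff
  by (simp add: matrix_vector_mult_def vec_eq_iff sum.distrib sum_distrib_left algebra_simps)
 thus ?thesis using bilinear_conv_bounded_bilinear by blast
qed

lemma bounded_bilinear_matrix_matrix:
 "bounded_bilinear ((**) :: real^'n^'m => real^'p^'n => real^'p^'m)"
proof -
 have "bilinear ((**) :: real^'n^'m => real^'p^'n => real^'p^'m)"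
  unfolding bilinear_def linear_iff
  by (simp add: matrix_matrix_mult_def vec_eq_iff sum.distrib sum_distrib_left algebra_simps)
 thus ?thesis using bilinear_conv_bounded_bilinear by blast
qed

lemma smooth_on_matrix_vector [intro]:
 "open S ==> smooth_on S M ==> smooth_on S a ==> smooth_on S (\<lambda>x. M x *v (a x :: real^'n) :: real^'m)"
 by (rule smooth_on_bilinear[OF bounded_bilinear_matrix_vector])

lemma has_derivative_form:
 fixes M :: "'a::real_normed_vector => real^'n^'m"
 assumes "(a has_derivative a') (at x)" "(M has_derivative M') (at x)" "(b has_derivative b') (at x)"
 shows "((\<lambda>y. a y \<bullet> (M y *v b y)) has_derivative
  (\<lambda>z. a' z \<bullet> (M x *v b x) + a x \<bullet> (M' z *v b x) + a x \<bullet> (M x *v b' z))) (at x)"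
proof -
 have "((\<lambda>y. a y \<bullet> (M y *v b y)) has_derivative
   (\<lambda>z. a x \<bullet> (M x *v b' z + M' z *v b x) + a' z \<bullet> (M x *v b x))) (at x)"
  by (intro has_derivative_inner assms bounded_bilinear.FDERIV[OF bounded_bilinear_matrix_vector])
 thus ?thesis by (simp add: inner_add_right algebra_simps)
qed

lemma dd_form:
 fixes M :: "'a::euclidean_space => real^'n^'m"
 assumes "smooth_on S a" "smooth_on S M" "smooth_on S b" "x \<in> S"
 shows "dd (\<lambda>y. a y \<bullet> (M y *v b y)) x z =
  dd a x z \<bullet> (M x *v b x) + a x \<bullet> (dd M x z *v b x) + a x \<bullet> (M x *v dd b x z)"
 using dd_eqI[OF has_derivative_form[OF assms(1-3)[THEN smooth_on_has_derivative[OF _ assms(4)]]]] by simp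

lemma dd_const [simp]: "dd (\<lambda>y. c) x = (\<lambda>v. 0)"
 by (rule dd_eqI) simp

lemma dd_form_const:
 fixes M :: "'a::euclidean_space => real^'n^'m"
 assumes "smooth_on S M" "x \<in> S"
 shows "dd (\<lambda>y. form (M y) a b) x z = form (dd M x z) a b"
 using dd_form[OF smooth_on_const assms(1) smooth_on_const assms(2), of a b] by simp

lemma dd_nth:
 fixes f :: "'a::euclidean_space => ('b::euclidean_space)^'n"
 assumes "smooth_on S f" "x \<in> S"
 shows "dd (\<lambda>y. f y $ i) x u = dd f x u $ i"
 using dd_eqI[OF bounded_linear.has_derivative[OF bounded_linear_vec_nth smooth_on_has_derivative[OF assms]]]
 by simp

definition posdef :: "real^'n^'n => bool" where
 "posdef P \<longleftrightarrow> transpose P = P \<and> (\<forall>v. v \<noteq> 0 \<longrightarrow> form P v v > 0)"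

lemma posdef_sym: "posdef P ==> form P u w = form P w u"
 unfolding posdef_def by (metis dot_lmul_matrix inner_commute transpose_matrix_vector)

lemma posdef_pos: "posdef P ==> v \<noteq> 0 ==> form P v v > 0"
 unfolding posdef_def by blast

lemma posdef_eq_0_iff: "posdef P ==> form P v v = 0 \<longleftrightarrow> v = 0"
 using posdef_pos by force

lemma posdef_cancel:
 assumes "posdef P" "\<And>z. form P z a = form P z b"
 shows "a = b"
proof -
 have "form P (a - b) (a - b) = 0"
  using assms(2)[of "a - b"] by (simp add: matrix_vector_mult_diff_distrib inner_diff_right)
 thus ?thesis using posdef_eq_0_iff[OF assms(1)] by simp
qed

lemma posdef_invertible: "posdef P ==> invertible P"
proof -
 assume P: "posdef P"
 have "inj ((*v) P)"
  by (rule injI) (metis P posdef_cancel)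
 thus ?thesis
  by (metis invertible_left_inverse matrix_left_invertible_injective)
qed

lemma posdef_det_nz: "posdef P ==> det P \<noteq> 0"
 using invertible_det_nz posdef_invertible by blast

text \<open>Christoffel symbols of an arbitrary matrix field on coordinate space. Detaching them
  from the atlas lets one calculus serve charts and exponential coordinates alike.\<close>

definition chr :: "(real^'n => real^'n^'n) => 'n::finite => 'n => 'n => real^'n => real" where
 "chr h k i j x = (1/2) * (\<Sum>l\<in>UNIV. matrix_inv (h x) $ k $ l *
   (partial i (\<lambda>y. h y $ j $ l) x + partial j (\<lambda>y. h y $ i $ l) x - partial l (\<lambda>y. h y $ i $ j) x))"

lemma christoffel_eq_chr: "christoffel A g c = chr (metric_matrix A g c)"
 by (intro ext) (simp add: christoffel_def chr_def)

definition riem ::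
  "(real^'n => real^'n^'n) => 'n::finite => 'n => 'n => 'n => real^'n => real" where
 "riem h l i j k x = partial i (chr h l j k) x - partial j (chr h l i k) x +
   (\<Sum>m\<in>UNIV. chr h l i m x * chr h m j k x - chr h l j m x * chr h m i k x)"

lemma riemann_eq_riem: "riemann A g c = riem (metric_matrix A g c)"
 by (intro ext) (simp add: riemann_def riem_def christoffel_eq_chr)

text \<open>
 \<open>chrv h x u v\<close> is the connection term of \<open>\<nabla>\<^sub>u v\<close>, and \<open>riemv h x u v w\<close> is \<open>R(u, v)w\<close>.
\<close>

definition chrv :: "(real^'n => real^'n^'n) => real^'n => real^'n => real^'n => real^'n" where
 "chrv h x u v = (\<chi> k. \<Sum>i\<in>UNIV. \<Sum>j\<in>UNIV. chr h k i j x * u $ i * v $ j)"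

definition riemv :: "(real^'n => real^'n^'n) => real^'n => real^'n => real^'n => real^'n => real^'n" where
 "riemv h x u v w = (\<chi> l. \<Sum>i\<in>UNIV. \<Sum>j\<in>UNIV. \<Sum>k\<in>UNIV. riem h l i j k x * u $ i * v $ j * w $ k)"

lemma chrv_bilinear:
 "chrv h x (u + u') v = chrv h x u v + chrv h x u' v"
 "chrv h x u (v + v') = chrv h x u v + chrv h x u v'"
 "chrv h x (c *R u) v = c *R chrv h x u v"
 "chrv h x u (c *R v) = c *R chrv h x u v"
 by (simp_all add: chrv_def vec_eq_iff sum.distrib sum_distrib_left algebra_simps)

lemma chrv_bilinear_diff:
 "chrv h x (u - u') v = chrv h x u v - chrv h x u' v"
 "chrv h x u (v - v') = chrv h x u v - chrv h x u v'"
 "chrv h x (- u) v = - chrv h x u v"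
 "chrv h x u (- v) = - chrv h x u v"
 by (simp_all add: chrv_def vec_eq_iff sum_subtractf algebra_simps sum_negf)

lemma linear_chrv: "linear (chrv h x u)" "linear (\<lambda>u. chrv h x u v)"
 by (auto simp: linear_iff chrv_bilinear)

lemma riemv_scale:
 "riemv h x (c *R u) v w = c *R riemv h x u v w"
 "riemv h x u (c *R v) w = c *R riemv h x u v w"
 "riemv h x u v (c *R w) = c *R riemv h x u v w"
 by (simp_all add: riemv_def vec_eq_iff sum_distrib_left algebra_simps)

lemma riemv_add:
 "riemv h x (u + u') v w = riemv h x u v w + riemv h x u' v w"
 "riemv h x u (v + v') w = riemv h x u v w + riemv h x u v' w"
 "riemv h x u v (w + w') = riemv h x u v w + riemv h x u v w'"
 by (simp_all add: riemv_def vec_eq_iff sum.distrib algebra_simps)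

lemma linear_riemv: "linear (\<lambda>u. riemv h x u v w)"
 by (auto simp: linear_iff riemv_add riemv_scale)

definition metric_on :: "(real^'n) set => (real^'n => real^'n^'n) => bool" where
 "metric_on U h \<longleftrightarrow> open U \<and> smooth_on U h \<and> (\<forall>x\<in>U. posdef (h x))"

lemma partial_eq:
 assumes "smooth_on U h" "x \<in> U"
 shows "partial i (\<lambda>y. h y $ j $ l) x = dd h x (axis i 1) $ j $ l"
proof -
 have "((\<lambda>y. h y $ j $ l) has_derivative (\<lambda>v. dd h x v $ j $ l)) (at x)"
  by (intro bounded_linear.has_derivative[OF bounded_linear_vec_nth] smooth_on_has_derivative[OF assms])
 from dd_eqI[OF this] show ?thesis by (simp add: partial_def)
qed

lemma smooth_on_chr:
 assumes "metric_on U h"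
 shows "smooth_on U (chr h k i j)"
proof -
 have o: "open U" and s: "smooth_on U h" and d: "\<And>x. x \<in> U ==> det (h x) \<noteq> 0"
  using assms posdef_det_nz by (auto simp: metric_on_def)
 have p: "smooth_on U (\<lambda>x. partial i (\<lambda>y. h y $ j $ l) x)" for i j l
  using partial_eq[OF s]
  by (subst smooth_on_cong[OF o, of _ "\<lambda>x. dd h x (axis i 1) $ j $ l"]) (auto intro!: smooth_on_nth o smooth_on_dd s)
 show ?thesis
  unfolding chr_def[abs_def]
  by (intro smooth_on_mult o smooth_on_const smooth_on_sum smooth_on_nth smooth_on_matrix_inv s smooth_on_diff
    smooth_on_add p d)
qed

lemma smooth_on_chrv:
 assumes "metric_on U h" "smooth_on U a" "smooth_on U b"
 shows "smooth_on U (\<lambda>x. chrv h x (a x) (b x))"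
proof -
 have "open U" using assms by (simp add: metric_on_def)
 thus ?thesis
  unfolding chrv_def
  by (intro smooth_on_vec_lambda smooth_on_sum smooth_on_mult smooth_on_chr[OF assms(1)] smooth_on_nth assms) auto
qed

text \<open>Koszul's formula for constant coordinate fields. It is free of indices and of the
  inverse matrix; together with \<open>posdef_cancel\<close> it replaces the explicit symbols in the
  transformation law and in the Gauss lemma.\<close>

lemma chrv_characterization:
 assumes "metric_on U h" "x \<in> U"
 shows "form (h x) z (chrv h x u v) =
  (form (dd h x u) v z + form (dd h x v) u z - form (dd h x z) u v) / 2"
proof -
 have s: "smooth_on U h" and inv: "invertible (h x)"
  using assms posdef_invertible by (auto simp: metric_on_def)
 define P where "P i j l = dd h x (axis i 1) $ j $ l + dd h x (axis j 1) $ i $ l - dd h x (axis l 1) $ i $ j" for i j l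
 define c where "c = (\<chi> l. \<Sum>i\<in>UNIV. \<Sum>j\<in>UNIV. P i j l * u $ i * v $ j)"
 have "chrv h x u v $ k = ((1/2) *R (matrix_inv (h x) *v c)) $ k" for k
 proof -
  have "chrv h x u v $ k = (\<Sum>i\<in>UNIV. \<Sum>j\<in>UNIV. \<Sum>l\<in>UNIV. (1/2) * (matrix_inv (h x) $ k $ l * (P i j l * u $ i * v $ j)))"
   by (simp add: chrv_def chr_def partial_eq[OF s assms(2)] P_def sum_distrib_left sum_distrib_right mult.assoc)
  also have "\<dots> = (\<Sum>i\<in>UNIV. \<Sum>l\<in>UNIV. \<Sum>j\<in>UNIV. (1/2) * (matrix_inv (h x) $ k $ l * (P i j l * u $ i * v $ j)))"
   by (intro sum.cong refl sum.swap)
  also have "\<dots> = (\<Sum>l\<in>UNIV. \<Sum>i\<in>UNIV. \<Sum>j\<in>UNIV. (1/2) * (matrix_inv (h x) $ k $ l * (P i j l * u $ i * v $ j)))"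
   by (rule sum.swap)
  finally show ?thesis
   by (simp add: c_def matrix_vector_mult_def sum_distrib_left)
 qed
 hence "chrv h x u v = (1/2) *R (matrix_inv (h x) *v c)" by (simp add: vec_eq_iff)
 hence "h x *v chrv h x u v = (1/2) *R c"
  by (simp add: mv_scaleR matrix_vector_mul_assoc matrix_inv_inverse[OF inv])
 hence L: "form (h x) z (chrv h x u v) = (z \<bullet> c) / 2" by simp
 have lin: "dd h x a $ j $ l = (\<Sum>i\<in>UNIV. a $ i * dd h x (axis i 1) $ j $ l)" for a j l
  using linear_axis_expand[OF smooth_on_linear_dd[OF s assms(2)], of a] by simp
 have "form (dd h x u) v z = (\<Sum>j\<in>UNIV. \<Sum>l\<in>UNIV. \<Sum>i\<in>UNIV. z $ l * (dd h x (axis i 1) $ j $ l * u $ i * v $ j))"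
  unfolding inner_vec_def matrix_vector_mult_def
  by (subst lin) (simp add: sum_distrib_left sum_distrib_right mult_ac)
 also have "\<dots> = (\<Sum>l\<in>UNIV. \<Sum>j\<in>UNIV. \<Sum>i\<in>UNIV. z $ l * (dd h x (axis i 1) $ j $ l * u $ i * v $ j))"
  by (rule sum.swap)
 also have "\<dots> = (\<Sum>l\<in>UNIV. \<Sum>i\<in>UNIV. \<Sum>j\<in>UNIV. z $ l * (dd h x (axis i 1) $ j $ l * u $ i * v $ j))"
  by (intro sum.cong refl sum.swap)
 finally have 1: "form (dd h x u) v z = \<dots>" .
 have "form (dd h x v) u z = (\<Sum>i\<in>UNIV. \<Sum>l\<in>UNIV. \<Sum>j\<in>UNIV. z $ l * (dd h x (axis j 1) $ i $ l * u $ i * v $ j))"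
  unfolding inner_vec_def matrix_vector_mult_def
  by (subst lin) (simp add: sum_distrib_left sum_distrib_right mult_ac)
 also have "\<dots> = (\<Sum>l\<in>UNIV. \<Sum>i\<in>UNIV. \<Sum>j\<in>UNIV. z $ l * (dd h x (axis j 1) $ i $ l * u $ i * v $ j))"
  by (rule sum.swap)
 finally have 2: "form (dd h x v) u z = \<dots>" .
 have "form (dd h x z) u v = (\<Sum>i\<in>UNIV. \<Sum>j\<in>UNIV. \<Sum>l\<in>UNIV. z $ l * (dd h x (axis l 1) $ i $ j * u $ i * v $ j))"
  unfolding inner_vec_def matrix_vector_mult_def
  by (subst lin) (simp add: sum_distrib_left sum_distrib_right mult_ac)
 also have "\<dots> = (\<Sum>i\<in>UNIV. \<Sum>l\<in>UNIV. \<Sum>j\<in>UNIV. z $ l * (dd h x (axis l 1) $ i $ j * u $ i * v $ j))"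
  by (intro sum.cong refl sum.swap)
 also have "\<dots> = (\<Sum>l\<in>UNIV. \<Sum>i\<in>UNIV. \<Sum>j\<in>UNIV. z $ l * (dd h x (axis l 1) $ i $ j * u $ i * v $ j))"
  by (rule sum.swap)
 finally have 3: "form (dd h x z) u v = \<dots>" .
 have "z \<bullet> c = form (dd h x u) v z + form (dd h x v) u z - form (dd h x z) u v"
  unfolding 1 2 3
  by (simp add: c_def P_def inner_vec_def sum_distrib_left sum.distrib sum_subtractf algebra_simps)
 thus ?thesis using L by simp
qed

lemma chrv_commute:
 assumes "metric_on U h" "x \<in> U"
 shows "chrv h x u v = chrv h x v u"
proof (rule posdef_cancel)
 show P: "posdef (h x)" using assms by (simp add: metric_on_def)
 have o: "open U" and s: "smooth_on U h" and pd: "\<And>x. x \<in> U ==> posdef (h x)"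
  using assms by (auto simp: metric_on_def)
 have "form (dd h x z) u v = form (dd h x z) v u" for z
 proof -
  have "dd (\<lambda>y. form (h y) u v) x = dd (\<lambda>y. form (h y) v u) x"
   by (rule dd_cong_open[OF o assms(2)]) (simp add: posdef_sym[OF pd])
  thus ?thesis using dd_form_const[OF s assms(2)] by metis
 qed
 thus "form (h x) z (chrv h x u v) = form (h x) z (chrv h x v u)" for z
  by (simp add: chrv_characterization[OF assms])
qed

text \<open>For constant fields the bracket vanishes, so \<open>R(u, v)w\<close> is the commutator
  of two covariant derivatives. The proof only reorders the index sums of
  \<open>riem\<close>.\<close>

lemma riemv_formula:
 fixes h :: "real^'n => real^'n^'n"
 assumes "metric_on U h" "x \<in> U"
 shows "riemv h x u v w = dd (\<lambda>y. chrv h y v w) x u - dd (\<lambda>y. chrv h y u w) x v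
  + chrv h x u (chrv h x v w) - chrv h x v (chrv h x u w)"
proof -
 have o: "open U" using assms by (simp add: metric_on_def)
 have s: "smooth_on U (\<lambda>y. chrv h y v w)" for v w
  by (intro smooth_on_chrv assms smooth_on_const)
 have A: "dd (\<lambda>y. chrv h y v w) x u $ l =
   (\<Sum>i\<in>UNIV. \<Sum>j\<in>UNIV. \<Sum>k\<in>UNIV. partial i (chr h l j k) x * u $ i * v $ j * w $ k)" for u v w l
 proof -
  have "dd (\<lambda>y. chrv h y v w) x u $ l = dd (\<lambda>y. chrv h y v w $ l) x u"
   using dd_nth[OF s assms(2)] by simp
  also have "\<dots> = dd (\<lambda>y. \<Sum>j\<in>UNIV. \<Sum>k\<in>UNIV. chr h l j k y * v $ j * w $ k) x u"
   by (simp add: chrv_def)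
  also have "\<dots> = (\<Sum>j\<in>UNIV. \<Sum>k\<in>UNIV. dd (chr h l j k) x u * v $ j * w $ k)"
  proof -
   have "((\<lambda>y. \<Sum>j\<in>UNIV. \<Sum>k\<in>UNIV. chr h l j k y * v $ j * w $ k) has_derivative
    (\<lambda>u. \<Sum>j\<in>UNIV. \<Sum>k\<in>UNIV. dd (chr h l j k) x u * v $ j * w $ k)) (at x)"
    by (intro has_derivative_sum has_derivative_mult_left
      smooth_on_has_derivative[OF smooth_on_chr[OF assms(1)] assms(2)])
   from dd_eqI[OF this] show ?thesis by simp
  qed
  also have "\<dots> = (\<Sum>j\<in>UNIV. \<Sum>k\<in>UNIV. \<Sum>i\<in>UNIV. partial i (chr h l j k) x * u $ i * v $ j * w $ k)"
   using linear_axis_expand[OF smooth_on_linear_dd[OF smooth_on_chr[OF assms(1)] assms(2)], of l _ _ u]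
   by (simp add: partial_def sum_distrib_left sum_distrib_right mult_ac)
  also have "\<dots> = (\<Sum>j\<in>UNIV. \<Sum>i\<in>UNIV. \<Sum>k\<in>UNIV. partial i (chr h l j k) x * u $ i * v $ j * w $ k)"
   by (intro sum.cong refl sum.swap)
  also have "\<dots> = (\<Sum>i\<in>UNIV. \<Sum>j\<in>UNIV. \<Sum>k\<in>UNIV. partial i (chr h l j k) x * u $ i * v $ j * w $ k)"
   by (rule sum.swap)
  finally show ?thesis .
 qed
 have A': "(\<Sum>i\<in>UNIV. \<Sum>j\<in>UNIV. \<Sum>k\<in>UNIV. partial i (chr h l j k) x * u $ i * v $ j * w $ k) =
   (\<Sum>j\<in>UNIV. \<Sum>i\<in>UNIV. \<Sum>k\<in>UNIV. partial i (chr h l j k) x * u $ i * v $ j * w $ k)" for u v w :: "real^'n" and l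
  by (rule sum.swap)
 have B: "chrv h x u (chrv h x v w) $ l =
   (\<Sum>i\<in>UNIV. \<Sum>j\<in>UNIV. \<Sum>k\<in>UNIV. (\<Sum>m\<in>UNIV. chr h l i m x * chr h m j k x) * u $ i * v $ j * w $ k)" for u v w l
 proof -
  have "chrv h x u (chrv h x v w) $ l = (\<Sum>i\<in>UNIV. \<Sum>m\<in>UNIV. \<Sum>j\<in>UNIV. \<Sum>k\<in>UNIV.
    chr h l i m x * chr h m j k x * u $ i * v $ j * w $ k)"
   by (simp add: chrv_def sum_distrib_left mult_ac)
  also have "\<dots> = (\<Sum>i\<in>UNIV. \<Sum>j\<in>UNIV. \<Sum>m\<in>UNIV. \<Sum>k\<in>UNIV.
    chr h l i m x * chr h m j k x * u $ i * v $ j * w $ k)"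
   by (intro sum.cong refl sum.swap)
  also have "\<dots> = (\<Sum>i\<in>UNIV. \<Sum>j\<in>UNIV. \<Sum>k\<in>UNIV. \<Sum>m\<in>UNIV.
    chr h l i m x * chr h m j k x * u $ i * v $ j * w $ k)"
   by (intro sum.cong refl sum.swap)
  finally show ?thesis by (simp add: sum_distrib_right)
 qed
 have B': "chrv h x v (chrv h x u w) $ l =
   (\<Sum>i\<in>UNIV. \<Sum>j\<in>UNIV. \<Sum>k\<in>UNIV. (\<Sum>m\<in>UNIV. chr h l j m x * chr h m i k x) * u $ i * v $ j * w $ k)" for l
  unfolding B by (subst sum.swap) (simp add: mult_ac)
 have A'': "dd (\<lambda>y. chrv h y u w) x v $ l =
   (\<Sum>i\<in>UNIV. \<Sum>j\<in>UNIV. \<Sum>k\<in>UNIV. partial j (chr h l i k) x * u $ i * v $ j * w $ k)" for l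
  unfolding A by (subst sum.swap) (simp add: mult_ac)
 show ?thesis
 proof (subst vec_eq_iff, intro allI)
  fix l
  show "riemv h x u v w $ l = (dd (\<lambda>y. chrv h y v w) x u - dd (\<lambda>y. chrv h y u w) x v
    + chrv h x u (chrv h x v w) - chrv h x v (chrv h x u w)) $ l"
   unfolding vector_minus_component vector_add_component A[of v w u] A'' B[of u v w] B'
   unfolding sum_subtractf[symmetric] sum.distrib[symmetric] riemv_def vec_lambda_beta
   by (intro sum.cong refl) (simp add: riem_def sum_subtractf ring_distribs)
 qed
qed

text \<open>Here \<open>L y\<close> is linear, but its dependence on \<open>y\<close> is known only
  after a fixed vector is inserted. Expanding \<open>c y\<close> in \<open>Basis\<close> turns the
  expression into a finite sum of ordinary products.\<close>

lemma dd_linear_family: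
 fixes L :: "'a::euclidean_space => 'b::euclidean_space => 'c::euclidean_space"
 assumes "open U" "x \<in> U" "\<And>y. y \<in> U ==> linear (L y)" "\<And>b. smooth_on U (\<lambda>y. L y b)" "smooth_on U c"
 shows "smooth_on U (\<lambda>y. L y (c y))"
  and "dd (\<lambda>y. L y (c y)) x u = dd (\<lambda>y. L y (c x)) x u + L x (dd c x u)"
proof -
 have exp: "L y e = (\<Sum>b\<in>Basis. (e \<bullet> b) *R L y b)" if "y \<in> U" for y e
 proof -
  have "L y (\<Sum>b\<in>Basis. (e \<bullet> b) *R b) = (\<Sum>b\<in>Basis. (e \<bullet> b) *R L y b)"
   using assms(3)[OF that] by (simp add: linear_sum linear_scale)
  thus ?thesis by (simp add: euclidean_representation)
 qed
 show "smooth_on U (\<lambda>y. L y (c y))"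
  by (subst smooth_on_cong[OF assms(1) exp])
   (auto intro!: smooth_on_sum smooth_on_scaleR smooth_on_inner assms)
 have der: "((\<lambda>y. \<Sum>b\<in>Basis. (e y \<bullet> b) *R L y b) has_derivative
  (\<lambda>u. \<Sum>b\<in>Basis. (e x \<bullet> b) *R dd (\<lambda>y. L y b) x u + (dd e x u \<bullet> b) *R L x b)) (at x)"
  if "smooth_on U e" for e
  by (intro has_derivative_sum has_derivative_scaleR has_derivative_inner_left
    smooth_on_has_derivative[OF _ assms(2)] assms that)
 have eq: "dd (\<lambda>y. L y (e y)) x u =
   (\<Sum>b\<in>Basis. (e x \<bullet> b) *R dd (\<lambda>y. L y b) x u + (dd e x u \<bullet> b) *R L x b)"
  if "smooth_on U e" for e
 proof -
  have "dd (\<lambda>y. L y (e y)) x = dd (\<lambda>y. \<Sum>b\<in>Basis. (e y \<bullet> b) *R L y b) x"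
   by (rule dd_cong_open[OF assms(1,2) exp])
  thus ?thesis using dd_eqI[OF der[OF that]] by simp
 qed
 show "dd (\<lambda>y. L y (c y)) x u = dd (\<lambda>y. L y (c x)) x u + L x (dd c x u)"
  unfolding eq[OF assms(5)] eq[OF smooth_on_const, of "c x"] exp[OF assms(2), of "dd c x u"]
  by (simp add: sum.distrib)
qed

lemma dd_bilinear_family:
 fixes L :: "'a::euclidean_space => 'b::euclidean_space => 'd::euclidean_space => 'c::euclidean_space"
 assumes "open U" "x \<in> U" "\<And>y a. y \<in> U ==> linear (L y a)" "\<And>y b. y \<in> U ==> linear (\<lambda>a. L y a b)"
  "\<And>a b. smooth_on U (\<lambda>y. L y a b)" "smooth_on U a" "smooth_on U b"
 shows "dd (\<lambda>y. L y (a y) (b y)) x u =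
  dd (\<lambda>y. L y (a x) (b x)) x u + L x (dd a x u) (b x) + L x (a x) (dd b x u)"
proof -
 have s: "smooth_on U (\<lambda>y. L y (a y) e)" for e
  using dd_linear_family(1)[where L = "\<lambda>y a. L y a e", OF assms(1,2,4,5,6)] .
 have "dd (\<lambda>y. L y (a y) (b y)) x u = dd (\<lambda>y. L y (a y) (b x)) x u + L x (a x) (dd b x u)"
  by (rule dd_linear_family(2)[where L = "\<lambda>y. L y (a y)", OF assms(1,2,3) s assms(7)])
 also have "dd (\<lambda>y. L y (a y) (b x)) x u = dd (\<lambda>y. L y (a x) (b x)) x u + L x (dd a x u) (b x)"
  by (rule dd_linear_family(2)[where L = "\<lambda>y a. L y a (b x)", OF assms(1,2,4,5,6)])
 finally show ?thesis by simp
qed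

text \<open>Local isometries between open sets of coordinate space. The differential is injective
  because the pulled-back metric is definite, hence bijective in equal dimensions. Instances are
  transition maps, exponential coordinates read in a chart, and the passage between two systems of
  exponential coordinates.\<close>

locale metric_pullback =
 fixes U V :: "(real^'n) set" and h k :: "real^'n => real^'n^'n" and ph :: "real^'n => real^'n"
 assumes hU: "metric_on U h" and kV: "metric_on V k" and smooth: "smooth_on U ph" and into: "ph ` U \<subseteq> V"
  and pullback: "\<And>x u w. x \<in> U ==> form (h x) u w = dd ph x u \<bullet> (k (ph x) *v dd ph x w)"
begin

lemma open_U: "open U" and open_V: "open V" and smooth_h: "smooth_on U h" and smooth_k: "smooth_on V k"
 using hU kV by (auto simp: metric_on_def)

lemma linear_D: "x \<in> U ==> linear (dd ph x)"
 by (rule smooth_on_linear_dd[OF smooth])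

lemma inj_D:
 assumes "x \<in> U" "dd ph x u = 0"
 shows "u = 0"
proof -
 have "form (h x) u u = 0" using pullback[OF assms(1), of u u] assms(2) by simp
 thus ?thesis using hU assms(1) posdef_eq_0_iff by (auto simp: metric_on_def)
qed

lemma surj_D: "x \<in> U ==> surj (dd ph x)"
 using inj_D linear_D linear_injective_0 linear_injective_imp_surjective by blast

lemma D_commute: "x \<in> U ==> dd (\<lambda>y. dd ph y u) x v = dd (\<lambda>y. dd ph y v) x u"
 by (rule dd_commute[OF open_U smooth])

lemma smooth_k_comp: "smooth_on U (\<lambda>y. k (ph y))"
 by (rule smooth_on_compose[OF smooth_k smooth open_U open_V into])

lemma dd_h:
 assumes "x \<in> U"
 shows "form (dd h x z) u w = dd (\<lambda>y. dd ph y u) x z \<bullet> (k (ph x) *v dd ph x w)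
  + dd ph x u \<bullet> (dd k (ph x) (dd ph x z) *v dd ph x w)
  + dd ph x u \<bullet> (k (ph x) *v dd (\<lambda>y. dd ph y w) x z)"
proof -
 have "form (dd h x z) u w = dd (\<lambda>y. form (h y) u w) x z"
  using dd_form_const[OF smooth_h assms] by simp
 also have "dd (\<lambda>y. form (h y) u w) x = dd (\<lambda>y. dd ph y u \<bullet> (k (ph y) *v dd ph y w)) x"
  by (rule dd_cong_open[OF open_U assms pullback])
 also have "\<dots> z = dd (\<lambda>y. dd ph y u) x z \<bullet> (k (ph x) *v dd ph x w)
   + dd ph x u \<bullet> (dd (\<lambda>y. k (ph y)) x z *v dd ph x w)
   + dd ph x u \<bullet> (k (ph x) *v dd (\<lambda>y. dd ph y w) x z)"
  by (rule dd_form[OF smooth_on_dd[OF smooth] smooth_k_comp smooth_on_dd[OF smooth] assms])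
 also have "dd (\<lambda>y. k (ph y)) x z = dd k (ph x) (dd ph x z)"
  using into assms by (intro dd_compose[OF smooth assms smooth_k]) auto
 finally show ?thesis .
qed

lemma posdef_k: "x \<in> U ==> posdef (k (ph x))"
 using kV into by (auto simp: metric_on_def)

text \<open>Insert \<open>dd_h\<close> into Koszul's formula. Second derivatives of
  \<open>ph\<close> occur in six terms; by their symmetry four cancel and the other two add up to
  the single term displayed. As the differential is onto, testing against vectors
  \<open>dd ph x w\<close> suffices.\<close>

lemma chrv_transform:
 assumes "x \<in> U"
 shows "dd ph x (chrv h x u v) = dd (\<lambda>y. dd ph y v) x u + chrv k (ph x) (dd ph x u) (dd ph x v)"
proof (rule posdef_cancel[OF posdef_k[OF assms]])
 have V: "ph x \<in> V" using into assms by auto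
 fix z
 obtain w where z: "z = dd ph x w" using surj_D[OF assms] by (metis surjD)
 have "form (k (ph x)) z (dd ph x (chrv h x u v)) = form (h x) w (chrv h x u v)"
  using pullback[OF assms] z by simp
 also have "\<dots> = (form (dd h x u) v w + form (dd h x v) u w - form (dd h x w) u v) / 2"
  by (rule chrv_characterization[OF hU assms])
 also have "\<dots> = dd ph x w \<bullet> (k (ph x) *v dd (\<lambda>y. dd ph y v) x u)
   + dd ph x w \<bullet> (k (ph x) *v chrv k (ph x) (dd ph x u) (dd ph x v))"
  unfolding chrv_characterization[OF kV V] dd_h[OF assms]
  using D_commute[OF assms, of u v] D_commute[OF assms, of u w] D_commute[OF assms, of v w]
   posdef_sym[OF posdef_k[OF assms]]
  by (simp add: field_simps)
 finally show "form (k (ph x)) z (dd ph x (chrv h x u v)) =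
   form (k (ph x)) z (dd (\<lambda>y. dd ph y v) x u + chrv k (ph x) (dd ph x u) (dd ph x v))"
  by (simp add: z matrix_vector_right_distrib inner_add_right)
qed

lemma det_pullback:
 assumes "y \<in> U"
 shows "det (h y) = (det (matrix (dd ph y)))^2 * det (k (ph y))"
proof -
 define M where "M = matrix (dd ph y)"
 have M: "M *v b = dd ph y b" for b
  unfolding M_def by (rule matrix_works) (simp add: linear_D[OF assms] linear_matrix_vector_mul_eq)
 have "h y = transpose M ** k (ph y) ** M"
  unfolding matrix_eq
 proof
  fix b
  have "form (h y) a b = form (transpose M ** k (ph y) ** M) a b" for a
  proof -
   have "form (h y) a b = form (k (ph y)) (M *v a) (M *v b)"
    using pullback[OF assms, of a b] by (simp add: M)
   also have "\<dots> = form (transpose M) a (k (ph y) *v (M *v b))"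
    by (metis dot_lmul_matrix inner_commute transpose_matrix_vector)
   finally show ?thesis by (simp only: matrix_vector_mul_assoc matrix_mul_assoc)
  qed
  thus "h y *v b = (transpose M ** k (ph y) ** M) *v b" by (metis inner_commute vector_eq_rdot)
 qed
 thus ?thesis by (simp add: det_mul M_def power2_eq_square)
qed

text \<open>Differentiating \<open>chrv_transform\<close> once more and antisymmetrising in
  \<open>u\<close> and \<open>v\<close> removes the third derivatives of \<open>ph\<close>, which
  are symmetric. The remaining second derivatives are replaced by connection terms through the same
  transformation law.\<close>

lemma riemv_transform:
 assumes "x \<in> U"
 shows "dd ph x (riemv h x u v w) = riemv k (ph x) (dd ph x u) (dd ph x v) (dd ph x w)"
proof -
 have V: "ph x \<in> V" using into assms by auto
 note lin = linear_D[OF assms]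
 define D2 where "D2 a b = dd (\<lambda>y. dd ph y a) x b" for a b
 define G where "G = chrv h x" 
 define K where "K = chrv k (ph x)"
 define F where "F = dd ph x"
 have D2: "D2 b a = F (G a b) - K (F a) (F b)" for a b
  using chrv_transform[OF assms, of a b] by (simp add: D2_def F_def G_def K_def)
 \<comment> \<open>This is \<open>chrv_transform\<close> for \<open>v\<close> and \<open>w\<close>,
   differentiated in direction \<open>u\<close>: the left side by the product rule for linear
   families, the right side by the bilinear one and the chain rule.\<close>
 have key: "D2 (G v w) u + F (dd (\<lambda>y. chrv h y v w) x u) =
   dd (\<lambda>y. dd (\<lambda>z. dd ph z w) y v) x u + dd (\<lambda>z. chrv k z (F v) (F w)) (ph x) (F u)
   + K (D2 v u) (F w) + K (F v) (D2 w u)" for u v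
 proof -
  have smG: "smooth_on U (\<lambda>y. chrv h y v w)"
   by (intro smooth_on_chrv hU smooth_on_const)
  have smK: "smooth_on V (\<lambda>z. chrv k z a b)" for a b
   by (intro smooth_on_chrv kV smooth_on_const)
  have smK': "smooth_on U (\<lambda>y. chrv k (ph y) a b)" for a b
   by (rule smooth_on_compose[OF smK smooth open_U open_V into])
  have "D2 (G v w) u + F (dd (\<lambda>y. chrv h y v w) x u) = dd (\<lambda>y. dd ph y (chrv h y v w)) x u"
   using dd_linear_family(2)[where L = "dd ph", OF open_U assms linear_D smooth_on_dd[OF smooth] smG]
   by (simp add: D2_def G_def F_def)
  also have "dd (\<lambda>y. dd ph y (chrv h y v w)) x =
    dd (\<lambda>y. dd (\<lambda>z. dd ph z w) y v + chrv k (ph y) (dd ph y v) (dd ph y w)) x"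
   by (rule dd_cong_open[OF open_U assms chrv_transform])
  also have "\<dots> u = dd (\<lambda>y. dd (\<lambda>z. dd ph z w) y v) x u
    + dd (\<lambda>y. chrv k (ph y) (dd ph y v) (dd ph y w)) x u"
  proof -
   have "smooth_on U (\<lambda>y. chrv k (ph y) (dd ph y v) (dd ph y w))"
   proof -
    have "smooth_on U (\<lambda>y. chrv k (ph y) (dd ph y v) e)" for e
     by (rule dd_linear_family(1)[where L = "\<lambda>y a. chrv k (ph y) a e", OF open_U assms linear_chrv(2) smK'
       smooth_on_dd[OF smooth]])
    thus ?thesis
     by (rule dd_linear_family(1)[where L = "\<lambda>y. chrv k (ph y) (dd ph y v)", OF open_U assms linear_chrv(1) _
       smooth_on_dd[OF smooth]])
   qed
   from dd_eqI[OF has_derivative_add[OF smooth_on_has_derivative[OF smooth_on_dd[OF smooth_on_dd[OF smooth]] assms]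
     smooth_on_has_derivative[OF this assms]]]
   show ?thesis by simp
  qed
  also have "dd (\<lambda>y. chrv k (ph y) (dd ph y v) (dd ph y w)) x u =
    dd (\<lambda>y. chrv k (ph y) (F v) (F w)) x u + K (D2 v u) (F w) + K (F v) (D2 w u)"
   unfolding F_def K_def D2_def
   by (rule dd_bilinear_family[where L = "\<lambda>y. chrv k (ph y)", OF open_U assms linear_chrv smK'
      smooth_on_dd[OF smooth] smooth_on_dd[OF smooth]])
  also have "dd (\<lambda>y. chrv k (ph y) (F v) (F w)) x u = dd (\<lambda>z. chrv k z (F v) (F w)) (ph x) (F u)"
   unfolding F_def by (rule dd_compose[OF smooth assms smK V])
  finally show ?thesis by simp
 qed
 have D3: "dd (\<lambda>y. dd (\<lambda>z. dd ph z w) y v) x u = dd (\<lambda>y. dd (\<lambda>z. dd ph z w) y u) x v"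
  by (rule dd_commute[OF open_U smooth_on_dd[OF smooth] assms])
 have D2c: "D2 u v = D2 v u" unfolding D2_def by (rule D_commute[OF assms])
 have "F (riemv h x u v w) = F (dd (\<lambda>y. chrv h y v w) x u) - F (dd (\<lambda>y. chrv h y u w) x v)
   + F (G u (G v w)) - F (G v (G u w))"
  unfolding riemv_formula[OF hU assms] G_def F_def using lin by (simp add: linear_add linear_diff)
 also have "\<dots> = dd (\<lambda>z. chrv k z (F v) (F w)) (ph x) (F u) - dd (\<lambda>z. chrv k z (F u) (F w)) (ph x) (F v)
   + K (F v) (D2 w u) - K (F u) (D2 w v) - D2 (G v w) u + D2 (G u w) v + F (G u (G v w)) - F (G v (G u w))"
 proof -
  have "F (dd (\<lambda>y. chrv h y v w) x u) = dd (\<lambda>y. dd (\<lambda>z. dd ph z w) y v) x u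
   + dd (\<lambda>z. chrv k z (F v) (F w)) (ph x) (F u) + K (D2 v u) (F w) + K (F v) (D2 w u) - D2 (G v w) u" for u v
   using add_implies_diff[OF key[of v u, unfolded add.commute[of "D2 (G v w) u"]]] by simp
  thus ?thesis by (simp add: D3 D2c)
 qed
 also have "\<dots> = dd (\<lambda>z. chrv k z (F v) (F w)) (ph x) (F u) - dd (\<lambda>z. chrv k z (F u) (F w)) (ph x) (F v)
   + K (F u) (K (F v) (F w)) - K (F v) (K (F u) (F w))"
 proof -
  have "K a (b - c) = K a b - K a c" for a b c by (simp add: K_def chrv_bilinear_diff)
  hence "K a (D2 b c) = K a (F (G c b)) - K a (K (F c) (F b))" for a b c by (simp only: D2)
  thus ?thesis by (simp only: D2[of "G v w" u] D2[of "G u w" v]) (simp add: algebra_simps)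
 qed
 also have "\<dots> = riemv k (ph x) (F u) (F v) (F w)"
  unfolding riemv_formula[OF kV V] K_def ..
 finally show ?thesis by (simp add: F_def)
qed

end

section \<open>Operators that are self-adjoint for an inner product\<close>

definition selfadj :: "real^'n^'n => real^'n^'n => bool" where
 "selfadj P S \<longleftrightarrow> (\<forall>u w. form P u (S *v w) = form P w (S *v u))"

definition orthonormal_for :: "real^'n^'n => (real^'n) set => bool" where
 "orthonormal_for P B \<longleftrightarrow> (\<forall>b\<in>B. \<forall>b'\<in>B. form P b b' = (if b = b' then 1 else 0))"

lemma continuous_on_form [continuous_intros]:
 fixes M :: "real^'n^'m"
 assumes "continuous_on S a" "continuous_on S b"
 shows "continuous_on S (\<lambda>x. a x \<bullet> (M *v b x))"
proof -
 have "continuous_on S (\<lambda>x. M *v b x)"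
  by (rule continuous_on_compose2[OF linear_continuous_on assms(2)])
   (auto simp: linear_conv_bounded_linear[symmetric])
 thus ?thesis by (intro continuous_intros assms)
qed

lemma posdef_lower_bound:
 fixes P :: "real^'n^'n"
 assumes "posdef P"
 obtains m where "m > 0" "\<And>u. m * (norm u)^2 \<le> form P u u"
proof -
 have "compact (sphere (0::real^'n) 1)" "sphere (0::real^'n) 1 \<noteq> {}" by auto
 moreover have "continuous_on (sphere 0 1) (\<lambda>u. form P u u)"
  by (intro continuous_intros)
 ultimately obtain u0 where u0: "u0 \<in> sphere 0 1" "\<And>u. u \<in> sphere 0 1 ==> form P u0 u0 \<le> form P u u"
  using continuous_attains_inf[of "sphere (0::real^'n) 1" "\<lambda>u. form P u u"] by blast
 show thesis
 proof (rule that)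
  show "form P u0 u0 > 0" using u0(1) by (intro posdef_pos[OF assms]) auto
  fix u :: "real^'n"
  show "(form P u0 u0) * (norm u)^2 \<le> form P u u"
  proof (cases "u = 0")
   case False
   hence "form P u0 u0 \<le> form P (u /\<^sub>R norm u) (u /\<^sub>R norm u)"
    by (intro u0) simp
   thus ?thesis
    using False by (simp add: mv_scaleR field_simps power2_eq_square)
  qed simp
 qed
qed

text \<open>The spectral theorem relative to the inner product \<open>P\<close>. A maximiser of the
  quadratic form on the unit sphere of \<open>W\<close> is an eigenvector, and its orthogonal
  complement in \<open>W\<close> is again invariant. Allowing subspaces \<open>W\<close> covers the
  complement of the radial direction as well.\<close>

lemma selfadj_eigenbasis:
 assumes P: "posdef P" and S: "selfadj P S" and W: "subspace W" and inv: "\<And>w. w \<in> W ==> S *v w \<in> W"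
 shows "\<exists>B\<subseteq>W. finite B \<and> card B = dim W \<and> orthonormal_for P B \<and> (\<forall>b\<in>B. \<exists>c. S *v b = c *R b)"
 using W inv
proof (induction "dim W" arbitrary: W)
 case 0
 show ?case by (rule exI[of _ "{}"]) (use 0 in \<open>auto simp: orthonormal_for_def\<close>)
next
 case (Suc d W)
 define f where "f u = form P u (S *v u)" for u
 have sym: "form P u w = form P w u" for u w by (rule posdef_sym[OF P])
 have sa: "form P u (S *v w) = form P w (S *v u)" for u w using S by (simp add: selfadj_def)
 obtain m where m: "m > 0" "\<And>u. m * (norm u)^2 \<le> form P u u" using posdef_lower_bound[OF P] by blast
 define K where "K = W \<inter> {u. form P u u = 1}"
 have "bounded K"
  unfolding bounded_iff
 proof (intro exI ballI)
  fix u assume "u \<in> K"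
  hence "(norm u)^2 \<le> 1 / m" using m(2)[of u] m(1) by (simp add: K_def field_simps)
  thus "norm u \<le> sqrt (1 / m)" using real_le_rsqrt by blast
 qed
 moreover have "closed K"
  unfolding K_def
  by (intro closed_Int closed_subspace Suc closed_Collect_eq continuous_intros)
 ultimately have "compact K" by (simp add: compact_eq_bounded_closed)
 moreover obtain w0 where w0: "w0 \<in> W" "w0 \<noteq> 0"
  using Suc(2) by (metis dim_eq_0 nat.distinct(1) singleton_iff subsetI)
 have K1: "(1 / sqrt (form P u u)) *R u \<in> K" if "u \<in> W" "u \<noteq> 0" for u
  using that posdef_pos[OF P that(2)] Suc(3)
  by (auto simp: K_def subspace_scale mv_scaleR real_sqrt_mult[symmetric])
 hence "K \<noteq> {}" using w0 by blast
 moreover have "continuous_on K f"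
  unfolding f_def matrix_vector_mul_assoc by (intro continuous_intros)
 ultimately obtain b where b: "b \<in> K" and max: "\<And>u. u \<in> K ==> f u \<le> f b"
  using continuous_attains_sup by metis
 have bW: "b \<in> W" and b1: "form P b b = 1" using b by (auto simp: K_def)
 have ineq: "f u \<le> f b * (form P u u)" if "u \<in> W" for u
 proof (cases "u = 0")
  case False
  have "f ((1 / sqrt (form P u u)) *R u) \<le> f b" using max K1 that False by blast
  thus ?thesis
   using posdef_pos[OF P False] by (simp add: f_def mv_scaleR field_simps)
 qed (simp add: f_def)
 \<comment> \<open>Stationarity at the maximiser \<open>b\<close>: along \<open>b + t *R w\<close>
   the form changes by a linear and a quadratic term in \<open>t\<close>, so a nonzero linear
   coefficient would contradict maximality.\<close>
 have orth: "form P w (S *v b) = 0" if w: "w \<in> W" "form P w b = 0" for w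
 proof (rule ccontr)
  define a where "a = form P w (S *v b)"
  assume "form P w (S *v b) \<noteq> 0"
  hence a: "a \<noteq> 0" by (simp add: a_def)
  define C where "C = f b * (form P w w) - f w"
  have quad: "2 * t * a \<le> t^2 * C" for t
  proof -
   have "b + t *R w \<in> W" using bW w Suc(3) by (simp add: subspace_add subspace_scale)
   from ineq[OF this] have "f (b + t *R w) \<le> f b * (form P (b + t *R w) (b + t *R w))" .
   moreover have "f (b + t *R w) = f b + 2 * t * a + t^2 * f w"
    using sa[of b w] by (simp add: f_def a_def matrix_vector_right_distrib mv_scaleR
     inner_add_left inner_add_right power2_eq_square algebra_simps)
   moreover have "form P (b + t *R w) (b + t *R w) = 1 + t^2 * (form P w w)"
    using b1 w(2) sym[of b w] by (simp add: matrix_vector_right_distrib mv_scaleR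
     inner_add_left inner_add_right power2_eq_square)
   ultimately have "f b + 2 * t * a + t^2 * f w \<le> f b * (1 + t^2 * (form P w w))" by metis
   thus ?thesis by (simp add: C_def algebra_simps)
  qed
  \<comment> \<open>Small enough that \<open>2 * t * a\<close> exceeds \<open>t^2 * C\<close>; the
    summand 1 covers \<open>C = 0\<close>.\<close>
  define t where "t = a / (\<bar>C\<bar> + 1)"
  have "2 * t * a = 2 * a^2 / (\<bar>C\<bar> + 1)" by (simp add: t_def power2_eq_square)
  moreover have "t^2 * C \<le> a^2 / (\<bar>C\<bar> + 1)"
  proof -
   have "t^2 * C \<le> t^2 * (\<bar>C\<bar> + 1)" by (intro mult_left_mono) auto
   also have "\<dots> = a^2 / (\<bar>C\<bar> + 1)" by (simp add: t_def power2_eq_square)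
   finally show ?thesis .
  qed
  moreover have "a^2 / (\<bar>C\<bar> + 1) > 0" using a by (simp add: add_nonneg_pos)
  ultimately show False using quad[of t] by simp
 qed
 have eig: "S *v b = f b *R b"
 proof -
  define w where "w = S *v b - f b *R b"
  have wW: "w \<in> W" using bW Suc(3,4) by (simp add: w_def subspace_diff subspace_scale)
  have wb: "form P w b = 0"
   using sym[of "S *v b" b] b1 by (simp add: w_def inner_diff_left f_def)
  have "form P w w = 0"
   using orth[OF wW wb] wb
   by (subst (2) w_def) (simp add: matrix_vector_mult_diff_distrib mv_scaleR inner_diff_right)
  thus ?thesis using posdef_eq_0_iff[OF P] by (simp add: w_def)
 qed
 define W' where "W' = W \<inter> {w. form P w b = 0}"
 have W': "subspace W'"
  using Suc(3) unfolding W'_def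
  by (auto simp: subspace_def inner_add_left)
 have inv': "S *v w \<in> W'" if "w \<in> W'" for w
  using that Suc(4) sym[of "S *v w" b] sa[of b w] eig
  by (auto simp: W'_def mv_scaleR)
 have "b \<notin> span W'" using b1 W' by (metis IntD2 W'_def mem_Collect_eq span_eq_iff zero_neq_one)
 hence "dim (insert b W') = Suc (dim W')" by (simp add: dim_insert)
 moreover have "span (insert b W') = W"
 proof (rule span_subspace)
  show "insert b W' \<subseteq> W" using bW by (auto simp: W'_def)
  show "W \<subseteq> span (insert b W')"
  proof
   fix w assume w: "w \<in> W"
   define w' where "w' = w - (form P w b) *R b"
   have "w' \<in> W'" using w bW b1 Suc(3) by (auto simp: w'_def W'_def subspace_diff subspace_scale inner_diff_left)
   hence "w' + (form P w b) *R b \<in> span (insert b W')"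
    by (intro span_add span_scale span_base) auto
   thus "w \<in> span (insert b W')" by (simp add: w'_def)
  qed
 qed (fact Suc(3))
 ultimately have dimW: "dim W = Suc (dim W')" by (metis dim_span)
 hence "d = dim W'" using Suc(2) by simp
 from Suc(1)[OF this W' inv'] obtain B where B: "B \<subseteq> W'" "finite B" "card B = dim W'" "orthonormal_for P B"
  "\<forall>b\<in>B. \<exists>c. S *v b = c *R b" by blast
 have nb: "b \<notin> B" using B(1) b1 by (auto simp: W'_def)
 show ?case
 proof (intro exI[of _ "insert b B"] conjI)
  show "insert b B \<subseteq> W" using B bW by (auto simp: W'_def)
  show "card (insert b B) = dim W" using B nb dimW by simp
  have "form P b c = 0" "form P c b = 0" if "c \<in> B" for c
   using that B(1) sym[of b c] by (auto simp: W'_def)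
  thus "orthonormal_for P (insert b B)"
   using B(4) b1 nb unfolding orthonormal_for_def by auto
  show "\<forall>b\<in>insert b B. \<exists>c. S *v b = c *R b" using B(5) eig by auto
 qed (use B in auto)
qed

lemma form_sum_right:
 fixes P :: "real^'n^'m"
 shows "form P a (\<Sum>b\<in>B. c b *R b) = (\<Sum>b\<in>B. c b * (form P a b))"
 by (simp add: linear_sum[OF matrix_vector_mul_linear] mv_scaleR inner_sum_right)

lemma orthonormal_for_independent:
 assumes "finite B" "orthonormal_for P B"
 shows "independent B"
 unfolding independent_explicit
proof (intro conjI allI impI ballI assms(1))
 fix c b assume 0: "(\<Sum>v\<in>B. c v *R v) = 0" and b: "b \<in> B"
 have "0 = form P b (\<Sum>v\<in>B. c v *R v)" unfolding 0 by simp
 also have "\<dots> = (\<Sum>v\<in>B. c v * (if b = v then 1 else 0))"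
  unfolding form_sum_right using assms(2) b by (simp add: orthonormal_for_def)
 also have "\<dots> = c b" using assms(1) b by (simp add: if_distrib cong: if_cong)
 finally show "c b = 0" by simp
qed

lemma orthonormal_for_expand:
 assumes "finite B" "orthonormal_for P B" "w \<in> span B"
 shows "w = (\<Sum>b\<in>B. (form P b w) *R b)"
proof -
 obtain c where w: "w = (\<Sum>b\<in>B. c b *R b)" using assms(1,3) span_finite by blast
 have "form P b w = c b" if b: "b \<in> B" for b
 proof -
  have "form P b w = (\<Sum>v\<in>B. c v * (if b = v then 1 else 0))"
   unfolding w form_sum_right using assms(2) b by (simp add: orthonormal_for_def)
  also have "\<dots> = c b" using assms(1) b by (simp add: if_distrib cong: if_cong)
  finally show ?thesis .
 qed
 thus ?thesis using w by simp
qed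

lemma orthonormal_for_span:
 assumes "finite B" "orthonormal_for P B" "B \<subseteq> W" "card B = dim W" "subspace W"
 shows "span B = W"
 using card_eq_dim[OF assms(3,4,1)] orthonormal_for_independent[OF assms(1,2)] assms(3,5)
 by (meson span_subspace)

text \<open>The columns of \<open>L\<close> are the basis vectors. Then
  \<open>transpose L ** P\<close> inverts \<open>L\<close>, and the trace formula is the invariance
  of the trace under conjugation.\<close>

lemma orthonormal_for_matrix:
 fixes P :: "real^'n^'n"
 assumes "finite B" "orthonormal_for P B" "card B = CARD('n)"
 obtains L :: "real^'n^'n" where "transpose L ** P ** L = mat 1"
  "\<And>S. trace S = (\<Sum>b\<in>B. form P b (S *v b))"
proof -
 obtain e where e: "bij_betw e (UNIV::'n set) B"
  using assms by (metis finite_same_card_bij finite_class.finite_UNIV)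
 define L :: "real^'n^'n" where "L = (\<chi> i j. e j $ i)"
 have col: "column j L = e j" for j by (simp add: column_def L_def vec_eq_iff)
 have entry: "(transpose L ** M ** L) $ i $ j = e i \<bullet> (M *v e j)" for M :: "real^'n^'n" and i j
 proof -
  have "(transpose L ** M ** L) $ i $ j = (\<Sum>m\<in>UNIV. \<Sum>l\<in>UNIV. e i $ l * (M $ l $ m * e j $ m))"
   by (simp add: matrix_matrix_mult_def transpose_def L_def sum_distrib_right mult.assoc)
  also have "\<dots> = (\<Sum>l\<in>UNIV. \<Sum>m\<in>UNIV. e i $ l * (M $ l $ m * e j $ m))"
   by (rule sum.swap)
  finally show ?thesis by (simp add: inner_vec_def matrix_vector_mult_def sum_distrib_left)
 qed
 have ei: "e i \<in> B" for i using e by (auto simp: bij_betw_def)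
 have inj: "e i = e j \<longleftrightarrow> i = j" for i j using e by (auto simp: bij_betw_def inj_on_def)
 have 1: "transpose L ** P ** L = mat 1"
  unfolding vec_eq_iff entry using assms(2) ei inj by (simp add: orthonormal_for_def mat_def)
 show thesis
 proof (rule that)
  show "transpose L ** P ** L = mat 1" by (rule 1)
  fix S :: "real^'n^'n"
  have "L ** (transpose L ** P) = mat 1" using 1 by (simp add: matrix_left_right_inverse)
  hence "trace S = trace (S ** L ** (transpose L ** P))" by (simp add: matrix_mul_assoc[symmetric])
  also have "\<dots> = trace (transpose L ** (P ** S) ** L)"
   by (subst trace_mul_sym) (simp add: matrix_mul_assoc)
  also have "\<dots> = (\<Sum>i\<in>UNIV. e i \<bullet> (P *v (S *v e i)))"
   by (simp add: trace_def entry matrix_vector_mul_assoc)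
  also have "\<dots> = (\<Sum>b\<in>B. form P b (S *v b))"
   by (rule sum.reindex_bij_betw[OF e])
  finally show "trace S = (\<Sum>b\<in>B. form P b (S *v b))" .
 qed
qed

lemma posdef_diagonalize:
 assumes "posdef P"
 obtains L :: "real^'n^'n" where "transpose L ** P ** L = mat 1"
proof -
 have "selfadj P (mat 1)" by (simp add: selfadj_def posdef_sym[OF assms])
 from selfadj_eigenbasis[OF assms this subspace_UNIV]
 obtain B where "finite B" "card B = CARD('n)" "orthonormal_for P B" by auto
 thus thesis using orthonormal_for_matrix that by metis
qed

lemma posdef_det_pos:
 fixes P :: "real^'n^'n"
 assumes "posdef P"
 shows "det P > 0"
proof -
 obtain L :: "real^'n^'n" where "transpose L ** P ** L = mat 1" using posdef_diagonalize[OF assms] .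
 hence "det (transpose L ** P ** L) = 1" by simp
 hence "det L * det L * det P = 1" by (simp add: det_mul mult_ac)
 hence "\<not> det L * det L * det P \<le> 0" by simp
 thus ?thesis
  using mult_nonneg_nonpos[of "det L * det L" "det P"] zero_le_square[of "det L"] not_le by blast
qed

lemma selfadj_spectrum:
 fixes P S :: "real^'n^'n"
 assumes "posdef P" "selfadj P S"
 obtains B l where "finite B" "card B = CARD('n)" "orthonormal_for P B" "\<And>b. b \<in> B ==> S *v b = l b *R b"
  "trace S = (\<Sum>b\<in>B. l b)" "trace (S ** S) = (\<Sum>b\<in>B. (l b)^2)" "span B = UNIV"
proof -
 from selfadj_eigenbasis[OF assms subspace_UNIV]
 obtain B where B: "finite B" "card B = CARD('n)" "orthonormal_for P B" "\<forall>b\<in>B. \<exists>c. S *v b = c *R b" by auto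
 then obtain l where l: "\<And>b. b \<in> B ==> S *v b = l b *R b" by metis
 obtain L :: "real^'n^'n" where tr: "\<And>S. trace S = (\<Sum>b\<in>B. form P b (S *v b))"
  using orthonormal_for_matrix[OF B(1,3,2)] by metis
 have 1: "form P b b = 1" if "b \<in> B" for b using B(3) that by (simp add: orthonormal_for_def)
 show thesis
 proof (rule that[OF B(1-3) l])
  show "trace S = (\<Sum>b\<in>B. l b)"
   unfolding tr by (intro sum.cong refl) (simp add: l mv_scaleR 1)
  show "trace (S ** S) = (\<Sum>b\<in>B. (l b)^2)"
  proof -
   have "(S ** S) *v b = (l b)^2 *R b" if "b \<in> B" for b
    using l[OF that] by (simp add: matrix_vector_mul_assoc[symmetric] mv_scaleR power2_eq_square)
   thus ?thesis
    unfolding tr by (intro sum.cong refl) (simp add: mv_scaleR 1)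
  qed
  show "span B = UNIV"
   using orthonormal_for_span[OF B(1,3), of UNIV] B(2) by simp
 qed
qed

text \<open>All three follow from the real eigenvalues \<open>l b\<close>: the trace of the square
  is the sum of their squares, and the second bound is Cauchy-Schwarz. They serve the upper bound of
  the mean curvature, its lower bound, and the equality case, in this order.\<close>

lemma selfadj_trace_square:
 fixes P S :: "real^'n^'n"
 assumes "posdef P" "selfadj P S"
 shows "trace (S ** S) \<ge> 0" "(trace S)^2 \<le> real CARD('n) * trace (S ** S)"
  "trace (S ** S) = 0 ==> S = 0"
proof -
 obtain B l where B: "finite B" "card B = CARD('n)" "orthonormal_for P B" "\<And>b. b \<in> B ==> S *v b = l b *R b"
  "trace S = (\<Sum>b\<in>B. l b)" "trace (S ** S) = (\<Sum>b\<in>B. (l b)^2)" "span B = UNIV"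
  using selfadj_spectrum[OF assms] by metis
 show "trace (S ** S) \<ge> 0" by (simp add: B(6) sum_nonneg)
 show "(trace S)^2 \<le> real CARD('n) * trace (S ** S)"
  using Cauchy_Schwarz_ineq_sum[of "\<lambda>_. 1" l B] by (simp add: B)
 assume "trace (S ** S) = 0"
 hence l0: "l b = 0" if "b \<in> B" for b using B(1,6) that by (simp add: sum_nonneg_eq_0_iff)
 have "S *v w = 0" for w
 proof -
  have "w = (\<Sum>b\<in>B. (form P b w) *R b)" using orthonormal_for_expand[OF B(1,3)] B(7) by blast
  hence "S *v w = (\<Sum>b\<in>B. (form P b w) *R (S *v b))"
   by (metis (no_types, lifting) linear_sum[OF matrix_vector_mul_linear] mv_scaleR sum.cong)
  thus ?thesis by (simp add: B(4) l0)
 qed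
 thus "S = 0" by (simp add: matrix_eq)
qed

text \<open>The left-hand side has the shape of \<open>mean_curvature\<close>: distinct eigenvalues
  weighted by dimensions. An orthonormal eigenbasis of the complement of \<open>x\<close> groups
  into bases of the spaces \<open>E kp\<close>; adjoining the normalised \<open>x\<close> gives a
  full basis, in which \<open>x\<close> contributes \<open>\<mu>\<close> to the trace.\<close>

lemma selfadj_sum_eigenvalues:
 fixes P S :: "real^'n^'n"
 assumes P: "posdef P" and S: "selfadj P S" and x: "x \<noteq> 0" "S *v x = \<mu> *R x"
 defines "E kp \<equiv> {w. form P w x = 0 \<and> S *v w = kp *R w}"
 shows "(\<Sum>kp | \<exists>w\<in>E kp. w \<noteq> 0. real (dim (E kp)) * kp) = trace S - \<mu>"
proof -
 define W where "W = {w. form P w x = 0}"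
 have sym: "form P u w = form P w u" for u w by (rule posdef_sym[OF P])
 have sa: "form P u (S *v w) = form P w (S *v u)" for u w using S by (simp add: selfadj_def)
 have W: "subspace W" by (auto simp: W_def subspace_def inner_add_left)
 have inv: "S *v w \<in> W" if "w \<in> W" for w
  using that sa[of x w] x(2) sym[of "S *v w" x] by (simp add: W_def mv_scaleR)
 obtain B where B: "B \<subseteq> W" "finite B" "card B = dim W" "orthonormal_for P B" "\<forall>b\<in>B. \<exists>c. S *v b = c *R b"
  using selfadj_eigenbasis[OF P S W inv] by blast
 obtain l where l: "\<And>b. b \<in> B ==> S *v b = l b *R b" using B(5) by metis
 have spB: "span B = W" using orthonormal_for_span[OF B(2,4,1,3) W] .
 have b1: "form P b b = 1" if "b \<in> B" for b using B(4) that by (simp add: orthonormal_for_def)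
 have b0: "b \<noteq> 0" if "b \<in> B" for b using b1[OF that] by auto
 have Espan: "E kp = span {b\<in>B. l b = kp}" for kp
 proof
  show "E kp \<subseteq> span {b\<in>B. l b = kp}"
  proof
   fix w assume w: "w \<in> E kp"
   hence "w \<in> span B" unfolding spB by (simp add: E_def W_def)
   hence exp: "w = (\<Sum>b\<in>B. (form P b w) *R b)" by (rule orthonormal_for_expand[OF B(2,4)])
   have "(form P b w) = 0" if "b \<in> B" "l b \<noteq> kp" for b
   proof -
    have "kp * (form P b w) = form P b (S *v w)" using w by (simp add: E_def mv_scaleR)
    also have "\<dots> = l b * (form P b w)" using sa[of b w] l[OF that(1)] sym[of w b] by (simp add: mv_scaleR)
    finally show ?thesis using that(2) by simp
   qed
   hence "w = (\<Sum>b\<in>{b\<in>B. l b = kp}. (form P b w) *R b)"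
    by (subst exp) (rule sum.mono_neutral_right[OF B(2)], auto)
   thus "w \<in> span {b\<in>B. l b = kp}"
    by (metis (no_types, lifting) span_sum span_scale span_base)
  qed
  show "span {b\<in>B. l b = kp} \<subseteq> E kp"
  proof (rule span_minimal)
   show "{b\<in>B. l b = kp} \<subseteq> E kp" using B(1) l by (auto simp: E_def W_def)
   show "subspace (E kp)"
    by (auto simp: E_def subspace_def inner_add_left matrix_vector_right_distrib mv_scaleR scaleR_add_right)
  qed
 qed
 have dimE: "dim (E kp) = card {b\<in>B. l b = kp}" for kp
  unfolding Espan dim_span
  by (rule dim_eq_card_independent, rule independent_mono[OF orthonormal_for_independent[OF B(2,4)]]) auto
 have ev: "{kp. \<exists>w\<in>E kp. w \<noteq> 0} = l ` B"
 proof (intro equalityI subsetI)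
  fix kp assume "kp \<in> {kp. \<exists>w\<in>E kp. w \<noteq> 0}"
  hence "{b\<in>B. l b = kp} \<noteq> {}" unfolding Espan by force
  thus "kp \<in> l ` B" by auto
 next
  fix kp assume "kp \<in> l ` B"
  then obtain b where "b \<in> B" "l b = kp" by auto
  hence "b \<in> E kp" "b \<noteq> 0" unfolding Espan using b0 by (auto intro: span_base)
  thus "kp \<in> {kp. \<exists>w\<in>E kp. w \<noteq> 0}" by blast
 qed
 have "(\<Sum>kp | \<exists>w\<in>E kp. w \<noteq> 0. real (dim (E kp)) * kp) = (\<Sum>kp\<in>l ` B. \<Sum>b\<in>{b\<in>B. l b = kp}. l b)"
  unfolding ev dimE by (intro sum.cong refl) simp
 also have "\<dots> = (\<Sum>b\<in>B. l b)"
  using sum.image_gen[OF B(2), of l l] by simp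
 also have "\<dots> = trace S - \<mu>"
 proof -
  define a where "a = sqrt (form P x x)"
  define y where "y = (1 / a) *R x"
  have xx: "form P x x > 0" by (rule posdef_pos[OF P x(1)])
  hence a: "a > 0" "a^2 = form P x x" by (auto simp: a_def)
  have y1: "form P y y = 1"
   using a xx by (simp add: y_def mv_scaleR power2_eq_square[symmetric])
  have yB: "form P b y = 0 \<and> form P y b = 0" if "b \<in> B" for b
   using that B(1) sym[of y b] by (auto simp: W_def y_def mv_scaleR)
  have ynB: "y \<notin> B" using yB y1 by force
  have ortho: "orthonormal_for P (insert y B)"
   using B(4) y1 yB ynB unfolding orthonormal_for_def by auto
  have "span (insert y B) = UNIV"
  proof (intro equalityI subset_UNIV subsetI)
   fix w
   have "w - (form P w y) *R y \<in> span B"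
    unfolding spB using xx a by (simp add: W_def inner_diff_left y_def mv_scaleR power2_eq_square)
   hence "w - (form P w y) *R y \<in> span (insert y B)" using span_mono[of B "insert y B"] by blast
   from span_add[OF this span_scale[OF span_base[of y], where c = "form P w y"]]
   have "w - (form P w y) *R y + (form P w y) *R y \<in> span (insert y B)" by simp
   thus "w \<in> span (insert y B)" by simp
  qed
  moreover have fin: "finite (insert y B)" using B by simp
  ultimately have "card (insert y B) = CARD('n)"
   using dim_eq_card[of "insert y B" UNIV] orthonormal_for_independent[OF fin ortho] by simp
  hence "trace S = (\<Sum>b\<in>insert y B. form P b (S *v b))"
   using orthonormal_for_matrix[OF fin ortho] by metis
  also have "\<dots> = form P y (S *v y) + (\<Sum>b\<in>B. form P b (S *v b))"
   using ynB B by simp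
  also have "form P y (S *v y) = \<mu>"
  proof -
   have "S *v y = \<mu> *R y" by (simp add: y_def mv_scaleR x(2))
   thus ?thesis using y1 by (simp add: mv_scaleR)
  qed
  also have "(\<Sum>b\<in>B. form P b (S *v b)) = (\<Sum>b\<in>B. l b)"
   by (intro sum.cong refl) (simp add: l mv_scaleR b1)
  finally show ?thesis by simp
 qed
 finally show ?thesis .
qed

section \<open>Normal coordinates\<close>

lemma dd_matrix_vector_const:
 fixes M :: "'a::euclidean_space => real^'n^'m"
 assumes "smooth_on S M" "x \<in> S"
 shows "dd (\<lambda>y. M y *v w) x u = dd M x u *v w"
 using dd_eqI[OF bounded_bilinear.FDERIV[OF bounded_bilinear_matrix_vector
    smooth_on_has_derivative[OF assms] has_derivative_const[of w]]] by simp

lemma uminus_matrix_vector: "(- M) *v w = - (M *v (w :: real^'n))"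
 by (simp add: matrix_vector_mult_def vec_eq_iff sum_negf)

lemma chrv_zero: "chrv h x u 0 = 0" "chrv h x 0 v = 0"
 by (simp_all add: chrv_def vec_eq_iff)

lemma dd_sym_form:
 assumes "metric_on U h" "x \<in> U"
 shows "form (dd h x z) u w = form (dd h x z) w u"
proof -
 have o: "open U" and s: "smooth_on U h" and P: "\<And>x. x \<in> U ==> posdef (h x)"
  using assms by (auto simp: metric_on_def)
 have "dd (\<lambda>y. form (h y) u w) x = dd (\<lambda>y. form (h y) w u) x"
  by (rule dd_cong_open[OF o assms(2)]) (simp add: posdef_sym[OF P])
 thus ?thesis using dd_form_const[OF s assms(2)] by metis
qed

lemma form_scale:
 fixes M :: "real^'n^'n"
 shows "form M (c *R u) w = c * (form M u w)" "form M u (c *R w) = c * (form M u w)"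
  "form (c *R M) u w = c * (form M u w)"
 by (simp_all add: mv_scaleR scaleR_matrix_vector_assoc[symmetric])

section \<open>Derivatives along rays, the radial shape operator and the Ricci form\<close>

lemma ray_has_vector_derivative:
 fixes F :: "'a::euclidean_space => 'b::euclidean_space"
 assumes "smooth_on U F" "t *R x \<in> U"
 shows "((\<lambda>t. F (t *R x)) has_vector_derivative dd F (t *R x) x) (at t)"
proof -
 have "((\<lambda>t. t *R x) has_derivative (\<lambda>k. k *R x)) (at t)"
  by (auto intro!: derivative_eq_intros)
 from has_derivative_compose[OF this smooth_on_has_derivative[OF assms]]
 show ?thesis
  by (simp add: has_vector_derivative_def linear_scale[OF smooth_on_linear_dd[OF assms]])
qed

text \<open>The position field, with value \<open>y\<close> at \<open>y\<close>, has covariant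
  derivative \<open>w + shp h y *v w\<close>. On the sphere of radius \<open>s\<close> the unit
  normal is the position field over \<open>s\<close>, so \<open>shp\<close> is \<open>s\<close>
  times the operator \<open>E\<close> of the overview; at the centre it is smooth and
  vanishes.\<close>

definition shp :: "(real^'n => real^'n^'n) => real^'n => real^'n^'n" where
 "shp h y = matrix (\<lambda>w. chrv h y w y)"

lemma shp_mult: "shp h y *v w = chrv h y w y"
 unfolding shp_def by (rule matrix_works) (simp add: linear_chrv linear_matrix_vector_mul_eq)

definition ricq :: "(real^'n => real^'n^'n) => real^'n => real^'n => real" where
 "ricq h y v = trace (matrix (\<lambda>w. riemv h y w v v))"

lemma linear_trace: "linear (trace :: real^'n^'n => real)"
 by (auto simp: linear_iff trace_def sum.distrib sum_distrib_left)

lemma riemv_matrix: "matrix (\<lambda>w. riemv h y w u v) *v w = riemv h y w u v"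
 by (rule matrix_works) (simp add: linear_riemv linear_matrix_vector_mul_eq)

lemma ricq_scale: "ricq h y (c *R v) = c^2 * ricq h y v"
proof -
 have "matrix (\<lambda>w. riemv h y w (c *R v) (c *R v)) = c^2 *R matrix (\<lambda>w. riemv h y w v v)"
  unfolding matrix_eq riemv_matrix scaleR_matrix_vector_assoc[symmetric] by (simp add: riemv_scale power2_eq_square)
 thus ?thesis unfolding ricq_def by (simp add: linear_scale[OF linear_trace])
qed

lemma smooth_on_riemv:
 assumes "metric_on U h"
 shows "smooth_on U (\<lambda>y. riemv h y u v w)"
proof -
 have o: "open U" using assms by (simp add: metric_on_def)
 have s: "smooth_on U (\<lambda>y. chrv h y v w)" for v w
  by (intro smooth_on_chrv assms smooth_on_const)
 have "smooth_on U (\<lambda>x. dd (\<lambda>y. chrv h y v w) x u - dd (\<lambda>y. chrv h y u w) x v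
  + chrv h x u (chrv h x v w) - chrv h x v (chrv h x u w))"
  by (intro smooth_on_diff smooth_on_add o smooth_on_dd s smooth_on_chrv assms smooth_on_const)
 thus ?thesis using riemv_formula[OF assms] by (subst smooth_on_cong[OF o]) auto
qed

lemma smooth_on_trace:
 fixes M :: "'a::euclidean_space => real^'n^'n"
 shows "open S ==> smooth_on S M ==> smooth_on S (\<lambda>x. trace (M x))"
 unfolding trace_def by (intro smooth_on_sum smooth_on_nth)

lemma smooth_on_ricq:
 assumes "metric_on U h"
 shows "smooth_on U (\<lambda>y. ricq h y v)"
proof -
 have o: "open U" using assms by (simp add: metric_on_def)
 thus ?thesis
  unfolding ricq_def matrix_def
  by (intro smooth_on_trace smooth_on_vec_lambda smooth_on_nth smooth_on_riemv assms)
qed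

text \<open>\<open>ray\<close> is the geodesic equation for the lines through the origin, evaluated
  at time 1; \<open>star\<close> provides the segment back to the centre for integration. Together
  they capture what the Gauss lemma and the Riccati equation draw from the exponential map.\<close>

locale normal_coords =
 fixes U :: "(real^'n) set" and h :: "real^'n => real^'n^'n"
 assumes hU: "metric_on U h" and zero: "0 \<in> U" and star: "\<And>x t. x \<in> U ==> 0 \<le> t ==> t \<le> 1 ==> t *R x \<in> U"
  and ray: "\<And>y. y \<in> U ==> chrv h y y y = 0"
begin

lemma open_U: "open U" and smooth_h: "smooth_on U h" and posdef_h: "\<And>x. x \<in> U ==> posdef (h x)"
 using hU by (auto simp: metric_on_def)

lemma ray_form:
 assumes "y \<in> U"
 shows "form (dd h y w) y y = 2 * (form (dd h y y) y w)"
 using chrv_characterization[OF hU assms, of w y y] ray[OF assms] by simp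

lemma constant_speed:
 assumes "x \<in> U"
 shows "form (h x) x x = form (h 0) x x"
proof -
 have der: "((\<lambda>t. form (h (t *R x)) x x) has_real_derivative x \<bullet> (dd h (t *R x) x *v x)) (at t)"
  if "0 \<le> t" "t \<le> 1" for t
 proof -
  have "smooth_on U (\<lambda>y. form (h y) x x)"
   using smooth_h open_U by (intro smooth_on_inner smooth_on_matrix_vector smooth_on_const)
  from ray_has_vector_derivative[OF this star[OF assms that]] dd_form_const[OF smooth_h star[OF assms that]]
  show ?thesis by (simp add: has_real_derivative_iff_has_vector_derivative)
 qed
 have "form (h (1 *R x)) x x = form (h (0 *R x)) x x"
 proof (rule DERIV_isconst_end[where a = 0 and b = 1 and f = "\<lambda>t. form (h (t *R x)) x x"])
  show "continuous_on {0..1} (\<lambda>t. form (h (t *R x)) x x)"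
   by (intro continuous_at_imp_continuous_on) (auto intro!: DERIV_isCont[OF der])
  fix t :: real assume t: "0 < t" "t < 1"
  have y: "t *R x \<in> U" using star[OF assms] t by simp
  have "form (dd h (t *R x) (t *R x)) (t *R x) (t *R x) = 0" using ray_form[OF y, of "t *R x"] by simp
  hence "form (dd h (t *R x) x) x x = 0"
   using t by (simp add: linear_scale[OF smooth_on_linear_dd[OF smooth_h y]] form_scale)
  thus "((\<lambda>t. form (h (t *R x)) x x) has_real_derivative 0) (at t)" using der[of t] t by simp
 qed simp
 thus ?thesis by simp
qed

lemma gauss_aux:
 assumes y: "y \<in> U"
 shows "form (h y) w y + form (dd h y y) y w = form (h 0) w y"
proof -
 have "dd (\<lambda>y. form (h y) y y) y = dd (\<lambda>y. form (h 0) y y) y"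
  by (rule dd_cong_open[OF open_U y constant_speed])
 moreover have "dd (\<lambda>y. form (h y) y y) y w = form (h y) w y + form (dd h y w) y y + form (h y) y w"
  using dd_form[OF smooth_on_id smooth_h smooth_on_id y, of w]
   dd_eqI[OF has_derivative_ident[of "at y"]] by simp
 moreover have "dd (\<lambda>y. form (h 0) y y) y w = form (h 0) w y + form (h 0) y w"
  using dd_form[OF smooth_on_id smooth_on_const smooth_on_id y, of "h 0" w]
   dd_eqI[OF has_derivative_ident[of "at y"]] by simp
 ultimately show ?thesis
  using ray_form[OF y, of w] posdef_sym[OF posdef_h[OF y], of w y] posdef_sym[OF posdef_h[OF zero], of w y] by simp
qed

text \<open>Differentiating the constancy of speed across the rays gives \<open>gauss_aux\<close>, a
  first-order equation along the ray for the difference of the two sides. The factor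
  \<open>t\<close> in \<open>m\<close> turns it into the vanishing of the derivative of
  \<open>m\<close>, and \<open>m 0 = 0\<close>.\<close>

lemma gauss:
 assumes "x \<in> U"
 shows "h x *v x = h 0 *v x"
proof -
 have "form (h x) w x = form (h 0) w x" for w
 proof -
  define m where "m t = t * (form (h (t *R x)) w x - form (h 0) w x)" for t
  have der: "(m has_real_derivative
    (form (h (t *R x)) w x - form (h 0) w x) + t * (form (dd h (t *R x) x) w x)) (at t)"
   if "0 \<le> t" "t \<le> 1" for t
  proof -
   have "smooth_on U (\<lambda>y. form (h y) w x)"
    using smooth_h open_U by (intro smooth_on_inner smooth_on_matrix_vector smooth_on_const)
   from ray_has_vector_derivative[OF this star[OF assms that]] dd_form_const[OF smooth_h star[OF assms that]]
   have "((\<lambda>t. form (h (t *R x)) w x) has_real_derivative w \<bullet> (dd h (t *R x) x *v x)) (at t)"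
    by (simp add: has_real_derivative_iff_has_vector_derivative)
   thus ?thesis unfolding m_def by (auto intro!: derivative_eq_intros)
  qed
  have "m 1 = m 0"
  proof (rule DERIV_isconst_end[where a = 0 and b = 1 and f = m])
   show "continuous_on {0..1} m"
    by (intro continuous_at_imp_continuous_on) (auto intro!: DERIV_isCont[OF der])
   fix t :: real assume t: "0 < t" "t < 1"
   have y: "t *R x \<in> U" using star[OF assms] t by simp
   have "t * (form (h (t *R x)) w x) + t * t * (form (dd h (t *R x) x) x w) = t * (form (h 0) w x)"
    using gauss_aux[OF y, of w]
    by (simp add: linear_scale[OF smooth_on_linear_dd[OF smooth_h y]] form_scale)
   hence "t * ((form (h (t *R x)) w x - form (h 0) w x) + t * (form (dd h (t *R x) x) w x)) = 0"
    using dd_sym_form[OF hU y, of x x w] by (simp add: algebra_simps)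
   thus "(m has_real_derivative 0) (at t)" using der[of t] t by simp
  qed simp
  thus ?thesis by (simp add: m_def)
 qed
 thus ?thesis by (metis inner_commute vector_eq_rdot)
qed

lemma dd_gauss:
 assumes "y \<in> U"
 shows "form (dd h y w) z y = form (h 0) z w - form (h y) z w"
proof -
 have "dd (\<lambda>y. form (h y) z y) y = dd (\<lambda>y. form (h 0) z y) y"
  by (rule dd_cong_open[OF open_U assms]) (simp add: gauss)
 moreover have "dd (\<lambda>y. form (h y) z y) y w = form (dd h y w) z y + form (h y) z w"
  using dd_form[OF smooth_on_const smooth_h smooth_on_id assms, of z w]
   dd_eqI[OF has_derivative_ident[of "at y"]] by simp
 moreover have "dd (\<lambda>y. form (h 0) z y) y w = form (h 0) z w"
  using dd_form[OF smooth_on_const smooth_on_const smooth_on_id assms, of z "h 0" w]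
   dd_eqI[OF has_derivative_ident[of "at y"]] by simp
 ultimately show ?thesis by simp
qed

text \<open>Two of the three terms in Koszul's formula are derivatives of the metric paired with the
  radial vector; \<open>dd_gauss\<close> evaluates both to the same number, so they cancel. Half the
  radial derivative of the metric remains.\<close>

lemma shp_form:
 assumes y: "y \<in> U"
 shows "form (h y) z (shp h y *v w) = form (dd h y y) z w / 2"
proof -
 have "form (dd h y z) w y = form (dd h y z) y w" by (rule dd_sym_form[OF hU y])
 moreover have "form (dd h y w) z y = form (dd h y w) y z" by (rule dd_sym_form[OF hU y])
 moreover have "form (dd h y y) w z = form (dd h y y) z w" by (rule dd_sym_form[OF hU y])
 ultimately show ?thesis
  unfolding shp_mult chrv_characterization[OF hU y]
  using dd_gauss[OF y, of z w] dd_gauss[OF y, of w z] posdef_sym[OF posdef_h[OF y], of z w]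
   posdef_sym[OF posdef_h[OF zero], of z w] by simp
qed

lemma shp_matrix:
 assumes "y \<in> U"
 shows "dd h y y *v w = 2 *R (h y *v (shp h y *v w))"
proof -
 have "form (dd h y y) z w = z \<bullet> (2 *R (h y *v (shp h y *v w)))" for z
  using shp_form[OF assms, of z w] by simp
 thus ?thesis by (metis inner_commute vector_eq_rdot)
qed

lemma selfadj_shp:
 assumes "y \<in> U"
 shows "selfadj (h y) (shp h y)"
 unfolding selfadj_def shp_form[OF assms] using dd_sym_form[OF hU assms] by simp

lemma shp_radial: "y \<in> U ==> shp h y *v y = 0"
 by (simp add: shp_mult ray)

lemma shp_0: "shp h 0 = 0"
 unfolding matrix_eq shp_mult by (simp add: chrv_zero)

lemma smooth_shp: "smooth_on U (shp h)"
 unfolding shp_def[abs_def] matrix_def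
 by (intro smooth_on_vec_lambda open_U smooth_on_nth smooth_on_chrv hU smooth_on_const smooth_on_id)

text \<open>The two derivatives in \<open>riemv_formula\<close> for \<open>R(w, y)y\<close> come
  from differentiating \<open>ray\<close> in direction \<open>w\<close> and \<open>shp\<close> in
  direction \<open>y\<close>. The linear term reflects that \<open>shp\<close> is
  \<open>s E\<close>: in terms of \<open>E\<close> the equation reads
  \<open>E' + (2/s) E + E^2 = - R\<close>.\<close>

lemma riccati:
 assumes y: "y \<in> U"
 shows "riemv h y w y y = - (dd (shp h) y y *v w + shp h y *v w + shp h y *v (shp h y *v w))"
proof -
 have s: "smooth_on U (\<lambda>y. chrv h y v w)" for v w
  by (intro smooth_on_chrv hU smooth_on_const)
 \<comment> \<open>\<open>ray\<close> holds on an open set, so its derivative vanishes in every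
   direction, not just along the ray.\<close>
 have "dd (\<lambda>y. chrv h y y y) y w = 0"
  using dd_cong_open[OF open_U y, of "\<lambda>y. chrv h y y y" "\<lambda>_. 0"] ray by simp
 moreover have "dd (\<lambda>y. chrv h y y y) y w = dd (\<lambda>z. chrv h z y y) y w + chrv h y w y + chrv h y y w"
  using dd_bilinear_family[where L = "chrv h", OF open_U y linear_chrv s smooth_on_id smooth_on_id]
   dd_eqI[OF has_derivative_ident[of "at y"]] by simp
 ultimately have 1: "dd (\<lambda>z. chrv h z y y) y w = - 2 *R (shp h y *v w)"
  using chrv_commute[OF hU y, of w y] by (simp add: shp_mult algebra_simps scaleR_2 eq_neg_iff_add_eq_0)
 have "dd (shp h) y y *v w = dd (\<lambda>z. chrv h z w z) y y"
  using dd_matrix_vector_const[OF smooth_shp y, of w y] by (simp add: shp_mult)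
 also have "\<dots> = dd (\<lambda>z. chrv h z w y) y y + chrv h y w y"
  using dd_linear_family(2)[where L = "\<lambda>z. chrv h z w", OF open_U y linear_chrv(1) s smooth_on_id]
   dd_eqI[OF has_derivative_ident[of "at y"]] by simp
 finally have 2: "dd (\<lambda>z. chrv h z w y) y y = dd (shp h) y y *v w - shp h y *v w"
  by (simp add: shp_mult)
 have "chrv h y w (chrv h y y y) = 0" using ray[OF y] by (simp add: chrv_zero)
 moreover have "chrv h y y (chrv h y w y) = shp h y *v (shp h y *v w)"
  by (simp add: shp_mult chrv_commute[OF hU y, of y])
 ultimately show ?thesis
  unfolding riemv_formula[OF hU y] 1 2 by (simp add: scaleR_2)
qed

lemma trace_riccati:
 assumes y: "y \<in> U"
 shows "ricq h y y = - (trace (dd (shp h) y y) + trace (shp h y) + trace (shp h y ** shp h y))"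
proof -
 have "matrix (\<lambda>w. riemv h y w y y) = - (dd (shp h) y y + shp h y + shp h y ** shp h y)"
  unfolding matrix_eq riemv_matrix unfolding riccati[OF y]
  by (simp add: matrix_vector_mult_add_rdistrib matrix_vector_mult_diff_rdistrib matrix_vector_mul_assoc
    uminus_matrix_vector)
 thus ?thesis
  unfolding ricq_def
  by (simp add: linear_neg[OF linear_trace] linear_add[OF linear_trace] linear_diff[OF linear_trace])
qed

section \<open>The traced Riccati equation along rays: integral form, bounds, equality\<close>

definition tau :: "real^'n => real" where "tau y = trace (shp h y)"

lemma smooth_tau: "smooth_on U tau"
 unfolding tau_def[abs_def] by (intro smooth_on_trace open_U smooth_shp)

lemma dd_tau: "y \<in> U ==> dd tau y u = trace (dd (shp h) y u)"
 unfolding tau_def[abs_def]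
 using dd_eqI[OF bounded_linear.has_derivative[OF linear_trace[unfolded linear_conv_bounded_linear]
   smooth_on_has_derivative[OF smooth_shp]]] by simp

text \<open>The product \<open>t * tau\<close> is the quantity \<open>s^2 tr E\<close> of the
  overview, with \<open>t\<close> for \<open>s\<close>, and the trace of the squared
  \<open>shp\<close> is \<open>t^2\<close> times the squared norm of \<open>E\<close>. The factor
  \<open>t\<close> absorbs the linear term of \<open>trace_riccati\<close>.\<close>

lemma tau_ray_derivative:
 assumes "t *R x \<in> U"
 shows "((\<lambda>t. t * tau (t *R x)) has_real_derivative
  - (trace (shp h (t *R x) ** shp h (t *R x)) + t^2 * ricq h (t *R x) x)) (at t)"
proof -
 have "((\<lambda>t. tau (t *R x)) has_real_derivative dd tau (t *R x) x) (at t)"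
  using ray_has_vector_derivative[OF smooth_tau assms] by (simp add: has_real_derivative_iff_has_vector_derivative)
 hence "((\<lambda>t. t * tau (t *R x)) has_real_derivative tau (t *R x) + t * dd tau (t *R x) x) (at t)"
  by (auto intro!: derivative_eq_intros)
 moreover have "t * dd tau (t *R x) x = trace (dd (shp h) (t *R x) (t *R x))"
  using dd_tau[OF assms, of "t *R x"] linear_scale[OF smooth_on_linear_dd[OF smooth_tau assms]] by simp
 ultimately show ?thesis
  using trace_riccati[OF assms] by (simp add: ricq_scale tau_def)
qed

lemma continuous_ray:
 assumes "smooth_on U F" "\<And>t. 0 \<le> t ==> t \<le> r ==> t *R x \<in> U"
 shows "continuous_on {0..r} (\<lambda>t. F (t *R x))"
 by (rule continuous_on_compose2[OF smooth_on_continuous_on[OF assms(1)]])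
  (use assms(2) in \<open>auto intro!: continuous_intros\<close>)

lemma smooth_trace_square: "smooth_on U (\<lambda>y. trace (shp h y ** shp h y))"
 using smooth_shp
 by (intro smooth_on_trace open_U smooth_on_bilinear[OF bounded_bilinear_matrix_matrix]) auto

text \<open>The factor \<open>t\<close> removes the boundary term at the centre, and both integrands
  are continuous up to 0.\<close>

lemma tau_integral:
 assumes "0 < r" "\<And>t. 0 \<le> t ==> t \<le> r ==> t *R x \<in> U"
 shows "r * tau (r *R x) = - integral {0..r} (\<lambda>t. trace (shp h (t *R x) ** shp h (t *R x)))
  - integral {0..r} (\<lambda>t. t^2 * ricq h (t *R x) x)"
proof -
 have c1: "continuous_on {0..r} (\<lambda>t. trace (shp h (t *R x) ** shp h (t *R x)))"
  by (rule continuous_ray[OF smooth_trace_square assms(2)])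
 have c2: "continuous_on {0..r} (\<lambda>t. t^2 * ricq h (t *R x) x)"
  by (intro continuous_intros continuous_ray[OF smooth_on_ricq[OF hU]] assms(2))
 have "((\<lambda>t. - (trace (shp h (t *R x) ** shp h (t *R x)) + t^2 * ricq h (t *R x) x)) has_integral
   r * tau (r *R x) - 0 * tau (0 *R x)) {0..r}"
 proof (rule fundamental_theorem_of_calculus)
  show "0 \<le> r" using assms by simp
  fix t assume "t \<in> {0..r}"
  thus "((\<lambda>t. t * tau (t *R x)) has_vector_derivative
    - (trace (shp h (t *R x) ** shp h (t *R x)) + t^2 * ricq h (t *R x) x)) (at t within {0..r})"
   using assms(2) tau_ray_derivative[unfolded has_real_derivative_iff_has_vector_derivative, of t x]
   by (auto intro: has_vector_derivative_at_within)
 qed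
 from integral_unique[OF this] show ?thesis
  unfolding integral_neg using integral_add[OF integrable_continuous_interval[OF c1] integrable_continuous_interval[OF c2]]
  by simp
qed

lemma trace_square_nonneg: "y \<in> U ==> 0 \<le> trace (shp h y ** shp h y)"
 by (rule selfadj_trace_square(1)[OF posdef_h selfadj_shp])

lemma tau_upper_bound:
 assumes "0 < r" "\<And>t. 0 \<le> t ==> t \<le> r ==> t *R x \<in> U"
 shows "r * tau (r *R x) \<le> - integral {0..r} (\<lambda>t. t^2 * ricq h (t *R x) x)"
proof -
 have "0 \<le> integral {0..r} (\<lambda>t. trace (shp h (t *R x) ** shp h (t *R x)))"
 proof (rule integral_nonneg)
  show "(\<lambda>t. trace (shp h (t *R x) ** shp h (t *R x))) integrable_on {0..r}"
   by (rule integrable_continuous_interval[OF continuous_ray[OF smooth_trace_square assms(2)]])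
  show "0 \<le> trace (shp h (t *R x) ** shp h (t *R x))" if "t \<in> {0..r}" for t
   using that by (intro trace_square_nonneg assms(2)) auto
 qed
 thus ?thesis using tau_integral[OF assms] by simp
qed

text \<open>Equality forces a continuous nonnegative function to have integral 0. Hence
  \<open>shp\<close> vanishes along the ray, so does its radial derivative, and
  \<open>riccati\<close> leaves no curvature term. At \<open>s *R x\<close> this yields
  \<open>s^2\<close> times the claim; the centre, which is the point used later, is therefore
  reached by continuity.\<close>

lemma tau_equality:
 assumes "0 < r" "\<And>t. 0 \<le> t ==> t \<le> r ==> t *R x \<in> U"
  and eq: "r * tau (r *R x) = - integral {0..r} (\<lambda>t. t^2 * ricq h (t *R x) x)"
  and t: "0 \<le> t" "t < r"
 shows "riemv h (t *R x) w x x = 0"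
proof -
 have shp0: "shp h (t *R x) = 0" if "t \<in> {0..r}" for t
 proof -
  have c: "continuous_on {0..r} (\<lambda>t. trace (shp h (t *R x) ** shp h (t *R x)))"
   by (rule continuous_ray[OF smooth_trace_square assms(2)])
  have "integral {0..r} (\<lambda>t. trace (shp h (t *R x) ** shp h (t *R x))) = 0"
   using tau_integral[OF assms(1,2)] eq by simp
  hence "trace (shp h (t *R x) ** shp h (t *R x)) = 0"
   using integral_eq_0_iff[OF c assms(1)] trace_square_nonneg assms(2) that by auto
  thus ?thesis
   using selfadj_trace_square(3)[OF posdef_h selfadj_shp] assms(2) that by auto
 qed
 have pos: "riemv h (s *R x) w x x = 0" if s: "0 < s" "s < r" for s
 proof -
  have U: "s *R x \<in> U" using assms(2) s by simp
  have "((\<lambda>t. shp h (t *R x)) has_vector_derivative 0) (at s)"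
  proof (rule has_vector_derivative_transform_within_open)
   show "((\<lambda>t. 0) has_vector_derivative 0) (at s)" by simp
   show "open {0<..<r}" "s \<in> {0<..<r}" using s by auto
   show "\<And>t. t \<in> {0<..<r} ==> 0 = shp h (t *R x)" using shp0 by simp
  qed
  hence "dd (shp h) (s *R x) x = 0"
   using ray_has_vector_derivative[OF smooth_shp U] vector_derivative_unique_at by blast
  hence "dd (shp h) (s *R x) (s *R x) = 0"
   using linear_scale[OF smooth_on_linear_dd[OF smooth_shp U]] by simp
  hence "riemv h (s *R x) w (s *R x) (s *R x) = 0"
   using riccati[OF U, of w] shp0[of s] s by simp
  thus ?thesis using s by (simp add: riemv_scale)
 qed
 show ?thesis
 proof (cases "t = 0")
  case True
  have "continuous_on {0..r} (\<lambda>t. riemv h (t *R x) w x x)"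
   by (rule continuous_ray[OF smooth_on_riemv[OF hU] assms(2)])
  hence "((\<lambda>t. riemv h (t *R x) w x x) \<longlongrightarrow> riemv h (0 *R x) w x x) (at 0 within {0..r})"
   unfolding continuous_on_def by (rule bspec) (use assms(1) in simp)
  hence "((\<lambda>t. riemv h (t *R x) w x x) \<longlongrightarrow> riemv h (0 *R x) w x x) (at_right 0)"
   using assms(1) by (simp add: at_within_Icc_at_right)
  moreover have "((\<lambda>t. riemv h (t *R x) w x x) \<longlongrightarrow> 0) (at_right 0)"
   using pos assms(1) by (intro tendsto_eventually) (auto simp: eventually_at_right_field)
  ultimately show ?thesis using True tendsto_unique[OF trivial_limit_at_right_real] by blast
 qed (use pos t in auto)
qed

text \<open>
 Along a ray, \<open>y = t \<tau>(t)\<close> satisfies \<open>y' \<le> K t^2 - y^2 / (n t^2)\<close>, so it would reach \<open>-\<infinity>\<close> before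
 time \<open>r'\<close> if it were too negative at time \<open>r\<close>.
\<close>

lemma tau_lower_bound:
 assumes r: "0 < r" "r < r'" and U: "\<And>t. 0 \<le> t ==> t \<le> r' ==> t *R x \<in> U"
  and K: "\<And>t. 0 \<le> t ==> t \<le> r' ==> - ricq h (t *R x) x \<le> K" "0 \<le> K"
 shows "- (r' - r) * (r * tau (r *R x)) \<le> real CARD('n) * r'^2 + K * r' ^ 4"
proof -
 define n where "n = real CARD('n)"
 have n: "n \<ge> 1" by (simp add: n_def)
 define y where "y t = t * tau (t *R x)" for t
 define y' where "y' t = - (trace (shp h (t *R x) ** shp h (t *R x)) + t^2 * ricq h (t *R x) x)" for t
 define M where "M = n * r'^2 + K * r' ^ 4"
 \<comment> \<open>The weight vanishes at \<open>r'\<close>, so the mean value theorem bounds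
   \<open>y r\<close> with no information on \<open>y r'\<close>; being a square, it matches the
   quadratic term in the inequality for \<open>y'\<close>.\<close>
 have der: "((\<lambda>t. (r' - t)^2 * y t) has_real_derivative (-2 * (r' - t) * y t + (r' - t)^2 * y' t)) (at t)"
  if "r \<le> t" "t \<le> r'" for t
 proof -
  have "(y has_real_derivative y' t) (at t)"
   unfolding y_def[abs_def] y'_def using that r by (intro tau_ray_derivative U) auto
  thus ?thesis by (auto intro!: derivative_eq_intros simp: algebra_simps)
 qed
 obtain z where z: "r < z" "z < r'" and eq: "(r' - r')^2 * y r' - (r' - r)^2 * y r =
   (r' - r) * (-2 * (r' - z) * y z + (r' - z)^2 * y' z)"
  using MVT2[OF r(2) der] by auto
 have zU: "z *R x \<in> U" using U z r by simp
 have z0: "z > 0" using z r by simp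
 have "(y z)^2 \<le> n * z^2 * trace (shp h (z *R x) ** shp h (z *R x))"
  using selfadj_trace_square(2)[OF posdef_h[OF zU] selfadj_shp[OF zU]] z0
  by (simp add: y_def tau_def n_def power_mult_distrib)
 hence "(y z)^2 / (n * z^2) \<le> trace (shp h (z *R x) ** shp h (z *R x))"
  using z0 n by (simp add: field_simps)
 moreover have "z^2 * (- ricq h (z *R x) x) \<le> z^2 * K"
  using K(1)[of z] z r by (intro mult_left_mono) auto
 ultimately have y': "y' z \<le> K * z^2 - (y z)^2 / (n * z^2)"
  unfolding y'_def by (simp add: algebra_simps)
 define u where "u = r' - z"
 have u: "0 < u" "u \<le> r'" using z z0 by (auto simp: u_def)
 \<comment> \<open>Completing the square absorbs the first-order term, of unknown size and sign,
   into the quadratic Riccati term.\<close>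
 have "0 \<le> (u * y z + n * z^2)^2 / (n * z^2)" using n by simp
 also have "\<dots> = u^2 * (y z)^2 / (n * z^2) + 2 * u * y z + n * z^2"
  using n z0 by (simp add: field_simps power2_eq_square)
 finally have sq: "-2 * u * y z - u^2 * ((y z)^2 / (n * z^2)) \<le> n * z^2" by simp
 have "-2 * u * y z + u^2 * y' z \<le> -2 * u * y z + u^2 * (K * z^2 - (y z)^2 / (n * z^2))"
  using y' by (intro add_left_mono mult_left_mono) auto
 also have "\<dots> \<le> n * z^2 + K * (u^2 * z^2)" using sq by (simp add: algebra_simps)
 also have "\<dots> \<le> n * r'^2 + K * (r'^2 * r'^2)"
  using z z0 u n K(2) by (intro add_mono mult_left_mono mult_mono power_mono) auto
 also have "\<dots> = M" by (simp add: M_def power_def numeral_eq_Suc)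
 finally have "-2 * (r' - z) * y z + (r' - z)^2 * y' z \<le> M" by (simp add: u_def)
 hence "(r' - r) * (-2 * (r' - z) * y z + (r' - z)^2 * y' z) \<le> (r' - r) * M"
  using r by (intro mult_left_mono) auto
 moreover have "(r' - r) * (- (r' - r) * y r) = (r' - r) * (-2 * (r' - z) * y z + (r' - z)^2 * y' z)"
  unfolding eq[symmetric] by (simp add: power2_eq_square algebra_simps)
 ultimately have "- (r' - r) * y r \<le> M"
  using r by (metis diff_gt_0_iff_gt mult_left_le_imp_le)
 thus ?thesis by (simp add: y_def M_def n_def)
qed

end

section \<open>Symmetry of the volume density\<close>

text \<open>
 Normal coordinates about the two ends of a geodesic segment.  With \<open>\<Phi>(s) = dd ph (s w)\<close> and the
 shape operators \<open>T\<^sub>p\<close>, \<open>T\<^sub>q\<close> along the segment, the Wronskian of the Jacobi fields vanishing at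
 one or the other end is \<open>h\<^sub>p (s (1 + T\<^sub>p) \<Phi> + (1 - s) \<Phi> (1 + T\<^sub>q))\<close>; that it is constant in \<open>s\<close>
 relates the volume densities at both ends.
\<close>

locale normal_coords_pair =
 p: normal_coords Up hp + q: normal_coords Uq hq + metric_pullback W Up hq hp ph
 for Up Uq W :: "(real^'n) set" and hp hq :: "real^'n => real^'n^'n" and ph +
 fixes v w :: "real^'n"
 assumes WUq: "W \<subseteq> Uq" and segment: "\<And>s. 0 \<le> s ==> s \<le> 1 ==> s *R w \<in> W \<and> ph (s *R w) = (1 - s) *R v"
begin

lemma segment_in:
 assumes "0 \<le> s" "s \<le> 1"
 shows "s *R w \<in> W" "s *R w \<in> Uq" "(1 - s) *R v \<in> Up" "ph (s *R w) = (1 - s) *R v"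
 using segment[OF assms] WUq into by auto

lemma dd_segment:
 assumes "0 < s" "s < 1"
 shows "dd ph (s *R w) w = - v"
proof -
 have "((\<lambda>s. ph (s *R w)) has_vector_derivative dd ph (s *R w) w) (at s)"
  using segment_in(1) assms by (intro ray_has_vector_derivative[OF smooth]) auto
 moreover have "((\<lambda>s. ph (s *R w)) has_vector_derivative - v) (at s)"
 proof (rule has_vector_derivative_transform_within_open)
  show "((\<lambda>s. (1 - s) *R v) has_vector_derivative - v) (at s)"
   by (auto intro!: derivative_eq_intros simp: has_vector_derivative_def)
  show "open {0<..<1::real}" "s \<in> {0<..<1}" using assms by auto
  show "\<And>s. s \<in> {0<..<1} ==> (1 - s) *R v = ph (s *R w)" using segment_in(4) by simp
 qed
 ultimately show ?thesis by (rule vector_derivative_unique_at)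
qed

text \<open>In the notation above these are \<open>\<Phi> b\<close>, then \<open>T_p\<close> applied
  to \<open>\<Phi> b\<close>, and \<open>\<Phi>\<close> applied to \<open>T_q b\<close>, spread out
  to functions on \<open>W\<close> so that they can be differentiated.\<close>

definition F1 where "F1 b y = dd ph y b"
definition F2 where "F2 b y = shp hp (ph y) *v dd ph y b"
definition F3 where "F3 b y = dd ph y (shp hq y *v b)"

lemma smooth_shq: "smooth_on W (\<lambda>y. shp hq y *v b)"
 by (intro smooth_on_matrix_vector open_U smooth_on_subset[OF q.smooth_shp WUq] smooth_on_const)

lemma smooth_shp_comp: "smooth_on W (\<lambda>y. shp hp (ph y))"
 by (rule smooth_on_compose[OF p.smooth_shp smooth open_U open_V into])

lemma smooth_F: "smooth_on W (F1 b)" "smooth_on W (F2 b)" "smooth_on W (F3 b)"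
proof -
 show 1: "smooth_on W (F1 b)"
  unfolding F1_def[abs_def] by (rule smooth_on_dd[OF smooth])
 show "smooth_on W (F2 b)"
  unfolding F2_def[abs_def]
  by (intro smooth_on_matrix_vector open_U smooth_shp_comp smooth_on_dd[OF smooth])
 show "smooth_on W (F3 b)"
  unfolding F3_def[abs_def] by (rule smooth_on_dd_apply[OF open_U smooth smooth_shq])
qed

text \<open>The transformation law with first argument \<open>w\<close>, for which \<open>ph\<close>
  has derivative \<open>- v\<close>. The two connection terms are \<open>shp\<close> at the points
  \<open>s *R w\<close> and \<open>(1 - s) *R v\<close>, divided by the scale of the radial
  vector.\<close>

lemma dd_F1:
 assumes s: "0 < s" "s < 1"
 shows "dd (\<lambda>y. dd ph y b) (s *R w) w =
  (1 / s) *R dd ph (s *R w) (shp hq (s *R w) *v b)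
  + (1 / (1 - s)) *R (shp hp ((1 - s) *R v) *v dd ph (s *R w) b)"
proof -
 note in' = segment_in[OF less_imp_le[OF s(1)] less_imp_le[OF s(2)]]
 let ?y = "s *R w"
 let ?x = "(1 - s) *R v"
 have 1: "chrv hq ?y w b = (1 / s) *R (shp hq ?y *v b)"
 proof -
  have "shp hq ?y *v b = s *R chrv hq ?y w b"
   unfolding shp_mult chrv_commute[OF q.hU in'(2), of b] by (simp add: chrv_bilinear)
  thus ?thesis using s by simp
 qed
 have 2: "chrv hp ?x (- v) (dd ph ?y b) = - ((1 / (1 - s)) *R (shp hp ?x *v dd ph ?y b))"
 proof -
  have "shp hp ?x *v dd ph ?y b = (1 - s) *R chrv hp ?x v (dd ph ?y b)"
   unfolding shp_mult chrv_commute[OF p.hU in'(3), of "dd ph ?y b"] by (simp add: chrv_bilinear)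
  thus ?thesis using s by (simp add: chrv_bilinear_diff)
 qed
 have "dd (\<lambda>y. dd ph y b) ?y w = dd ph ?y (chrv hq ?y w b) - chrv hp ?x (- v) (dd ph ?y b)"
  using chrv_transform[OF in'(1), of w b] in'(4) dd_segment[OF s] by simp
 thus ?thesis
  unfolding 1 2 by (simp add: linear_scale[OF linear_D[OF in'(1)]])
qed

definition wron :: "real^'n => real => real^'n" where
 "wron b s = s *R (F1 b (s *R w) + F2 b (s *R w)) + (1 - s) *R (F1 b (s *R w) + F3 b (s *R w))"

lemma wron_has_derivative:
 assumes "0 \<le> s" "s \<le> 1"
 shows "(wron b has_vector_derivative
  (F2 b (s *R w) - F3 b (s *R w)
  + s *R (dd (F1 b) (s *R w) w + dd (F2 b) (s *R w) w)
  + (1 - s) *R (dd (F1 b) (s *R w) w + dd (F3 b) (s *R w) w))) (at s)"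
proof -
 note d = ray_has_vector_derivative[OF _ segment_in(1)[OF assms]]
 show ?thesis
  unfolding wron_def[abs_def]
  by (auto intro!: derivative_eq_intros d smooth_F simp: algebra_simps)
qed

text \<open>The curvature terms of the two Riccati equations cancel: \<open>ph\<close> carries one
  curvature to the other, and the radial vectors correspond up to a scalar factor. What remains is
  exactly compensated by the derivative of \<open>hp\<close> along the segment in
  \<open>wron_form_constant\<close>.\<close>

lemma wron_derivative:
 assumes s: "0 < s" "s < 1"
 shows "(wron b has_vector_derivative (2 / (1 - s)) *R (shp hp ((1 - s) *R v) *v wron b s)) (at s)"
proof -
 note in' = segment_in[OF less_imp_le[OF s(1)] less_imp_le[OF s(2)]]
 define y where "y = s *R w"
 define x where "x = (1 - s) *R v"
 define t where "t = 1 - s"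
 have y: "y \<in> W" "y \<in> Uq" and x: "x \<in> Up" "ph y = x" using in' by (auto simp: x_def y_def)
 have t: "t > 0" "s + t = 1" using s by (auto simp: t_def)
 define F where "F = dd ph y"
 define P where "P = shp hp x"
 define Q where "Q = shp hq y"
 define R where "R a = riemv hp x a x x" for a
 have linF: "linear F" unfolding F_def by (rule linear_D[OF y(1)])
 have Fw: "dd ph y w = - v" using dd_segment[OF s] by (simp add: y_def)
 have D1: "dd (\<lambda>y. dd ph y b) y w = (1 / s) *R F (Q *v b) + (1 / t) *R (P *v F b)" for b
  using dd_F1[OF s, of b] by (simp add: F_def P_def Q_def x_def y_def t_def)
 have dP: "dd (shp hp) x v *v a = - (1 / t) *R (P *v a + P *v (P *v a) + R a)" for a
 proof -
  have "t *R (dd (shp hp) x v *v a) = dd (shp hp) x x *v a"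
   using linear_scale[OF smooth_on_linear_dd[OF p.smooth_shp x(1)], of t v]
   by (simp add: x_def t_def scaleR_matrix_vector_assoc)
  also have "\<dots> = - (P *v a + P *v (P *v a) + R a)"
   using p.riccati[OF x(1), of a] by (simp add: P_def R_def)
  finally have "(1 / t) *R (t *R (dd (shp hp) x v *v a)) = (1 / t) *R (- (P *v a + P *v (P *v a) + R a))"
   by simp
  thus ?thesis using t by (simp add: algebra_simps)
 qed
 \<comment> \<open>The radial vector \<open>y\<close> is mapped to \<open>-(s / t)\<close> times
   \<open>x\<close>, and the curvature term is quadratic in it.\<close>
 have FR: "F (riemv hq y b y y) = (s / t)^2 *R R (F b)"
 proof -
  have "F y = - (s / t) *R x"
   using Fw t linear_scale[OF linF, of s w] by (simp add: F_def y_def x_def t_def)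
  hence "F (riemv hq y b y y) = riemv hp x (F b) (- (s / t) *R x) (- (s / t) *R x)"
   using riemv_transform[OF y(1), of b y y] x(2) by (simp add: F_def)
  thus ?thesis by (simp only: riemv_scale R_def) (simp add: power2_eq_square)
 qed
 have dQ: "F (dd (shp hq) y w *v b) = - (1 / s) *R (F (Q *v b) + F (Q *v (Q *v b)) + (s / t)^2 *R R (F b))"
 proof -
  have "s *R (dd (shp hq) y w *v b) = dd (shp hq) y y *v b"
   using linear_scale[OF smooth_on_linear_dd[OF q.smooth_shp y(2)], of s w]
   by (simp add: y_def scaleR_matrix_vector_assoc)
  also have "\<dots> = - (Q *v b + Q *v (Q *v b) + riemv hq y b y y)"
   using q.riccati[OF y(2), of b] by (simp add: Q_def)
  finally have "F ((1 / s) *R (s *R (dd (shp hq) y w *v b))) =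
    F ((1 / s) *R (- (Q *v b + Q *v (Q *v b) + riemv hq y b y y)))"
   by simp
  thus ?thesis
   using s by (simp add: linear_scale[OF linF] linear_add[OF linF] linear_neg[OF linF] linear_diff[OF linF] FR
     algebra_simps)
 qed
 have d1: "dd (F1 b) y w = (1 / s) *R F (Q *v b) + (1 / t) *R (P *v F b)"
  using D1 by (simp add: F1_def[abs_def])
 have d2: "dd (F2 b) y w = (1 / t) *R (P *v F b + P *v (P *v F b) + R (F b))
   + (1 / s) *R (P *v F (Q *v b)) + (1 / t) *R (P *v (P *v F b))"
 proof -
  have "dd (F2 b) y w = dd (\<lambda>z. shp hp (ph z) *v F b) y w + P *v dd (\<lambda>y. dd ph y b) y w"
   using dd_linear_family(2)[where L = "\<lambda>z. (*v) (shp hp (ph z))", OF open_U y(1)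
     matrix_vector_mul_linear smooth_on_matrix_vector[OF open_U smooth_shp_comp smooth_on_const]
     smooth_on_dd[OF smooth]] x(2)
   by (simp add: F2_def[abs_def] F_def P_def)
  also have "dd (\<lambda>z. shp hp (ph z) *v F b) y w = dd (shp hp) x (- v) *v F b"
   using dd_matrix_vector_const[OF smooth_shp_comp y(1), of "F b" w]
    dd_compose[OF smooth y(1) p.smooth_shp, of w] x Fw by simp
  also have "\<dots> = (1 / t) *R (P *v F b + P *v (P *v F b) + R (F b))"
   using dP[of "F b"] linear_neg[OF smooth_on_linear_dd[OF p.smooth_shp x(1)]]
   by (simp add: uminus_matrix_vector)
  finally show ?thesis
   by (simp only: D1) (simp add: matrix_vector_right_distrib mv_scaleR)
 qed
 have d3: "dd (F3 b) y w = (1 / s) *R F (Q *v (Q *v b)) + (1 / t) *R (P *v F (Q *v b))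
   - (1 / s) *R (F (Q *v b) + F (Q *v (Q *v b)) + (s / t)^2 *R R (F b))"
 proof -
  have "dd (F3 b) y w = dd (\<lambda>z. dd ph z (Q *v b)) y w + F (dd (\<lambda>y. shp hq y *v b) y w)"
   using dd_linear_family(2)[where L = "dd ph", OF open_U y(1) linear_D smooth_on_dd[OF smooth] smooth_shq]
   by (simp add: F3_def[abs_def] F_def Q_def)
  also have "dd (\<lambda>y. shp hq y *v b) y w = dd (shp hq) y w *v b"
   by (rule dd_matrix_vector_const[OF q.smooth_shp y(2)])
  finally show ?thesis by (simp add: D1 dQ)
 qed
 have wr: "wron b s = s *R (F b + P *v F b) + t *R (F b + F (Q *v b))"
  using x(2) by (simp add: wron_def F1_def F2_def F3_def F_def P_def Q_def y_def t_def)
 have val: "F2 b y - F3 b y + s *R (dd (F1 b) y w + dd (F2 b) y w) + t *R (dd (F1 b) y w + dd (F3 b) y w)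
   = (2 / t) *R (P *v wron b s)"
 proof -
  have F23: "F2 b y = P *v F b" "F3 b y = F (Q *v b)"
   using x(2) by (simp_all add: F2_def F3_def F_def P_def Q_def)
  have Pw: "P *v wron b s = s *R (P *v F b + P *v (P *v F b)) + t *R (P *v F b + P *v F (Q *v b))"
   unfolding wr by (simp only: matrix_vector_right_distrib mv_scaleR)
  \<comment> \<open>Tested against an arbitrary \<open>z\<close>, the vector identity becomes a
    rational identity in six real numbers and the two times \<open>s\<close> and
    \<open>t\<close>.\<close>
  have "z \<bullet> (F2 b y - F3 b y + s *R (dd (F1 b) y w + dd (F2 b) y w) + t *R (dd (F1 b) y w + dd (F3 b) y w))
    = z \<bullet> ((2 / t) *R (P *v wron b s))" for z
  proof -
   define A B C D E G where "A = form P z (F b)" and "B = z \<bullet> F (Q *v b)" and "C = form P z (P *v F b)"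
    and "D = form P z (F (Q *v b))" and "E = z \<bullet> F (Q *v (Q *v b))" and "G = z \<bullet> R (F b)"
   have "A - B + s * ((1 / s * B + 1 / t * A) + (1 / t * (A + C + G) + 1 / s * D + 1 / t * C))
     + t * ((1 / s * B + 1 / t * A) + (1 / s * E + 1 / t * D - 1 / s * (B + E + (s / t)^2 * G)))
    = 2 / t * (s * (A + C) + t * (A + D))"
    using s(1) t(1) by (simp add: field_simps power2_eq_square)
   thus ?thesis
    unfolding F23 d1 d2 d3 Pw inner_add_right inner_diff_right inner_scaleR_right
    unfolding A_def B_def C_def D_def E_def G_def .
  qed
  thus ?thesis by (metis inner_commute vector_eq_rdot)
 qed
 show ?thesis
  using wron_has_derivative[OF less_imp_le[OF s(1)] less_imp_le[OF s(2)], of b] val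
  by (simp add: y_def x_def t_def P_def)
qed

text \<open>By \<open>shp_matrix\<close> the radial derivative of the metric is twice
  \<open>hp\<close> applied to \<open>shp\<close>, up to the scale \<open>1 - s\<close>. The segment
  runs towards the centre of these coordinates, so the sign is opposite to that in
  \<open>wron_derivative\<close>.\<close>

lemma wron_form_constant: "form (hp v) a (wron b 0) = form (hp 0) a (wron b 1)"
proof -
 define f where "f s = form (hp ((1 - s) *R v)) a (wron b s)" for s
 have der: "(f has_real_derivative
   form (dd hp ((1 - s) *R v) (- v)) a (wron b s) + form (hp ((1 - s) *R v)) a d) (at s)"
  if "(wron b has_vector_derivative d) (at s)" "0 \<le> s" "s \<le> 1" for s d
 proof -
  have "((\<lambda>s. (1 - s) *R v) has_derivative (\<lambda>k. - (k *R v))) (at s)"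
   by (auto intro!: derivative_eq_intros)
  from has_derivative_compose[OF this smooth_on_has_derivative[OF p.smooth_h segment_in(3)[OF that(2,3)]]]
  have "((\<lambda>s. hp ((1 - s) *R v)) has_derivative (\<lambda>k. k *R dd hp ((1 - s) *R v) (- v))) (at s)"
   using smooth_on_linear_dd[OF p.smooth_h segment_in(3)[OF that(2,3)]]
   by (simp add: linear_neg linear_scale)
  from has_derivative_form[OF has_derivative_const[of a] this that(1)[unfolded has_vector_derivative_def]]
  have "(f has_derivative (\<lambda>k. form (k *R dd hp ((1 - s) *R v) (- v)) a (wron b s)
    + form (hp ((1 - s) *R v)) a (k *R d))) (at s)"
   by (simp add: f_def[abs_def])
  moreover have "(\<lambda>k. form (k *R dd hp ((1 - s) *R v) (- v)) a (wron b s) + form (hp ((1 - s) *R v)) a (k *R d))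
    = (*) (form (dd hp ((1 - s) *R v) (- v)) a (wron b s) + form (hp ((1 - s) *R v)) a d)"
   by (rule ext) (simp only: form_scale ring_distribs mult.commute)
  ultimately show ?thesis by (simp add: has_field_derivative_def)
 qed
 have "f 1 = f 0"
 proof (rule DERIV_isconst_end[where a = 0 and b = 1 and f = f])
  show "continuous_on {0..1} f"
   by (intro continuous_at_imp_continuous_on) (auto intro!: DERIV_isCont[OF der[OF wron_has_derivative]])
  fix s :: real assume s: "0 < s" "s < 1"
  let ?x = "(1 - s) *R v"
  have x: "?x \<in> Up" using segment_in(3)[of s] s by simp
  have "(1 - s) *R (dd hp ?x v *v wron b s) = dd hp ?x ?x *v wron b s"
   by (simp add: linear_scale[OF smooth_on_linear_dd[OF p.smooth_h x]] scaleR_matrix_vector_assoc)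
  also have "\<dots> = 2 *R (hp ?x *v (shp hp ?x *v wron b s))" by (rule p.shp_matrix[OF x])
  finally have "(1 / (1 - s)) *R ((1 - s) *R (dd hp ?x v *v wron b s)) =
    (1 / (1 - s)) *R (2 *R (hp ?x *v (shp hp ?x *v wron b s)))" by simp
  hence "dd hp ?x v *v wron b s = (2 / (1 - s)) *R (hp ?x *v (shp hp ?x *v wron b s))"
   using s by simp
  hence "form (dd hp ?x (- v)) a (wron b s)
   + form (hp ?x) a ((2 / (1 - s)) *R (shp hp ?x *v wron b s)) = 0"
   by (simp add: linear_neg[OF smooth_on_linear_dd[OF p.smooth_h x]] uminus_matrix_vector mv_scaleR)
  thus "(f has_real_derivative 0) (at s)"
   using der[OF wron_derivative[OF s]] s by simp
 qed simp
 thus ?thesis by (simp add: f_def)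
qed

text \<open>The weights \<open>s\<close> and \<open>1 - s\<close>, and the vanishing of
  \<open>shp\<close> at a centre, reduce \<open>wron\<close> at either end to the differential of
  \<open>ph\<close> there.\<close>

lemma endpoint_differentials: "hp 0 *v dd ph w b = hp v *v dd ph 0 b"
proof -
 have 0: "wron b 0 = dd ph 0 b"
  using linear_0[OF linear_D] segment_in(1)[of 0] by (simp add: wron_def F1_def F3_def p.shp_0 q.shp_0)
 have "ph w = 0" using segment_in(4)[of 1] by simp
 hence 1: "wron b 1 = dd ph w b"
  by (simp add: wron_def F1_def F2_def p.shp_0)
 have "form (hp 0) a (dd ph w b) = form (hp v) a (dd ph 0 b)" for a
  using wron_form_constant[of a b] by (simp add: 0 1)
 thus ?thesis by (metis inner_commute vector_eq_rdot)
qed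

text \<open>Determinants of \<open>endpoint_differentials\<close>, squared because
  \<open>det_pullback\<close> contains the square of the Jacobian. In orthonormal frames the
  determinants at both centres are 1.\<close>

theorem density_symmetric: "det (hq w) * det (hp 0) = det (hp v) * det (hq 0)"
proof -
 define M1 M0 where "M1 = matrix (dd ph w)" and "M0 = matrix (dd ph 0)"
 have in': "w \<in> W" "0 \<in> W" "ph w = 0" "ph 0 = v" using segment_in(1,4)[of 1] segment_in(1,4)[of 0] by auto
 have M: "M1 *v b = dd ph w b" "M0 *v b = dd ph 0 b" for b
  unfolding M1_def M0_def
  by (rule matrix_works, simp add: linear_D in' linear_matrix_vector_mul_eq)+
 have "hp 0 ** M1 = hp v ** M0"
  unfolding matrix_eq by (simp add: matrix_vector_mul_assoc[symmetric] M endpoint_differentials)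
 hence "det (hp 0) * det M1 = det (hp v) * det M0" by (metis det_mul)
 hence "(det (hp 0) * det M1)^2 = (det (hp v) * det M0)^2" by simp
 thus ?thesis
  using det_pullback[OF in'(1)] det_pullback[OF in'(2)]
  by (simp add: in' M1_def M0_def power_mult_distrib power2_eq_square mult_ac)
qed

end

section \<open>Charts, tangent vectors and parametrizations\<close>

lemma form_sum_right_image:
 fixes P :: "real^'n^'m"
 shows "form P a (\<Sum>b\<in>B. c b *R f b) = (\<Sum>b\<in>B. c b * (form P a (f b)))"
 by (simp add: linear_sum[OF matrix_vector_mul_linear] mv_scaleR inner_sum_right)

locale riemannian_manifold =
 fixes A :: "('a::{t2_space,second_countable_topology}, 'n::finite) chart set"
  and g :: "('a, 'n) metric_tensor"
 assumes atlas: "oriented_smooth_atlas A" and metric: "riemannian_metric A g"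
begin

abbreviation "gmat \<equiv> metric_matrix A g"
abbreviation "TS \<equiv> tangent_space A"
abbreviation "Tmap \<equiv> tangent_map A"
abbreviation "frm \<equiv> frame A g"
abbreviation "cvec \<equiv> coord_vector A"
abbreviation "vel \<equiv> velocity A"
abbreviation "geod \<equiv> geodesic A g"
abbreviation "expm \<equiv> exp_map A g"
abbreviation "scal \<equiv> scalar_curvature A g"
abbreviation "diffeo \<equiv> exp_diffeomorphism A g"

abbreviation Om :: "('a, 'n) chart => (real^'n) set" where "Om c \<equiv> snd c ` fst c"

lemma chart_exists: "\<exists>c\<in>A. p \<in> fst c"
 using atlas unfolding oriented_smooth_atlas_def by blast

lemma
 assumes "c \<in> A"
 shows open_dom: "open (fst c)" and open_Om: "open (Om c)"
  and chart_homeo: "homeomorphism (fst c) (Om c) (snd c) (chart_inv c)"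
 using atlas assms unfolding oriented_smooth_atlas_def by auto

lemma
 assumes "c \<in> A"
 shows chart_inv_chart: "p \<in> fst c ==> chart_inv c (snd c p) = p"
  and chart_chart_inv: "x \<in> Om c ==> snd c (chart_inv c x) = x"
  and chart_inv_in: "x \<in> Om c ==> chart_inv c x \<in> fst c"
  and continuous_chart: "continuous_on (fst c) (snd c)"
  and continuous_chart_inv: "continuous_on (Om c) (chart_inv c)"
 using chart_homeo[OF assms] by (auto simp: homeomorphism_def)

lemma inj_on_chart: "c \<in> A ==> inj_on (snd c) (fst c)"
 by (metis chart_inv_chart inj_onI)

text \<open>Immersions, tested in charts; injectivity is a separate condition where volumes are
  computed. Chart inverses and exponential maps are both of this kind, so that pulled-back metric,
  curvature and volume are treated once for both.\<close>

definition param :: "(real^'n) set => (real^'n => 'a) => bool" where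
 "param U ps \<longleftrightarrow> open U \<and> continuous_on U ps \<and>
  (\<forall>c\<in>A. smooth_on {x\<in>U. ps x \<in> fst c} (\<lambda>x. snd c (ps x)) \<and>
   (\<forall>x\<in>U. ps x \<in> fst c \<longrightarrow> inj (dd (\<lambda>x. snd c (ps x)) x)))"

lemma param_open_dom:
 assumes "open U" "continuous_on U ps" "c \<in> A"
 shows "open {x\<in>U. ps x \<in> fst c}"
proof -
 have "{x\<in>U. ps x \<in> fst c} = U \<inter> ps -` fst c" by auto
 thus ?thesis using continuous_open_preimage[OF assms(2,1) open_dom[OF assms(3)]] by simp
qed

lemma transition_dom:
 assumes "c \<in> A"
 shows "{x \<in> Om c. chart_inv c x \<in> fst d} = snd c ` (fst c \<inter> fst d)"
 using chart_inv_chart[OF assms] by force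

lemma transition_smooth:
 assumes "c \<in> A" "d \<in> A"
 shows "smooth_on {x \<in> Om c. chart_inv c x \<in> fst d} (\<lambda>x. snd d (chart_inv c x))"
 using atlas assms unfolding oriented_smooth_atlas_def transition_dom[OF assms(1)] by (auto simp: o_def)

lemma chart_change_derivative:
 fixes F :: "'m::real_normed_vector => 'a"
 assumes "c \<in> A" "d \<in> A" "x \<in> S" "open S" "continuous_on S F" "F x \<in> fst c" "F x \<in> fst d"
  and "((\<lambda>y. snd c (F y)) has_derivative D) (at x)"
 shows "((\<lambda>y. snd d (F y)) has_derivative (\<lambda>w. dd (\<lambda>z. snd d (chart_inv c z)) (snd c (F x)) (D w))) (at x)"
proof -
 have o: "open (S \<inter> F -` (fst c \<inter> fst d))"
  using assms by (intro continuous_open_preimage open_Int open_dom) auto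
 have "((\<lambda>z. snd d (chart_inv c z)) has_derivative dd (\<lambda>z. snd d (chart_inv c z)) (snd c (F x))) (at (snd c (F x)))"
  using assms by (intro smooth_on_has_derivative[OF transition_smooth[OF assms(1,2)]])
   (auto simp: chart_inv_chart)
 from has_derivative_transform_within_open[OF has_derivative_compose[OF assms(8) this] o, of "\<lambda>y. snd d (F y)"]
 show ?thesis using assms by (simp add: chart_inv_chart)
qed

lemma transition_inverse:
 assumes "c \<in> A" "d \<in> A" "p \<in> fst c" "p \<in> fst d"
 shows "dd (\<lambda>z. snd c (chart_inv d z)) (snd d p) (dd (\<lambda>z. snd d (chart_inv c z)) (snd c p) u) = u"
proof -
 have 1: "((\<lambda>y. snd d (chart_inv c y)) has_derivative dd (\<lambda>z. snd d (chart_inv c z)) (snd c p)) (at (snd c p))"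
  using assms by (intro smooth_on_has_derivative[OF transition_smooth]) (auto simp: chart_inv_chart)
 have "((\<lambda>y. snd c (chart_inv c y)) has_derivative
  (\<lambda>w. dd (\<lambda>z. snd c (chart_inv d z)) (snd d (chart_inv c (snd c p))) (dd (\<lambda>z. snd d (chart_inv c z)) (snd c p) w))) (at (snd c p))"
  by (rule chart_change_derivative[OF assms(2,1) _ open_Om[OF assms(1)] continuous_chart_inv[OF assms(1)] _ _ 1])
   (use assms in \<open>auto simp: chart_inv_chart\<close>)
 moreover have "((\<lambda>y. snd c (chart_inv c y)) has_derivative (\<lambda>w. w)) (at (snd c p))"
  by (rule has_derivative_transform_within_open[OF has_derivative_ident open_Om[OF assms(1)]])
   (use assms in \<open>auto simp: chart_chart_inv\<close>)
 ultimately have "(\<lambda>w. dd (\<lambda>z. snd c (chart_inv d z)) (snd d (chart_inv c (snd c p))) (dd (\<lambda>z. snd d (chart_inv c z)) (snd c p) w)) = (\<lambda>w. w)"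
  by (rule has_derivative_unique)
 from fun_cong[OF this, of u] show ?thesis by (simp add: chart_inv_chart[OF assms(1,3)])
qed

lemma param_chart_inv: 
 assumes "c \<in> A"
 shows "param (Om c) (chart_inv c)"
 unfolding param_def
proof (intro conjI ballI impI)
 fix d x assume d: "d \<in> A" and x: "x \<in> Om c" "chart_inv c x \<in> fst d"
 show "inj (dd (\<lambda>x. snd d (chart_inv c x)) x)"
  using transition_inverse[OF assms d chart_inv_in[OF assms x(1)] x(2)]
  unfolding chart_chart_inv[OF assms x(1)] by (rule inj_on_inverseI)
qed (use open_Om continuous_chart_inv transition_smooth assms in auto)

lemma tangent_map_apply:
 "c \<in> A ==> F x \<in> fst c ==> Tmap F x w c = frechet_derivative (\<lambda>y. snd c (F y)) (at x) w"
 by (simp add: tangent_map_def o_def)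

lemma param_smooth:
 assumes "param U ps" "c \<in> A"
 shows "open {x\<in>U. ps x \<in> fst c}" "smooth_on {x\<in>U. ps x \<in> fst c} (\<lambda>x. snd c (ps x))"
 using assms param_open_dom[OF _ _ assms(2)] unfolding param_def by blast+

lemma tangent_map_in:
 fixes F :: "'m::real_normed_vector => 'a"
 assumes "x \<in> S" "open S" "continuous_on S F" "c \<in> A" "F x \<in> fst c" "(\<lambda>y. snd c (F y)) differentiable (at x)"
 shows "Tmap F x w \<in> TS (F x)"
proof -
 have dif: "((\<lambda>y. snd d (F y)) has_derivative frechet_derivative (\<lambda>y. snd d (F y)) (at x)) (at x)"
  if "d \<in> A" "F x \<in> fst d" for d
  using chart_change_derivative[OF assms(4) that(1) assms(1-3,5) that(2)] assms(6)
  by (metis differentiable_def frechet_derivative_works)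
 show ?thesis
  unfolding tangent_space_def
 proof (intro CollectI conjI allI impI ballI)
  fix c d assume cd: "c \<in> A" "d \<in> A" "F x \<in> fst c \<inter> fst d"
  hence "frechet_derivative (\<lambda>y. snd d (F y)) (at x) =
   (\<lambda>w. dd (\<lambda>z. snd d (chart_inv c z)) (snd c (F x)) (frechet_derivative (\<lambda>y. snd c (F y)) (at x) w))"
   using frechet_derivative_at[OF chart_change_derivative[OF cd(1,2) assms(1-3) _ _ dif[OF cd(1)]]] by simp
  thus "Tmap F x w d = frechet_derivative (snd d \<circ> chart_inv c) (at (snd c (F x))) (Tmap F x w c)"
   using cd by (simp add: tangent_map_apply o_def)
 qed (auto simp: tangent_map_def)
qed

lemma param_tangent_map_in:
 assumes "param U ps" "x \<in> U"
 shows "Tmap ps x w \<in> TS (ps x)"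
proof -
 obtain c where c: "c \<in> A" "ps x \<in> fst c" using chart_exists by blast
 have U: "open U" "continuous_on U ps" using assms(1) by (simp_all add: param_def)
 have "(\<lambda>y. snd c (ps y)) differentiable (at x)"
  by (rule smooth_on_differentiable[OF param_smooth(2)[OF assms(1) c(1)]]) (use assms(2) c(2) in simp)
 from tangent_map_in[OF assms(2) U c this] show ?thesis .
qed

lemma tangent_space_transition:
 assumes "v \<in> TS p" "c \<in> A" "d \<in> A" "p \<in> fst c" "p \<in> fst d"
 shows "v d = dd (\<lambda>z. snd d (chart_inv c z)) (snd c p) (v c)"
proof -
 have "v d = frechet_derivative (snd d \<circ> chart_inv c) (at (snd c p)) (v c)"
  using assms unfolding tangent_space_def by blast
 thus ?thesis by (simp add: o_def)
qed

lemma tangent_space_outside: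
 "v \<in> TS p ==> \<not> (c \<in> A \<and> p \<in> fst c) ==> v c = 0"
 unfolding tangent_space_def by blast

lemma tangent_vector_eqI:
 assumes "v \<in> TS p" "w \<in> TS p" "c \<in> A" "p \<in> fst c" "v c = w c"
 shows "v = w"
proof
 fix d show "v d = w d"
 proof (cases "d \<in> A \<and> p \<in> fst d")
  case True
  thus ?thesis
   using tangent_space_transition[OF assms(1,3) _ assms(4), of d]
    tangent_space_transition[OF assms(2,3) _ assms(4), of d] assms(5) by simp
 next
  case False
  thus ?thesis
   using tangent_space_outside[OF assms(1)] tangent_space_outside[OF assms(2)] by simp
 qed
qed

lemma coord_vector_in:
 assumes "c \<in> A" "x \<in> Om c"
 shows "cvec c x u \<in> TS (chart_inv c x)"
 unfolding coord_vector_def by (rule param_tangent_map_in[OF param_chart_inv[OF assms(1)] assms(2)])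

lemma dd_chart_chart_inv:
 assumes "c \<in> A" "x \<in> Om c"
 shows "dd (\<lambda>y. snd c (chart_inv c y)) x u = u"
 using dd_cong_open[OF open_Om[OF assms(1)] assms(2), of "\<lambda>y. snd c (chart_inv c y)" "\<lambda>y. y"]
  dd_eqI[OF has_derivative_ident] chart_chart_inv[OF assms(1)] by metis

lemma coord_vector_apply: "c \<in> A ==> x \<in> Om c ==> cvec c x u c = u"
 unfolding coord_vector_def
 by (simp add: tangent_map_apply chart_inv_in dd_chart_chart_inv)

lemma coord_vector_of:
 assumes "c \<in> A" "p \<in> fst c" "v \<in> TS p"
 shows "cvec c (snd c p) (v c) = v"
proof (rule tangent_vector_eqI[OF _ assms(3,1,2)])
 show "cvec c (snd c p) (v c) \<in> TS p"
  using coord_vector_in[OF assms(1), of "snd c p"] chart_inv_chart[OF assms(1,2)] assms(2) by auto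
 show "cvec c (snd c p) (v c) c = v c"
  using coord_vector_apply assms by simp
qed

lemma coord_vector_linear:
 assumes "c \<in> A" "x \<in> Om c"
 shows "linear (\<lambda>u. cvec c x u d)"
proof (cases "d \<in> A \<and> chart_inv c x \<in> fst d")
 case True
 hence "(\<lambda>u. cvec c x u d) = dd (\<lambda>y. snd d (chart_inv c y)) x"
  by (auto simp: coord_vector_def tangent_map_apply)
 thus ?thesis
  using smooth_on_linear_dd[OF transition_smooth[OF assms(1), of d]] True assms(2) by simp
next
 case False
 thus ?thesis
  unfolding linear_iff coord_vector_def tangent_map_def by auto
qed

lemma metric_matrix_form:
 assumes "c \<in> A" "x \<in> Om c"
 shows "g (chart_inv c x) (cvec c x u) (cvec c x w) = form (gmat c x) u w"
proof -
 define B where "B u w = g (chart_inv c x) (cvec c x u) (cvec c x w)" for u w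
 have "bilinear B" using metric assms unfolding riemannian_metric_def B_def by blast
 hence l1: "linear (\<lambda>u. B u w)" and l2: "linear (B u)" for u w by (auto simp: bilinear_def)
 have "B u w = (\<Sum>i\<in>UNIV. \<Sum>j\<in>UNIV. u $ i * (B (axis i 1) (axis j 1) * w $ j))"
 proof -
  have "B u w = (\<Sum>i\<in>UNIV. u $ i * B (axis i 1) w)" using linear_axis_expand[OF l1, of u] by simp
  moreover have "B a w = (\<Sum>j\<in>UNIV. B a (axis j 1) * w $ j)" for a
   using linear_axis_expand[OF l2, of a w] by (simp add: mult.commute)
  ultimately show ?thesis by (simp add: sum_distrib_left)
 qed
 also have "\<dots> = form (gmat c x) u w"
  by (simp add: metric_matrix_def B_def inner_vec_def matrix_vector_mult_def sum_distrib_left)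
 finally show ?thesis by (simp add: B_def)
qed

lemma g_chart:
 assumes "c \<in> A" "p \<in> fst c" "v \<in> TS p" "w \<in> TS p"
 shows "g p v w = v c \<bullet> (gmat c (snd c p) *v w c)"
 using metric_matrix_form[OF assms(1), of "snd c p" "v c" "w c"] coord_vector_of[OF assms(1,2)] assms
  chart_inv_chart[OF assms(1,2)] by simp

lemma metric_on_chart:
 assumes c: "c \<in> A"
 shows "metric_on (Om c) (gmat c)"
 unfolding metric_on_def
proof (intro conjI ballI)
 show "open (Om c)" by (rule open_Om[OF c])
 show "smooth_on (Om c) (gmat c)" using metric c unfolding riemannian_metric_def by blast
 fix x assume x: "x \<in> Om c"
 have "transpose (gmat c x) = gmat c x"
  using metric coord_vector_in[OF c x]
  unfolding riemannian_metric_def vec_eq_iff transpose_def metric_matrix_def by simp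
 moreover have "form (gmat c x) v v > 0" if "v \<noteq> 0" for v
 proof -
  have "cvec c x v \<noteq> (\<lambda>_. 0)" using coord_vector_apply[OF c x, of v] that by auto
  thus ?thesis
   using metric coord_vector_in[OF c x] metric_matrix_form[OF c x, of v v]
   unfolding riemannian_metric_def by metis
 qed
 ultimately show "posdef (gmat c x)" by (simp add: posdef_def)
qed

definition pull_metric :: "(real^'n => 'a) => real^'n => real^'n^'n" where
 "pull_metric ps x = (\<chi> i j. g (ps x) (Tmap ps x (axis i 1)) (Tmap ps x (axis j 1)))"

lemma metric_matrix_eq_pull: "gmat c = pull_metric (chart_inv c)"
 by (rule ext) (simp add: metric_matrix_def pull_metric_def coord_vector_def)

lemma pull_metric_entry:
 assumes "param U ps" "x \<in> U" "c \<in> A" "ps x \<in> fst c"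
 shows "pull_metric ps x $ i $ j = dd (\<lambda>y. snd c (ps y)) x (axis i 1) \<bullet>
  (gmat c (snd c (ps x)) *v dd (\<lambda>y. snd c (ps y)) x (axis j 1))"
 unfolding pull_metric_def
 using g_chart[OF assms(3,4) param_tangent_map_in[OF assms(1,2)] param_tangent_map_in[OF assms(1,2)]]
  tangent_map_apply[of c ps x, OF assms(3,4)] by simp

lemma pull_metric_chart:
 assumes "param U ps" "x \<in> U" "c \<in> A" "ps x \<in> fst c"
 shows "form (pull_metric ps x) u w =
  dd (\<lambda>y. snd c (ps y)) x u \<bullet> (gmat c (snd c (ps x)) *v dd (\<lambda>y. snd c (ps y)) x w)"
proof -
 define D where "D = dd (\<lambda>y. snd c (ps y)) x"
 define K where "K = gmat c (snd c (ps x))"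
 have lin: "linear D"
  unfolding D_def using smooth_on_linear_dd[OF param_smooth(2)[OF assms(1,3)]] assms by simp
 have e: "pull_metric ps x $ i $ j = D (axis i 1) \<bullet> (K *v D (axis j 1))" for i j
  using pull_metric_entry[OF assms] by (simp add: D_def K_def)
 have "D u \<bullet> (K *v D w) = (\<Sum>i\<in>UNIV. \<Sum>j\<in>UNIV. u $ i * ((D (axis i 1) \<bullet> (K *v D (axis j 1))) * w $ j))"
 proof -
  have "D u \<bullet> (K *v D w) = (\<Sum>i\<in>UNIV. u $ i * (D (axis i 1) \<bullet> (K *v D w)))"
   by (subst linear_axis_expand[OF lin, of u]) (simp add: inner_sum_left)
  moreover have "form K a (D w) = (\<Sum>j\<in>UNIV. (form K a (D (axis j 1))) * w $ j)" for a
   by (subst linear_axis_expand[OF lin, of w]) (simp add: form_sum_right_image mult.commute)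
  ultimately show ?thesis by (simp add: sum_distrib_left)
 qed
 thus ?thesis
  by (simp add: D_def K_def e[unfolded D_def K_def] inner_vec_def[of u] matrix_vector_mult_def[of "pull_metric ps x"] sum_distrib_left)
qed

lemma pull_metric_tangent:
 assumes "param U ps" "x \<in> U"
 shows "g (ps x) (Tmap ps x u) (Tmap ps x w) = form (pull_metric ps x) u w"
proof -
 obtain c where c: "c \<in> A" "ps x \<in> fst c" using chart_exists by blast
 show ?thesis
  using g_chart[OF c param_tangent_map_in[OF assms] param_tangent_map_in[OF assms]]
   pull_metric_chart[OF assms c] tangent_map_apply[of c ps x, OF c] by simp
qed

lemma pull_metric_on:
 assumes ps: "param U ps"
 shows "metric_on U (pull_metric ps)"
 unfolding metric_on_def
proof (intro conjI ballI)
 show "open U" using ps by (simp add: param_def)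
 show "smooth_on U (pull_metric ps)"
 proof (rule smooth_on_local)
  fix x assume x: "x \<in> U"
  obtain c where c: "c \<in> A" "ps x \<in> fst c" using chart_exists by blast
  define T where "T = {x\<in>U. ps x \<in> fst c}"
  have T: "open T" "smooth_on T (\<lambda>x. snd c (ps x))" using param_smooth[OF ps c(1)] by (auto simp: T_def)
  have K: "smooth_on T (\<lambda>x. gmat c (snd c (ps x)))"
  proof (rule smooth_on_compose[OF _ T(2,1) open_Om[OF c(1)]])
   show "smooth_on (Om c) (gmat c)" using metric_on_chart[OF c(1)] by (simp add: metric_on_def)
   show "(\<lambda>x. snd c (ps x)) ` T \<subseteq> Om c" unfolding T_def by blast
  qed
  define M where "M x = (\<chi> i j. dd (\<lambda>y. snd c (ps y)) x (axis i 1) \<bullet>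
   (gmat c (snd c (ps x)) *v dd (\<lambda>y. snd c (ps y)) x (axis j 1)))" for x
  have "smooth_on T M"
   unfolding M_def[abs_def]
   by (intro smooth_on_vec_lambda T(1) smooth_on_inner smooth_on_matrix_vector K smooth_on_dd[OF T(2)])
  moreover have "pull_metric ps x = M x" if "x \<in> T" for x
   using pull_metric_entry[OF ps _ c(1), of x] that by (simp add: T_def vec_eq_iff M_def)
  ultimately have "smooth_on T (pull_metric ps)"
   using smooth_on_cong[OF T(1), of "pull_metric ps" M] by simp
  moreover have "x \<in> T" using x c(2) by (simp add: T_def)
  ultimately show "\<exists>T. open T \<and> x \<in> T \<and> smooth_on T (pull_metric ps)" using T(1) by metis
 qed
 fix x assume x: "x \<in> U"
 obtain c where c: "c \<in> A" "ps x \<in> fst c" using chart_exists by blast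
 have P: "posdef (gmat c (snd c (ps x)))" using metric_on_chart[OF c(1)] c by (simp add: metric_on_def)
 have lin: "linear (dd (\<lambda>y. snd c (ps y)) x)"
  using smooth_on_linear_dd[OF param_smooth(2)[OF ps c(1)]] x c by simp
 have "inj (dd (\<lambda>y. snd c (ps y)) x)" using ps x c by (simp add: param_def)
 hence nz: "dd (\<lambda>y. snd c (ps y)) x v \<noteq> 0" if "v \<noteq> 0" for v
  using that linear_injective_0[OF lin] by blast
 have "transpose (pull_metric ps x) = pull_metric ps x"
  unfolding vec_eq_iff transpose_def
  using pull_metric_entry[OF ps x c] posdef_sym[OF P] by simp
 thus "posdef (pull_metric ps x)"
  using pull_metric_chart[OF ps x c] posdef_pos[OF P] nz by (simp add: posdef_def)
qed

lemma param_pullback: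
 assumes "param U ps" "c \<in> A"
 shows "metric_pullback {x\<in>U. ps x \<in> fst c} (Om c) (pull_metric ps) (gmat c) (\<lambda>x. snd c (ps x))"
proof
 show "metric_on {x \<in> U. ps x \<in> fst c} (pull_metric ps)"
  using pull_metric_on[OF assms(1)] param_smooth(1)[OF assms]
  unfolding metric_on_def by (simp add: smooth_on_subset[of U])
 show "metric_on (Om c) (gmat c)" by (rule metric_on_chart[OF assms(2)])
 show "smooth_on {x \<in> U. ps x \<in> fst c} (\<lambda>x. snd c (ps x))" by (rule param_smooth(2)[OF assms])
 show "(\<lambda>x. snd c (ps x)) ` {x \<in> U. ps x \<in> fst c} \<subseteq> Om c" by blast
 show "form (pull_metric ps x) u w = dd (\<lambda>x. snd c (ps x)) x u \<bullet>
   (gmat c (snd c (ps x)) *v dd (\<lambda>x. snd c (ps x)) x w)"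
  if "x \<in> {x \<in> U. ps x \<in> fst c}" for x u w
  using that by (intro pull_metric_chart[OF assms(1) _ assms(2)]) simp_all
qed

text \<open>The chart is an arbitrary choice; on tangent vectors the value is the same in every
  chart, by \<open>ric_chart\<close>.\<close>

definition ric :: "'a => ('a, 'n) tangent_vector => real" where
 "ric p v = (let c = (SOME c. c \<in> A \<and> p \<in> fst c) in ricq (gmat c) (snd c p) (v c))"

text \<open>The differential \<open>M\<close> conjugates the curvature endomorphism of
  \<open>u\<close> into that of its image, and a trace is invariant under conjugation.\<close>

lemma ricq_pullback:
 assumes "metric_pullback U V h k ph" "x \<in> U"
 shows "ricq k (ph x) (dd ph x u) = ricq h x u"
proof -
 interpret metric_pullback U V h k ph by fact
 define M where "M = matrix (dd ph x)"
 have M: "M *v b = dd ph x b" for b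
  unfolding M_def by (rule matrix_works) (simp add: linear_D[OF assms(2)] linear_matrix_vector_mul_eq)
 have "invertible M"
  using inj_D[OF assms(2)] M by (metis invertible_left_inverse matrix_left_invertible_ker)
 note inv = matrix_inv_inverse[OF this]
 let ?R = "matrix (\<lambda>w. riemv k (ph x) w (dd ph x u) (dd ph x u))"
 let ?S = "matrix (\<lambda>w. riemv h x w u u)"
 have "M ** ?S = ?R ** M"
  unfolding matrix_eq
  by (simp add: matrix_vector_mul_assoc[symmetric] M riemv_matrix riemv_transform[OF assms(2)] del: matrix_vector_mul_assoc)
 hence "?S = matrix_inv M ** (?R ** M)"
  by (metis inv(2) matrix_mul_assoc matrix_mul_lid)
 hence "trace ?S = trace ((?R ** M) ** matrix_inv M)" by (metis trace_mul_sym)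
 also have "\<dots> = trace ?R" by (simp add: matrix_mul_assoc[symmetric] inv)
 finally show ?thesis by (simp add: ricq_def)
qed

lemma ric_chart:
 assumes "c \<in> A" "p \<in> fst c" "v \<in> TS p"
 shows "ric p v = ricq (gmat c) (snd c p) (v c)"
proof -
 define d where "d = (SOME c. c \<in> A \<and> p \<in> fst c)"
 have "\<exists>c. c \<in> A \<and> p \<in> fst c" using assms(1,2) by blast
 from someI_ex[OF this] have d: "d \<in> A" "p \<in> fst d" unfolding d_def by blast+
 have "ricq (gmat c) (snd c p) (v c) = ricq (gmat d) (snd d p) (v d)"
  using ricq_pullback[OF param_pullback[OF param_chart_inv[OF d(1)] assms(1)], of "snd d p" "v d"]
   assms(2) d chart_inv_chart[OF d] tangent_space_transition[OF assms(3) d(1) assms(1) d(2) assms(2)]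
  by (simp add: metric_matrix_eq_pull)
 thus ?thesis by (simp add: ric_def d_def Let_def)
qed

lemma ric_param:
 assumes "param U ps" "x \<in> U"
 shows "ric (ps x) (Tmap ps x u) = ricq (pull_metric ps) x u"
proof -
 obtain c where c: "c \<in> A" "ps x \<in> fst c" using chart_exists by blast
 show ?thesis
  using ric_chart[OF c param_tangent_map_in[OF assms]] ricq_pullback[OF param_pullback[OF assms(1) c(1)], of x u]
   tangent_map_apply[of c ps x, OF c] assms c by simp
qed

lemma ricq_ricci: "ricq (gmat c) x v = (\<Sum>j\<in>UNIV. \<Sum>k\<in>UNIV. ricci A g c j k x * v $ j * v $ k)"
proof -
 have "ricq (gmat c) x v = (\<Sum>i\<in>UNIV. \<Sum>j\<in>UNIV. \<Sum>k\<in>UNIV. riemann A g c i i j k x * v $ j * v $ k)"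
 proof -
  have "riemv h x (axis i 1) v v $ l = (\<Sum>m\<in>UNIV. axis i 1 $ m * (\<Sum>j\<in>UNIV. \<Sum>k\<in>UNIV. riem h l m j k x * v $ j * v $ k))"
   for h :: "real^'n => real^'n^'n" and i l
   by (simp add: riemv_def sum_distrib_left mult_ac)
  hence "riemv h x (axis i 1) v v $ l = (\<Sum>j\<in>UNIV. \<Sum>k\<in>UNIV. riem h l i j k x * v $ j * v $ k)"
   for h :: "real^'n => real^'n^'n" and i l
   by (simp add: axis_def if_distrib[of "\<lambda>b. b * _"] cong: if_cong)
  thus ?thesis by (simp add: ricq_def trace_def riemann_eq_riem matrix_def)
 qed
 also have "\<dots> = (\<Sum>j\<in>UNIV. \<Sum>i\<in>UNIV. \<Sum>k\<in>UNIV. riemann A g c i i j k x * v $ j * v $ k)"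
  by (rule sum.swap)
 also have "\<dots> = (\<Sum>j\<in>UNIV. \<Sum>k\<in>UNIV. \<Sum>i\<in>UNIV. riemann A g c i i j k x * v $ j * v $ k)"
  by (intro sum.cong refl sum.swap)
 finally show ?thesis by (simp add: ricci_def sum_distrib_right)
qed

end

section \<open>Geodesics\<close>

text \<open>The squared distance times \<open>exp (- 2 * L * t)\<close> is nonincreasing, by
  Cauchy-Schwarz and the Lipschitz bound. That both curves stay in \<open>K\<close> is a hypothesis
  here; for geodesics \<open>geodesic_trap\<close> establishes it.\<close>

lemma gronwall:
 fixes z z' :: "real => 'e::euclidean_space"
 assumes "a \<le> b"
  and z: "\<And>t. a \<le> t ==> t \<le> b ==> (z has_vector_derivative f (z t)) (at t) \<and> z t \<in> K"
  and z': "\<And>t. a \<le> t ==> t \<le> b ==> (z' has_vector_derivative f (z' t)) (at t) \<and> z' t \<in> K"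
  and L: "\<And>x y. x \<in> K ==> y \<in> K ==> norm (f x - f y) \<le> L * norm (x - y)"
 shows "dist (z' b) (z b) \<le> exp (L * (b - a)) * dist (z' a) (z a)"
proof -
 define w where "w t = z' t - z t" for t
 define e where "e t = w t \<bullet> w t" for t
 define ph where "ph t = e t * exp (- 2 * L * t)" for t
 have "ph b \<le> ph a"
 proof (rule DERIV_nonpos_imp_nonincreasing[OF assms(1)])
  fix t assume t: "a \<le> t" "t \<le> b"
  define d where "d = f (z' t) - f (z t)"
  have "(w has_vector_derivative d) (at t)"
   unfolding w_def[abs_def] d_def using z[OF t] z'[OF t] by (intro has_vector_derivative_diff) auto
  hence "(e has_real_derivative 2 * (w t \<bullet> d)) (at t)"
   unfolding e_def[abs_def] has_vector_derivative_def has_field_derivative_def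
   by (auto intro!: derivative_eq_intros simp: inner_commute fun_eq_iff)
  hence "(ph has_real_derivative (2 * (w t \<bullet> d) - 2 * L * e t) * exp (- 2 * L * t)) (at t)"
   unfolding ph_def[abs_def] by (auto intro!: derivative_eq_intros simp: algebra_simps)
  moreover have "2 * (w t \<bullet> d) \<le> 2 * L * e t"
  proof -
   have "w t \<bullet> d \<le> norm (w t) * norm d" by (rule norm_cauchy_schwarz)
   also have "\<dots> \<le> norm (w t) * (L * norm (w t))"
    unfolding w_def d_def using z[OF t] z'[OF t] by (intro mult_left_mono L) auto
   also have "\<dots> = L * e t" by (simp add: e_def dot_square_norm power2_eq_square)
   finally show ?thesis by simp
  qed
  ultimately show "\<exists>y. (ph has_real_derivative y) (at t) \<and> y \<le> 0"
   by (intro exI[of _ "(2 * (w t \<bullet> d) - 2 * L * e t) * exp (- 2 * L * t)"])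
    (simp add: mult_nonpos_nonneg)
 qed
 hence "e b \<le> e a * (exp (L * (b - a)))^2"
  by (simp add: ph_def exp_minus field_simps exp_double[symmetric] exp_add[symmetric] exp_diff)
 hence "(norm (w b))^2 \<le> (exp (L * (b - a)) * norm (w a))^2"
  by (simp add: e_def dot_square_norm power_mult_distrib mult.commute)
 hence "norm (w b) \<le> exp (L * (b - a)) * norm (w a)"
  by (rule power2_le_imp_le) simp
 thus ?thesis by (simp add: w_def dist_norm)
qed

lemma smooth_on_lipschitz:
 fixes f :: "'a::euclidean_space => 'b::euclidean_space"
 assumes "smooth_on S f" "compact K" "convex K" "K \<subseteq> S"
 obtains L where "L \<ge> 0" "\<And>x y. x \<in> K ==> y \<in> K ==> norm (f x - f y) \<le> L * norm (x - y)"
proof -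
 have "\<exists>M\<ge>0. \<forall>x\<in>K. norm (dd f x b) \<le> M" for b
 proof -
  have "continuous_on K (\<lambda>x. dd f x b)"
   using smooth_on_continuous_on[OF smooth_on_dd[OF assms(1)]] assms(4) continuous_on_subset by blast
  hence "bounded ((\<lambda>x. dd f x b) ` K)" using assms(2) compact_continuous_image compact_imp_bounded by blast
  then obtain M where "\<forall>x\<in>K. norm (dd f x b) \<le> M" unfolding bounded_iff by auto
  thus ?thesis by (intro exI[of _ "max M 0"]) auto
 qed
 then obtain M where M: "\<And>b. M b \<ge> 0" "\<And>b x. x \<in> K ==> norm (dd f x b) \<le> M b" by metis
 define L where "L = (\<Sum>b\<in>Basis. M b)"
 have "norm (f x - f y) \<le> L * norm (x - y)" if "x \<in> K" "y \<in> K" for x y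
 proof (rule differentiable_bound[OF assms(3) _ _ that])
  fix x assume x: "x \<in> K"
  show "(f has_derivative dd f x) (at x within K)"
   using smooth_on_has_derivative[OF assms(1)] x assms(4) has_derivative_at_withinI by blast
  show "onorm (dd f x) \<le> L"
  proof (rule onorm_le)
   fix v
   have "norm (dd f x v) \<le> (\<Sum>b\<in>Basis. norm ((v \<bullet> b) *R dd f x b))"
    using dd_apply_sum[OF assms(1), of x v] x assms(4) by (metis norm_sum subsetD)
   also have "\<dots> \<le> (\<Sum>b\<in>Basis. norm v * M b)"
    using M x Basis_le_norm by (intro sum_mono) (auto intro!: mult_mono)
   also have "\<dots> = L * norm v" by (simp add: L_def sum_distrib_left mult.commute)
   finally show "norm (dd f x v) \<le> L * norm v" .
  qed
 qed
 moreover have "L \<ge> 0" using M by (simp add: L_def sum_nonneg)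
 ultimately show thesis using that by blast
qed

lemma smooth_on_Pair:
 fixes f :: "'a::euclidean_space => 'b::euclidean_space" and g :: "'a => 'c::euclidean_space"
 assumes "open S" "smooth_on S f" "smooth_on S g"
 shows "smooth_on S (\<lambda>x. (f x, g x))"
proof -
 have "smooth_on S (\<lambda>x. (f x, 0) + (0, g x))"
  by (intro smooth_on_add assms smooth_on_linear_compose[of "\<lambda>x. (x, 0)"] smooth_on_linear_compose[of "\<lambda>x. (0, x)"]
    bounded_linear_Pair bounded_linear_ident bounded_linear_zero)
 thus ?thesis by simp
qed

text \<open>The hypothesis makes \<open>P\<close> locally constant, and the real line is connected.
  This serves uniqueness as well as continuous dependence of geodesics.\<close>

lemma local_imp_global_real:
 fixes P :: "real => bool"
 assumes "\<And>t. \<exists>\<delta>>0. \<forall>s s'. \<bar>s - t\<bar> \<le> \<delta> \<longrightarrow> \<bar>s' - t\<bar> \<le> \<delta> \<longrightarrow> P s \<longrightarrow> P s'" and "P a"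
 shows "P b"
proof -
 have "P a = P b"
 proof (rule connected_local_const[OF connected_UNIV])
  show "\<forall>a\<in>UNIV. \<forall>\<^sub>F b in at a within UNIV. P a = P b"
  proof
   fix t
   obtain \<delta> where \<delta>: "\<delta> > 0" "\<And>s s'. \<bar>s - t\<bar> \<le> \<delta> ==> \<bar>s' - t\<bar> \<le> \<delta> ==> P s ==> P s'" using assms(1) by blast
   have "P t = P s" if "dist s t < \<delta>" for s
   proof -
    have "\<bar>s - t\<bar> \<le> \<delta>" "\<bar>t - t\<bar> \<le> \<delta>" using that \<delta>(1) by (auto simp: dist_real_def)
    thus ?thesis using \<delta>(2) by blast
   qed
   thus "\<forall>\<^sub>F s in at t within UNIV. P t = P s"
    unfolding eventually_at using \<delta>(1) by blast
  qed
 qed auto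
 thus ?thesis using assms(2) by simp
qed

context riemannian_manifold
begin

text \<open>The geodesic equation as a first-order system for position and velocity;
  \<open>zc\<close> below is the corresponding phase curve.\<close>

definition spray :: "('a, 'n) chart => (real^'n) \<times> (real^'n) => (real^'n) \<times> (real^'n)" where
 "spray c z = (snd z, - chrv (gmat c) (fst z) (snd z) (snd z))"

lemma smooth_spray:
 assumes c: "c \<in> A"
 shows "smooth_on (Om c \<times> UNIV) (spray c)"
proof -
 have o: "open (Om c \<times> (UNIV :: (real^'n) set))" using open_Om[OF c] by (simp add: open_Times)
 have f: "smooth_on (Om c \<times> (UNIV :: (real^'n) set)) (fst :: (real^'n) \<times> (real^'n) => _)"
  and s: "smooth_on (Om c \<times> (UNIV :: (real^'n) set)) (snd :: (real^'n) \<times> (real^'n) => _)"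
  by (rule smooth_on_bounded_linear; rule bounded_linear_fst bounded_linear_snd)+
 have ch: "smooth_on (Om c \<times> (UNIV :: (real^'n) set)) (\<lambda>z. chr (gmat c) k i j (fst z))" for k i j
  by (rule smooth_on_compose[OF smooth_on_chr[OF metric_on_chart[OF c]] f o open_Om[OF c]]) auto
 show ?thesis
  unfolding spray_def[abs_def] chrv_def
  by (intro smooth_on_Pair o s smooth_on_uminus smooth_on_vec_lambda smooth_on_sum smooth_on_mult ch smooth_on_nth)
qed

definition zc :: "('a, 'n) chart => (real => 'a) => real => (real^'n) \<times> (real^'n)" where
 "zc c ga t = (snd c (ga t), vel ga t c)"

lemma covariant_derivative_apply:
 assumes "c \<in> A" "F x \<in> fst c"
 shows "covariant_derivative A g F V x w c = frechet_derivative (\<lambda>y. V y c) (at x) w +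
  chrv (gmat c) (snd c (F x)) (Tmap F x w c) (V x c)"
 using assms by (simp add: covariant_derivative_def chrv_def christoffel_eq_chr)

lemma velocity_apply: "c \<in> A ==> ga t \<in> fst c ==> vel ga t c = frechet_derivative (\<lambda>s. snd c (ga s)) (at t) 1"
 unfolding velocity_def by (rule tangent_map_apply)

lemma geodesic_continuous: "geod ga ==> continuous_on UNIV ga"
 by (simp add: geodesic_def)

lemma geodesic_differentiable:
 assumes "geod ga" "c \<in> A" "ga t \<in> fst c"
 shows "((\<lambda>s. snd c (ga s)) has_vector_derivative vel ga t c) (at t)"
  "((\<lambda>s. vel ga s c) has_vector_derivative
   - chrv (gmat c) (snd c (ga t)) (vel ga t c) (vel ga t c)) (at t)"
proof -
 have d1: "(\<lambda>s. snd c (ga s)) differentiable at t" and d2: "(\<lambda>s. vel ga s c) differentiable at t"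
  and cov: "covariant_derivative A g ga (vel ga) t 1 = (\<lambda>_. 0)"
  using assms unfolding geodesic_def o_def by blast+
 have vd: "(f has_vector_derivative frechet_derivative f (at t) 1) (at t)" if "f differentiable at t" for f :: "real => real^'n"
 proof -
  have "(f has_derivative frechet_derivative f (at t)) (at t)" using that frechet_derivative_works by blast
  moreover from has_derivative_linear[OF this]
  have "frechet_derivative f (at t) = (\<lambda>k. k *R frechet_derivative f (at t) 1)"
   by (metis linear_scale mult.right_neutral real_scaleR_def)
  ultimately show ?thesis unfolding has_vector_derivative_def by simp
 qed
 show "((\<lambda>s. snd c (ga s)) has_vector_derivative vel ga t c) (at t)"
  using vd[OF d1] velocity_apply[of c ga t, OF assms(2,3)] by simp
 have "frechet_derivative (\<lambda>s. vel ga s c) (at t) 1 +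
  chrv (gmat c) (snd c (ga t)) (vel ga t c) (vel ga t c) = 0"
  using fun_cong[OF cov, of c] covariant_derivative_apply[of c ga t "vel ga" 1, OF assms(2,3)]
  by (simp add: velocity_def)
 thus "((\<lambda>s. vel ga s c) has_vector_derivative
   - chrv (gmat c) (snd c (ga t)) (vel ga t c) (vel ga t c)) (at t)"
  using vd[OF d2] by (simp add: add_eq_0_iff2)
qed

lemma geodesic_velocity_in:
 assumes "geod ga"
 shows "vel ga t \<in> TS (ga t)"
proof -
 obtain c where c: "c \<in> A" "ga t \<in> fst c" using chart_exists by blast
 have "(\<lambda>s. snd c (ga s)) differentiable at t"
  using geodesic_differentiable(1)[OF assms c] unfolding has_vector_derivative_def differentiable_def by blast
 from tangent_map_in[OF UNIV_I open_UNIV geodesic_continuous[OF assms] c this]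
 show ?thesis by (simp add: velocity_def)
qed

lemma zc_derivative:
 assumes "geod ga" "c \<in> A" "ga t \<in> fst c"
 shows "(zc c ga has_vector_derivative spray c (zc c ga t)) (at t)"
 unfolding zc_def[abs_def] spray_def has_vector_derivative_def
 using has_derivative_Pair[OF geodesic_differentiable[OF assms, unfolded has_vector_derivative_def]]
 by simp

lemma geodesic_open_dom: "geod ga ==> c \<in> A ==> open {t. ga t \<in> fst c}"
 using open_vimage[OF open_dom geodesic_continuous] by (simp add: vimage_def)

lemma zc_isCont: "geod ga ==> c \<in> A ==> ga t \<in> fst c ==> isCont (zc c ga) t"
 by (rule has_vector_derivative_continuous[OF zc_derivative])

lemma geodesic_affine:
 assumes ga: "geod ga"
 shows "geod (\<lambda>t. ga (a * t + b))"
  and "vel (\<lambda>t. ga (a * t + b)) t c = a *R vel ga (a * t + b) c"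
proof -
 let ?ga = "\<lambda>t. ga (a * t + b)"
 have aff: "((\<lambda>t. a * t + b) has_vector_derivative a) (at t)" for t
  by (auto intro!: derivative_eq_intros simp: has_vector_derivative_def)
 have d1: "((\<lambda>s. snd c (ga (a * s + b))) has_vector_derivative a *R vel ga (a * t + b) c) (at t)"
  if "c \<in> A" "?ga t \<in> fst c" for c t
  using vector_diff_chain_at[OF aff geodesic_differentiable(1)[OF ga that]] by (simp add: o_def)
 have v: "vel ?ga t c = a *R vel ga (a * t + b) c" for t c
 proof (cases "c \<in> A \<and> ?ga t \<in> fst c")
  case True
  have "frechet_derivative (\<lambda>s. snd c (ga (a * s + b))) (at t) = (\<lambda>k. k *R (a *R vel ga (a * t + b) c))"
   using d1 True frechet_derivative_at unfolding has_vector_derivative_def by metis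
  thus ?thesis using velocity_apply[of c "?ga" t] True by simp
 next
  case False
  thus ?thesis by (auto simp: velocity_def tangent_map_def)
 qed
 thus "vel ?ga t c = a *R vel ga (a * t + b) c" .
 have d2: "((\<lambda>s. vel ?ga s c) has_vector_derivative
   (a * a) *R (- chrv (gmat c) (snd c (?ga t)) (vel ga (a * t + b) c) (vel ga (a * t + b) c))) (at t)"
  if "c \<in> A" "?ga t \<in> fst c" for c t
  using bounded_linear.has_vector_derivative[OF bounded_linear_scaleR_right[of a]
    vector_diff_chain_at[OF aff geodesic_differentiable(2)[OF ga that]]]
  by (simp add: o_def v)
 show "geod ?ga"
  unfolding geodesic_def
 proof (intro conjI allI ballI impI)
  show "continuous_on UNIV ?ga"
   by (rule continuous_on_compose2[OF geodesic_continuous[OF ga]]) (auto intro!: continuous_intros)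
  fix t
  {
   fix c assume c: "c \<in> A" "?ga t \<in> fst c"
   show "(snd c \<circ> ?ga) differentiable at t"
    using d1[OF c] unfolding o_def has_vector_derivative_def differentiable_def by blast
   show "(\<lambda>s. vel ?ga s c) differentiable at t"
    using d2[OF c] unfolding has_vector_derivative_def differentiable_def by blast
  }
  show "covariant_derivative A g ?ga (vel ?ga) t 1 = (\<lambda>_. 0)"
  proof
   fix c
   show "covariant_derivative A g ?ga (vel ?ga) t 1 c = 0"
   proof (cases "c \<in> A \<and> ?ga t \<in> fst c")
    case True
    have "frechet_derivative (\<lambda>s. vel ?ga s c) (at t) 1 =
     (a * a) *R (- chrv (gmat c) (snd c (?ga t)) (vel ga (a * t + b) c) (vel ga (a * t + b) c))"
     using fun_cong[OF frechet_derivative_at[OF d2[of c t, unfolded has_vector_derivative_def]], of 1] True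
     by simp
    moreover have "Tmap ?ga t 1 c = a *R vel ga (a * t + b) c"
     using v[of t c] by (simp add: velocity_def)
    ultimately show ?thesis
     using covariant_derivative_apply[of c "?ga" t] True by (simp add: v chrv_bilinear)
   qed (auto simp: covariant_derivative_def)
  qed
 qed
qed

abbreviation gap :: "('a, 'n) chart => (real => 'a) => (real => 'a) => real => real" where
 "gap c ga ga' t \<equiv> dist (zc c ga' t) (zc c ga t)"

text \<open>A first-exit argument. A priori \<open>ga'\<close> might leave the chart or drift away
  from \<open>ga\<close>. Before the first time \<open>u\<close> at which either happens Gronwall's
  bound holds, and it is strictly below \<open>e / 2\<close>, so neither can happen at
  \<open>u\<close>.\<close>

lemma geodesic_trap:
 assumes c: "c \<in> A" and ball: "cball z0 e \<subseteq> Om c \<times> UNIV" and "e > 0" "L \<ge> 0"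
  and L: "\<And>x y. x \<in> cball z0 e ==> y \<in> cball z0 e ==> norm (spray c x - spray c y) \<le> L * norm (x - y)"
  and ga: "geod ga" and ga': "geod ga'" and ab: "a \<le> b"
  and in_c: "\<And>t. a \<le> t ==> t \<le> b ==> ga t \<in> fst c \<and> dist (zc c ga t) z0 \<le> e / 2"
  and start: "ga' a \<in> fst c" "exp (L * (b - a)) * gap c ga ga' a < e / 2"
 shows "ga' b \<in> fst c \<and> gap c ga ga' b \<le> exp (L * (b - a)) * gap c ga ga' a"
proof -
 define d where "d = exp (L * (b - a)) * gap c ga ga' a"
 define G where "G = {t. ga t \<in> fst c \<and> ga' t \<in> fst c \<and> gap c ga ga' t < e / 2}"
 have zK: "zc c ga t \<in> cball z0 e" if "a \<le> t" "t \<le> b" for t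
  using in_c[OF that] assms(3) by (simp add: dist_commute)
 have near: "zc c ga' t \<in> cball z0 e" if "a \<le> t" "t \<le> b" "gap c ga ga' t < e / 2" for t
  using in_c[OF that(1,2)] that(3) dist_triangle[of "zc c ga' t" z0 "zc c ga t"] by (simp add: dist_commute)
 have bound: "gap c ga ga' s \<le> d" if s: "a \<le> s" "s \<le> b" "\<And>t. a \<le> t ==> t \<le> s ==> t \<in> G" for s
 proof -
  have "gap c ga ga' s \<le> exp (L * (s - a)) * gap c ga ga' a"
  proof (rule gronwall[OF s(1)])
   show "(zc c ga has_vector_derivative spray c (zc c ga t)) (at t) \<and> zc c ga t \<in> cball z0 e" if "a \<le> t" "t \<le> s" for t
    using zc_derivative[OF ga c] in_c zK that s(2) by simp
   show "(zc c ga' has_vector_derivative spray c (zc c ga' t)) (at t) \<and> zc c ga' t \<in> cball z0 e" if "a \<le> t" "t \<le> s" for t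
    using zc_derivative[OF ga' c, of t] s(3)[OF that] near[of t] that s(2) by (simp add: G_def)
  qed (rule L)
  also have "\<dots> \<le> d"
   unfolding d_def using s(2) assms(4) by (intro mult_right_mono) (auto intro!: mult_left_mono)
  finally show ?thesis .
 qed
 let ?S = "{t. ga t \<in> fst c \<and> ga' t \<in> fst c}"
 have S: "open ?S" using open_Int[OF geodesic_open_dom[OF ga c] geodesic_open_dom[OF ga' c]] by (simp add: Int_def)
 have "continuous_on ?S (gap c ga ga')"
  by (intro continuous_on_dist continuous_at_imp_continuous_on) (use zc_isCont ga ga' c in simp_all)
 from continuous_open_preimage[OF this S, of "{..<e/2}"]
 have "open G" by (simp add: G_def vimage_def Int_def conj_assoc)
 have "1 * gap c ga ga' a \<le> d" unfolding d_def using ab assms(4) by (intro mult_right_mono) auto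
 hence aG: "a \<in> G" using start in_c[of a] ab by (simp add: G_def d_def)
 have allG: "t \<in> G" if "a \<le> t" "t \<le> b" for t
 proof (rule ccontr)
  assume "t \<notin> G"
  hence ne: "{a..b} - G \<noteq> {}" using that by auto
  have "compact ({a..b} - G)" using \<open>open G\<close> by (simp add: compact_diff)
  then obtain u where u: "u \<in> {a..b} - G" "\<And>t. t \<in> {a..b} - G ==> u \<le> t"
   using compact_attains_inf[OF _ ne] by blast
  have au: "a < u" using aG u(1) by (cases "a = u") auto
  have before: "s \<in> G" if "a \<le> s" "s < u" for s using u that by fastforce
  have ev: "\<forall>\<^sub>F s in at_left u. a \<le> s \<and> s < u"
   using eventually_at_left_real[OF au] by (rule eventually_mono) auto
  have ntb: "at_left u \<noteq> bot" by simp
  \<comment> \<open>A compact part of the chart domain in which \<open>ga'\<close> stays before time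
    \<open>u\<close>; its closedness keeps \<open>ga' u\<close> inside the chart.\<close>
  define Q where "Q = chart_inv c ` fst ` cball z0 e"
  have sub: "fst ` cball z0 e \<subseteq> Om c" using ball by auto
  have "compact Q"
   unfolding Q_def using continuous_on_subset[OF continuous_chart_inv[OF c] sub]
   by (intro compact_continuous_image continuous_on_fst continuous_on_id) auto
  hence "closed Q" by (rule compact_imp_closed)
  moreover have "(ga' \<longlongrightarrow> ga' u) (at_left u)"
   using geodesic_continuous[OF ga'] by (metis continuous_on_def UNIV_I tendsto_within_subset subset_UNIV)
  moreover have "\<forall>\<^sub>F s in at_left u. ga' s \<in> Q"
   using ev
  proof (rule eventually_mono)
   fix s assume s: "a \<le> s \<and> s < u"
   hence 1: "ga' s \<in> fst c" "gap c ga ga' s < e / 2" using before[of s] by (auto simp: G_def)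
   hence "zc c ga' s \<in> cball z0 e" using near[of s] s u(1) by simp
   from imageI[OF imageI[OF this, of fst], of "chart_inv c"]
   show "ga' s \<in> Q" by (simp add: Q_def zc_def chart_inv_chart[OF c 1(1)])
  qed
  ultimately have "ga' u \<in> Q" using Lim_in_closed_set[OF _ _ ntb] by blast
  then obtain x where x: "x \<in> fst ` cball z0 e" "ga' u = chart_inv c x" unfolding Q_def by (rule imageE) (rule that)
  have uc: "ga' u \<in> fst c" unfolding x(2) by (rule chart_inv_in[OF c subsetD[OF sub x(1)]])
  have "isCont (gap c ga ga') u"
   using in_c[of u] u(1) by (intro continuous_dist zc_isCont[OF ga' c uc] zc_isCont[OF ga c]) simp
  hence "(gap c ga ga' \<longlongrightarrow> gap c ga ga' u) (at_left u)"
   unfolding isCont_def by (rule tendsto_within_subset) simp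
  hence "gap c ga ga' u \<le> d"
  proof (rule tendsto_upperbound[OF _ _ ntb])
   show "\<forall>\<^sub>F s in at_left u. gap c ga ga' s \<le> d"
    using ev by (rule eventually_mono) (use bound before u(1) in simp)
  qed
  hence "u \<in> G" using uc in_c[of u] u(1) start(2) by (simp add: G_def d_def)
  thus False using u(1) by simp
 qed
 thus ?thesis using bound[of b] allG[of b] ab by (simp add: G_def d_def)
qed

lemma zc_reverse:
 assumes "geod ga"
 shows "zc c (\<lambda>t. ga (- t)) t = (fst (zc c ga (- t)), - snd (zc c ga (- t)))"
 using geodesic_affine(2)[OF assms, of "-1" 0] by (simp add: zc_def)

text \<open>Local control with constants that do not depend on the competing geodesic
  \<open>ga'\<close>. The forward estimate is \<open>geodesic_trap\<close>; times before
  \<open>s\<close> are reached by applying it to the reversed geodesics.\<close>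

lemma geodesic_local:
 assumes ga: "geod ga"
 shows "\<exists>c\<in>A. \<exists>d>0. \<exists>h>0. \<exists>C. (\<forall>t. \<bar>t - t0\<bar> \<le> d \<longrightarrow> ga t \<in> fst c) \<and>
  (\<forall>ga' s t. geod ga' \<longrightarrow> \<bar>s - t0\<bar> \<le> d \<longrightarrow> \<bar>t - t0\<bar> \<le> d \<longrightarrow> ga' s \<in> fst c \<longrightarrow>
   gap c ga ga' s < h \<longrightarrow> ga' t \<in> fst c \<and> gap c ga ga' t \<le> C * gap c ga ga' s)"
proof -
 have fwd: "\<exists>d>0. \<exists>h>0. \<exists>C. (\<forall>t. \<bar>t - t0\<bar> \<le> d \<longrightarrow> ga t \<in> fst c) \<and>
  (\<forall>ga' s t. geod ga' \<longrightarrow> \<bar>s - t0\<bar> \<le> d \<longrightarrow> \<bar>t - t0\<bar> \<le> d \<longrightarrow> s \<le> t \<longrightarrow> ga' s \<in> fst c \<longrightarrow>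
   gap c ga ga' s < h \<longrightarrow> ga' t \<in> fst c \<and> gap c ga ga' t \<le> C * gap c ga ga' s)"
  if ga: "geod ga" and c: "c \<in> A" "ga t0 \<in> fst c" for ga c t0
 proof -
  define z0 where "z0 = zc c ga t0"
  have "z0 \<in> Om c \<times> UNIV" using c by (simp add: z0_def zc_def)
  then obtain e where e: "e > 0" "cball z0 e \<subseteq> Om c \<times> UNIV"
   using open_Times[OF open_Om[OF c(1)] open_UNIV] open_contains_cball by blast
  obtain L where L: "L \<ge> 0" "\<And>x y. x \<in> cball z0 e ==> y \<in> cball z0 e ==> norm (spray c x - spray c y) \<le> L * norm (x - y)"
   by (rule smooth_on_lipschitz[OF smooth_spray[OF c(1)] compact_cball convex_cball e(2)]) (rule that)
  have "isCont (zc c ga) t0" by (rule zc_isCont[OF ga c])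
  then obtain d1 where d1: "d1 > 0" "\<And>t. dist t t0 < d1 ==> dist (zc c ga t) z0 < e / 2"
   unfolding continuous_at_eps_delta z0_def using e(1) by (metis half_gt_zero)
  obtain d2 where d2: "d2 > 0" "\<And>t. dist t t0 < d2 ==> ga t \<in> fst c"
   using geodesic_open_dom[OF ga c(1)] c(2) unfolding open_dist by auto
  define d where "d = min d1 d2 / 2"
  \<comment> \<open>Two times in the window of radius \<open>d\<close> differ by at most
    \<open>2 * d\<close>.\<close>
  define C where "C = exp (L * (2 * d))"
  have pos: "d > 0" "C > 0" using d1 d2 by (simp_all add: d_def C_def)
  have in_c: "ga t \<in> fst c \<and> dist (zc c ga t) z0 \<le> e / 2" if "\<bar>t - t0\<bar> \<le> d" for t
  proof -
   have "dist t t0 < d1" "dist t t0 < d2" using that d1(1) d2(1) by (auto simp: d_def dist_real_def)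
   from d1(2)[OF this(1)] d2(2)[OF this(2)] show ?thesis by simp
  qed
  have "ga' t \<in> fst c \<and> gap c ga ga' t \<le> C * gap c ga ga' s"
   if ga': "geod ga'" and st: "\<bar>s - t0\<bar> \<le> d" "\<bar>t - t0\<bar> \<le> d" "s \<le> t" and s: "ga' s \<in> fst c"
    "gap c ga ga' s < e / (2 * C)" for ga' s t
  proof -
   have eC: "exp (L * (t - s)) * gap c ga ga' s \<le> C * gap c ga ga' s"
    unfolding C_def using st L(1) by (intro mult_right_mono) (auto intro!: mult_left_mono)
   moreover have "C * gap c ga ga' s < e / 2" using s(2) pos(2) by (simp add: field_simps)
   ultimately have small: "exp (L * (t - s)) * gap c ga ga' s < e / 2" by linarith
   have "ga' t \<in> fst c \<and> gap c ga ga' t \<le> exp (L * (t - s)) * gap c ga ga' s"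
    by (rule geodesic_trap[OF c(1) e(2,1) L ga ga' st(3) in_c s(1) small]) (use st in \<open>auto simp: abs_le_iff\<close>)
   thus ?thesis using eC by simp
  qed
  moreover have "e / (2 * C) > 0" using e pos by simp
  ultimately show ?thesis using pos(1) in_c by blast
 qed
 obtain c where c: "c \<in> A" "ga t0 \<in> fst c" using chart_exists by blast
 let ?r = "\<lambda>ga t. ga (- t)"
 have rev: "geod (?r ga)" if "geod ga" for ga using geodesic_affine(1)[OF that, of "-1" 0] by simp
 have gap_rev: "gap c (?r ga) (?r ga') t = gap c ga ga' (- t)" if "geod ga'" for ga' t
  unfolding zc_reverse[OF ga] zc_reverse[OF that] by (simp add: dist_prod_def dist_minus)
 obtain d h C where F: "d > 0" "h > 0" "\<forall>t. \<bar>t - t0\<bar> \<le> d \<longrightarrow> ga t \<in> fst c"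
  "\<And>ga' s t. geod ga' ==> \<bar>s - t0\<bar> \<le> d ==> \<bar>t - t0\<bar> \<le> d ==> s \<le> t ==> ga' s \<in> fst c ==>
   gap c ga ga' s < h ==> ga' t \<in> fst c \<and> gap c ga ga' t \<le> C * gap c ga ga' s"
  using fwd[OF ga c] by blast
 have "?r ga (- t0) \<in> fst c" using c by simp
 then obtain d' h' C' where R: "d' > 0" "h' > 0"
  "\<And>ga' s t. geod ga' ==> \<bar>s - - t0\<bar> \<le> d' ==> \<bar>t - - t0\<bar> \<le> d' ==> s \<le> t ==> ga' s \<in> fst c ==>
   gap c (?r ga) ga' s < h' ==> ga' t \<in> fst c \<and> gap c (?r ga) ga' t \<le> C' * gap c (?r ga) ga' s"
  using fwd[OF rev[OF ga] c(1), of "- t0"] by blast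
 have "ga' t \<in> fst c \<and> gap c ga ga' t \<le> max C C' * gap c ga ga' s"
  if ga': "geod ga'" and st: "\<bar>s - t0\<bar> \<le> min d d'" "\<bar>t - t0\<bar> \<le> min d d'" and s: "ga' s \<in> fst c" "gap c ga ga' s < min h h'" for ga' s t
 proof -
  have "ga' t \<in> fst c \<and> (gap c ga ga' t \<le> C * gap c ga ga' s \<or> gap c ga ga' t \<le> C' * gap c ga ga' s)"
  proof (cases "s \<le> t")
   case True
   thus ?thesis using F(4)[OF ga' _ _ True s(1)] st s(2) by simp
  next
   case False
   thus ?thesis using R(3)[OF rev[OF ga'], of "- s" "- t"] st s by (simp add: gap_rev[OF ga'] abs_minus_commute)
  qed
  moreover have "K * gap c ga ga' s \<le> max C C' * gap c ga ga' s" if "K \<le> max C C'" for K using that by (rule mult_right_mono) simp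
  ultimately show ?thesis by (meson max.cobounded1 max.cobounded2 order_trans)
 qed
 moreover have "min d d' > 0" "min h h' > 0" using F(1,2) R(1,2) by simp_all
 moreover have "\<forall>t. \<bar>t - t0\<bar> \<le> min d d' \<longrightarrow> ga t \<in> fst c" using F(3) by simp
 ultimately show ?thesis using c(1) by blast
qed

text \<open>Where position and velocity agree the gap is 0, and the linear bound of
  \<open>geodesic_local\<close> keeps it 0 nearby; agreement thus spreads along the whole
  line.\<close>

lemma geodesic_unique:
 assumes ga: "geod ga" and ga': "geod ga'" and "ga 0 = ga' 0" "vel ga 0 = vel ga' 0"
 shows "ga = ga'"
proof
 fix t
 define P where "P t \<longleftrightarrow> ga t = ga' t \<and> vel ga t = vel ga' t" for t
 have "P t"
 proof (rule local_imp_global_real)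
  show "P 0" using assms by (simp add: P_def)
  fix t0
  obtain c \<delta> \<eta> C where c: "c \<in> A" "\<delta> > 0" "\<eta> > 0" and in_c: "\<And>t. \<bar>t - t0\<bar> \<le> \<delta> ==> ga t \<in> fst c"
   and loc: "\<And>ga' s t. geod ga' ==> \<bar>s - t0\<bar> \<le> \<delta> ==> \<bar>t - t0\<bar> \<le> \<delta> ==> ga' s \<in> fst c ==>
   gap c ga ga' s < \<eta> ==>
   ga' t \<in> fst c \<and> gap c ga ga' t \<le> C * gap c ga ga' s"
   using geodesic_local[OF ga, of t0] by blast
  have "P s'" if s: "\<bar>s - t0\<bar> \<le> \<delta>" "\<bar>s' - t0\<bar> \<le> \<delta>" "P s" for s s'
  proof -
   have z: "gap c ga ga' s = 0" using s(3) by (simp add: P_def zc_def)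
   have "ga' s' \<in> fst c \<and> gap c ga ga' s' \<le> C * gap c ga ga' s"
    using in_c[OF s(1)] s(3) z c(3) by (intro loc[OF ga' s(1,2)]) (simp_all add: P_def)
   hence 1: "ga' s' \<in> fst c" "zc c ga' s' = zc c ga s'" using z by auto
   hence eq: "ga' s' = ga s'"
    using chart_inv_chart[OF c(1)] in_c[OF s(2)] unfolding zc_def by (metis prod.inject)
   have "vel ga s' \<in> TS (ga' s')"
    using geodesic_velocity_in[OF ga, of s'] unfolding eq .
   hence "vel ga s' = vel ga' s'"
    using tangent_vector_eqI[OF _ geodesic_velocity_in[OF ga'] c(1) 1(1)] 1(2) by (simp add: zc_def)
   thus ?thesis using eq by (simp add: P_def)
  qed
  thus "\<exists>\<delta>>0. \<forall>s s'. \<bar>s - t0\<bar> \<le> \<delta> \<longrightarrow> \<bar>s' - t0\<bar> \<le> \<delta> \<longrightarrow> P s \<longrightarrow> P s'" using c(2) by blast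
 qed
 thus "ga t = ga' t" by (simp add: P_def)
qed

section \<open>Continuous dependence of geodesics on their initial data\<close>

definition geo_conv :: "'i filter => ('i => real => 'a) => (real => 'a) => ('a, 'n) chart => real => bool" where
 "geo_conv F G ga c t \<longleftrightarrow> ga t \<in> fst c \<and> (\<forall>\<^sub>F i in F. G i t \<in> fst c) \<and> ((\<lambda>i. zc c (G i) t) \<longlongrightarrow> zc c ga t) F"

lemma geo_conv_point:
 assumes "geo_conv F G ga c t" "c \<in> A"
 shows "((\<lambda>i. G i t) \<longlongrightarrow> ga t) F"
proof -
 have x: "((\<lambda>i. snd c (G i t)) \<longlongrightarrow> snd c (ga t)) F"
  using assms(1) tendsto_fst[of "\<lambda>i. zc c (G i) t"] by (auto simp: geo_conv_def zc_def)
 have "isCont (chart_inv c) (snd c (ga t))"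
  using continuous_chart_inv[OF assms(2)] open_Om[OF assms(2)] assms(1)
  by (simp add: geo_conv_def continuous_on_eq_continuous_at)
 from isCont_tendsto_compose[OF this x]
 have "((\<lambda>i. chart_inv c (snd c (G i t))) \<longlongrightarrow> chart_inv c (snd c (ga t))) F" .
 thus ?thesis
 proof (rule Lim_transform_eventually[THEN tendsto_eq_rhs])
  have "\<forall>\<^sub>F i in F. G i t \<in> fst c" using assms(1) by (simp add: geo_conv_def)
  thus "\<forall>\<^sub>F i in F. chart_inv c (snd c (G i t)) = G i t"
   by (rule eventually_mono) (rule chart_inv_chart[OF assms(2)])
  show "chart_inv c (snd c (ga t)) = ga t" using assms by (simp add: geo_conv_def chart_inv_chart)
 qed
qed

lemma geo_conv_chart:
 assumes conv: "geo_conv F G ga c t" and c: "c \<in> A" and d: "d \<in> A" "ga t \<in> fst d"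
  and geo: "\<And>i. geod (G i)" "geod ga"
 shows "geo_conv F G ga d t"
proof -
 let ?T = "\<lambda>z. snd d (chart_inv c z)"
 have gac: "ga t \<in> fst c" and evc: "\<forall>\<^sub>F i in F. G i t \<in> fst c" using conv by (auto simp: geo_conv_def)
 have pt: "((\<lambda>i. G i t) \<longlongrightarrow> ga t) F" by (rule geo_conv_point[OF conv c])
 have evd: "\<forall>\<^sub>F i in F. G i t \<in> fst d" using topological_tendstoD[OF pt open_dom[OF d(1)] d(2)] .
 have x: "((\<lambda>i. snd c (G i t)) \<longlongrightarrow> snd c (ga t)) F" and v: "((\<lambda>i. vel (G i) t c) \<longlongrightarrow> vel ga t c) F"
  using conv tendsto_fst[of "\<lambda>i. zc c (G i) t"] tendsto_snd[of "\<lambda>i. zc c (G i) t"] by (auto simp: geo_conv_def zc_def)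
 have "((\<lambda>i. snd d (G i t)) \<longlongrightarrow> snd d (ga t)) F"
  using continuous_chart[OF d(1)] open_dom[OF d(1)] d(2) pt
  by (intro isCont_tendsto_compose[of _ "snd d"]) (auto simp: continuous_on_eq_continuous_at)
 moreover have "((\<lambda>i. vel (G i) t d) \<longlongrightarrow> vel ga t d) F"
 proof -
  have tr: "vel rh t d = (\<Sum>b\<in>Basis. (vel rh t c \<bullet> b) *R dd ?T (snd c (rh t)) b)"
   if "geod rh" "rh t \<in> fst c" "rh t \<in> fst d" for rh
   unfolding tangent_space_transition[OF geodesic_velocity_in[OF that(1)] c d(1) that(2,3)]
   using that by (intro dd_apply_sum[OF transition_smooth[OF c d(1)]]) (simp add: chart_inv_chart[OF c])
  have "isCont (\<lambda>x. dd ?T x b) (snd c (ga t))" for b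
  proof -
   have "continuous_on {x \<in> Om c. chart_inv c x \<in> fst d} (\<lambda>x. dd ?T x b)"
    by (rule smooth_on_continuous_on[OF smooth_on_dd[OF transition_smooth[OF c d(1)]]])
   moreover have "snd c (ga t) \<in> {x \<in> Om c. chart_inv c x \<in> fst d}" using gac d by (simp add: chart_inv_chart[OF c])
   ultimately show ?thesis
    using param_open_dom[OF open_Om[OF c] continuous_chart_inv[OF c] d(1)] continuous_on_eq_continuous_at by blast
  qed
  hence "((\<lambda>i. \<Sum>b\<in>Basis. (vel (G i) t c \<bullet> b) *R dd ?T (snd c (G i t)) b) \<longlongrightarrow>
    (\<Sum>b\<in>Basis. (vel ga t c \<bullet> b) *R dd ?T (snd c (ga t)) b)) F"
   by (intro tendsto_sum tendsto_scaleR tendsto_inner tendsto_const v isCont_tendsto_compose[OF _ x])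
  thus ?thesis
  proof (rule Lim_transform_eventually[THEN tendsto_eq_rhs])
   show "(\<Sum>b\<in>Basis. (vel ga t c \<bullet> b) *R dd ?T (snd c (ga t)) b) = vel ga t d"
    using tr[OF geo(2) gac d(2)] by simp
   show "\<forall>\<^sub>F i in F. (\<Sum>b\<in>Basis. (vel (G i) t c \<bullet> b) *R dd ?T (snd c (G i t)) b) = vel (G i) t d"
    using evc evd by eventually_elim (simp add: tr[OF geo(1)])
  qed
 qed
 ultimately show ?thesis using evd d by (simp add: geo_conv_def zc_def tendsto_Pair)
qed

text \<open>One chart need not contain the whole geodesic, so the property propagated is convergence
  in some chart. \<open>geo_conv_chart\<close> switches to the chart provided by
  \<open>geodesic_local\<close>, whose linear bound forces the gap to 0 at neighbouring
  times.\<close>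

lemma geo_conv_propagate:
 assumes geo: "\<And>i. geod (G i)" "geod ga" and "c0 \<in> A" "geo_conv F G ga c0 0"
 shows "\<exists>c\<in>A. geo_conv F G ga c t"
proof (rule local_imp_global_real[where P = "\<lambda>t. \<exists>c\<in>A. geo_conv F G ga c t" and a = 0])
 show "\<exists>c\<in>A. geo_conv F G ga c 0" using assms by blast
 fix t0
 obtain c \<delta> \<eta> C where c: "c \<in> A" "\<delta> > 0" "\<eta> > 0" and in_c: "\<And>t. \<bar>t - t0\<bar> \<le> \<delta> ==> ga t \<in> fst c"
  and loc: "\<And>ga' s t. geod ga' ==> \<bar>s - t0\<bar> \<le> \<delta> ==> \<bar>t - t0\<bar> \<le> \<delta> ==> ga' s \<in> fst c ==>
  gap c ga ga' s < \<eta> ==>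
  ga' t \<in> fst c \<and> gap c ga ga' t \<le> C * gap c ga ga' s"
  using geodesic_local[OF geo(2), of t0] by blast
 have "geo_conv F G ga c s'" if s: "\<bar>s - t0\<bar> \<le> \<delta>" "\<bar>s' - t0\<bar> \<le> \<delta>" "d \<in> A" "geo_conv F G ga d s" for s s' d
 proof -
  have cs: "geo_conv F G ga c s" by (rule geo_conv_chart[OF s(4,3) c(1) in_c[OF s(1)] geo])
  hence "((\<lambda>i. zc c (G i) s) \<longlongrightarrow> zc c ga s) F" by (simp add: geo_conv_def)
  hence ds: "((\<lambda>i. gap c ga (G i) s) \<longlongrightarrow> 0) F"
   by (rule tendsto_dist_iff[THEN iffD1])
  have ev: "\<forall>\<^sub>F i in F. G i s' \<in> fst c \<and> gap c ga (G i) s' \<le> C * gap c ga (G i) s"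
  proof -
   have "\<forall>\<^sub>F i in F. gap c ga (G i) s < \<eta>" using order_tendstoD(2)[OF ds c(3)] .
   moreover have "\<forall>\<^sub>F i in F. G i s \<in> fst c" using cs by (simp add: geo_conv_def)
   ultimately show ?thesis by eventually_elim (rule loc[OF geo(1) s(1,2)])
  qed
  have "((\<lambda>i. gap c ga (G i) s') \<longlongrightarrow> 0) F"
  proof (rule tendsto_sandwich[where f = "\<lambda>_. 0" and h = "\<lambda>i. C * gap c ga (G i) s"])
   show "((\<lambda>i. C * gap c ga (G i) s) \<longlongrightarrow> 0) F" using tendsto_mult_right_zero[OF ds] by simp
   show "\<forall>\<^sub>F i in F. gap c ga (G i) s' \<le> C * gap c ga (G i) s"
    using ev by (rule eventually_mono) simp
  qed auto
  hence "((\<lambda>i. zc c (G i) s') \<longlongrightarrow> zc c ga s') F" by (rule tendsto_dist_iff[THEN iffD2])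
  moreover have "\<forall>\<^sub>F i in F. G i s' \<in> fst c" using ev by (rule eventually_mono) simp
  ultimately show ?thesis using in_c[OF s(2)] by (simp add: geo_conv_def)
 qed
 thus "\<exists>\<delta>>0. \<forall>s s'. \<bar>s - t0\<bar> \<le> \<delta> \<longrightarrow> \<bar>s' - t0\<bar> \<le> \<delta> \<longrightarrow> (\<exists>c\<in>A. geo_conv F G ga c s) \<longrightarrow> (\<exists>c\<in>A. geo_conv F G ga c s')"
  using c(1,2) by blast
qed

end

locale complete_manifold = riemannian_manifold A g
 for A :: "('a::{t2_space,second_countable_topology}, 'n::finite) chart set" and g :: "('a, 'n) metric_tensor" +
 assumes complete: "geodesically_complete A g"
begin

definition geo :: "'a => ('a, 'n) tangent_vector => real => 'a" where
 "geo p v = (THE ga. geod ga \<and> ga 0 = p \<and> vel ga 0 = v)"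

lemma
 assumes "v \<in> TS p"
 shows geodesic_geo: "geod (geo p v)" and geo_0: "geo p v 0 = p" and velocity_geo_0: "vel (geo p v) 0 = v"
proof -
 obtain ga where ga: "geod ga \<and> ga 0 = p \<and> vel ga 0 = v"
  using complete assms unfolding geodesically_complete_def by blast
 have "geod (geo p v) \<and> geo p v 0 = p \<and> vel (geo p v) 0 = v"
  unfolding geo_def
  by (rule theI[where P = "\<lambda>ga. geod ga \<and> ga 0 = p \<and> vel ga 0 = v", OF ga])
   (rule geodesic_unique, use ga in simp_all)
 thus "geod (geo p v)" "geo p v 0 = p" "vel (geo p v) 0 = v" by auto
qed

lemma exp_map_eq_geo: "expm p v = geo p v 1"
 by (simp add: exp_map_def geo_def)

lemma geo_eqI:
 assumes "geod ga" "ga 0 = p" "vel ga 0 = v"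
 shows "geo p v = ga"
 unfolding geo_def by (rule the_equality) (use assms in simp, rule geodesic_unique, use assms in simp_all)

text \<open>An affine reparametrisation of a geodesic is again a geodesic. Negative \<open>a\<close>
  retraces it, which is how reversal enters later.\<close>

lemma exp_map_geodesic:
 assumes "geod ga"
 shows "expm (ga b) (\<lambda>c. a *R vel ga b c) = ga (a + b)"
proof -
 have "geo (ga b) (\<lambda>c. a *R vel ga b c) = (\<lambda>t. ga (a * t + b))"
  by (rule geo_eqI) (auto simp: geodesic_affine[OF assms])
 thus ?thesis by (simp add: exp_map_eq_geo)
qed

lemma exp_map_scale:
 assumes "v \<in> TS p"
 shows "expm p (\<lambda>c. t *R v c) = geo p v t"
 using exp_map_geodesic[OF geodesic_geo[OF assms], of 0 t] by (simp add: geo_0[OF assms] velocity_geo_0[OF assms])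

text \<open>Joint continuity in base point and vector is the regularity on which all measurability
  on the tangent bundle is built.\<close>

lemma continuous_exp_map:
 assumes c: "c \<in> A"
 shows "continuous_on (Om c \<times> UNIV) (\<lambda>(x, u). expm (chart_inv c x) (cvec c x u))"
proof -
 define \<Gamma> where "\<Gamma> z = geo (chart_inv c (fst z)) (cvec c (fst z) (snd z))" for z
 have T: "cvec c (fst z) (snd z) \<in> TS (chart_inv c (fst z))" if "z \<in> Om c \<times> UNIV" for z
  using coord_vector_in[OF c] that by auto
 have start: "zc c (\<Gamma> z) 0 = z" "\<Gamma> z 0 \<in> fst c" "geod (\<Gamma> z)" if "z \<in> Om c \<times> UNIV" for z
  unfolding zc_def \<Gamma>_def geo_0[OF T[OF that]] velocity_geo_0[OF T[OF that]]
  using that coord_vector_apply[OF c, of "fst z"] chart_chart_inv[OF c, of "fst z"] chart_inv_in[OF c, of "fst z"]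
   geodesic_geo[OF T[OF that]] by (auto simp: mem_Times_iff)
 have "continuous_on (Om c \<times> UNIV) (\<lambda>z. \<Gamma> z 1)"
  unfolding continuous_on_def
 proof
  fix z :: "(real^'n) \<times> (real^'n)" assume z: "z \<in> Om c \<times> UNIV"
  \<comment> \<open>\<open>geo_conv_propagate\<close> wants a geodesic for every index; outside the
    domain the limit geodesic itself fills in.\<close>
  define G where "G y = (if y \<in> Om c \<times> UNIV then \<Gamma> y else \<Gamma> z)" for y
  have G: "geod (G y)" for y using start(3) z by (simp add: G_def)
  let ?F = "at z within Om c \<times> UNIV"
  have "geo_conv ?F G (\<Gamma> z) c 0"
  proof -
   have ev: "\<forall>\<^sub>F y in ?F. y \<in> Om c \<times> UNIV" by (simp add: eventually_at_filter)
   have "((\<lambda>y. zc c (G y) 0) \<longlongrightarrow> z) ?F"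
    by (rule Lim_transform_eventually[OF tendsto_ident_at])
     (use ev in \<open>eventually_elim, simp add: G_def start(1)\<close>)
   moreover have "\<forall>\<^sub>F y in ?F. G y 0 \<in> fst c"
    using ev by eventually_elim (simp only: G_def if_True start(2))
   ultimately show ?thesis using start(1,2)[OF z] by (simp add: geo_conv_def)
  qed
  from geo_conv_propagate[OF G start(3)[OF z] c this, of 1]
  obtain d where d: "d \<in> A" "geo_conv ?F G (\<Gamma> z) d 1" by blast
  have "((\<lambda>y. G y 1) \<longlongrightarrow> \<Gamma> z 1) ?F" by (rule geo_conv_point[OF d(2,1)])
  thus "((\<lambda>z. \<Gamma> z 1) \<longlongrightarrow> \<Gamma> z 1) ?F"
   by (rule Lim_transform_eventually) (simp add: eventually_at_filter G_def)
 qed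
 thus ?thesis by (simp add: \<Gamma>_def exp_map_eq_geo case_prod_beta)
qed

end

section \<open>Exponential coordinates and the mean curvature of geodesic spheres\<close>

context riemannian_manifold
begin

lemma frame_exists:
 "\<exists>L. (\<forall>x. L x \<in> TS p) \<and> (\<forall>c. linear (\<lambda>x. L x c)) \<and> (\<forall>x y. g p (L x) (L y) = (x :: real^'n) \<bullet> y)"
proof -
 obtain c where c: "c \<in> A" "p \<in> fst c" using chart_exists by blast
 have x: "snd c p \<in> Om c" using c(2) by simp
 have P: "posdef (gmat c (snd c p))" using metric_on_chart[OF c(1)] x unfolding metric_on_def by blast
 obtain M :: "real^'n^'n" where M: "transpose M ** gmat c (snd c p) ** M = mat 1"
  using posdef_diagonalize[OF P] .
 define L where "L x = cvec c (snd c p) (M *v x)" for x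
 have "L x \<in> TS p" for x
  unfolding L_def using coord_vector_in[OF c(1) x] chart_inv_chart[OF c] by simp
 moreover have "linear (\<lambda>x. L x d)" for d
  unfolding L_def
  using linear_compose[OF matrix_vector_mul_linear[of M] coord_vector_linear[OF c(1) x, of d]] by (simp add: o_def)
 moreover have "g p (L x) (L y) = x \<bullet> y" for x y
 proof -
  have "g p (L x) (L y) = form (gmat c (snd c p)) (M *v x) (M *v y)"
   unfolding L_def using metric_matrix_form[OF c(1) x] chart_inv_chart[OF c] by simp
  also have "\<dots> = form (transpose M) x (gmat c (snd c p) *v (M *v y))"
   by (metis dot_lmul_matrix inner_commute transpose_matrix_vector)
  also have "\<dots> = form (transpose M ** gmat c (snd c p) ** M) x y"
   by (simp only: matrix_vector_mul_assoc matrix_mul_assoc)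
  finally show ?thesis by (simp add: M)
 qed
 ultimately show ?thesis by blast
qed

lemma
 shows frame_in: "frm p x \<in> TS p"
  and frame_linear: "linear (\<lambda>x. frm p x c)"
  and frame_isometry: "g p (frm p x) (frm p y) = x \<bullet> y"
 using someI_ex[OF frame_exists[of p]] unfolding frame_def[symmetric] by blast+

lemma frame_inj: "frm p x = frm p y \<longleftrightarrow> x = y"
proof
 assume "frm p x = frm p y"
 hence "z \<bullet> x = z \<bullet> y" for z using frame_isometry[of p z x] frame_isometry[of p z y] by simp
 thus "x = y" by (metis inner_commute vector_eq_rdot)
qed simp

lemma linear_into_tangent_surj:
 assumes L: "\<And>x. L x \<in> TS p" "\<And>c. linear (\<lambda>x. L x c)" "inj (L :: real^'n => _)"
  and v: "v \<in> TS p"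
 shows "\<exists>x. L x = v"
proof -
 obtain c where c: "c \<in> A" "p \<in> fst c" using chart_exists by blast
 have "inj (\<lambda>x. L x c)"
  using tangent_vector_eqI[OF L(1) L(1) c] L(3) by (simp add: inj_def)
 hence "surj (\<lambda>x. L x c)" using linear_injective_imp_surjective[OF L(2)] by blast
 then obtain x where "v c = L x c" by (rule surjE)
 thus ?thesis using tangent_vector_eqI[OF L(1) v c] by metis
qed

lemma frame_surj: "v \<in> TS p ==> \<exists>x. frm p x = v"
 by (rule linear_into_tangent_surj[OF frame_in frame_linear]) (simp add: frame_inj inj_def)

lemma inv_frame: "inv (frm p) (frm p x) = x"
 by (rule inv_f_f) (simp add: frame_inj inj_def)

lemma tangent_scale_linear:
 assumes "\<And>c. linear (\<lambda>x. L x c)"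
 shows "L (t *R x) = (\<lambda>c. t *R (L x :: ('a, 'n) tangent_vector) c)"
 using linear_scale[OF assms] by blast

end

context complete_manifold
begin

abbreviation Ex :: "'a => real^'n => 'a" where
 "Ex p \<equiv> \<lambda>x. expm p (frm p x)"

lemma exp_ray:
 assumes "\<And>x. L x \<in> TS p" "\<And>c. linear (\<lambda>x. L x c)"
 shows "expm p (L (t *R x)) = geo p (L x) t"
 unfolding tangent_scale_linear[OF assms(2)] by (rule exp_map_scale[OF assms(1)])

lemma velocity_exp_ray:
 assumes L: "\<And>x. L x \<in> TS p" "\<And>c. linear (\<lambda>x. L x c)"
  and U: "param U (\<lambda>x. expm p (L x))" "t *R x \<in> U"
 shows "vel (geo p (L x)) t = Tmap (\<lambda>x. expm p (L x)) (t *R x) x"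
proof -
 let ?E = "\<lambda>x. expm p (L x)"
 have E: "?E (s *R x) = geo p (L x) s" for s by (rule exp_ray[OF L])
 obtain c where c: "c \<in> A" "?E (t *R x) \<in> fst c" using chart_exists by blast
 have c': "geo p (L x) t \<in> fst c" using c(2) unfolding E .
 have in_U: "t *R x \<in> {x \<in> U. ?E x \<in> fst c}" using U(2) c(2) by simp
 have "((\<lambda>s. snd c (?E (s *R x))) has_vector_derivative dd (\<lambda>y. snd c (?E y)) (t *R x) x) (at t)"
  by (rule ray_has_vector_derivative[OF param_smooth(2)[OF U(1) c(1)] in_U])
 hence "((\<lambda>s. snd c (geo p (L x) s)) has_vector_derivative dd (\<lambda>y. snd c (?E y)) (t *R x) x) (at t)"
  unfolding E .
 hence "vel (geo p (L x)) t c = dd (\<lambda>y. snd c (?E y)) (t *R x) x"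
  using geodesic_differentiable(1)[OF geodesic_geo[OF L(1)] c(1) c'] vector_derivative_unique_at by blast
 moreover have "Tmap ?E (t *R x) x c = dd (\<lambda>y. snd c (?E y)) (t *R x) x"
  by (rule tangent_map_apply[of c ?E "t *R x" x, OF c])
 moreover have "vel (geo p (L x)) t \<in> TS (?E (t *R x))"
  unfolding E by (rule geodesic_velocity_in[OF geodesic_geo[OF L(1)]])
 ultimately show ?thesis
  using tangent_vector_eqI[OF _ param_tangent_map_in[OF U] c] by simp
qed

text \<open>The geodesic equation in a chart at time 1, compared with the second derivative of the
  exponential map along the ray, says through \<open>chrv_transform\<close> that the differential
  sends \<open>chrv y y y\<close> to 0; and the differential is injective.\<close>

lemma normal_coords_exp:
 assumes L: "\<And>x. L x \<in> TS p" "\<And>c. linear (\<lambda>x. L x c)"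
  and U: "param U (\<lambda>x. expm p (L x))" "0 \<in> U" "\<And>x t. x \<in> U ==> 0 \<le> t ==> t \<le> 1 ==> t *R x \<in> U"
 shows "normal_coords U (pull_metric (\<lambda>x. expm p (L x)))"
proof
 let ?E = "\<lambda>x. expm p (L x)"
 show "metric_on U (pull_metric ?E)" by (rule pull_metric_on[OF U(1)])
 show "0 \<in> U" "\<And>x t. x \<in> U ==> 0 \<le> t ==> t \<le> 1 ==> t *R x \<in> U" using U by auto
 fix y assume y: "y \<in> U"
 define ga where "ga = geo p (L y)"
 have geo: "geod ga" unfolding ga_def by (rule geodesic_geo[OF L(1)])
 have E: "?E (s *R y) = ga s" for s unfolding ga_def by (rule exp_ray[OF L])
 obtain c where c: "c \<in> A" "?E y \<in> fst c" using chart_exists by blast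
 define W where "W = {x \<in> U. ?E x \<in> fst c}"
 define ph where "ph x = snd c (?E x)" for x
 interpret metric_pullback W "Om c" "pull_metric ?E" "gmat c" ph
  unfolding W_def ph_def[abs_def] by (rule param_pullback[OF U(1) c(1)])
 have yW: "y \<in> W" using y c by (simp add: W_def)
 have "(1::real) *R y \<in> W" using yW by simp
 have "open ((\<lambda>s. s *R y) -` W)"
  by (rule open_vimage[OF open_U]) (auto intro!: continuous_intros)
 hence oS: "open {s. s *R y \<in> W}" by (simp add: vimage_def)
 have gac: "ga s \<in> fst c" if "s *R y \<in> W" for s using that E[of s] by (simp add: W_def)
 have vel: "vel ga s c = dd ph (s *R y) y" if "s *R y \<in> W" for s
 proof -
  have "vel ga s = Tmap ?E (s *R y) y"
   unfolding ga_def using that by (intro velocity_exp_ray[OF L U(1)]) (simp add: W_def)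
  moreover have "?E (s *R y) \<in> fst c" using that by (simp add: W_def)
  ultimately show ?thesis using tangent_map_apply[of c ?E "s *R y" y, OF c(1)] by (simp add: ph_def[abs_def])
 qed
 have 1: "((\<lambda>s. vel ga s c) has_vector_derivative
   - chrv (gmat c) (snd c (ga 1)) (vel ga 1 c) (vel ga 1 c)) (at 1)"
  using gac[of 1] yW by (intro geodesic_differentiable(2)[OF geo c(1)]) simp
 have "((\<lambda>s. dd ph (s *R y) y) has_vector_derivative dd (\<lambda>x. dd ph x y) (1 *R y) y) (at 1)"
  by (rule ray_has_vector_derivative[OF smooth_on_dd[OF smooth]]) (use yW in simp)
 hence "((\<lambda>s. vel ga s c) has_vector_derivative dd (\<lambda>x. dd ph x y) (1 *R y) y) (at 1)"
  by (rule has_vector_derivative_transform_within_open[OF _ oS]) (use yW vel in simp_all)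
 hence "dd (\<lambda>x. dd ph x y) y y = - chrv (gmat c) (ph y) (dd ph y y) (dd ph y y)"
  using vector_derivative_unique_at[OF 1] vel[of 1] yW E[of 1] by (simp add: ph_def)
 hence "dd ph y (chrv (pull_metric ?E) y y y) = 0" using chrv_transform[OF yW, of y y] by simp
 thus "chrv (pull_metric ?E) y y y = 0" by (rule inj_D[OF yW])
qed

lemma exp_pull_metric_0:
 assumes L: "\<And>x. L x \<in> TS p" "\<And>c. linear (\<lambda>x. L x c)"
  and U: "param U (\<lambda>x. expm p (L x))" "0 \<in> U"
 shows "expm p (L 0) = p" "form (pull_metric (\<lambda>x. expm p (L x)) 0) u w = g p (L u) (L w)"
  "Tmap (\<lambda>x. expm p (L x)) 0 u = L u"
proof -
 show 0: "expm p (L 0) = p" using exp_ray[OF L, of 0 0] geo_0[OF L(1)] by simp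
 show t: "Tmap (\<lambda>x. expm p (L x)) 0 u = L u" for u
  using velocity_exp_ray[OF L U(1), of 0 u] U(2) velocity_geo_0[OF L(1)] by simp
 show "form (pull_metric (\<lambda>x. expm p (L x)) 0) u w = g p (L u) (L w)"
  using pull_metric_tangent[OF U, of u w] by (simp add: t 0)
qed

text \<open>That the exponential map is an immersion comes from its smooth inverse: by the chain
  rule the differential has a left inverse.\<close>

lemma exp_diffeo_param:
 assumes "diffeo p rh"
 shows "param (ball 0 rh) (Ex p)" "inj_on (Ex p) (ball 0 rh)" "open (Ex p ` ball 0 rh)"
  "\<And>c. c \<in> A ==> smooth_on (snd c ` (fst c \<inter> Ex p ` ball 0 rh)) (\<lambda>z. inv_into (ball 0 rh) (Ex p) (chart_inv c z))"
proof -
 let ?B = "ball 0 rh :: (real^'n) set"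
 show inj: "inj_on (Ex p) ?B" and op: "open (Ex p ` ?B)"
  and inv: "\<And>c. c \<in> A ==> smooth_on (snd c ` (fst c \<inter> Ex p ` ?B)) (\<lambda>z. inv_into ?B (Ex p) (chart_inv c z))"
  using assms unfolding exp_diffeomorphism_def Let_def o_def by blast+
 have cont: "continuous_on ?B (Ex p)"
  and sm: "\<And>c. c \<in> A ==> smooth_on {x\<in>?B. Ex p x \<in> fst c} (\<lambda>x. snd c (Ex p x))"
  using assms unfolding exp_diffeomorphism_def Let_def o_def by blast+
 show "param ?B (Ex p)"
  unfolding param_def
 proof (intro conjI ballI impI)
  show "open ?B" by simp
  show "continuous_on ?B (Ex p)" by (rule cont)
  fix c assume c: "c \<in> A"
  show "smooth_on {x\<in>?B. Ex p x \<in> fst c} (\<lambda>x. snd c (Ex p x))" by (rule sm[OF c])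
  fix x assume x: "x \<in> ?B" "Ex p x \<in> fst c"
  define G where "G z = inv_into ?B (Ex p) (chart_inv c z)" for z
  define W where "W = {x\<in>?B. Ex p x \<in> fst c}"
  have W: "x \<in> W" "open W" using x param_open_dom[OF open_ball cont c] by (auto simp: W_def)
  have G: "G (snd c (Ex p y)) = y" if "y \<in> W" for y
   using that inv_into_f_f[OF inj] unfolding W_def G_def by (simp add: chart_inv_chart[OF c])
  have S: "snd c (Ex p x) \<in> snd c ` (fst c \<inter> Ex p ` ?B)" using x by blast
  have "dd (\<lambda>y. G (snd c (Ex p y))) x v = dd G (snd c (Ex p x)) (dd (\<lambda>y. snd c (Ex p y)) x v)" for v
   using inv[OF c] by (intro dd_compose[OF sm[OF c] _ _ S]) (use x in \<open>simp_all add: G_def[abs_def]\<close>)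
  moreover have "dd (\<lambda>y. G (snd c (Ex p y))) x v = v" for v
   using dd_cong_open[OF W(2,1), of "\<lambda>y. G (snd c (Ex p y))" "\<lambda>y. y"] G dd_eqI[OF has_derivative_ident[of "at x"]] by simp
  ultimately have "dd G (snd c (Ex p x)) (dd (\<lambda>y. snd c (Ex p y)) x v) = v" for v by simp
  thus "inj (dd (\<lambda>x. snd c (Ex p x)) x)" by (rule inj_on_inverseI)
 qed
qed

definition hE :: "'a => real^'n => real^'n^'n" where "hE p = pull_metric (Ex p)"

context
 fixes p :: 'a and rh :: real
 assumes diffeo: "diffeo p rh" and rh: "rh > 0"
begin

lemma normal_coords_hE: "normal_coords (ball 0 rh) (hE p)"
proof -
 have "t *R x \<in> ball 0 rh" if "x \<in> ball 0 rh" "0 \<le> t" "t \<le> 1" for x :: "real^'n" and t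
 proof -
  have "t * norm x \<le> norm x" using that mult_left_le_one_le[of "norm x" t] by simp
  thus ?thesis using that by simp
 qed
 thus ?thesis
  unfolding hE_def using normal_coords_exp[OF frame_in frame_linear exp_diffeo_param(1)[OF diffeo]] rh by simp
qed

interpretation nc: normal_coords "ball 0 rh" "hE p" by (rule normal_coords_hE)

lemma hE_0: "hE p 0 = mat 1"
proof -
 have 0: "0 \<in> ball (0::real^'n) rh" using rh by simp
 have "form (hE p 0) u w = u \<bullet> w" for u w
  using exp_pull_metric_0(2)[OF frame_in frame_linear exp_diffeo_param(1)[OF diffeo] 0, of u w] frame_isometry
  by (simp add: hE_def)
 hence "hE p 0 *v w = w" for w by (metis inner_commute vector_eq_rdot)
 thus ?thesis by (simp add: matrix_eq)
qed

lemma hE_gauss: "x \<in> ball 0 rh ==> hE p x *v x = x"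
 using nc.gauss hE_0 by simp

lemma hE_form:
 "x \<in> ball 0 rh ==> g (Ex p x) (Tmap (Ex p) x u) (Tmap (Ex p) x w) = form (hE p x) u w"
 unfolding hE_def by (rule pull_metric_tangent[OF exp_diffeo_param(1)[OF diffeo]])

lemma tangent_map_Ex_surj:
 assumes x: "x \<in> ball 0 rh" and v: "v \<in> TS (Ex p x)"
 shows "\<exists>u. Tmap (Ex p) x u = v"
proof -
 note param = exp_diffeo_param(1)[OF diffeo]
 obtain c where c: "c \<in> A" "Ex p x \<in> fst c" using chart_exists by blast
 have xW: "x \<in> {x\<in>ball 0 rh. Ex p x \<in> fst c}" using x c by simp
 interpret metric_pullback "{x\<in>ball 0 rh. Ex p x \<in> fst c}" "Om c" "pull_metric (Ex p)" "gmat c" "\<lambda>x. snd c (Ex p x)"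
  by (rule param_pullback[OF param c(1)])
 obtain u where "v c = dd (\<lambda>x. snd c (Ex p x)) x u" using surjE[OF surj_D[OF xW]] by metis
 hence "Tmap (Ex p) x u c = v c" using tangent_map_apply[of c "Ex p" x u, OF c] by simp
 thus ?thesis using tangent_vector_eqI[OF param_tangent_map_in[OF param x] v c] by blast
qed

lemma tangent_map_Ex_linear:
 assumes x: "x \<in> ball 0 rh"
 shows "linear (\<lambda>u. Tmap (Ex p) x u c)"
proof (cases "c \<in> A \<and> Ex p x \<in> fst c")
 case True
 hence "(\<lambda>u. Tmap (Ex p) x u c) = dd (\<lambda>y. snd c (Ex p y)) x"
  using tangent_map_apply[of c "Ex p" x] by (intro ext) simp
 thus ?thesis
  using smooth_on_linear_dd[OF param_smooth(2)[OF exp_diffeo_param(1)[OF diffeo], of c], of x] x True by simp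
next
 case False
 hence "(\<lambda>u. Tmap (Ex p) x u c) = (\<lambda>u. 0)"
  by (intro ext) (simp only: tangent_map_def False if_False)
 thus ?thesis by (simp add: linear_iff)
qed

section \<open>Geodesic spheres: tangent vectors, unit normal, shape operator, mean
  curvature\<close>

lemma radial_has_derivative:
 fixes y :: "real^'n"
 assumes "y \<noteq> 0"
 shows "((\<lambda>y. (r / norm y) *R y) has_derivative
  (\<lambda>w. (r / norm y) *R w - (r * (y \<bullet> w) / norm y ^ 3) *R y)) (at y)"
proof -
 have n: "norm y > 0" using assms by simp
 have "(norm has_derivative (\<lambda>w. w \<bullet> sgn y)) (at y)"
  by (rule has_derivative_norm[OF assms])
 thus ?thesis
  using n by (auto intro!: derivative_eq_intros simp: sgn_div_norm fun_eq_iff power3_eq_cube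
   divide_simps power2_eq_square algebra_simps inner_commute)
qed

context
 fixes r :: real
 assumes r: "0 < r" "r < rh"
begin

lemma sphere_in_ball: "(y :: real^'n) \<noteq> 0 ==> (r / norm y) *R y \<in> ball 0 rh"
 using r by simp

lemma tangent_map_sphere_param:
 assumes y: "y \<noteq> 0" and w: "w \<bullet> y = 0"
 shows "Tmap (geodesic_sphere_param A g p r) y w =
  Tmap (Ex p) ((r / norm y) *R y) ((r / norm y) *R w)"
proof
 fix c
 let ?z = "(r / norm y) *R y"
 have F: "geodesic_sphere_param A g p r = (\<lambda>y. Ex p ((r / norm y) *R y))"
  by (rule ext) (simp add: geodesic_sphere_param_def)
 show "Tmap (geodesic_sphere_param A g p r) y w c =
  Tmap (Ex p) ?z ((r / norm y) *R w) c"
 proof (cases "c \<in> A \<and> Ex p ?z \<in> fst c")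
  case True
  have z: "?z \<in> {x\<in>ball 0 rh. Ex p x \<in> fst c}" using sphere_in_ball[OF y] True by simp
  have "((\<lambda>x. snd c (Ex p x)) has_derivative dd (\<lambda>x. snd c (Ex p x)) ?z) (at ?z)"
   using smooth_on_has_derivative[OF param_smooth(2)[OF exp_diffeo_param(1)[OF diffeo]] z] True by simp
  from frechet_derivative_at[OF has_derivative_compose[OF radial_has_derivative[OF y, of r] this]]
  have "frechet_derivative (\<lambda>y. snd c (Ex p ((r / norm y) *R y))) (at y) w
    = dd (\<lambda>x. snd c (Ex p x)) ?z ((r / norm y) *R w)"
   using w by (metis (no_types, lifting) diff_zero div_0 inner_commute mult_zero_right scale_zero_left)
  thus ?thesis
   using tangent_map_apply[of c "geodesic_sphere_param A g p r" y w] tangent_map_apply[of c "Ex p" ?z] True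
   by (simp add: F)
 qed (auto simp: tangent_map_def F)
qed

text \<open>By the Gauss lemma the radial vector is orthogonal to the sphere and keeps its Euclidean
  length. The formula covers all \<open>y \<noteq> 0\<close> and not just unit vectors, since the
  shape operator differentiates the normal over a full neighbourhood.\<close>

lemma outer_normal:
 assumes y: "y \<noteq> 0"
 shows "outer_unit_normal A g p r y = Tmap (Ex p) ((r / norm y) *R y) ((1 / norm y) *R y)"
proof -
 define z where "z = (r / norm y) *R y"
 define \<nu> where "\<nu> = Tmap (Ex p) z ((1 / norm y) *R y)"
 have z: "z \<in> ball 0 rh" unfolding z_def by (rule sphere_in_ball[OF y])
 have ny: "norm y > 0" using y by simp
 have Fz: "geodesic_sphere_param A g p r y = Ex p z" by (simp add: geodesic_sphere_param_def z_def)
 have hy: "hE p z *v y = y"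
 proof -
  have "hE p z *v ((norm y / r) *R z) = (norm y / r) *R z"
   using hE_gauss[OF z] by (simp add: mv_scaleR)
  thus ?thesis using r ny by (simp add: z_def)
 qed
 have P: "posdef (hE p z)" by (rule nc.posdef_h[OF z])
 have vel: "vel (\<lambda>s. expm p (frm p (s *R y))) (r / norm y) = Tmap (Ex p) z y"
 proof -
  have "(\<lambda>s. expm p (frm p (s *R y))) = geo p (frm p y)"
   by (rule ext) (rule exp_ray[OF frame_in frame_linear])
  thus ?thesis
   using velocity_exp_ray[OF frame_in frame_linear exp_diffeo_param(1)[OF diffeo]] z by (simp add: z_def)
 qed
 have cond: "(Tmap (Ex p) z m \<in> TS (Ex p z) \<and>
   g (Ex p z) (Tmap (Ex p) z m) (Tmap (Ex p) z m) = 1 \<and>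
   (\<forall>w. w \<bullet> y = 0 \<longrightarrow> g (Ex p z) (Tmap (Ex p) z m) (Tmap (geodesic_sphere_param A g p r) y w) = 0) \<and>
   g (Ex p z) (Tmap (Ex p) z m) (vel (\<lambda>s. expm p (frm p (s *R y))) (r / norm y)) > 0)
  \<longleftrightarrow> m = (1 / norm y) *R y" (is "?C m \<longleftrightarrow> _") for m
 proof
  assume C: "?C m"
  have orth: "form (hE p z) m w = 0" if "w \<bullet> y = 0" for w
  proof -
   have "g (Ex p z) (Tmap (Ex p) z m) (Tmap (geodesic_sphere_param A g p r) y w) = 0"
    using C that by blast
   hence "g (Ex p z) (Tmap (Ex p) z m) (Tmap (Ex p) z ((r / norm y) *R w)) = 0"
    unfolding tangent_map_sphere_param[OF y that] z_def[symmetric] .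
   hence "(r / norm y) * (form (hE p z) m w) = 0"
    unfolding hE_form[OF z] by (simp add: form_scale)
   thus ?thesis using r ny by simp
  qed
  \<comment> \<open>Splitting off the Euclidean radial part leaves \<open>d\<close>, which is
    tangent to the sphere, hence orthogonal to \<open>m\<close> and to \<open>y\<close>, hence to
    itself.\<close>
  define a where "a = (m \<bullet> y) / (y \<bullet> y)"
  define d where "d = m - a *R y"
  have dy: "d \<bullet> y = 0" using y by (simp add: d_def a_def inner_diff_left)
  have "form (hE p z) d d = form (hE p z) m d - a * (form (hE p z) y d)"
   by (subst (1) d_def) (simp add: inner_diff_left)
  also have "form (hE p z) y d = d \<bullet> y" using posdef_sym[OF P, of y d] hy by simp
  finally have "form (hE p z) d d = 0" using orth[OF dy] dy by simp
  hence "d = 0" using posdef_eq_0_iff[OF P] by blast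
  hence m: "m = a *R y" by (simp add: d_def)
  have "a * a * (norm y)^2 = 1"
   using C unfolding hE_form[OF z] m by (simp add: form_scale hy dot_square_norm)
  hence a2: "(a * norm y)^2 = 1" by (simp add: power2_eq_square mult_ac)
  have "a * (norm y)^2 > 0"
   using C unfolding vel hE_form[OF z] m by (simp add: form_scale hy dot_square_norm)
  hence "a > 0" by (simp add: zero_less_mult_iff)
  hence "a * norm y > 0" using ny by simp
  hence "a * norm y = 1" using a2 by (auto simp: power2_eq_1_iff)
  hence "a = 1 / norm y" using ny by (simp add: field_simps)
  thus "m = (1 / norm y) *R y" using m by simp
 next
  assume m: "m = (1 / norm y) *R y"
  show "?C m"
  proof (intro conjI allI impI)
   show "Tmap (Ex p) z m \<in> TS (Ex p z)"
    by (rule param_tangent_map_in[OF exp_diffeo_param(1)[OF diffeo] z])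
   show "g (Ex p z) (Tmap (Ex p) z m) (Tmap (Ex p) z m) = 1"
    unfolding hE_form[OF z] m using ny by (simp add: form_scale hy dot_square_norm power2_eq_square)
   show "0 < g (Ex p z) (Tmap (Ex p) z m) (vel (\<lambda>s. expm p (frm p (s *R y))) (r / norm y))"
    unfolding vel hE_form[OF z] m using ny by (simp add: form_scale hy dot_square_norm)
   fix w assume w: "w \<bullet> y = 0"
   have "form (hE p z) y w = 0" using posdef_sym[OF P, of y w] hy w by simp
   thus "g (Ex p z) (Tmap (Ex p) z m) (Tmap (geodesic_sphere_param A g p r) y w) = 0"
    unfolding tangent_map_sphere_param[OF y w] z_def[symmetric] hE_form[OF z] m by (simp add: form_scale)
  qed
 qed
 show ?thesis
  unfolding outer_unit_normal_def Let_def Fz z_def[symmetric]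
 proof (rule the_equality)
  fix \<nu>
  assume "\<nu> \<in> TS (Ex p z) \<and> g (Ex p z) \<nu> \<nu> = 1 \<and>
   (\<forall>w. w \<bullet> y = 0 \<longrightarrow> g (Ex p z) \<nu> (Tmap (geodesic_sphere_param A g p r) y w) = 0) \<and>
   g (Ex p z) \<nu> (vel (\<lambda>s. expm p (frm p (s *R y))) (r / norm y)) > 0"
  moreover from this obtain m where "Tmap (Ex p) z m = \<nu>" using tangent_map_Ex_surj[OF z] by blast
  ultimately show "\<nu> = Tmap (Ex p) z ((1 / norm y) *R y)" using cond[of m] by metis
 qed (use cond[of "(1 / norm y) *R y"] in blast)
qed

text \<open>Along the sphere the normal is \<open>1 / r\<close> times the image of the position
  field, whose covariant derivative is the identity plus \<open>shp\<close>. The factor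
  \<open>r\<close> in the tangent map of the parametrisation cancels the
  \<open>1 / r\<close>.\<close>

lemma shape_operator:
 assumes x: "norm x = 1" and w: "w \<bullet> x = 0"
 shows "covariant_derivative A g (geodesic_sphere_param A g p r) (outer_unit_normal A g p r) x w =
  Tmap (Ex p) (r *R x) (w + shp (hE p) (r *R x) *v w)"
proof
 fix c
 define z where "z = r *R x"
 let ?F = "geodesic_sphere_param A g p r"
 have x0: "x \<noteq> 0" using x by auto
 have z: "z \<in> ball 0 rh" using sphere_in_ball[OF x0] x by (simp add: z_def)
 have Fx: "?F x = Ex p z" by (simp add: geodesic_sphere_param_def z_def x)
 show "covariant_derivative A g ?F (outer_unit_normal A g p r) x w c =
  Tmap (Ex p) (r *R x) (w + shp (hE p) (r *R x) *v w) c"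
 proof (cases "c \<in> A \<and> Ex p z \<in> fst c")
  case True
  hence c: "c \<in> A" "Ex p z \<in> fst c" by auto
  define ph where "ph x = snd c (Ex p x)" for x
  define W where "W = {x\<in>ball 0 rh. Ex p x \<in> fst c}"
  interpret metric_pullback W "Om c" "hE p" "gmat c" ph
   unfolding W_def ph_def[abs_def] hE_def by (rule param_pullback[OF exp_diffeo_param(1)[OF diffeo] c(1)])
  have zW: "z \<in> W" using z c by (simp add: W_def)
  define f where "f y = (r / norm y) *R y" for y :: "real^'n"
  have fx: "f x = z" by (simp add: f_def z_def x)
  have tm: "Tmap (Ex p) a b c = dd ph a b" if "a \<in> W" for a b
   using tangent_map_apply[of c "Ex p" a b] that c(1) by (simp add: W_def ph_def[abs_def])
  define S where "S = {y. y \<noteq> 0 \<and> f y \<in> W}"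
  have "open S"
  proof -
   have "continuous_on (- {0}) f" unfolding f_def by (auto intro!: continuous_intros)
   from continuous_open_preimage[OF this _ open_U] show ?thesis
    by (simp add: S_def vimage_def Int_def open_Compl)
  qed
  have xS: "x \<in> S" using x0 fx zW by (simp add: S_def)
  define \<Psi> where "\<Psi> y = dd ph y y" for y
  have N: "outer_unit_normal A g p r y c = (1 / r) *R \<Psi> (f y)" if "y \<in> S" for y
  proof -
   have y: "y \<noteq> 0" "f y \<in> W" using that by (auto simp: S_def)
   have e: "(1 / norm y) *R y = (1 / r) *R f y" using r by (simp add: f_def)
   have "outer_unit_normal A g p r y c = Tmap (Ex p) (f y) ((1 / r) *R f y) c"
    unfolding outer_normal[OF y(1)] e by (simp add: f_def)
   also have "\<dots> = dd ph (f y) ((1 / r) *R f y)" by (rule tm[OF y(2)])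
   finally show ?thesis by (simp add: \<Psi>_def linear_scale[OF linear_D[OF y(2)]])
  qed
  have sm\<Psi>: "smooth_on W \<Psi>" and d\<Psi>: "dd \<Psi> z u = dd (\<lambda>y. dd ph y z) z u + dd ph z u" for u
   using dd_linear_family[where L = "dd ph", OF open_U zW linear_D smooth_on_dd[OF smooth] smooth_on_id]
    dd_eqI[OF has_derivative_ident[of "at z"]] by (simp_all add: \<Psi>_def[abs_def])
  have "((\<lambda>y. (1 / r) *R \<Psi> (f y)) has_derivative (\<lambda>w. (1 / r) *R dd \<Psi> z ((r / norm x) *R w - (r * (x \<bullet> w) / norm x ^ 3) *R x))) (at x)"
   using smooth_on_has_derivative[OF sm\<Psi> zW] fx
   by (intro has_derivative_scaleR_right has_derivative_compose[where g = \<Psi> and f = f])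
    (simp_all add: f_def[abs_def] radial_has_derivative[OF x0])
  hence "((\<lambda>y. outer_unit_normal A g p r y c) has_derivative
    (\<lambda>w. (1 / r) *R dd \<Psi> z ((r / norm x) *R w - (r * (x \<bullet> w) / norm x ^ 3) *R x))) (at x)"
   by (rule has_derivative_transform_within_open[OF _ \<open>open S\<close> xS]) (simp add: N)
  from frechet_derivative_at[OF this, symmetric]
  have "frechet_derivative (\<lambda>y. outer_unit_normal A g p r y c) (at x) w = (1 / r) *R dd \<Psi> z (r *R w)"
   using w x by (simp add: inner_commute)
  also have "\<dots> = dd \<Psi> z w" using r linear_scale[OF smooth_on_linear_dd[OF sm\<Psi> zW]] by simp
  finally have 1: "frechet_derivative (\<lambda>y. outer_unit_normal A g p r y c) (at x) w =
    dd (\<lambda>y. dd ph y z) z w + dd ph z w" by (simp only: d\<Psi>)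
  have 2: "Tmap ?F x w c = r *R dd ph z w"
   using tangent_map_sphere_param[OF x0 w] tm[OF zW, of "r *R w"] x
   by (simp add: z_def[symmetric] linear_scale[OF linear_D[OF zW]])
  have 3: "outer_unit_normal A g p r x c = (1 / r) *R dd ph z z"
   using N[OF xS] by (simp add: fx \<Psi>_def)
  have "covariant_derivative A g ?F (outer_unit_normal A g p r) x w c =
    dd (\<lambda>y. dd ph y z) z w + dd ph z w + chrv (gmat c) (ph z) (dd ph z w) (dd ph z z)"
   using covariant_derivative_apply[of c ?F x "outer_unit_normal A g p r" w] c r
   unfolding Fx by (simp add: 1 2 3 chrv_bilinear ph_def)
  also have "\<dots> = dd ph z (w + shp (hE p) z *v w)"
   using chrv_transform[OF zW, of w z] by (simp add: shp_mult linear_add[OF linear_D[OF zW]])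
  also have "\<dots> = Tmap (Ex p) z (w + shp (hE p) z *v w) c" by (rule tm[OF zW, symmetric])
  finally show ?thesis by (simp add: z_def)
 next
  case False
  thus ?thesis
   unfolding z_def[symmetric] covariant_derivative_def tangent_map_def Fx by (simp only: False if_False)
 qed
qed

text \<open>The principal curvatures times \<open>r\<close> are the eigenvalues of the identity plus
  \<open>shp\<close> on the complement of \<open>x\<close>. The radial direction is an eigenvector
  with eigenvalue 1, which accounts for \<open>n - 1\<close> in place of \<open>n\<close>.\<close>

lemma mean_curvature_formula:
 assumes x: "norm x = 1"
 shows "mean_curvature A g p r (frm p x) = (real CARD('n) - 1) / r + trace (shp (hE p) (r *R x)) / r"
proof -
 define z where "z = r *R x"
 have x0: "x \<noteq> 0" using x by auto
 have z: "z \<in> ball 0 rh" using sphere_in_ball[OF x0] x by (simp add: z_def)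
 define T where "T = shp (hE p) z"
 define S where "S = mat 1 + T"
 have Sw: "S *v w = w + T *v w" for w by (simp add: S_def matrix_vector_mult_add_rdistrib)
 have P: "posdef (hE p z)" by (rule nc.posdef_h[OF z])
 have hx: "hE p z *v x = x"
  using hE_gauss[OF z] r by (simp add: z_def mv_scaleR)
 have Tx: "T *v x = 0"
  using nc.shp_radial[OF z] r by (simp add: z_def T_def mv_scaleR)
 have "selfadj (hE p z) T" unfolding T_def by (rule nc.selfadj_shp[OF z])
 hence S: "selfadj (hE p z) S"
  using posdef_sym[OF P] unfolding selfadj_def Sw by (simp add: matrix_vector_right_distrib inner_add_right)
 define E where "E kp = {w. form (hE p z) w x = 0 \<and> S *v w = kp *R w}" for kp
 have inj: "u = v" if "Tmap (Ex p) z u = Tmap (Ex p) z v" for u v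
 proof -
  have "form (hE p z) w u = form (hE p z) w v" for w
   using hE_form[OF z, of w u] hE_form[OF z, of w v] that by simp
  thus ?thesis by (rule posdef_cancel[OF P])
 qed
 have ps: "principal_space A g p r x kp = E (r * kp)" for kp
 proof -
  have "(covariant_derivative A g (geodesic_sphere_param A g p r) (outer_unit_normal A g p r) x w =
    (\<lambda>c. kp *R Tmap (geodesic_sphere_param A g p r) x w c)) \<longleftrightarrow> S *v w = (r * kp) *R w"
   if w: "w \<bullet> x = 0" for w
  proof -
   have "(\<lambda>c. kp *R Tmap (geodesic_sphere_param A g p r) x w c) = Tmap (Ex p) z ((r * kp) *R w)"
    unfolding tangent_map_sphere_param[OF x0 w] using x
    by (intro ext) (simp add: z_def[symmetric] mult.commute linear_scale[OF tangent_map_Ex_linear[OF z]])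
   moreover have "covariant_derivative A g (geodesic_sphere_param A g p r) (outer_unit_normal A g p r) x w =
     Tmap (Ex p) z (S *v w)"
    unfolding shape_operator[OF x w] Sw by (simp add: z_def T_def)
   ultimately show ?thesis using inj by auto
  qed
  thus ?thesis unfolding principal_space_def Let_def E_def hx by blast
 qed
 have "mean_curvature A g p r (frm p x) = (\<Sum>kp | \<exists>w\<in>E (r * kp). w \<noteq> 0. real (dim (E (r * kp))) * kp)"
  unfolding mean_curvature_def Let_def inv_frame ps ..
 also have "\<dots> = (\<Sum>kp | \<exists>w\<in>E kp. w \<noteq> 0. real (dim (E kp)) * kp / r)"
  by (rule sum.reindex_bij_witness[of _ "\<lambda>kp. kp / r" "\<lambda>kp. r * kp"]) (use r in auto)
 also have "\<dots> = (\<Sum>kp | \<exists>w\<in>E kp. w \<noteq> 0. real (dim (E kp)) * kp) / r"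
  by (simp add: sum_divide_distrib)
 also have "(\<Sum>kp | \<exists>w\<in>E kp. w \<noteq> 0. real (dim (E kp)) * kp) = trace S - 1"
  unfolding E_def by (rule selfadj_sum_eigenvalues[OF P S x0]) (simp add: Sw Tx)
 also have "trace S = real CARD('n) + trace T"
  unfolding S_def by (simp add: linear_add[OF linear_trace] trace_I)
 finally show ?thesis by (simp add: T_def z_def add_divide_distrib diff_divide_distrib)
qed

end

end

end

section \<open>Reversing a geodesic\<close>

context complete_manifold
begin

text \<open>Smoothness is checked locally, through a chart around the image point in which the
  inverse of one exponential map and the other exponential map are both smooth.\<close>

lemma exp_transition_pullback:
 assumes p: "diffeo p rh" and q: "diffeo q rh'"
 defines "W \<equiv> {y\<in>ball 0 rh'. Ex q y \<in> Ex p ` ball 0 rh}" and "ph \<equiv> \<lambda>y. inv_into (ball 0 rh) (Ex p) (Ex q y)"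
 shows "metric_pullback W (ball 0 rh) (hE q) (hE p) ph"
proof -
 note P = exp_diffeo_param[OF p] and Q = exp_diffeo_param[OF q]
 have cq: "continuous_on (ball 0 rh') (Ex q)" using Q(1) by (simp add: param_def)
 have W_sub: "W \<subseteq> ball 0 rh'" by (auto simp: W_def)
 have "W = ball 0 rh' \<inter> Ex q -` (Ex p ` ball 0 rh)" unfolding W_def by blast
 hence oW: "open W" using continuous_open_preimage[OF cq open_ball P(3)] by simp
 have ph_in: "ph y \<in> ball 0 rh" and Eph: "Ex p (ph y) = Ex q y" if "y \<in> W" for y
  using that inv_into_into[of "Ex q y" "Ex p" "ball 0 rh"] f_inv_into_f[of "Ex q y" "Ex p" "ball 0 rh"]
  unfolding W_def ph_def by blast+
 have sm: "smooth_on W ph"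
 proof (rule smooth_on_local)
  fix y assume y: "y \<in> W"
  obtain c where c: "c \<in> A" "Ex q y \<in> fst c" using chart_exists by blast
  define T where "T = {y\<in>ball 0 rh'. Ex q y \<in> fst c}"
  define S where "S = snd c ` (fst c \<inter> Ex p ` ball 0 rh)"
  have T: "open T" "smooth_on T (\<lambda>x. snd c (Ex q x))" using param_smooth[OF Q(1) c(1)] by (auto simp: T_def)
  have S: "open S"
  proof -
   have "S = {x \<in> Om c. chart_inv c x \<in> Ex p ` ball 0 rh}"
    unfolding S_def using chart_inv_chart[OF c(1)] by force
   also have "\<dots> = Om c \<inter> chart_inv c -` (Ex p ` ball 0 rh)" by blast
   finally show ?thesis
    using continuous_open_preimage[OF continuous_chart_inv[OF c(1)] open_Om[OF c(1)] P(3)] by simp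
  qed
  have "smooth_on (W \<inter> T) (\<lambda>y. inv_into (ball 0 rh) (Ex p) (chart_inv c (snd c (Ex q y))))"
  proof (rule smooth_on_compose[OF P(4)[OF c(1), folded S_def] _ open_Int[OF oW T(1)] S])
   show "smooth_on (W \<inter> T) (\<lambda>y. snd c (Ex q y))" by (rule smooth_on_subset[OF T(2)]) simp
   show "(\<lambda>y. snd c (Ex q y)) ` (W \<inter> T) \<subseteq> S" unfolding W_def T_def S_def by blast
  qed
  moreover have "ph z = inv_into (ball 0 rh) (Ex p) (chart_inv c (snd c (Ex q z)))" if "z \<in> W \<inter> T" for z
   using that unfolding T_def ph_def by (simp add: chart_inv_chart[OF c(1)])
  ultimately have "smooth_on (W \<inter> T) ph"
   using smooth_on_cong[OF open_Int[OF oW T(1)], of ph "\<lambda>y. inv_into (ball 0 rh) (Ex p) (chart_inv c (snd c (Ex q y)))"]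
   by simp
  moreover have "y \<in> W \<inter> T" using y W_sub c(2) by (auto simp: T_def)
  ultimately show "\<exists>T. open T \<and> y \<in> T \<and> smooth_on T ph" using open_Int[OF oW T(1)] by metis
 qed
 show ?thesis
 proof
  show "metric_on W (hE q)"
   using pull_metric_on[OF Q(1)] oW smooth_on_subset[OF _ W_sub] W_sub unfolding metric_on_def hE_def by blast
  show "metric_on (ball 0 rh) (hE p)" unfolding hE_def by (rule pull_metric_on[OF P(1)])
  show "smooth_on W ph" by (rule sm)
  show "ph ` W \<subseteq> ball 0 rh" using ph_in by blast
  fix y u w assume y: "y \<in> W"
  obtain c where c: "c \<in> A" "Ex q y \<in> fst c" using chart_exists by blast
  have c': "Ex p (ph y) \<in> fst c" using c(2) Eph[OF y] by simp
  have yb: "y \<in> ball 0 rh'" using y W_sub by blast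
  have D: "dd (\<lambda>y. snd c (Ex q y)) y u = dd (\<lambda>x. snd c (Ex p x)) (ph y) (dd ph y u)" for u
  proof -
   have "dd (\<lambda>y. snd c (Ex q y)) y = dd (\<lambda>y. snd c (Ex p (ph y))) y"
    by (rule dd_cong_open[OF oW y]) (simp add: Eph)
   moreover have "ph y \<in> {x\<in>ball 0 rh. Ex p x \<in> fst c}" using ph_in[OF y] c' by simp
   ultimately show ?thesis
    using dd_compose[OF sm y param_smooth(2)[OF P(1) c(1)]] by simp
  qed
  show "form (hE q y) u w = dd ph y u \<bullet> (hE p (ph y) *v dd ph y w)"
   unfolding hE_def pull_metric_chart[OF Q(1) yb c] pull_metric_chart[OF P(1) ph_in[OF y] c(1) c'] D Eph[OF y] ..
 qed
qed

lemma ric_neg: "v \<in> TS p ==> w \<in> TS p ==> (\<And>c. w c = - v c) ==> ric p w = ric p v"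
proof -
 assume v: "v \<in> TS p" "w \<in> TS p" and eq: "\<And>c. w c = - v c"
 obtain c where c: "c \<in> A" "p \<in> fst c" using chart_exists by blast
 show ?thesis
  using ric_chart[OF c v(1)] ric_chart[OF c v(2)] ricq_scale[of "gmat c" "snd c p" "-1" "v c"]
  by (simp add: eq)
qed

text \<open>The vector \<open>w\<close> is minus the final velocity of the geodesic, expressed in
  the frame at \<open>q\<close>. As its length is below both radii, the segment lies in both
  exponential balls and \<open>normal_coords_pair\<close> applies. The Ricci values agree because
  they are even in the vector.\<close>

lemma reverse_geodesic:
 assumes p: "diffeo p rh" and q: "diffeo q rh'"
  and v: "norm v < rh" "norm v < rh'" and qv: "q = Ex p v"
 obtains w where "norm w = norm v" "Ex q w = p" "det (hE q w) = det (hE p v)"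
  "ric p (Tmap (Ex q) w w) = ric p (frm p v)"
  "ric q (frm q w) = ric q (Tmap (Ex p) v v)"
proof -
 have rh: "rh > 0" "rh' > 0" using v norm_ge_zero[of v] by linarith+
 note P = exp_diffeo_param[OF p] and Q = exp_diffeo_param[OF q]
 have vb: "v \<in> ball 0 rh" using v by simp
 define ga where "ga = geo p (frm p v)"
 have geo: "geod ga" unfolding ga_def by (rule geodesic_geo[OF frame_in])
 have E: "Ex p (s *R v) = ga s" for s unfolding ga_def by (rule exp_ray[OF frame_in frame_linear])
 have ga1: "ga 1 = q" using E[of 1] qv by simp
 have ga0: "ga 0 = p" "vel ga 0 = frm p v" unfolding ga_def by (rule geo_0[OF frame_in] velocity_geo_0[OF frame_in])+
 have vel: "vel ga 1 = Tmap (Ex p) v v"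
  using velocity_exp_ray[OF frame_in frame_linear P(1), of 1 v] vb by (simp add: ga_def)
 have "vel ga 1 \<in> TS q" using geodesic_velocity_in[OF geo, of 1] ga1 by simp
 then obtain w' where w': "frm q w' = vel ga 1" using frame_surj by blast
 define w where "w = - w'"
 have fw: "frm q (s *R w) = (\<lambda>c. (- s) *R vel ga 1 c)" for s
  using tangent_scale_linear[where L = "frm q" and t = "- s" and x = w', OF frame_linear] by (simp add: w_def w')
 have Eq: "Ex q (s *R w) = ga (1 - s)" for s
  using exp_map_geodesic[OF geo, of 1 "- s"] by (simp add: fw ga1)
 have nw: "norm w = norm v"
 proof -
  have "w' \<bullet> w' = g q (vel ga 1) (vel ga 1)" using frame_isometry[of q w' w'] by (simp add: w')
  also have "\<dots> = form (hE p v) v v" unfolding vel qv by (rule hE_form[OF p rh(1) vb])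
  also have "\<dots> = v \<bullet> v" using hE_gauss[OF p rh(1) vb] by simp
  finally show ?thesis by (simp add: w_def norm_eq_sqrt_inner)
 qed
 show thesis
 proof (rule that[OF nw])
  show Ew: "Ex q w = p" using Eq[of 1] ga0 by simp
  have wb: "w \<in> ball 0 rh'" using v nw by simp
  define W where "W = {y\<in>ball 0 rh'. Ex q y \<in> Ex p ` ball 0 rh}"
  define ph where "ph y = inv_into (ball 0 rh) (Ex p) (Ex q y)" for y
  interpret nq: normal_coords "ball 0 rh'" "hE q" by (rule normal_coords_hE[OF q rh(2)])
  interpret np: normal_coords "ball 0 rh" "hE p" by (rule normal_coords_hE[OF p rh(1)])
  interpret mp: metric_pullback W "ball 0 rh" "hE q" "hE p" ph
   using exp_transition_pullback[OF p q] unfolding W_def ph_def[abs_def] .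
  interpret pair: normal_coords_pair "ball 0 rh" "ball 0 rh'" W "hE p" "hE q" ph v w
  proof
   show "W \<subseteq> ball 0 rh'" by (auto simp: W_def)
   fix s :: real assume s: "0 \<le> s" "s \<le> 1"
   have 1: "s *R w \<in> ball 0 rh'" by (rule nq.star[OF wb s])
   have 2: "(1 - s) *R v \<in> ball 0 rh" using s by (intro np.star[OF vb]) auto
   have 3: "Ex q (s *R w) = Ex p ((1 - s) *R v)" unfolding Eq E ..
   have "ph (s *R w) = (1 - s) *R v" unfolding ph_def 3 by (rule inv_into_f_f[OF P(2) 2])
   moreover have "s *R w \<in> W" unfolding W_def using 1 2 3 by blast
   ultimately show "s *R w \<in> W \<and> ph (s *R w) = (1 - s) *R v" by simp
  qed
  show "det (hE q w) = det (hE p v)"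
   using pair.density_symmetric hE_0[OF p rh(1)] hE_0[OF q rh(2)] by simp
  have "geo q (frm q w) = (\<lambda>s. ga (1 - s))"
   by (rule ext) (metis Eq exp_ray[OF frame_in frame_linear])
  hence "Tmap (Ex q) w w = vel (\<lambda>s. ga (- 1 * s + 1)) 1"
   using velocity_exp_ray[OF frame_in frame_linear Q(1), of 1 w] wb by simp
  hence neg: "Tmap (Ex q) w w c = - frm p v c" for c
   using geodesic_affine(2)[OF geo, of "-1" 1 1 c] ga0 by simp
  show "ric q (frm q w) = ric q (Tmap (Ex p) v v)"
  proof (rule ric_neg[OF _ frame_in])
   show "Tmap (Ex p) v v \<in> TS q"
    using param_tangent_map_in[OF P(1) vb, of v] qv by simp
   show "frm q w c = - Tmap (Ex p) v v c" for c
    using fw[of 1] vel by simp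
  qed
  show "ric p (Tmap (Ex q) w w) = ric p (frm p v)"
  proof (rule ric_neg[OF frame_in _ neg])
   show "Tmap (Ex q) w w \<in> TS p"
    using param_tangent_map_in[OF Q(1) wb, of w] Ew by simp
  qed
 qed
qed

end

section \<open>Change of variables\<close>

text \<open>
 The library's change of variables formula is for index types that are well-ordered.  The copy
 \<open>'n worder\<close> of a finite type carries a well-order, and the formula is transported along it.
\<close>

typedef 'n worder = "UNIV :: 'n set" by simp

lemma bij_Rep_worder: "bij Rep_worder"
 by (rule bij_betw_byWitness[where f' = Abs_worder]) (auto simp: Abs_worder_inverse Rep_worder_inverse)

lemma bij_Abs_worder: "bij Abs_worder"
 by (rule bij_betw_byWitness[where f' = Rep_worder]) (auto simp: Abs_worder_inverse Rep_worder_inverse)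

instance worder :: (finite) finite
proof
 show "finite (UNIV :: 'a worder set)"
  using bij_betw_finite[OF bij_Rep_worder[where 'a = 'a]] by simp
qed

definition worder_nat :: "'n::finite worder => nat" where
 "worder_nat = (SOME f. inj f)"

lemma inj_worder_nat: "inj worder_nat"
 unfolding worder_nat_def
 using finite_imp_inj_to_nat_seg[OF finite_class.finite_UNIV] by (metis someI_ex)

instantiation worder :: (finite) wellorder
begin

definition "x \<le> y \<longleftrightarrow> worder_nat x \<le> worder_nat y"
definition "x < y \<longleftrightarrow> worder_nat x < worder_nat y"

instance
proof
 fix x y z :: "'a worder"
 show "x < y \<longleftrightarrow> x \<le> y \<and> \<not> y \<le> x" "x \<le> x" "x \<le> y ==> y \<le> z ==> x \<le> z" "x \<le> y \<or> y \<le> x"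
  by (auto simp: less_eq_worder_def less_worder_def)
 show "x \<le> y ==> y \<le> x ==> x = y"
  using inj_worder_nat by (auto simp: less_eq_worder_def inj_def)
next
 fix P :: "'a worder => bool" and a assume H: "\<And>x. (\<And>y. y < x ==> P y) ==> P x"
 show "P a"
  by (induction a rule: measure_induct_rule[of worder_nat]) (rule H, simp add: less_worder_def)
qed

end

definition to_worder :: "real^'n => real^('n worder)" where
 "to_worder x = (\<chi> i. x $ Rep_worder i)"

definition of_worder :: "real^('n worder) => real^'n" where
 "of_worder y = (\<chi> i. y $ Abs_worder i)"

lemma of_to_worder [simp]: "of_worder (to_worder x) = x"
 by (simp add: of_worder_def to_worder_def vec_eq_iff Abs_worder_inverse)

lemma to_of_worder [simp]: "to_worder (of_worder x) = x"
 by (simp add: of_worder_def to_worder_def vec_eq_iff Rep_worder_inverse)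

lemma bounded_linear_to_worder: "bounded_linear to_worder" and bounded_linear_of_worder: "bounded_linear of_worder"
 unfolding linear_conv_bounded_linear[symmetric]
 by (auto simp: linear_iff to_worder_def of_worder_def vec_eq_iff)

lemma measurable_to_worder [measurable]: "to_worder \<in> borel_measurable borel"
 by (rule borel_measurable_continuous_onI[OF linear_continuous_on[OF bounded_linear_to_worder]])

lemma measurable_of_worder [measurable]: "of_worder \<in> borel_measurable borel"
 by (rule borel_measurable_continuous_onI[OF linear_continuous_on[OF bounded_linear_of_worder]])

lemma prod_Basis_cart:
 fixes f :: "real^'n => real"
 shows "(\<Prod>b\<in>Basis. f b) = (\<Prod>i\<in>UNIV. f (axis i 1))"
proof -
 have B: "Basis = range (\<lambda>i::'n. axis i (1::real))" by (auto simp: Basis_vec_def)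
 have "inj (\<lambda>i::'n. axis i (1::real))" by (auto simp: inj_def axis_eq_axis)
 from prod.reindex[OF this, of f] show ?thesis unfolding B by (simp add: o_def)
qed

lemma lborel_to_worder: "distr lborel borel to_worder = (lborel :: (real^('n::finite worder)) measure)"
proof (rule lborel_eqI[symmetric])
 fix l u :: "real^('n worder)" assume le: "\<And>b. b \<in> Basis ==> l \<bullet> b \<le> u \<bullet> b"
 have le': "of_worder l \<bullet> b \<le> of_worder u \<bullet> b" if bB: "b \<in> Basis" for b
 proof -
  obtain i where b: "b = axis i 1" using bB by (auto simp: Basis_vec_def)
  have "axis (Abs_worder i) 1 \<in> (Basis :: (real^('n worder)) set)" by (auto simp: Basis_vec_def)
  from le[OF this] show ?thesis by (simp add: b inner_axis of_worder_def)
 qed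
 have "to_worder -` box l u = box (of_worder l) (of_worder u)"
 proof (intro set_eqI iffI)
  fix x assume x: "x \<in> to_worder -` box l u"
  have "l $ Abs_worder i < x $ i \<and> x $ i < u $ Abs_worder i" for i
   using x unfolding vimage_eq mem_box_cart(1)
   by (metis (no_types) Abs_worder_inverse UNIV_I to_worder_def vec_lambda_beta)
  thus "x \<in> box (of_worder l) (of_worder u)" by (simp add: mem_box_cart of_worder_def)
 next
  fix x assume x: "x \<in> box (of_worder l) (of_worder u)"
  have "l $ i < x $ Rep_worder i \<and> x $ Rep_worder i < u $ i" for i
   using x unfolding mem_box_cart(1)
   by (metis (no_types) Rep_worder_inverse of_worder_def vec_lambda_beta)
  thus "x \<in> to_worder -` box l u" by (simp add: mem_box_cart to_worder_def)
 qed
 hence "emeasure (distr lborel borel to_worder) (box l u) = emeasure lborel (box (of_worder l) (of_worder u))"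
  by (subst emeasure_distr) auto
 also have "\<dots> = (\<Prod>b\<in>Basis. (of_worder u - of_worder l) \<bullet> b)"
  using le' by (rule emeasure_lborel_box)
 also have "\<dots> = (\<Prod>i\<in>UNIV. (u - l) $ Abs_worder i)"
  by (simp add: prod_Basis_cart inner_axis of_worder_def)
 also have "\<dots> = (\<Prod>i\<in>UNIV. (u - l) $ i)"
  by (rule arg_cong[where f = ennreal], rule prod.reindex_bij_betw[OF bij_Abs_worder])
 also have "\<dots> = (\<Prod>b\<in>Basis. (u - l) \<bullet> b)" by (simp add: prod_Basis_cart inner_axis)
 finally show "emeasure (distr lborel borel to_worder) (box l u) = (\<Prod>b\<in>Basis. (u - l) \<bullet> b)" .
qed simp

lemma det_worder:
 fixes M :: "real^'n^'n"
 shows "det (\<chi> i j. M $ Rep_worder i $ Rep_worder j) = det M"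
proof -
 let ?P = "map_permutation UNIV (Rep_worder :: 'n worder => 'n)"
 let ?Q = "map_permutation UNIV (Abs_worder :: 'n => 'n worder)"
 have bR: "bij (Rep_worder :: 'n worder => 'n)" by (rule bij_Rep_worder)
 have bA: "bij (Abs_worder :: 'n => 'n worder)" by (rule bij_Abs_worder)
 have iR: "inv (Rep_worder :: 'n worder => 'n) = Abs_worder"
  by (rule inv_equality) (simp_all add: Abs_worder_inverse Rep_worder_inverse)
 have iA: "inv (Abs_worder :: 'n => 'n worder) = Rep_worder"
  by (rule inv_equality) (simp_all add: Abs_worder_inverse Rep_worder_inverse)
 have P: "?P p = Rep_worder \<circ> p \<circ> Abs_worder" for p
  using bR by (simp add: map_permutation_def iR bij_is_surj restrict_id_def fun_eq_iff)
 have Q: "?Q p = Abs_worder \<circ> p \<circ> Rep_worder" for p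
  using bA by (simp add: map_permutation_def iA bij_is_surj restrict_id_def fun_eq_iff)
 have PQ: "?P (?Q p) = p" "?Q (?P p') = p'" for p p'
  unfolding P Q by (simp_all add: fun_eq_iff Abs_worder_inverse Rep_worder_inverse)
 show ?thesis
  unfolding det_def
 proof (rule sum.reindex_bij_witness[of _ ?Q ?P])
  show "?Q (?P p) = p" "?P (?Q q) = q" for p q by (simp_all add: PQ)
  show "?P p \<in> {p. p permutes UNIV}" if "p \<in> {p. p permutes UNIV}" for p
   using that map_permutation_permutes[of Rep_worder UNIV UNIV p] bR by simp
  show "?Q p \<in> {p. p permutes UNIV}" if "p \<in> {p. p permutes UNIV}" for p
   using that map_permutation_permutes[of Abs_worder UNIV UNIV p] bA by simp
  fix p :: "'n worder => 'n worder" assume p: "p \<in> {p. p permutes UNIV}"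
  have "sign (?P p) = sign p"
   using p bR by (intro sign_map_permutation) (auto simp: bij_is_inj)
  moreover have "(\<Prod>i\<in>UNIV. M $ i $ ?P p i) = (\<Prod>i\<in>UNIV. M $ Rep_worder i $ ?P p (Rep_worder i))"
   using prod.reindex_bij_betw[OF bR, of "\<lambda>i. M $ i $ ?P p i"] by simp
  ultimately show "of_int (sign (?P p)) * (\<Prod>i\<in>UNIV. M $ i $ ?P p i) =
    of_int (sign p) * (\<Prod>i\<in>UNIV. (\<chi> i j. M $ Rep_worder i $ Rep_worder j) $ i $ p i)"
   by (simp add: P Rep_worder_inverse)
 qed
qed

text \<open>The known formula concerns Jacobians with a finite integral. The sets
  \<open>T k\<close>, on which point and Jacobian are bounded, exhaust \<open>S\<close>, and
  monotone convergence passes to the limit.\<close>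

lemma emeasure_differentiable_image_wellorder:
 fixes ph :: "real^'m::{finite,wellorder} => real^'m::_"
 assumes S: "S \<in> sets borel" "ph ` S \<in> sets borel"
  and der: "\<And>x. x \<in> S ==> (ph has_derivative D x) (at x)" and inj: "inj_on ph S"
  and J: "J \<in> borel_measurable borel" "\<And>x. x \<in> S ==> \<bar>det (matrix (D x))\<bar> = J x"
 shows "emeasure lborel (ph ` S) = (LBNN x. ennreal (J x) * indicator S x)"
proof -
 define T where "T k = {x \<in> S. norm x \<le> real k \<and> J x \<le> real k}" for k :: nat
 have [measurable]: "S \<in> sets borel" "J \<in> borel_measurable borel" by (fact S(1) J(1))+
 have T [measurable]: "T k \<in> sets borel" for k unfolding T_def by measurable
 have Tmono: "incseq T" unfolding T_def incseq_def by (auto elim: order_trans)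
 have TU: "(\<Union>k. T k) = S"
 proof -
  have "\<exists>k. x \<in> T k" if "x \<in> S" for x
  proof -
   obtain k where "max (norm x) (J x) \<le> real k" using real_arch_simple by blast
   thus ?thesis using that by (auto simp: T_def)
  qed
  thus ?thesis by (auto simp: T_def)
 qed
 have J0: "0 \<le> J x" if "x \<in> S" for x using J(2)[OF that] by (metis abs_ge_zero)
 have piece: "ph ` T k \<in> sets lebesgue \<and> emeasure lebesgue (ph ` T k) = (LBNN x. ennreal (J x) * indicator (T k) x)" for k
 proof -
  define f where "f x = (if x \<in> T k then J x else 0)" for x
  have fm: "f \<in> borel_measurable borel" unfolding f_def by measurable
  have f0: "0 \<le> f x" for x using J0 by (auto simp: f_def T_def)
  have nf: "(LBNN x. ennreal (J x) * indicator (T k) x) = (LBNN x. ennreal (f x))"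
   by (intro nn_integral_cong) (simp add: f_def)
  have "(LBNN x. ennreal (f x)) \<le> (LBNN x. ennreal (real k) * indicator (cball (0::real^'m::_) (real k)) x)"
   by (intro nn_integral_mono) (auto simp: f_def T_def indicator_def ennreal_leI)
  also have "\<dots> = ennreal (real k) * emeasure lborel (cball (0::real^'m::_) (real k))"
   by (rule nn_integral_cmult_indicator) simp
  also have "\<dots> < \<infinity>"
   using emeasure_lborel_cball_finite[of "0::real^'m::_" "real k"] by (simp add: ennreal_mult_less_top)
  finally have fin: "(LBNN x. ennreal (f x)) < \<infinity>" .
  define r where "r = enn2real (LBNN x. ennreal (f x))"
  have r: "(LBNN x. ennreal (f x)) = ennreal r" using fin by (simp add: r_def)
  have "(f has_integral r) UNIV"
   by (rule nn_integral_has_integral[OF fm f0 r]) (simp add: r_def)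
  hence "((\<lambda>x. if x \<in> T k then J x else 0) has_integral r) UNIV" by (simp add: f_def[abs_def])
  hence "(J has_integral r) (T k)" by (simp add: has_integral_restrict_UNIV)
  hence hi: "((\<lambda>x. \<bar>det (matrix (D x))\<bar>) has_integral r) (T k)"
   by (rule has_integral_eq[rotated]) (use J(2) in \<open>simp add: T_def\<close>)
  have l: "T k \<in> sets lebesgue" using T by simp
  have d: "(ph has_derivative D x) (at x within T k)" if "x \<in> T k" for x
  proof -
   have "x \<in> S" using that by (simp add: T_def)
   thus ?thesis by (rule has_derivative_at_withinI[OF der])
  qed
  have i: "inj_on ph (T k)" by (rule inj_on_subset[OF inj]) (simp add: T_def)
  have "ph ` T k \<in> lmeasurable \<and> measure lebesgue (ph ` T k) = r"
   using has_measure_differentiable_image[OF l d i, of r] hi by simp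
  thus ?thesis unfolding nf r by (auto simp: emeasure_eq_measure2 fmeasurableD)
 qed
 have "emeasure lborel (ph ` S) = emeasure lebesgue (ph ` S)" using S(2) by simp
 also have "ph ` S = (\<Union>k. ph ` T k)" using TU by blast
 also have "emeasure lebesgue (\<Union>k. ph ` T k) = (SUP k. emeasure lebesgue (ph ` T k))"
  using piece Tmono by (intro SUP_emeasure_incseq[symmetric]) (auto simp: incseq_def image_mono)
 also have "\<dots> = (SUP k. (LBNN x. ennreal (J x) * indicator (T k) x))"
  using piece by simp
 also have "\<dots> = (LBNN x. (SUP k. ennreal (J x) * indicator (T k) x))"
  using Tmono by (intro nn_integral_monotone_convergence_SUP[symmetric])
   (auto simp: incseq_def le_fun_def indicator_def)
 also have "\<dots> = (LBNN x. ennreal (J x) * indicator S x)"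
 proof (intro nn_integral_cong)
  fix x
  have "(SUP k. ennreal (J x) * indicator (T k) x) = ennreal (J x) * (SUP k. indicator (T k) x)"
   by (simp add: SUP_mult_left_ennreal)
  also have "(SUP k. indicator (T k) x) = (indicator S x :: ennreal)"
  proof (cases "x \<in> S")
   case True
   then obtain k0 where "x \<in> T k0" using TU by blast
   thus ?thesis
    using True by (intro antisym SUP_least SUP_upper2[of k0]) (auto simp: indicator_def)
  next
   case False
   hence "x \<notin> T k" for k using TU by blast
   thus ?thesis using False by simp
  qed
  finally show "(SUP k. ennreal (J x) * indicator (T k) x) = ennreal (J x) * indicator S x" .
 qed
 finally show ?thesis using TU by (simp add: image_UN[symmetric])
qed


lemma emeasure_lborel_of_worder:
 assumes [measurable]: "B \<in> sets (borel :: (real^'n::finite) measure)"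
 shows "emeasure lborel (of_worder -` B) = emeasure lborel B"
proof -
 have [measurable]: "of_worder -` B \<in> sets borel"
  using measurable_sets[OF measurable_of_worder, of B] by simp
 have "emeasure (distr lborel borel to_worder) (of_worder -` B) = emeasure lborel (to_worder -` of_worder -` B)"
  by (subst emeasure_distr) auto
 also have "to_worder -` of_worder -` B = B" by auto
 finally show ?thesis by (simp add: lborel_to_worder)
qed

lemma emeasure_differentiable_image:
 fixes ph :: "real^'n => real^'n"
 assumes S: "S \<in> sets borel" "ph ` S \<in> sets borel"
  and der: "\<And>x. x \<in> S ==> (ph has_derivative D x) (at x)" and inj: "inj_on ph S"
  and J: "J \<in> borel_measurable borel" "\<And>x. x \<in> S ==> \<bar>det (matrix (D x))\<bar> = J x"
 shows "emeasure lborel (ph ` S) = (LBNN x. ennreal (J x) * indicator S x)"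
proof -
 have [measurable]: "S \<in> sets borel" "J \<in> borel_measurable borel" by (fact S(1) J(1))+
 define ph' where "ph' y = to_worder (ph (of_worder y))" for y
 define D' where "D' y = (\<lambda>v. to_worder (D (of_worder y) (of_worder v)))" for y
 have img: "ph' ` (of_worder -` S) = of_worder -` (ph ` S)"
 proof (intro equalityI subsetI)
  fix z assume "z \<in> of_worder -` (ph ` S)"
  then obtain x where x: "x \<in> S" "of_worder z = ph x" by auto
  hence "z = ph' (to_worder x)" by (metis ph'_def of_to_worder to_of_worder)
  moreover have "to_worder x \<in> of_worder -` S" using x by simp
  ultimately show "z \<in> ph' ` (of_worder -` S)" by blast
 qed (auto simp: ph'_def)
 have "emeasure lborel (ph ` S) = emeasure lborel (ph' ` (of_worder -` S))"
  unfolding img by (rule emeasure_lborel_of_worder[OF S(2), symmetric])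
 also have "\<dots> = (LBNN y. ennreal (J (of_worder y)) * indicator (of_worder -` S) y)"
 proof (rule emeasure_differentiable_image_wellorder[where D = D'])
  show "of_worder -` S \<in> sets borel" "ph' ` (of_worder -` S) \<in> sets borel"
   using measurable_sets[OF measurable_of_worder S(1)] measurable_sets[OF measurable_of_worder S(2)] by (auto simp: img)
  show "inj_on ph' (of_worder -` S)"
  proof (rule inj_onI)
   fix y z assume yz: "y \<in> of_worder -` S" "z \<in> of_worder -` S" "ph' y = ph' z"
   hence "ph (of_worder y) = ph (of_worder z)" by (metis ph'_def of_to_worder)
   thus "y = z" using inj yz(1,2) by (metis inj_onD to_of_worder vimageD)
  qed
  show "(\<lambda>y. J (of_worder y)) \<in> borel_measurable borel" by measurable
  fix y :: "real^('n worder)" assume y: "y \<in> of_worder -` S"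
  show "(ph' has_derivative D' y) (at y)"
   unfolding ph'_def[abs_def] D'_def
   by (intro bounded_linear.has_derivative[OF bounded_linear_to_worder]
     has_derivative_compose[OF bounded_linear_imp_has_derivative[OF bounded_linear_of_worder]] der)
    (use y in simp)
  have "matrix (D' y) = (\<chi> i j. matrix (D (of_worder y)) $ Rep_worder i $ Rep_worder j)"
  proof -
   have e: "of_worder (axis j 1) = axis (Rep_worder j) 1" for j :: "'n worder"
    by (auto simp: of_worder_def axis_def vec_eq_iff Abs_worder_inverse Rep_worder_inverse)
   show ?thesis unfolding matrix_def D'_def e to_worder_def by simp
  qed
  hence "det (matrix (D' y)) = det (matrix (D (of_worder y)))" by (simp add: det_worder)
  thus "\<bar>det (matrix (D' y))\<bar> = J (of_worder y)" using J(2) y by simp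
 qed
 also have "\<dots> = (\<integral>\<^sup>+y. ennreal (J (of_worder y)) * indicator (of_worder -` S) y \<partial>distr lborel borel to_worder)"
  by (simp add: lborel_to_worder)
 also have "\<dots> = (LBNN x. ennreal (J x) * indicator S x)"
  using measurable_sets[OF measurable_of_worder S(1)]
  by (subst nn_integral_distr) (auto intro!: nn_integral_cong simp: indicator_def)
 finally show ?thesis .
qed

lemma borel_measurable_open_extension:
 fixes f :: "'a::topological_space => 'b::real_normed_vector"
 assumes "open U" "continuous_on U f"
 shows "(\<lambda>x. if x \<in> U then f x else 0) \<in> borel_measurable borel"
 using assms by (intro borel_measurable_continuous_on_if continuous_on_const) auto

lemma smooth_on_jacobian:
 fixes ph :: "real^'n => real^'n"
 assumes "open U" "smooth_on U ph"
 shows "smooth_on U (\<lambda>x. det (matrix (dd ph x)))"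
 unfolding matrix_def using assms by (intro smooth_on_det smooth_on_vec_lambda smooth_on_nth smooth_on_dd)

text \<open>It suffices to compare the image of the Jacobian density with Lebesgue measure on the
  image of \<open>U\<close>, and measures are compared on Borel sets. Extending the map and the
  Jacobian by 0 outside \<open>U\<close> makes them Borel on the whole space.\<close>

theorem nn_integral_change_of_variables:
 fixes ph :: "real^'n => real^'n"
 assumes U: "open U" "smooth_on U ph" "inj_on ph U" "open (ph ` U)" and f[measurable]: "f \<in> borel_measurable borel"
 shows "(LBNN x. f (ph x) * ennreal \<bar>det (matrix (dd ph x))\<bar> * indicator U x)
  = (LBNN y. f y * indicator (ph ` U) y)"
proof -
 define J where "J x = (if x \<in> U then \<bar>det (matrix (dd ph x))\<bar> else 0)" for x
 define ph' where "ph' x = (if x \<in> U then ph x else 0)" for x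
 have [measurable]: "U \<in> sets borel" "ph ` U \<in> sets borel" using U by auto
 have [measurable]: "J \<in> borel_measurable borel"
  unfolding J_def[abs_def]
  by (intro borel_measurable_open_extension U continuous_intros smooth_on_continuous_on smooth_on_jacobian)
 have [measurable]: "ph' \<in> borel_measurable borel"
  unfolding ph'_def[abs_def] by (intro borel_measurable_open_extension U smooth_on_continuous_on)
 have eq: "distr (density lborel (\<lambda>x. ennreal (J x))) borel ph' = density lborel (indicator (ph ` U))" (is "?N1 = ?N2")
 proof (rule measure_eqI)
  fix B assume "B \<in> sets ?N1"
  hence [measurable]: "B \<in> sets borel" by simp
  define S where "S = {x \<in> U. ph' x \<in> B}"
  have [measurable]: "S \<in> sets borel" unfolding S_def by measurable
  have img: "ph ` S = ph ` U \<inter> B" by (auto simp: S_def ph'_def)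
  have "emeasure ?N1 B = (LBNN x. ennreal (J x) * indicator (ph' -` B) x)"
   using measurable_sets[of ph' borel borel B] by (simp add: emeasure_distr emeasure_density)
  also have "\<dots> = (LBNN x. ennreal (J x) * indicator S x)"
   by (intro nn_integral_cong) (auto simp: S_def J_def indicator_def)
  also have "\<dots> = emeasure lborel (ph ` S)"
  proof (rule emeasure_differentiable_image[symmetric, where D = "dd ph"])
   show "ph ` S \<in> sets borel" unfolding img by measurable
   show "inj_on ph S" using U(3) by (rule inj_on_subset) (auto simp: S_def)
   show "(ph has_derivative dd ph x) (at x)" if "x \<in> S" for x
    using that by (intro smooth_on_has_derivative[OF U(2)]) (simp add: S_def)
   show "\<bar>det (matrix (dd ph x))\<bar> = J x" if "x \<in> S" for x
    using that by (simp add: S_def J_def)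
  qed measurable
  also have "\<dots> = emeasure ?N2 B"
  proof -
   have "emeasure ?N2 B = (LBNN x. indicator (ph ` U) x * indicator B x)" by (simp add: emeasure_density)
   also have "\<dots> = (LBNN x. indicator (ph ` U \<inter> B) x)" by (simp add: indicator_inter_arith)
   also have "\<dots> = emeasure lborel (ph ` U \<inter> B)" by (rule nn_integral_indicator) measurable
   finally show ?thesis unfolding img by simp
  qed
  finally show "emeasure ?N1 B = emeasure ?N2 B" .
 qed simp
 have "(LBNN x. f (ph x) * ennreal \<bar>det (matrix (dd ph x))\<bar> * indicator U x)
   = (LBNN x. ennreal (J x) * f (ph' x))"
  by (intro nn_integral_cong) (simp add: J_def ph'_def indicator_def mult.commute)
 also have "\<dots> = (\<integral>\<^sup>+y. f y \<partial>?N1)" by (simp add: nn_integral_distr nn_integral_density)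
 also have "\<dots> = (LBNN y. f y * indicator (ph ` U) y)"
  unfolding eq by (simp add: nn_integral_density mult.commute)
 finally show ?thesis .
qed

section \<open>Integration in polar coordinates\<close>

lemma nn_integral_lborel_scale:
 fixes f :: "'a::euclidean_space => ennreal"
 assumes [measurable]: "f \<in> borel_measurable borel" and c: "c > 0"
 shows "(LBNN x. f x) = ennreal (c ^ DIM('a)) * (LBNN x. f (c *R x))"
proof -
 have "(LBNN x. f x) = (\<integral>\<^sup>+x. f x \<partial>density (distr lborel borel (\<lambda>x. 0 + c *R x)) (\<lambda>_. \<bar>c\<bar> ^ DIM('a)))"
  by (subst lborel_affine[of c 0]) (use c in auto)
 thus ?thesis
  using c by (simp add: nn_integral_density nn_integral_distr nn_integral_cmult)
qed

lemma nn_integral_power_tail: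
 assumes "a > 0" "n > 0"
 shows "(LBNN t. ennreal (1 / t ^ Suc n) * indicator {a<..} t) = ennreal (1 / (real n * a ^ n))"
proof -
 have "(LBNN t. ennreal (1 / t ^ Suc n) * indicator {a<..} t) = (LBNN t. ennreal (1 / t ^ Suc n) * indicator {a..} t)"
  by (rule nn_integral_cong_AE) (use AE_lborel_singleton[of a] in \<open>eventually_elim, auto simp: indicator_def\<close>)
 also have "\<dots> = ennreal (0 - (- 1 / (real n * a ^ n)))"
 proof (rule nn_integral_FTC_atLeast)
  show "((\<lambda>t. - 1 / (real n * t ^ n)) has_real_derivative 1 / t ^ Suc n) (at t)" if "a \<le> t" for t
  proof -
   obtain m where m: "n = Suc m" using assms(2) gr0_implies_Suc by blast
   have t: "t > 0" using that assms by simp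
   have "((\<lambda>t. - (inverse t ^ n) / real n) has_real_derivative
     - (real n * (inverse t ^ (n - 1) * - (inverse t * inverse t))) / real n) (at t)"
    using t by (auto intro!: derivative_eq_intros simp: power2_eq_square)
   moreover have "- (real n * (inverse t ^ (n - 1) * - (inverse t * inverse t))) / real n = 1 / t ^ Suc n"
    using t by (simp add: m inverse_eq_divide power_divide)
   moreover have "(\<lambda>t. - (inverse t ^ n) / real n) = (\<lambda>t. - 1 / (real n * t ^ n))"
    by (simp add: fun_eq_iff inverse_eq_divide power_divide)
   ultimately show ?thesis by simp
  qed
  have "filterlim (\<lambda>t::real. real n * t ^ n) at_top at_top"
   using assms(2) by (intro filterlim_tendsto_pos_mult_at_top[OF tendsto_const] filterlim_pow_at_top filterlim_ident) auto
  from tendsto_divide_0[OF tendsto_const filterlim_at_top_imp_at_infinity[OF this]]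
  show "((\<lambda>t. - 1 / (real n * t ^ n)) \<longlongrightarrow> 0) at_top" .
 qed (use assms in auto)
 finally show ?thesis by simp
qed

text \<open>
 The integral over the unit sphere is rendered as \<open>n\<close> times the integral over the punctured unit
 ball of the extension that is constant on rays.
\<close>

theorem nn_integral_polar:
 fixes k :: "'a::euclidean_space => ennreal"
 assumes k[measurable]: "k \<in> borel_measurable borel" and r: "r > 0"
 shows "of_nat DIM('a) * (LBNN v. (LBNN s. ennreal (s ^ (DIM('a) - 1)) * k (s *R sgn v) * indicator {0<..<r} s)
   * indicator (ball 0 1 - {0}) v)
  = (LBNN v. k v * indicator (ball 0 r - {0}) v)"
proof -
 define n where "n = DIM('a)"
 have n: "n > 0" by (simp add: n_def)
 obtain m where m: "n = Suc m" using n gr0_implies_Suc by blast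
 \<comment> \<open>Three moves: put \<open>s = t * norm v\<close> for fixed \<open>v\<close>,
   exchange the integrals, then put \<open>u = t *R v\<close> for fixed \<open>t\<close>. What is
   left is the integral of \<open>1 / t ^ Suc n\<close> over \<open>t > norm u\<close>, which
   together with the factor \<open>n * norm u ^ n\<close> gives 1.\<close>
 define G where "G v t = (if 0 < norm v \<and> norm v < 1 \<and> 0 < t \<and> t * norm v < r then ennreal (t ^ m * norm v ^ n) * k (t *R v) else 0)"
  for v :: 'a and t
 define H where "H u t = (if 0 < norm u \<and> norm u < t \<and> norm u < r then ennreal (norm u ^ n) * ennreal (1 / t ^ Suc n) * k u else 0)"
  for u :: 'a and t
 have [measurable]: "(\<lambda>(v, t). G v t) \<in> borel_measurable (borel \<Otimes>\<^sub>M borel)"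
  unfolding G_def by measurable
 have [measurable]: "(\<lambda>(v, t). H v t) \<in> borel_measurable (borel \<Otimes>\<^sub>M borel)"
  unfolding H_def by measurable
 have inner: "(LBNN s. ennreal (s ^ (DIM('a) - 1)) * k (s *R sgn v) * indicator {0<..<r} s) * indicator (ball 0 1 - {0}) v
   = (LBNN t. G v t)" for v
 proof (cases "v \<in> ball 0 1 - {0}")
  case True
  hence v: "0 < norm v" "norm v < 1" by auto
  have "(LBNN s. ennreal (s ^ m) * k (s *R sgn v) * indicator {0<..<r} s) =
    ennreal (norm v) * (LBNN t. ennreal ((norm v * t) ^ m) * k ((norm v * t) *R sgn v) * indicator {0<..<r} (norm v * t))"
   using v by (subst nn_integral_real_affine[where c = "norm v" and t = 0]) auto
  also have "\<dots> = (LBNN t. ennreal (norm v) * (ennreal ((norm v * t) ^ m) * k ((norm v * t) *R sgn v) * indicator {0<..<r} (norm v * t)))"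
   by (rule nn_integral_cmult[symmetric]) measurable
  also have "\<dots> = (LBNN t. G v t)"
  proof (intro nn_integral_cong)
   fix t
   have "(norm v * t) *R sgn v = t *R v" using v by (simp add: sgn_div_norm)
   moreover have "ennreal (norm v) * ennreal ((norm v * t) ^ m) = ennreal (t ^ m * norm v ^ n)" if "t > 0"
    using that v by (simp add: ennreal_mult[symmetric] m power_mult_distrib mult_ac)
   ultimately show "ennreal (norm v) * (ennreal ((norm v * t) ^ m) * k ((norm v * t) *R sgn v) * indicator {0<..<r} (norm v * t)) = G v t"
    using v by (auto simp: G_def indicator_def zero_less_mult_iff mult.commute[of "norm v" t] mult.assoc[symmetric])
  qed
  finally show ?thesis using True by (simp add: n_def[symmetric] m)
 next
  case False
  hence "G v t = 0" for t by (auto simp: G_def)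
  thus ?thesis using False by simp
 qed
 have scale: "(LBNN v. G v t) = (LBNN u. H u t)" for t
 proof (cases "t > 0")
  case True
  have "(LBNN u. H u t) = ennreal (t ^ n) * (LBNN v. H (t *R v) t)"
   unfolding n_def by (rule nn_integral_lborel_scale[OF _ True]) measurable
  also have "\<dots> = (LBNN v. ennreal (t ^ n) * H (t *R v) t)"
   by (rule nn_integral_cmult[symmetric]) measurable
  also have "\<dots> = (LBNN v. G v t)"
  proof (intro nn_integral_cong)
   fix v :: 'a
   have "ennreal (t ^ n) * (ennreal ((t * norm v) ^ n) * ennreal (1 / t ^ Suc n)) = ennreal (t ^ m * norm v ^ n)"
    using True by (simp add: ennreal_mult[symmetric] m power_mult_distrib field_simps)
   thus "ennreal (t ^ n) * H (t *R v) t = G v t"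
    using True by (auto simp: H_def G_def mult.assoc[symmetric] zero_less_mult_iff)
  qed
  finally show ?thesis by simp
 next
  case False
  hence "G v t = 0" "H v t = 0" for v
   by (auto simp: G_def H_def) (meson norm_ge_zero less_le_trans not_le order.strict_trans)
  thus ?thesis by simp
 qed
 have tail: "of_nat n * (LBNN t. H u t) = k u * indicator (ball 0 r - {0}) u" for u
 proof (cases "u \<in> ball 0 r - {0}")
  case True
  hence u: "0 < norm u" "norm u < r" by auto
  have "(LBNN t. H u t) = (LBNN t. (ennreal (norm u ^ n) * k u) * (ennreal (1 / t ^ Suc n) * indicator {norm u<..} t))"
   using u by (intro nn_integral_cong) (auto simp: H_def indicator_def mult_ac)
  also have "\<dots> = (ennreal (norm u ^ n) * k u) * ennreal (1 / (real n * norm u ^ n))"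
   by (subst nn_integral_cmult) (simp_all add: nn_integral_power_tail[OF u(1) n] del: power_Suc)
  finally have "of_nat n * (LBNN t. H u t) = (of_nat n * ennreal (norm u ^ n) * ennreal (1 / (real n * norm u ^ n))) * k u"
   by (simp add: mult_ac)
  also have "of_nat n * ennreal (norm u ^ n) * ennreal (1 / (real n * norm u ^ n)) = 1"
   using u n by (simp add: ennreal_of_nat_eq_real_of_nat ennreal_mult[symmetric])
  finally show ?thesis using True by simp
 next
  case False
  hence "H u t = 0" for t by (auto simp: H_def)
  thus ?thesis using False by simp
 qed
 have "(LBNN v. (LBNN t. G v t)) = (LBNN t. (LBNN v. G v t))"
  by (rule lborel_pair.Fubini'[symmetric]) measurable
 also have "\<dots> = (LBNN t. (LBNN u. H u t))" by (simp add: scale)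
 also have "\<dots> = (LBNN u. (LBNN t. H u t))"
  by (rule lborel_pair.Fubini') measurable
 finally have "of_nat n * (LBNN v. (LBNN t. G v t)) = (LBNN u. of_nat n * (LBNN t. H u t))"
  by (simp add: nn_integral_cmult)
 thus ?thesis unfolding inner tail by (simp add: n_def)
qed

section \<open>The volume measure\<close>

text \<open>Induction over a finite subcover. It yields the finite chart cover, the finiteness of
  the volume and the Ricci bound.\<close>

lemma compact_UNIV_local:
 assumes "compact (UNIV :: 'a::topological_space set)"
  and loc: "\<And>p::'a. \<exists>N. open N \<and> p \<in> N \<and> P N"
  and un: "\<And>S T. P S ==> P T ==> P (S \<union> T)" and "P {}"
 shows "P UNIV"
proof -
 obtain N where N: "\<And>p. open (N p)" "\<And>p. p \<in> N p" "\<And>p. P (N p)" using loc by metis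
 obtain C where C: "finite C" "UNIV \<subseteq> (\<Union>p\<in>C. N p)"
  by (rule compactE_image[OF assms(1), of UNIV N]) (use N in auto)
 have "P (\<Union>p\<in>C'. N p)" if "finite C'" for C'
  using that by induction (auto intro: un N(3) \<open>P {}\<close>)
 with C show ?thesis by (metis top.extremum_uniqueI)
qed

locale closed_manifold = complete_manifold A g
 for A :: "('a::{t2_space,second_countable_topology}, 'n::finite) chart set" and g :: "('a, 'n) metric_tensor" +
 assumes compact_UNIV: "compact (UNIV :: 'a set)"
begin

text \<open>A Borel choice of chart with finitely many values. The sets on which it is constant form
  a finite partition of the manifold, which does the work of a partition of unity.\<close>

lemma finite_chart_cover:
 "\<exists>ch :: 'a => ('a, 'n) chart. range ch \<subseteq> A \<and> finite (range ch) \<and> (\<forall>p. p \<in> fst (ch p)) \<and> (\<forall>c. {p. ch p = c} \<in> sets borel)"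
proof -
 \<comment> \<open>Outside \<open>S\<close> the choice is still some chart of the atlas, so that two
   choices can be combined by cases.\<close>
 define P where "P S \<longleftrightarrow> (\<exists>ch :: 'a => ('a, 'n) chart. S \<in> sets borel \<and> range ch \<subseteq> A \<and> finite (range ch) \<and> (\<forall>p\<in>S. p \<in> fst (ch p)) \<and>
  (\<forall>c. {p. ch p = c} \<in> sets borel))" for S
 obtain c0 where c0: "c0 \<in> A" using chart_exists by blast
 have const: "{p::'a. a = c} \<in> sets borel" for a c :: "('a, 'n) chart" by (cases "a = c") auto
 have "P UNIV"
 proof (rule compact_UNIV_local[OF compact_UNIV])
  fix p
  obtain c where c: "c \<in> A" "p \<in> fst c" using chart_exists by blast
  hence "P (fst c)" unfolding P_def using open_dom const[of c] by (intro exI[of _ "\<lambda>_. c"]) auto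
  thus "\<exists>N. open N \<and> p \<in> N \<and> P N" using c open_dom by metis
 next
  fix S T assume "P S" "P T"
  then obtain a b where a: "S \<in> sets borel" "range a \<subseteq> A" "finite (range a)" "\<forall>p\<in>S. p \<in> fst (a p)" "\<forall>c. {p. a p = c} \<in> sets borel"
   and b: "T \<in> sets borel" "range b \<subseteq> A" "finite (range b)" "\<forall>p\<in>T. p \<in> fst (b p)" "\<forall>c. {p. b p = c} \<in> sets borel"
   unfolding P_def by metis
  define ch where "ch p = (if p \<in> S then a p else b p)" for p
  have r: "range ch \<subseteq> range a \<union> range b" unfolding ch_def by auto
  have "{p. ch p = c} = (S \<inter> {p. a p = c}) \<union> ({p. b p = c} - S)" for c unfolding ch_def by auto
  hence "{p. ch p = c} \<in> sets borel" for c
   using sets.Un[OF sets.Int[OF a(1) a(5)[rule_format, of c]] sets.Diff[OF b(5)[rule_format, of c] a(1)]] by simp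
  moreover have "finite (range ch)" using finite_subset[OF r] a(3) b(3) by simp
  moreover have "range ch \<subseteq> A" using r a(2) b(2) by auto
  moreover have "\<forall>p\<in>S \<union> T. p \<in> fst (ch p)" using a(4) b(4) unfolding ch_def by auto
  ultimately show "P (S \<union> T)" unfolding P_def using a(1) b(1) by blast
 next
  show "P {}" unfolding P_def using c0 const[of c0] by (intro exI[of _ "\<lambda>_. c0"]) auto
 qed
 thus ?thesis unfolding P_def by simp
qed

definition ch :: "'a => ('a, 'n) chart" where
 "ch = (SOME ch. range ch \<subseteq> A \<and> finite (range ch) \<and> (\<forall>p. p \<in> fst (ch p)) \<and> (\<forall>c. {p. ch p = c} \<in> sets borel))"

lemma ch_in: "ch p \<in> A" and finite_ch: "finite (range ch)" and in_ch: "p \<in> fst (ch p)"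
 and sets_ch: "{p. ch p = c} \<in> sets borel"
 using someI_ex[OF finite_chart_cover] unfolding ch_def[symmetric] by blast+

lemma range_ch: "c \<in> range ch ==> c \<in> A"
 using ch_in by blast

definition chinv :: "('a, 'n) chart => real^'n => 'a" where
 "chinv c x = (if x \<in> Om c then chart_inv c x else undefined)"

lemma measurable_chinv [measurable]:
 assumes "c \<in> A"
 shows "chinv c \<in> borel_measurable borel"
proof -
 have "chart_inv c \<in> borel_measurable (restrict_space borel (Om c))"
  by (rule borel_measurable_continuous_on_restrict[OF continuous_chart_inv[OF assms]])
 hence "(\<lambda>x. if x \<in> Om c then chart_inv c x else undefined) \<in> borel_measurable borel"
  using open_Om[OF assms] by (intro measurable_If_restrict_space_iff[THEN iffD2]) auto
 thus ?thesis by (simp add: chinv_def[abs_def])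
qed

definition vdens :: "('a, 'n) chart => real^'n => real" where
 "vdens c x = (if x \<in> Om c then sqrt (det (gmat c x)) else 0)"

lemma continuous_metric_matrix: "c \<in> A ==> continuous_on (Om c) (gmat c)"
 using metric_on_chart smooth_on_continuous_on unfolding metric_on_def by metis

lemma posdef_metric_matrix: "c \<in> A ==> x \<in> Om c ==> posdef (gmat c x)"
 using metric_on_chart unfolding metric_on_def by metis

lemma continuous_on_det_vec:
 fixes M :: "'b::topological_space => real^'m^'m"
 shows "continuous_on S M ==> continuous_on S (\<lambda>x. det (M x))"
 unfolding det_def by (intro continuous_intros)

lemma measurable_vdens [measurable]: "c \<in> A ==> vdens c \<in> borel_measurable borel"
 unfolding vdens_def[abs_def]
 by (intro borel_measurable_open_extension open_Om continuous_intros continuous_on_det_vec continuous_metric_matrix)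

lemma vdens_nonneg: "c \<in> A ==> vdens c x \<ge> 0"
 using posdef_det_pos[OF posdef_metric_matrix, of c x] by (auto simp: vdens_def)

text \<open>The density is cut down to the piece on which \<open>ch\<close> selects the chart
  \<open>c\<close>, so overlapping charts count each point once. The finite counting measure makes
  integrals finite sums of Lebesgue integrals.\<close>

definition vol :: "'a measure" where
 "vol = distr (density (count_space (range ch) \<Otimes>\<^sub>M lborel) (\<lambda>(c, x). ennreal (vdens c x) * indicator {p. ch p = c} (chinv c x)))
  borel (\<lambda>(c, x). chinv c x)"

lemma sets_vol [simp, measurable_cong]: "sets vol = sets borel" and space_vol [simp]: "space vol = UNIV"
 by (simp_all add: vol_def)

lemma measurable_count_space_chart:
 assumes "\<And>c. c \<in> A ==> f c \<in> measurable borel M"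
 shows "(\<lambda>(c, x). f c x) \<in> measurable (count_space (range ch) \<Otimes>\<^sub>M lborel) M"
proof -
 have "countable (range ch)" using finite_ch by (rule countable_finite)
 thus ?thesis
  by (rule measurable_pair_measure_countable1) (use assms range_ch in auto)
qed

lemma nn_integral_vol:
 assumes [measurable]: "f \<in> borel_measurable borel"
 shows "(\<integral>\<^sup>+p. f p \<partial>vol) =
  (\<Sum>c\<in>range ch. (LBNN x. f (chinv c x) * indicator {p. ch p = c} (chinv c x) * ennreal (vdens c x)))"
proof -
 note [measurable] = sets_ch
 have m1: "(\<lambda>(c, x). chinv c x) \<in> measurable (count_space (range ch) \<Otimes>\<^sub>M lborel) borel"
  by (rule measurable_count_space_chart) simp
 have m2: "(\<lambda>(c, x). ennreal (vdens c x) * indicator {p. ch p = c} (chinv c x)) \<in>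
   borel_measurable (count_space (range ch) \<Otimes>\<^sub>M lborel)"
  by (rule measurable_count_space_chart) simp
 have m3: "(\<lambda>(c, x). ennreal (vdens c x) * indicator {p. ch p = c} (chinv c x) * f (chinv c x)) \<in>
   borel_measurable (count_space (range ch) \<Otimes>\<^sub>M lborel)"
  by (rule measurable_count_space_chart) simp
 have "(\<integral>\<^sup>+p. f p \<partial>vol) = (\<integral>\<^sup>+z. (\<lambda>(c, x). ennreal (vdens c x) * indicator {p. ch p = c} (chinv c x) * f (chinv c x)) z
   \<partial>(count_space (range ch) \<Otimes>\<^sub>M lborel))"
  unfolding vol_def
  by (subst nn_integral_distr) (use m1 m2 in \<open>auto simp: nn_integral_density split_beta' intro!: nn_integral_cong\<close>)
 also have "\<dots> = (\<integral>\<^sup>+c. (LBNN x. ennreal (vdens c x) * indicator {p. ch p = c} (chinv c x) * f (chinv c x)) \<partial>count_space (range ch))"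
  by (subst lborel.nn_integral_fst[OF m3, symmetric]) simp
 also have "\<dots> = (\<Sum>c\<in>range ch. (LBNN x. ennreal (vdens c x) * indicator {p. ch p = c} (chinv c x) * f (chinv c x)))"
  by (rule nn_integral_count_space_finite[OF finite_ch])
 finally show ?thesis by (simp only: mult_ac)
qed

text \<open>On each piece of the partition the change of variables is applied to the parametrisation
  read in the chart; by \<open>det_pullback\<close> its Jacobian converts one metric density into
  the other. Applied to chart inverses this shows that \<open>vol\<close> has the required density
  in every chart.\<close>

lemma vol_param:
 assumes ps: "param U ps" "inj_on ps U" "open (ps ` U)" and f[measurable]: "f \<in> borel_measurable borel"
 shows "(LBNN x. f (ps x) * ennreal (sqrt (det (pull_metric ps x))) * indicator U x) =
  (\<integral>\<^sup>+p. f p * indicator (ps ` U) p \<partial>vol)"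
proof -
 note [measurable] = sets_ch
 define V where "V c = {x\<in>U. ps x \<in> fst c}" for c :: "('a, 'n) chart"
 define ph where "ph c x = snd c (ps x)" for c :: "('a, 'n) chart" and x
 define F where "F c y = f (chinv c y) * indicator {p. ch p = c} (chinv c y) * ennreal (vdens c y)" for c y
 have U: "open U" "continuous_on U ps" using ps(1) by (auto simp: param_def)
 have oU[measurable]: "ps ` U \<in> sets borel" using ps(3) by simp
 have part: "(LBNN x. F c (ph c x) * ennreal \<bar>det (matrix (dd (ph c) x))\<bar> * indicator (V c) x) =
   (LBNN y. F c y * indicator (ph c ` V c) y)"
  and sub: "ph c ` V c = {y \<in> Om c. chinv c y \<in> ps ` U}" if c: "c \<in> range ch" for c
 proof -
  have cA: "c \<in> A" by (rule range_ch[OF c])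
  have V: "open (V c)" "smooth_on (V c) (ph c)"
   unfolding V_def ph_def[abs_def] by (rule param_smooth[OF ps(1) cA])+
  show sub: "ph c ` V c = {y \<in> Om c. chinv c y \<in> ps ` U}"
  proof (intro equalityI subsetI)
   fix y assume "y \<in> ph c ` V c"
   then obtain x where x: "x \<in> U" "ps x \<in> fst c" "y = snd c (ps x)" unfolding V_def ph_def by blast
   thus "y \<in> {y \<in> Om c. chinv c y \<in> ps ` U}"
    using chart_inv_chart[OF cA x(2)] by (simp add: chinv_def)
  next
   fix y assume "y \<in> {y \<in> Om c. chinv c y \<in> ps ` U}"
   then obtain x where x: "y \<in> Om c" "x \<in> U" "chart_inv c y = ps x" by (auto simp: chinv_def)
   hence "x \<in> V c" "y = ph c x"
    using chart_inv_in[OF cA x(1)] chart_chart_inv[OF cA x(1)] by (simp_all add: V_def ph_def)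
   thus "y \<in> ph c ` V c" by simp
  qed
  have "inj_on (ph c) (V c)"
  proof (rule inj_onI)
   fix x y assume "x \<in> V c" "y \<in> V c" "ph c x = ph c y"
   thus "x = y" using inj_onD[OF ps(2)] inj_onD[OF inj_on_chart[OF cA]] unfolding V_def ph_def by simp
  qed
  moreover have "open (ph c ` V c)"
  proof -
   have "ph c ` V c = Om c \<inter> chart_inv c -` (ps ` U)" unfolding sub by (auto simp: chinv_def)
   thus ?thesis using continuous_open_preimage[OF continuous_chart_inv[OF cA] open_Om[OF cA] ps(3)] by simp
  qed
  moreover have "F c \<in> borel_measurable borel" unfolding F_def[abs_def] using cA by measurable
  ultimately show "(LBNN x. F c (ph c x) * ennreal \<bar>det (matrix (dd (ph c) x))\<bar> * indicator (V c) x) =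
   (LBNN y. F c y * indicator (ph c ` V c) y)"
   by (intro nn_integral_change_of_variables V)
 qed
 have dens: "F c (ph c x) * ennreal \<bar>det (matrix (dd (ph c) x))\<bar> * indicator (V c) x =
   f (ps x) * ennreal (sqrt (det (pull_metric ps x))) * indicator U x * indicator {p. ch p = c} (ps x)" if c: "c \<in> range ch" for c x
 proof (cases "x \<in> V c")
  case True
  have cA: "c \<in> A" by (rule range_ch[OF c])
  have x: "x \<in> U" "ps x \<in> fst c" using True by (auto simp: V_def)
  have e: "chinv c (ph c x) = ps x" "ph c x \<in> Om c" using x chart_inv_chart[OF cA x(2)] by (auto simp: chinv_def ph_def)
  have "sqrt (det (pull_metric ps x)) = \<bar>det (matrix (dd (ph c) x))\<bar> * vdens c (ph c x)"
   using metric_pullback.det_pullback[OF param_pullback[OF ps(1) cA], of x] x e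
   unfolding ph_def[abs_def] by (simp add: vdens_def real_sqrt_mult)
  thus ?thesis
   using True x vdens_nonneg[OF cA] by (simp add: F_def e ennreal_mult' mult_ac)
 next
  case False
  have "ch (ps x) \<noteq> c \<or> x \<notin> U" using False in_ch[of "ps x"] unfolding V_def by auto
  with False show ?thesis by (auto simp: indicator_def)
 qed
 have M: "(\<lambda>x. f (ps x) * ennreal (sqrt (det (pull_metric ps x))) * indicator U x * indicator {p. ch p = c} (ps x)) \<in> borel_measurable lborel"
  if "c \<in> range ch" for c
 proof -
  have cA: "c \<in> A" by (rule range_ch[OF that])
  have V: "open (V c)" "smooth_on (V c) (ph c)"
   unfolding V_def ph_def[abs_def] by (rule param_smooth[OF ps(1) cA])+
  have [measurable]: "F c \<in> borel_measurable borel" unfolding F_def[abs_def] using cA by measurable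
  have [measurable]: "(\<lambda>x. if x \<in> V c then ph c x else 0) \<in> borel_measurable borel"
   "(\<lambda>x. if x \<in> V c then det (matrix (dd (ph c) x)) else 0) \<in> borel_measurable borel"
   by (intro borel_measurable_open_extension V smooth_on_continuous_on[OF V(2)] smooth_on_continuous_on[OF smooth_on_jacobian[OF V]])+
  have [measurable]: "V c \<in> sets borel" using V(1) by simp
  have "(\<lambda>x. F c (if x \<in> V c then ph c x else 0) * ennreal \<bar>if x \<in> V c then det (matrix (dd (ph c) x)) else 0\<bar> * indicator (V c) x) \<in> borel_measurable borel"
   by measurable
  moreover have "F c (if x \<in> V c then ph c x else 0) * ennreal \<bar>if x \<in> V c then det (matrix (dd (ph c) x)) else 0\<bar> * indicator (V c) x
   = F c (ph c x) * ennreal \<bar>det (matrix (dd (ph c) x))\<bar> * indicator (V c) x" for x by (simp add: indicator_def)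
  ultimately show ?thesis by (simp add: dens[OF that])
 qed
 have "(LBNN x. f (ps x) * ennreal (sqrt (det (pull_metric ps x))) * indicator U x) =
  (LBNN x. (\<Sum>c\<in>range ch. f (ps x) * ennreal (sqrt (det (pull_metric ps x))) * indicator U x * indicator {p. ch p = c} (ps x)))"
 proof (intro nn_integral_cong)
  fix x
  have "(\<Sum>c\<in>range ch. indicator {p. ch p = c} (ps x) :: ennreal) = 1"
   using finite_ch by (simp add: indicator_def)
  thus "f (ps x) * ennreal (sqrt (det (pull_metric ps x))) * indicator U x =
   (\<Sum>c\<in>range ch. f (ps x) * ennreal (sqrt (det (pull_metric ps x))) * indicator U x * indicator {p. ch p = c} (ps x))"
   by (simp add: sum_distrib_left[symmetric])
 qed
 also have "\<dots> = (\<Sum>c\<in>range ch. (LBNN x. f (ps x) * ennreal (sqrt (det (pull_metric ps x))) * indicator U x * indicator {p. ch p = c} (ps x)))"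
  by (rule nn_integral_sum[OF M])
 also have "\<dots> = (\<Sum>c\<in>range ch. (LBNN y. F c y * indicator (ph c ` V c) y))"
  by (intro sum.cong refl) (simp add: dens[symmetric] part)
 also have "\<dots> = (\<Sum>c\<in>range ch. (LBNN x. (f (chinv c x) * indicator (ps ` U) (chinv c x)) * indicator {p. ch p = c} (chinv c x) * ennreal (vdens c x)))"
 proof (intro sum.cong refl nn_integral_cong)
  fix c y assume c: "c \<in> range ch"
  show "F c y * indicator (ph c ` V c) y = (f (chinv c y) * indicator (ps ` U) (chinv c y)) * indicator {p. ch p = c} (chinv c y) * ennreal (vdens c y)"
   by (simp add: sub[OF c] F_def vdens_def indicator_def)
 qed
 also have "\<dots> = (\<integral>\<^sup>+p. f p * indicator (ps ` U) p \<partial>vol)"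
  by (rule nn_integral_vol[symmetric]) measurable
 finally show ?thesis .
qed

lemma chart_inv_image: "c \<in> A ==> chart_inv c ` Om c = fst c"
 using chart_homeo by (auto simp: homeomorphism_def)

lemma inj_on_chart_inv: "c \<in> A ==> inj_on (chart_inv c) (Om c)"
 by (metis chart_chart_inv inj_onI)

lemma vol_chart:
 assumes c: "c \<in> A" and f: "f \<in> borel_measurable borel"
 shows "(LBNN x. f (chart_inv c x) * ennreal (sqrt (det (gmat c x))) * indicator (Om c) x) =
  (\<integral>\<^sup>+p. f p * indicator (fst c) p \<partial>vol)"
 unfolding metric_matrix_eq_pull
 using vol_param[OF param_chart_inv[OF c] inj_on_chart_inv[OF c] _ f] open_dom[OF c] by (simp add: chart_inv_image[OF c])

lemma emeasure_vol_chart: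
 assumes c: "c \<in> A" and S: "S \<in> sets borel" "S \<subseteq> fst c"
 shows "emeasure vol S = (LBNN x. ennreal (sqrt (det (gmat c x))) * indicator (snd c ` S) x)"
proof -
 have "emeasure vol S = (\<integral>\<^sup>+p. indicator S p * indicator (fst c) p \<partial>vol)"
 proof -
  have "emeasure vol S = (\<integral>\<^sup>+p. indicator S p \<partial>vol)" using S(1) by simp
  also have "\<dots> = (\<integral>\<^sup>+p. indicator S p * indicator (fst c) p \<partial>vol)"
   using S(2) by (intro nn_integral_cong) (auto simp: indicator_def)
  finally show ?thesis .
 qed
 also have "\<dots> = (LBNN x. indicator S (chart_inv c x) * ennreal (sqrt (det (gmat c x))) * indicator (Om c) x)"
  using vol_chart[OF c, of "indicator S"] S by simp
 also have "\<dots> = (LBNN x. ennreal (sqrt (det (gmat c x))) * indicator (snd c ` S) x)"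
 proof (intro nn_integral_cong)
  fix x
  have "x \<in> snd c ` S \<longleftrightarrow> x \<in> Om c \<and> chart_inv c x \<in> S"
  proof
   assume "x \<in> snd c ` S"
   then obtain p where "p \<in> S" "x = snd c p" by blast
   thus "x \<in> Om c \<and> chart_inv c x \<in> S" using S(2) chart_inv_chart[OF c, of p] by auto
  next
   assume "x \<in> Om c \<and> chart_inv c x \<in> S"
   thus "x \<in> snd c ` S" using chart_chart_inv[OF c, of x] by (metis imageI)
  qed
  thus "indicator S (chart_inv c x) * ennreal (sqrt (det (gmat c x))) * indicator (Om c) x =
   ennreal (sqrt (det (gmat c x))) * indicator (snd c ` S) x"
   by (cases "x \<in> Om c"; cases "chart_inv c x \<in> S") simp_all
 qed
 finally show ?thesis .
qed

text \<open>The definition prescribes the measure inside every chart. Uniqueness comes from cutting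
  a Borel set along the finite partition, each piece of which lies in one chart.\<close>

lemma volume_measure_eq: "volume_measure A g = vol"
 unfolding volume_measure_def
proof (rule the_equality)
 show "sets vol = sets borel \<and> (\<forall>c\<in>A. \<forall>S\<in>sets borel. S \<subseteq> fst c \<longrightarrow> emeasure vol S =
   (LBNN x. ennreal (sqrt (det (gmat c x))) * indicator (snd c ` S) x))"
  using emeasure_vol_chart by simp
next
 fix \<mu> :: "'a measure"
 assume \<mu>: "sets \<mu> = sets borel \<and> (\<forall>c\<in>A. \<forall>S\<in>sets borel. S \<subseteq> fst c \<longrightarrow> emeasure \<mu> S =
   (LBNN x. ennreal (sqrt (det (gmat c x))) * indicator (snd c ` S) x))"
 have split: "emeasure \<nu> S = (\<Sum>c\<in>range ch. emeasure \<nu> (S \<inter> {p. ch p = c}))"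
  if S: "S \<in> sets borel" and \<nu>: "sets \<nu> = sets borel" for \<nu> :: "'a measure" and S
 proof -
  have "S = (\<Union>c\<in>range ch. S \<inter> {p. ch p = c})" by auto
  hence "emeasure \<nu> S = emeasure \<nu> (\<Union>c\<in>range ch. S \<inter> {p. ch p = c})" by simp
  also have "\<dots> = (\<Sum>c\<in>range ch. emeasure \<nu> (S \<inter> {p. ch p = c}))"
   by (rule sum_emeasure[symmetric]) (use S \<nu> sets_ch finite_ch in \<open>auto simp: disjoint_family_on_def\<close>)
  finally show ?thesis .
 qed
 show "\<mu> = vol"
 proof (rule measure_eqI)
  fix S assume "S \<in> sets \<mu>"
  hence S: "S \<in> sets borel" using \<mu> by simp
  have "emeasure \<mu> (S \<inter> {p. ch p = c}) = emeasure vol (S \<inter> {p. ch p = c})" if c: "c \<in> range ch" for c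
  proof -
   have "S \<inter> {p. ch p = c} \<in> sets borel" "S \<inter> {p. ch p = c} \<subseteq> fst c"
    using S sets_ch in_ch by auto
   thus ?thesis using \<mu> emeasure_vol_chart[OF range_ch[OF c]] range_ch[OF c] by simp
  qed
  thus "emeasure \<mu> S = emeasure vol S"
   using split[OF S] \<mu> by simp
 qed (use \<mu> in simp)
qed

lemma chart_neighbourhood:
 fixes B :: "real^'n => real"
 assumes c: "c \<in> A" "p \<in> fst c" and B: "continuous_on (Om c) B"
 obtains e b where "e > 0" "cball (snd c p) e \<subseteq> Om c" "open (chart_inv c ` ball (snd c p) e)" "p \<in> chart_inv c ` ball (snd c p) e"
  "\<And>x. x \<in> ball (snd c p) e ==> B x \<le> b"
proof -
 obtain e where e: "e > 0" "cball (snd c p) e \<subseteq> Om c" using open_Om[OF c(1)] c(2) open_contains_cball by blast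
 have "compact (B ` cball (snd c p) e)"
  using compact_continuous_image[OF continuous_on_subset[OF B e(2)]] by simp
 then obtain b where b: "\<And>y. y \<in> B ` cball (snd c p) e ==> y \<le> b"
  using compact_imp_bounded bounded_has_Sup(1) e(1) by (metis bounded_imp_bdd_above bdd_above.E)
 have "chart_inv c ` ball (snd c p) e = fst c \<inter> snd c -` ball (snd c p) e"
 proof (intro equalityI subsetI)
  fix q assume "q \<in> chart_inv c ` ball (snd c p) e"
  then obtain x where x: "x \<in> ball (snd c p) e" "q = chart_inv c x" by blast
  hence "x \<in> Om c" using e(2) ball_subset_cball by blast
  thus "q \<in> fst c \<inter> snd c -` ball (snd c p) e"
   using x chart_inv_in[OF c(1)] chart_chart_inv[OF c(1)] by simp
 next
  fix q assume q: "q \<in> fst c \<inter> snd c -` ball (snd c p) e"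
  hence "q = chart_inv c (snd c q)" using chart_inv_chart[OF c(1)] by simp
  thus "q \<in> chart_inv c ` ball (snd c p) e" using q by blast
 qed
 moreover have "open (fst c \<inter> snd c -` ball (snd c p) e)"
  by (rule continuous_open_preimage[OF continuous_chart[OF c(1)] open_dom[OF c(1)]]) simp
 ultimately have "open (chart_inv c ` ball (snd c p) e)" "p \<in> chart_inv c ` ball (snd c p) e"
  using c(2) e(1) by auto
 thus ?thesis by (rule that[OF e]) (use b ball_subset_cball in blast)
qed

lemma finite_measure_vol: "finite_measure vol"
proof
 have "(UNIV :: 'a set) \<in> sets borel \<and> emeasure vol UNIV < \<infinity>"
 proof (rule compact_UNIV_local[OF compact_UNIV, where P = "\<lambda>S. S \<in> sets borel \<and> emeasure vol S < \<infinity>"])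
  fix p
  obtain c where c: "c \<in> A" "p \<in> fst c" using chart_exists by blast
  have "continuous_on (Om c) (\<lambda>x. sqrt (det (gmat c x)))"
   by (intro continuous_intros continuous_on_det_vec continuous_metric_matrix c)
  from chart_neighbourhood[OF c this]
  obtain e b where e: "e > 0" "cball (snd c p) e \<subseteq> Om c" "open (chart_inv c ` ball (snd c p) e)" "p \<in> chart_inv c ` ball (snd c p) e"
   "\<And>x. x \<in> ball (snd c p) e ==> sqrt (det (gmat c x)) \<le> b" by metis
  let ?N = "chart_inv c ` ball (snd c p) e"
  have sub: "ball (snd c p) e \<subseteq> Om c" using e(2) ball_subset_cball by blast
  have img: "snd c ` ?N = ball (snd c p) e"
  proof -
   have "snd c ` ?N = (\<lambda>x. snd c (chart_inv c x)) ` ball (snd c p) e" by (simp add: image_image)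
   also have "\<dots> = ball (snd c p) e" using sub chart_chart_inv[OF c(1)] by (simp add: subset_iff image_def)
   finally show ?thesis .
  qed
  have "emeasure vol ?N = (LBNN x. ennreal (sqrt (det (gmat c x))) * indicator (snd c ` ?N) x)"
   by (rule emeasure_vol_chart[OF c(1)]) (use e(3) sub chart_inv_in[OF c(1)] in auto)
  also have "\<dots> \<le> (LBNN x. ennreal b * indicator (ball (snd c p) e) x)"
   unfolding img by (intro nn_integral_mono) (use e(5) in \<open>auto simp: indicator_def intro: ennreal_leI\<close>)
  also have "\<dots> = ennreal b * emeasure lborel (ball (snd c p) e)" by (simp add: nn_integral_cmult_indicator)
  also have "\<dots> < \<infinity>" using emeasure_lborel_ball_finite[of "snd c p" e] by (simp add: ennreal_mult_less_top)
  finally show "\<exists>N. open N \<and> p \<in> N \<and> N \<in> sets borel \<and> emeasure vol N < \<infinity>"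
   using e(3,4) by (intro exI[of _ ?N]) auto
 next
  fix S T assume a: "S \<in> sets borel \<and> emeasure vol S < \<infinity>" "T \<in> sets borel \<and> emeasure vol T < \<infinity>"
  have "emeasure vol (S \<union> T) \<le> emeasure vol S + emeasure vol T"
   by (rule emeasure_subadditive) (use a in auto)
  also have "\<dots> < \<infinity>" using a by simp
  finally show "S \<union> T \<in> sets borel \<and> emeasure vol (S \<union> T) < \<infinity>" using a by auto
 qed simp
 thus "emeasure vol (space vol) \<noteq> \<infinity>" by simp
qed

text \<open>Used to pass from almost every point to every point in the equality case, and for the
  positivity of the total volume.\<close>

lemma emeasure_vol_open_pos:
 assumes "open S" "p \<in> S"
 shows "emeasure vol S > 0"
proof -
 obtain c where c: "c \<in> A" "p \<in> fst c" using chart_exists by blast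
 define T where "T = S \<inter> fst c"
 have T: "open T" "p \<in> T" "T \<subseteq> fst c" "T \<subseteq> S" using assms c open_dom[OF c(1)] by (auto simp: T_def)
 have "snd c ` T = Om c \<inter> chart_inv c -` T"
 proof (intro equalityI subsetI)
  fix x assume "x \<in> snd c ` T"
  then obtain q where q: "q \<in> T" "x = snd c q" by blast
  thus "x \<in> Om c \<inter> chart_inv c -` T" using T(3) chart_inv_chart[OF c(1), of q] by auto
 next
  fix x assume "x \<in> Om c \<inter> chart_inv c -` T"
  thus "x \<in> snd c ` T" using chart_chart_inv[OF c(1), of x] by (metis IntD1 IntD2 image_eqI vimageE)
 qed
 hence o: "open (snd c ` T)"
  using continuous_open_preimage[OF continuous_chart_inv[OF c(1)] open_Om[OF c(1)] T(1)] by simp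
 have "emeasure vol T \<noteq> 0"
 proof
  assume "emeasure vol T = 0"
  hence "(LBNN x. ennreal (sqrt (det (gmat c x))) * indicator (snd c ` T) x) = 0"
   using emeasure_vol_chart[OF c(1) _ T(3)] T(1) by simp
  moreover have "ennreal (sqrt (det (gmat c x))) * indicator (snd c ` T) x =
   ennreal (vdens c x) * indicator (snd c ` T) x" for x
   using T(3) by (auto simp: vdens_def indicator_def)
  ultimately have "(LBNN x. ennreal (vdens c x) * indicator (snd c ` T) x) = 0" by simp
  moreover have "(\<lambda>x. ennreal (vdens c x) * indicator (snd c ` T) x) \<in> borel_measurable lborel"
   using c(1) borel_open[OF o] by measurable
  ultimately have "AE x in lborel. ennreal (vdens c x) * indicator (snd c ` T) x = 0"
   using nn_integral_0_iff_AE by blast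
  moreover have pos: "vdens c x > 0" if "x \<in> snd c ` T" for x
  proof -
   have "x \<in> Om c" using that T(3) by blast
   thus ?thesis using posdef_det_pos[OF posdef_metric_matrix[OF c(1)]] by (simp add: vdens_def)
  qed
  ultimately have "AE x in lborel. x \<notin> snd c ` T"
  proof (elim eventually_mono)
   fix x assume "ennreal (vdens c x) * indicator (snd c ` T) x = 0"
   thus "x \<notin> snd c ` T" using pos[of x] by (cases "x \<in> snd c ` T") (simp_all add: ennreal_eq_0_iff not_le)
  qed
  hence "snd c ` T \<in> null_sets lborel" using borel_open[OF o] by (simp add: AE_iff_null_sets)
  hence "negligible (snd c ` T)" by (simp add: negligible_iff_null_sets null_sets_completionI)
  hence "snd c ` T = {}" using open_not_negligible[OF o] by blast
  thus False using T(2) by simp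
 qed
 thus ?thesis using emeasure_mono[OF T(4), of vol] assms(1) by (auto simp: zero_less_iff_neq_zero)
qed

end

section \<open>Measurability on the tangent bundle\<close>

text \<open>Derivatives as limits along one fixed sequence: the derivative of a measurable family is
  then measurable in all its parameters, where joint differentiability is not at hand.\<close>

lemma difference_quotient_limit:
 fixes f :: "'a::real_normed_vector => 'b::real_normed_vector"
 assumes "(f has_derivative D) (at y)"
 shows "(\<lambda>n. real (Suc n) *R (f (y + (1 / real (Suc n)) *R w) - f y)) \<longlonglongrightarrow> D w"
proof (cases "w = 0")
 case True
 thus ?thesis using bounded_linear.linear[OF has_derivative_bounded_linear[OF assms]] by (simp add: linear_0)
next
 case False
 define h where "h n = (1 / real (Suc n)) *R w" for n
 have lin: "linear D" using bounded_linear.linear[OF has_derivative_bounded_linear[OF assms]] .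
 have "(\<lambda>n. 1 / real (Suc n)) \<longlonglongrightarrow> 0" using LIMSEQ_inverse_real_of_nat by (simp add: inverse_eq_divide)
 hence "(\<lambda>n. (1 / real (Suc n)) *R w) \<longlonglongrightarrow> 0 *R w" by (intro tendsto_intros)
 hence h: "filterlim h (at 0) sequentially"
  unfolding h_def[abs_def] filterlim_at using False by auto
 have "((\<lambda>z. norm (f (y + z) - f y - D z) / norm z) \<longlongrightarrow> 0) (at 0)"
  using assms unfolding has_derivative_at by simp
 from tendsto_mult_right_zero[OF filterlim_compose[OF this h], of "norm w"]
 have "(\<lambda>n. norm (f (y + h n) - f y - D (h n)) / norm (h n) * norm w) \<longlonglongrightarrow> 0" by (simp add: mult.commute)
 moreover have "norm (f (y + h n) - f y - D (h n)) / norm (h n) * norm w = norm (real (Suc n) *R (f (y + h n) - f y) - D w)" for n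
 proof -
  have "D w = real (Suc n) *R D (h n)" unfolding h_def linear_scale[OF lin] by simp
  hence "real (Suc n) *R (f (y + h n) - f y) - D w = real (Suc n) *R (f (y + h n) - f y - D (h n))"
   by (simp add: scaleR_diff_right)
  moreover have "norm (h n) = norm w / real (Suc n)" by (simp add: h_def)
  ultimately show ?thesis using False by simp
 qed
 ultimately have "(\<lambda>n. norm (real (Suc n) *R (f (y + h n) - f y) - D w)) \<longlonglongrightarrow> 0" by simp
 from LIM_zero_cancel[OF tendsto_norm_zero_cancel[OF this]] show ?thesis by (simp only: h_def)
qed

lemma borel_measurable_vec_nth [measurable (raw)]:
 assumes "f \<in> borel_measurable M"
 shows "(\<lambda>x. (f x :: real^'n) $ i) \<in> borel_measurable M"
 by (rule measurable_compose[OF assms borel_measurable_continuous_onI]) (intro continuous_intros)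

lemma borel_measurable_det_entries:
 assumes [measurable]: "\<And>i j. (\<lambda>x. f x i j) \<in> borel_measurable M"
 shows "(\<lambda>x. det (\<chi> i j. f x i j) :: real) \<in> borel_measurable M"
 unfolding det_def vec_lambda_beta by measurable

lemma form_entries: "form M a b = (\<Sum>k\<in>UNIV. \<Sum>l\<in>UNIV. a $ k * M $ k $ l * b $ l)"
 for M :: "real^'n^'n"
 by (simp add: inner_vec_def matrix_vector_mult_def sum_distrib_left mult.assoc)

lemma riem_eq_riemv: "riem h l i j k x = riemv h x (axis i 1) (axis j 1) (axis k 1) $ l"
proof -
 have "riemv h x (axis i 1) (axis j 1) (axis k 1) $ l = (\<Sum>a\<in>UNIV. axis i 1 $ a *
  (\<Sum>b\<in>UNIV. axis j 1 $ b * (\<Sum>c\<in>UNIV. axis k 1 $ c * riem h l a b c x)))"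
  by (simp add: riemv_def sum_distrib_left mult_ac)
 thus ?thesis by (simp add: axis_def if_distrib[of "\<lambda>b. b * _"] cong: if_cong)
qed

lemma continuous_on_ricq:
 assumes "metric_on U h"
 shows "continuous_on (U \<times> UNIV) (\<lambda>(x, u). ricq h x u)"
proof -
 have [continuous_intros]: "continuous_on (U \<times> UNIV) (\<lambda>z. riem h l i j k (fst z))" for l i j k
 proof -
  have "continuous_on U (riem h l i j k)"
   unfolding riem_eq_riemv[abs_def]
   by (intro continuous_intros smooth_on_continuous_on smooth_on_riemv assms)
  thus ?thesis by (rule continuous_on_compose2[OF _ continuous_on_fst[OF continuous_on_id]]) auto
 qed
 have "riemv h x (axis i 1) u u $ i = (\<Sum>m\<in>UNIV. axis i 1 $ m * (\<Sum>j\<in>UNIV. \<Sum>k\<in>UNIV. riem h i m j k x * u $ j * u $ k))" for x u i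
  by (simp add: riemv_def sum_distrib_left mult_ac)
 hence "riemv h x (axis i 1) u u $ i = (\<Sum>j\<in>UNIV. \<Sum>k\<in>UNIV. riem h i i j k x * u $ j * u $ k)" for x u i
  by (simp add: axis_def if_distrib[of "\<lambda>b. b * _"] cong: if_cong)
 hence "ricq h x u = (\<Sum>i\<in>UNIV. \<Sum>j\<in>UNIV. \<Sum>k\<in>UNIV. riem h i i j k x * u $ j * u $ k)" for x u
  by (simp add: ricq_def trace_def matrix_def)
 thus ?thesis by (simp add: split_beta') (intro continuous_intros)
qed

context closed_manifold
begin

text \<open>Coordinates of the chart \<open>ch p\<close> trivialise the tangent bundle in a Borel
  way. Frames cannot take this role, since they come from \<open>SOME\<close>.\<close>

definition tv :: "'a => real^'n => ('a, 'n) tangent_vector" where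
 "tv p u = cvec (ch p) (snd (ch p) p) u"

definition kap :: "'a => real^'n^'n" where
 "kap p = gmat (ch p) (snd (ch p) p)"

lemma ch_coord: "snd (ch p) p \<in> Om (ch p)" "chart_inv (ch p) (snd (ch p) p) = p"
 using in_ch chart_inv_chart[OF ch_in] by auto

lemma tv_in: "tv p u \<in> TS p"
 using coord_vector_in[OF ch_in ch_coord(1)] by (simp add: tv_def ch_coord)

lemma tv_ch: "tv p u (ch p) = u"
 using coord_vector_apply[OF ch_in ch_coord(1)] by (simp add: tv_def)

lemma tv_of: "V \<in> TS p ==> tv p (V (ch p)) = V"
 using coord_vector_of[OF ch_in in_ch] by (simp add: tv_def)

lemma tv_linear: "linear (\<lambda>u. tv p u c)"
 using coord_vector_linear[OF ch_in ch_coord(1)] by (simp add: tv_def)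

lemma tv_form: "g p (tv p u) (tv p w) = form (kap p) u w"
 using metric_matrix_form[OF ch_in ch_coord(1)] by (simp add: tv_def kap_def ch_coord)

lemma posdef_kap: "posdef (kap p)"
 unfolding kap_def by (rule posdef_metric_matrix[OF ch_in ch_coord(1)])

lemma borel_measurable_chartwise:
 fixes f :: "'a => 'm::second_countable_topology => 'b::topological_space"
 assumes F: "\<And>c. c \<in> A ==> continuous_on (Om c \<times> UNIV) (\<lambda>(x, u). F c x u)"
  and f: "\<And>p u. f p u = F (ch p) (snd (ch p) p) u"
 shows "(\<lambda>(p, u). f p u) \<in> borel_measurable borel"
proof (rule measurable_piecewise_restrict)
 let ?C = "(\<lambda>c. {p. ch p = c} \<times> (UNIV :: 'm set)) ` range ch"
 show "countable ?C" using countable_finite[OF finite_ch] by simp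
 show "space borel \<subseteq> \<Union>?C" by auto
 fix X assume "X \<in> ?C"
 then obtain c where c: "c \<in> range ch" and X: "X = {p. ch p = c} \<times> (UNIV :: 'm set)" by blast
 have cA: "c \<in> A" by (rule range_ch[OF c])
 have "X \<in> sets (borel \<Otimes>\<^sub>M borel)" unfolding X by (rule pair_measureI[OF sets_ch]) simp
 thus "X \<inter> space borel \<in> sets borel" by (simp only: borel_prod space_borel Int_UNIV_right)
 have "continuous_on X (\<lambda>z. (snd c (fst z), snd z))"
 proof -
  have "continuous_on X (\<lambda>z. snd c (fst z))"
   by (rule continuous_on_compose2[OF continuous_chart[OF cA] continuous_on_fst[OF continuous_on_id]])
    (use in_ch in \<open>auto simp: X\<close>)
  thus ?thesis by (intro continuous_intros)
 qed
 moreover have "(\<lambda>z. (snd c (fst z), snd z)) ` X \<subseteq> Om c \<times> UNIV"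
  using in_ch by (force simp: X)
 ultimately have "continuous_on X (\<lambda>z. (\<lambda>(x, u). F c x u) (snd c (fst z), snd z))"
  by (rule continuous_on_compose2[OF F[OF cA]])
 hence meas: "(\<lambda>z. F c (snd c (fst z)) (snd z)) \<in> borel_measurable (restrict_space borel X)"
  by (simp add: borel_measurable_continuous_on_restrict)
 have eq: "F c (snd c (fst z)) (snd z) = (\<lambda>(p, u). f p u) z" if "z \<in> space (restrict_space borel X)" for z
  using that by (auto simp: X f space_restrict_space)
 show "(\<lambda>(p, u). f p u) \<in> borel_measurable (restrict_space borel X)"
  by (rule measurable_cong[THEN iffD1, OF _ meas]) (rule eq)
qed

definition E :: "'a => real^'n => 'a" where "E p u = expm p (tv p u)"

lemma measurable_E: "(\<lambda>(p, u). E p u) \<in> borel_measurable borel"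
 by (rule borel_measurable_chartwise[OF continuous_exp_map]) (simp_all add: E_def tv_def ch_coord)

lemma measurable_ric_tv: "(\<lambda>(p, u). ric p (tv p u)) \<in> borel_measurable borel"
proof (rule borel_measurable_chartwise)
 show "continuous_on (Om c \<times> UNIV) (\<lambda>(x, u). ricq (gmat c) x u)" if "c \<in> A" for c
  by (rule continuous_on_ricq[OF metric_on_chart[OF that]])
 show "ric p (tv p u) = ricq (gmat (ch p)) (snd (ch p) p) u" for p u
  using ric_chart[OF ch_in in_ch tv_in, of p u] by (simp add: tv_ch)
qed

lemma measurable_fst_function:
 assumes "(\<lambda>(p, u :: real^'n). f p) \<in> borel_measurable borel"
 shows "f \<in> borel_measurable borel"
proof -
 have "(\<lambda>p. (p, 0 :: real^'n)) \<in> borel \<rightarrow>\<^sub>M borel"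
  by (intro borel_measurable_continuous_onI continuous_intros)
 from measurable_compose[OF this assms] show ?thesis by simp
qed

lemma measurable_kap: "(\<lambda>p. kap p $ i $ j) \<in> borel_measurable borel"
proof (rule measurable_fst_function, rule borel_measurable_chartwise)
 show "continuous_on (Om c \<times> UNIV) (\<lambda>(x, u). gmat c x $ i $ j)" if "c \<in> A" for c
 proof -
  have "continuous_on (Om c \<times> UNIV) (\<lambda>z. gmat c (fst z))"
   by (rule continuous_on_compose2[OF continuous_metric_matrix[OF that] continuous_on_fst[OF continuous_on_id]]) auto
  thus ?thesis by (simp add: split_beta') (intro continuous_intros)
 qed
qed (simp add: kap_def)

lemma measurable_det_kap: "(\<lambda>p. det (kap p)) \<in> borel_measurable borel"
 using borel_measurable_det_entries[of "\<lambda>p i j. kap p $ i $ j", OF measurable_kap] by simp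

text \<open>The passage from chart coordinates to frame coordinates. Nothing is known about its
  measurability in \<open>p\<close>; it enters through invariants such as lengths and the square of
  its determinant, which depend on \<open>kap\<close> alone.\<close>

definition fr :: "'a => real^'n => real^'n" where "fr p u = inv (frm p) (tv p u)"

lemma frame_fr: "frm p (fr p u) = tv p u"
 unfolding fr_def using frame_surj[OF tv_in] by (metis f_inv_into_f rangeI)

lemma fr_frame: "fr p (frm p y (ch p)) = y"
 by (simp add: fr_def tv_of[OF frame_in] inv_frame)

lemma linear_fr: "linear (fr p)"
proof (rule linearI)
 show "fr p (u + w) = fr p u + fr p w" for u w
 proof -
  have "frm p (fr p (u + w)) c = frm p (fr p u + fr p w) c" for c
   by (simp add: frame_fr linear_add[OF frame_linear] linear_add[OF tv_linear])
  thus ?thesis by (rule frame_inj[THEN iffD1, OF ext])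
 qed
 show "fr p (a *R u) = a *R fr p u" for a u
 proof -
  have "frm p (fr p (a *R u)) c = frm p (a *R fr p u) c" for c
   by (simp add: frame_fr linear_scale[OF frame_linear] linear_scale[OF tv_linear])
  thus ?thesis by (rule frame_inj[THEN iffD1, OF ext])
 qed
qed

lemma fr_form: "fr p u \<bullet> fr p w = form (kap p) u w"
 using frame_isometry[of p "fr p u" "fr p w"] by (simp add: frame_fr tv_form)

lemma bij_fr: "bij (fr p)"
proof (rule bijI)
 show "surj (fr p)" by (rule surjI[of _ "\<lambda>y. frm p y (ch p)"]) (rule fr_frame)
 show "inj (fr p)"
  by (metis frame_fr tv_ch injI)
qed

lemma fr_matrix: "matrix (fr p) *v u = fr p u"
 by (rule matrix_works) (simp add: linear_fr linear_matrix_vector_mul_eq)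

lemma matrix_eqI_form:
 fixes M N :: "real^'n^'n"
 assumes "\<And>a b. form M a b = form N a b"
 shows "M = N"
 unfolding matrix_eq using assms by (metis inner_commute vector_eq_rdot)

lemma det_kap: "det (kap p) = (det (matrix (fr p)))^2"
proof -
 have "kap p = transpose (matrix (fr p)) ** matrix (fr p)"
 proof (rule matrix_eqI_form)
  fix a b
  have "form (transpose (matrix (fr p)) ** matrix (fr p)) a b = form (transpose (matrix (fr p))) a (fr p b)"
   by (simp only: matrix_vector_mul_assoc[symmetric] fr_matrix)
  also have "\<dots> = (matrix (fr p) *v a) \<bullet> fr p b" 
   by (metis dot_lmul_matrix inner_commute transpose_matrix_vector)
  finally show "form (kap p) a b = form (transpose (matrix (fr p)) ** matrix (fr p)) a b"
   by (simp add: fr_form fr_matrix)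
 qed
 thus ?thesis by (simp add: det_mul power2_eq_square)
qed

lemma det_fr_nz: "det (matrix (fr p)) \<noteq> 0"
 using posdef_det_pos[OF posdef_kap[of p]] by (auto simp: det_kap)

lemma E_fr: "E p u = Ex p (fr p u)"
 by (simp add: E_def frame_fr)

section \<open>Borel versions of the exponential differential, of the volume density and of
  \<open>tau\<close>\<close>

definition coord_of :: "('a, 'n) chart => 'a => real^'n" where
 "coord_of d q = (if q \<in> fst d then snd d q else 0)"

lemma measurable_coord_of [measurable]: "d \<in> A ==> coord_of d \<in> borel_measurable borel"
 unfolding coord_of_def[abs_def]
 by (intro borel_measurable_open_extension open_dom continuous_chart)

text \<open>A coordinate derivative of the exponential map in the vector variable. Both
  \<open>lim\<close> and \<open>coord_of\<close> are total, so measurability holds everywhere, while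
  the value is identified with the derivative inside the ball and the chart
  (\<open>expd_eq\<close>).\<close>

definition expd :: "('a, 'n) chart => 'n => 'a => real^'n => real^'n" where
 "expd d j p u = lim (\<lambda>n. real (Suc n) *R (coord_of d (E p (u + (1 / real (Suc n)) *R axis j 1)) - coord_of d (E p u)))"

lemma measurable_E_shift:
 fixes L :: "real^'n => real^'n"
 assumes "continuous_on UNIV L"
 shows "(\<lambda>(p, u). E p (L u)) \<in> borel_measurable borel"
proof -
 have "(\<lambda>z :: 'a \<times> (real^'n). (fst z, L (snd z))) \<in> borel \<rightarrow>\<^sub>M borel"
  by (intro borel_measurable_continuous_onI continuous_intros continuous_on_compose2[OF assms]) auto
 from measurable_compose[OF this measurable_E] show ?thesis by (simp add: split_beta')
qed

lemma measurable_expd: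
 assumes d: "d \<in> A"
 shows "(\<lambda>(p, u). expd d j p u) \<in> borel_measurable borel"
proof -
 have [measurable]: "(\<lambda>z. E (fst z) (snd z + (1 / real (Suc n)) *R axis j 1)) \<in> borel_measurable borel" for n
  using measurable_E_shift[of "\<lambda>u. u + (1 / real (Suc n)) *R axis j 1"] by (simp add: split_beta' continuous_intros)
 have [measurable]: "(\<lambda>z. E (fst z) (snd z)) \<in> borel_measurable borel"
  using measurable_E by (simp add: split_beta')
 show ?thesis
  unfolding expd_def split_beta' using measurable_coord_of[OF d] by measurable
qed

lemma expd_eq:
 assumes p: "diffeo p rh" "norm (fr p u) < rh" and d: "d \<in> A" "E p u \<in> fst d"
 shows "expd d j p u = dd (\<lambda>y. snd d (Ex p y)) (fr p u) (fr p (axis j 1))"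
proof -
 note P = exp_diffeo_param[OF p(1)]
 let ?V = "{y \<in> ball 0 rh. Ex p y \<in> fst d}"
 have V: "open ?V" "smooth_on ?V (\<lambda>y. snd d (Ex p y))" by (rule param_smooth[OF P(1) d(1)])+
 have y: "fr p u \<in> ?V" using p(2) d(2) by (simp add: E_fr)
 let ?y = "\<lambda>n. fr p u + (1 / real (Suc n)) *R fr p (axis j 1)"
 have l: "(\<lambda>n. real (Suc n) *R (snd d (Ex p (?y n)) - snd d (Ex p (fr p u)))) \<longlonglongrightarrow>
   dd (\<lambda>y. snd d (Ex p y)) (fr p u) (fr p (axis j 1))"
  by (rule difference_quotient_limit[OF smooth_on_has_derivative[OF V(2) y]])
 have "(\<lambda>n. 1 / real (Suc n)) \<longlonglongrightarrow> 0" using LIMSEQ_inverse_real_of_nat by (simp add: inverse_eq_divide)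
 hence "?y \<longlonglongrightarrow> fr p u + 0 *R fr p (axis j 1)" by (intro tendsto_intros)
 hence "eventually (\<lambda>n. ?y n \<in> ?V) sequentially" by (intro topological_tendstoD V(1)) (use y in simp_all)
 moreover have e: "E p (u + (1 / real (Suc n)) *R axis j 1) = Ex p (?y n)" for n
  by (simp only: E_fr linear_add[OF linear_fr] linear_scale[OF linear_fr])
 ultimately have "eventually (\<lambda>n. real (Suc n) *R (snd d (Ex p (?y n)) - snd d (Ex p (fr p u))) =
   real (Suc n) *R (coord_of d (E p (u + (1 / real (Suc n)) *R axis j 1)) - coord_of d (E p u))) sequentially"
 proof (elim eventually_mono)
  fix n assume "?y n \<in> ?V"
  thus "real (Suc n) *R (snd d (Ex p (?y n)) - snd d (Ex p (fr p u))) =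
   real (Suc n) *R (coord_of d (E p (u + (1 / real (Suc n)) *R axis j 1)) - coord_of d (E p u))"
   unfolding e using y by (simp add: coord_of_def E_fr)
 qed
 hence "(\<lambda>n. real (Suc n) *R (coord_of d (E p (u + (1 / real (Suc n)) *R axis j 1)) - coord_of d (E p u)))
  \<longlonglongrightarrow> dd (\<lambda>y. snd d (Ex p y)) (fr p u) (fr p (axis j 1))"
  using l by (rule Lim_transform_eventually[rotated])
 thus ?thesis unfolding expd_def by (rule limI)
qed

text \<open>An entry of the metric pulled back by the exponential map, in the chart coordinates at
  \<open>p\<close>. The indicator picks the chart selected at the end point \<open>E p u\<close>, so
  all ingredients are Borel.\<close>

definition pm :: "'a => real^'n => 'n => 'n => real" where
 "pm p u i j = (\<Sum>d\<in>range ch. indicator {q. ch q = d} (E p u) * (\<Sum>k\<in>UNIV. \<Sum>l\<in>UNIV. expd d i p u $ k *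
  (if coord_of d (E p u) \<in> Om d then gmat d (coord_of d (E p u)) $ k $ l else 0) * expd d j p u $ l))"

lemma measurable_pm: "(\<lambda>(p, u). pm p u i j) \<in> borel_measurable borel"
proof -
 have [measurable]: "(\<lambda>z. E (fst z) (snd z)) \<in> borel_measurable borel"
  using measurable_E by (simp add: split_beta')
 have m: "(\<lambda>y. if y \<in> Om d then gmat d y $ k $ l else 0) \<in> borel_measurable borel" if "d \<in> A" for d k l
  by (intro borel_measurable_open_extension open_Om continuous_intros continuous_metric_matrix that)
 note [measurable] = sets_ch
 have "(\<lambda>z. indicator {q. ch q = d} (E (fst z) (snd z)) * (\<Sum>k\<in>UNIV. \<Sum>l\<in>UNIV. expd d i (fst z) (snd z) $ k *
  (if coord_of d (E (fst z) (snd z)) \<in> Om d then gmat d (coord_of d (E (fst z) (snd z))) $ k $ l else 0) *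
   expd d j (fst z) (snd z) $ l) :: real) \<in> borel_measurable borel" if d: "d \<in> range ch" for d
 proof -
  have dA: "d \<in> A" by (rule range_ch[OF d])
  have [measurable]: "(\<lambda>z. expd d i (fst z) (snd z)) \<in> borel_measurable borel" for i
   using measurable_expd[OF dA] by (simp add: split_beta')
  have [measurable]: "coord_of d \<in> borel_measurable borel" by (rule measurable_coord_of[OF dA])
  have [measurable]: "(\<lambda>z. if coord_of d (E (fst z) (snd z)) \<in> Om d
   then gmat d (coord_of d (E (fst z) (snd z))) $ k $ l else 0) \<in> borel_measurable borel" for k l
   by (rule measurable_compose[OF _ m[OF dA, of k l], of "\<lambda>z. coord_of d (E (fst z) (snd z))"]) simp
  show ?thesis by measurable
 qed
 thus ?thesis unfolding pm_def split_beta' by (rule borel_measurable_sum)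
qed

lemma pm_eq:
 assumes p: "diffeo p rh" "norm (fr p u) < rh"
 shows "pm p u i j = fr p (axis i 1) \<bullet> (hE p (fr p u) *v fr p (axis j 1))"
proof -
 define d where "d = ch (E p u)"
 have d: "d \<in> A" "E p u \<in> fst d" using ch_in in_ch by (simp_all add: d_def)
 define t where "t d = (\<Sum>k\<in>UNIV. \<Sum>l\<in>UNIV. expd d i p u $ k *
  (if coord_of d (E p u) \<in> Om d then gmat d (coord_of d (E p u)) $ k $ l else 0) * expd d j p u $ l)" for d
 have "pm p u i j = (\<Sum>d'\<in>range ch. if d' = d then t d else 0)"
  unfolding pm_def t_def[symmetric] by (intro sum.cong refl) (auto simp: d_def)
 also have "\<dots> = t d" using finite_ch by (simp add: d_def)
 also have "\<dots> = expd d i p u \<bullet> (gmat d (snd d (E p u)) *v expd d j p u)"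
  using d(2) by (simp add: t_def form_entries coord_of_def)
 also have "\<dots> = fr p (axis i 1) \<bullet> (hE p (fr p u) *v fr p (axis j 1))"
  unfolding expd_eq[OF p d] hE_def
  using pull_metric_chart[OF exp_diffeo_param(1)[OF p(1)] _ d(1), of "fr p u"] p(2) d(2) by (simp add: E_fr)
 finally show ?thesis .
qed

abbreviation PM :: "'a => real^'n => real^'n^'n" where "PM p u \<equiv> \<chi> i j. pm p u i j"

text \<open>\<open>PM\<close> is congruent to \<open>hE\<close> by the matrix of
  \<open>fr p\<close>, whose dependence on \<open>p\<close> is uncontrolled. This factor drops out
  of the determinant ratio \<open>detE\<close> and of the trace \<open>tr_quot\<close>, which are
  thereby identified with quantities of \<open>hE\<close>.\<close>

lemma PM_eq:
 assumes p: "diffeo p rh" "norm (fr p u) < rh"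
 shows "PM p u = transpose (matrix (fr p)) ** hE p (fr p u) ** matrix (fr p)"
proof -
 let ?M = "matrix (fr p)"
 let ?N = "transpose ?M ** hE p (fr p u) ** ?M"
 have "?N $ i $ j = pm p u i j" for i j
 proof -
  have "?N $ i $ j = axis i 1 \<bullet> (?N *v axis j 1)"
   by (simp add: matrix_vector_mul_component inner_axis' matrix_vector_mult_basis column_def)
  also have "\<dots> = axis i 1 \<bullet> (transpose ?M *v (hE p (fr p u) *v fr p (axis j 1)))"
   by (simp only: matrix_vector_mul_assoc[symmetric] fr_matrix)
  also have "\<dots> = form (hE p (fr p u)) (?M *v axis i 1) (fr p (axis j 1))"
   by (metis dot_lmul_matrix inner_commute transpose_matrix_vector)
  finally show ?thesis using pm_eq[OF p] by (simp add: fr_matrix)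
 qed
 thus ?thesis by (simp add: vec_eq_iff)
qed

definition detE :: "'a => real^'n => real" where "detE p u = det (PM p u) / det (kap p)"

lemma measurable_detE: "(\<lambda>(p, u). detE p u) \<in> borel_measurable borel"
proof -
 have 1: "(\<lambda>z. det (PM (fst z) (snd z))) \<in> borel_measurable borel"
  by (rule borel_measurable_det_entries) (use measurable_pm in \<open>simp add: split_beta'\<close>)
 have 2: "(\<lambda>z :: 'a \<times> (real^'n). det (kap (fst z))) \<in> borel_measurable borel"
  by (rule measurable_compose[OF borel_measurable_continuous_onI[OF continuous_on_fst[OF continuous_on_id]] measurable_det_kap])
 show ?thesis unfolding detE_def split_beta' using 1 2 by (rule borel_measurable_divide)
qed

lemma detE_eq:
 assumes p: "diffeo p rh" "norm (fr p u) < rh"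
 shows "detE p u = det (hE p (fr p u))"
 using det_fr_nz[of p] by (simp add: detE_def PM_eq[OF p] det_mul det_kap power2_eq_square)

text \<open>The trace of the inverse of \<open>PM p u\<close> times \<open>PM p (s *R u)\<close>,
  with the inverse written by Cramer's rule to keep the expression Borel.\<close>

definition tr_quot :: "'a => real^'n => real => real" where
 "tr_quot p u s = (\<Sum>k\<in>UNIV. \<Sum>l\<in>UNIV. det (\<chi> i j. if j = k then axis l 1 $ i else pm p u i j) / det (PM p u) * pm p (s *R u) l k)"

text \<open>By \<open>shp_matrix\<close> the derivative of the trace at \<open>s = 1\<close> is
  twice the trace of \<open>shp\<close>; hence the division by 2.\<close>

definition tauE :: "'a => real^'n => real" where
 "tauE p u = lim (\<lambda>n. real (Suc n) *R (tr_quot p u (1 + 1 / real (Suc n)) - tr_quot p u 1)) / 2"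

lemma measurable_tauE: "(\<lambda>(p, u). tauE p u) \<in> borel_measurable borel"
proof -
 have pm[measurable]: "(\<lambda>z. pm (fst z) (snd z) i j) \<in> borel_measurable borel" for i j
  using measurable_pm by (simp add: split_beta')
 have [measurable]: "(\<lambda>z. pm (fst z) (s *R snd z) i j) \<in> borel_measurable borel" for i j s
 proof -
  have "(\<lambda>z :: 'a \<times> (real^'n). (fst z, s *R snd z)) \<in> borel \<rightarrow>\<^sub>M borel"
   by (intro borel_measurable_continuous_onI continuous_intros)
  from measurable_compose[OF this pm, of i j] show ?thesis by simp
 qed
 have [measurable]: "(\<lambda>z. det (PM (fst z) (snd z))) \<in> borel_measurable borel"
  "(\<lambda>z. det (\<chi> i j. if j = k then axis l 1 $ i else pm (fst z) (snd z) i j)) \<in> borel_measurable borel" for k l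
  by (rule borel_measurable_det_entries; measurable)+
 have [measurable]: "(\<lambda>z. tr_quot (fst z) (snd z) s) \<in> borel_measurable borel" for s
  unfolding tr_quot_def by measurable
 show ?thesis unfolding tauE_def split_beta' by measurable
qed

lemma tr_quot_eq:
 assumes p: "diffeo p rh" "norm (fr p u) < rh" "norm (fr p (s *R u)) < rh"
 shows "tr_quot p u s = trace (matrix_inv (hE p (fr p u)) ** hE p (s *R fr p u))"
proof -
 let ?M = "matrix (fr p)" and ?H = "hE p (fr p u)" and ?H' = "hE p (s *R fr p u)"
 have inj: "inj_on (Ex p) (ball 0 rh)" by (rule exp_diffeo_param(2)[OF p(1)])
 have "posdef ?H"
  using pull_metric_on[OF exp_diffeo_param(1)[OF p(1)]] p(2) by (simp add: metric_on_def hE_def)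
 hence iH: "invertible ?H" by (rule posdef_invertible)
 have iM: "invertible ?M" using det_fr_nz invertible_det_nz by blast
 have P: "PM p u = transpose ?M ** ?H ** ?M" by (rule PM_eq[OF p(1,2)])
 have P': "PM p (s *R u) = transpose ?M ** ?H' ** ?M"
  using PM_eq[OF p(1,3)] by (simp add: linear_scale[OF linear_fr])
 have nz: "det (PM p u) \<noteq> 0"
  using iH iM by (simp add: P det_mul invertible_det_nz)
 have iP: "invertible (PM p u)" using nz invertible_det_nz by blast
 have "tr_quot p u s = trace (matrix_inv (PM p u) ** PM p (s *R u))"
  unfolding trace_def matrix_matrix_mult_def tr_quot_def using matrix_inv_cramer[OF nz] by (simp cong: if_cong)
 also have "matrix_inv (PM p u) ** PM p (s *R u) = matrix_inv ?M ** (matrix_inv ?H ** ?H') ** ?M"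
 proof -
  have "PM p u ** (matrix_inv ?M ** (matrix_inv ?H ** ?H') ** ?M) = PM p (s *R u)"
  proof -
   have "transpose ?M ** ?H ** ?M ** (matrix_inv ?M ** (matrix_inv ?H ** ?H') ** ?M) =
    transpose ?M ** (?H ** ((?M ** matrix_inv ?M) ** matrix_inv ?H)) ** ?H' ** ?M" by (simp only: matrix_mul_assoc)
   thus ?thesis unfolding P P' by (simp add: matrix_inv_inverse[OF iM] matrix_inv_inverse[OF iH] matrix_mul_assoc)
  qed
  hence "matrix_inv (PM p u) ** PM p (s *R u) =
   (matrix_inv (PM p u) ** PM p u) ** (matrix_inv ?M ** (matrix_inv ?H ** ?H') ** ?M)" by (metis matrix_mul_assoc)
  thus ?thesis using matrix_inv_inverse(2)[OF iP] by simp
 qed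
 also have "trace \<dots> = trace (?M ** (matrix_inv ?M ** (matrix_inv ?H ** ?H')))" by (rule trace_mul_sym)
 also have "\<dots> = trace (matrix_inv ?H ** ?H')" by (simp add: matrix_mul_assoc matrix_inv_inverse[OF iM])
 finally show ?thesis .
qed

lemma tauE_eq:
 assumes p: "diffeo p rh" "norm (fr p u) < rh"
 shows "tauE p u = trace (shp (hE p) (fr p u))"
proof -
 let ?y = "fr p u"
 have "rh > 0" using p(2) norm_ge_zero[of ?y] by linarith
 interpret normal_coords "ball 0 rh" "hE p" by (rule normal_coords_hE[OF p(1) \<open>rh > 0\<close>])
 have y: "?y \<in> ball 0 rh" using p(2) by simp
 define F where "F z = trace (matrix_inv (hE p ?y) ** hE p z)" for z
 have lin: "linear (\<lambda>N. trace (matrix_inv (hE p ?y) ** N))"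
  by (intro linearI) (simp_all add: matrix_add_ldistrib trace_add trace_def matrix_matrix_mult_def sum_distrib_left sum.distrib algebra_simps)
 have d: "(F has_derivative (\<lambda>w. trace (matrix_inv (hE p ?y) ** dd (hE p) ?y w))) (at ?y)"
  unfolding F_def[abs_def]
  by (rule bounded_linear.has_derivative[OF linear_conv_bounded_linear[THEN iffD1, OF lin] smooth_on_has_derivative[OF smooth_h y]])
 have "matrix_inv (hE p ?y) ** dd (hE p) ?y ?y = 2 *R shp (hE p) ?y"
  unfolding matrix_eq
  by (simp add: matrix_vector_mul_assoc[symmetric] shp_matrix[OF y] mv_scaleR scaleR_matrix_vector_assoc[symmetric]
    del: matrix_vector_mul_assoc)
   (simp add: matrix_vector_mul_assoc matrix_mul_assoc matrix_inv_inverse[OF posdef_invertible[OF posdef_h[OF y]]])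
 hence e: "trace (matrix_inv (hE p ?y) ** dd (hE p) ?y ?y) = 2 * trace (shp (hE p) ?y)"
  by (simp add: linear_scale[OF linear_trace])
 have l: "(\<lambda>n. real (Suc n) *R (F (?y + (1 / real (Suc n)) *R ?y) - F ?y)) \<longlonglongrightarrow> 2 * trace (shp (hE p) ?y)"
  using difference_quotient_limit[OF d, of ?y] unfolding e .
 have "(\<lambda>n. 1 / real (Suc n)) \<longlonglongrightarrow> 0" using LIMSEQ_inverse_real_of_nat by (simp add: inverse_eq_divide)
 hence "(\<lambda>n. ?y + (1 / real (Suc n)) *R ?y) \<longlonglongrightarrow> ?y + 0 *R ?y" by (intro tendsto_intros)
 hence "eventually (\<lambda>n. ?y + (1 / real (Suc n)) *R ?y \<in> ball 0 rh) sequentially"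
  by (intro topological_tendstoD open_ball) (use y in simp_all)
 moreover have s: "?y + (1 / real (Suc n)) *R ?y = (1 + 1 / real (Suc n)) *R ?y" for n
  by (simp add: scaleR_add_left)
 ultimately have "eventually (\<lambda>n. real (Suc n) *R (F (?y + (1 / real (Suc n)) *R ?y) - F ?y) =
   real (Suc n) *R (tr_quot p u (1 + 1 / real (Suc n)) - tr_quot p u 1)) sequentially"
 proof (elim eventually_mono)
  fix n assume "?y + (1 / real (Suc n)) *R ?y \<in> ball 0 rh"
  hence b: "norm (fr p ((1 + 1 / real (Suc n)) *R u)) < rh"
   unfolding s linear_scale[OF linear_fr] by simp
  show "real (Suc n) *R (F (?y + (1 / real (Suc n)) *R ?y) - F ?y) =
   real (Suc n) *R (tr_quot p u (1 + 1 / real (Suc n)) - tr_quot p u 1)"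
   unfolding s tr_quot_eq[OF p b] F_def using tr_quot_eq[OF p, of 1] p(2) by simp
 qed
 from Lim_transform_eventually[OF l this]
 show ?thesis unfolding tauE_def by (simp add: limI)
qed

lemma nn_integral_fr:
 assumes f: "f \<in> borel_measurable borel"
 shows "(LBNN y. f y) = (LBNN u. f (fr p u) * ennreal (sqrt (det (kap p))))"
proof -
 have s: "smooth_on UNIV (fr p)"
  by (rule smooth_on_bounded_linear[OF linear_conv_bounded_linear[THEN iffD1, OF linear_fr]])
 have "dd (fr p) u = fr p" for u
  using dd_eqI[OF bounded_linear_imp_has_derivative[OF linear_conv_bounded_linear[THEN iffD1, OF linear_fr]]] by blast
 moreover have "sqrt (det (kap p)) = \<bar>det (matrix (fr p))\<bar>" by (simp add: det_kap)
 moreover have "fr p ` UNIV = UNIV" using bij_fr bij_is_surj by blast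
 ultimately show ?thesis
  using nn_integral_change_of_variables[OF open_UNIV s _ _ f] bij_is_inj[OF bij_fr[of p]] by simp
qed

end

section \<open>Averages of quadratic forms and the scalar curvature\<close>

abbreviation pball :: "(real^'n::finite) set" where "pball \<equiv> ball 0 1 - {0}"

lemma sets_pball [measurable]: "(pball :: (real^'n) set) \<in> sets borel"
 by simp

lemma measure_pball: "measure lborel (pball :: (real^'n) set) = measure lborel (ball 0 1 :: (real^'n) set)"
proof -
 have "emeasure lborel (ball 0 1 :: (real^'n) set) < \<infinity>" by (rule emeasure_lborel_ball_finite)
 thus ?thesis by (subst measure_Diff) auto
qed

lemma emeasure_pball: "emeasure lborel (pball :: (real^'n) set) = ennreal (measure lborel (ball 0 1 :: (real^'n) set))"
proof -
 have "emeasure lborel (pball :: (real^'n) set) \<le> emeasure lborel (ball 0 1 :: (real^'n) set)"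
  by (rule emeasure_mono) auto
 hence "emeasure lborel (pball :: (real^'n) set) \<noteq> \<infinity>"
  using emeasure_lborel_ball_finite[of "0 :: real^'n" 1] by auto
 thus ?thesis by (simp add: emeasure_eq_ennreal_measure measure_pball)
qed

lemma measure_ball_pos: "measure lborel (ball 0 1 :: (real^'n) set) > 0"
proof -
 have "\<not> negligible (ball 0 1 :: (real^'n) set)" by (intro open_not_negligible) auto
 hence "emeasure lborel (ball 0 1 :: (real^'n) set) \<noteq> 0"
  by (auto simp: negligible_iff_null_sets null_sets_def)
 thus ?thesis
  using emeasure_lborel_ball_finite[of "0 :: real^'n" 1] by (simp add: measure_def enn2real_positive_iff less_top zero_less_iff_neq_zero)
qed

lemma integrable_pball: "integrable lborel (indicator pball :: real^'n => real)"
 by (intro integrable_real_indicator) (simp_all add: emeasure_pball)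

lemma integrable_on_pball:
 fixes h :: "real^'n => real"
 assumes [measurable]: "h \<in> borel_measurable borel" and "\<And>y. y \<in> pball ==> \<bar>h y\<bar> \<le> K"
 shows "integrable lborel (\<lambda>y. h y * indicator pball y)"
proof (rule Bochner_Integration.integrable_bound)
 show "integrable lborel (\<lambda>y :: real^'n. K * indicator pball y)"
  using integrable_pball by (rule integrable_mult_right)
 show "AE x in lborel. norm (h x * indicator pball x) \<le> norm (K * indicator pball x)"
 proof (rule AE_I2)
  fix x :: "real^'n"
  have "\<bar>h x\<bar> \<le> \<bar>K\<bar>" if "x \<in> pball" using assms(2)[OF that] by linarith
  thus "norm (h x * indicator pball x) \<le> norm (K * indicator pball x)" by (simp add: indicator_def)
 qed
qed simp

lemma sgn_pball: "y \<in> pball ==> norm (sgn y) = 1"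
 by (simp add: norm_sgn)

text \<open>An orthogonal map carrying \<open>b\<close> to \<open>b'\<close> preserves Lebesgue
  measure and the punctured ball, and commutes with \<open>sgn\<close>.\<close>

lemma sphere_second_moment_rotation:
 fixes b b' :: "real^'n"
 assumes "norm b = 1" "norm b' = 1"
 shows "(LINT y|lborel. (b \<bullet> sgn y)^2 * indicator pball y) = (LINT y|lborel. (b' \<bullet> sgn y)^2 * indicator pball y)"
proof -
 obtain T where T: "orthogonal_transformation T" "T b = b'"
  using orthogonal_transformation_exists_1[OF assms] by metis
 have lin: "bounded_linear T" using orthogonal_transformation_linear[OF T(1)] by (simp add: linear_conv_bounded_linear)
 have nT: "norm (T y) = norm y" for y using orthogonal_transformation_norm[OF T(1)] .
 define f where "f b y = ennreal ((b \<bullet> sgn y)^2 * indicator pball y)" for b y :: "real^'n"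
 have e: "f b' (T y) = f b y" for y
 proof -
  have "sgn (T y) = T (sgn y)" by (simp add: sgn_div_norm nT linear_scale[OF bounded_linear.linear[OF lin]])
  moreover have "T b \<bullet> T (sgn y) = b \<bullet> sgn y" using T(1) by (simp add: orthogonal_transformation_def)
  moreover have "T y \<in> pball \<longleftrightarrow> y \<in> pball" using nT[of y] by (metis DiffE DiffI mem_ball_0 norm_eq_zero singletonD singletonI)
  ultimately show ?thesis by (simp add: f_def T(2) indicator_def)
 qed
 have "(LBNN y. f b' y) = (LBNN y. f b' (T y) * ennreal \<bar>det (matrix (dd T y))\<bar> * indicator UNIV y)"
 proof -
  have "T ` UNIV = UNIV" using orthogonal_transformation_surj[OF T(1)] .
  moreover have "f b' \<in> borel_measurable borel" unfolding f_def[abs_def] by measurable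
  ultimately show ?thesis
   using nn_integral_change_of_variables[OF open_UNIV smooth_on_bounded_linear[OF lin] _ _ , of "f b'"]
    orthogonal_transformation_inj[OF T(1)] by simp
 qed
 also have "\<dots> = (LBNN y. f b y)"
 proof -
  have "dd T y = T" for y using dd_eqI[OF bounded_linear_imp_has_derivative[OF lin]] by blast
  moreover have "\<bar>det (matrix T)\<bar> = 1" using orthogonal_transformation_det[OF T(1)] .
  ultimately show ?thesis by (simp add: e)
 qed
 finally show ?thesis
  unfolding f_def by (subst (1 2) integral_eq_nn_integral) (auto simp: )
qed

text \<open>The diagonal moments are equal by rotation and add up to the volume of the ball, because
  \<open>sgn y\<close> is a unit vector. The mixed ones vanish by polarisation: the normalised sum
  and difference of two axis vectors have equal moments.\<close>

lemma sphere_second_moment: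
 fixes i j :: "'n::finite"
 shows "(LINT y|lborel. sgn y $ i * sgn y $ j * indicator (pball :: (real^'n) set) y) =
  (if i = j then measure lborel (ball 0 1 :: (real^'n) set) / real CARD('n) else 0)"
proof -
 define J where "J b = (LINT y|lborel. (b \<bullet> sgn y)^2 * indicator (pball :: (real^'n) set) y)" for b :: "real^'n"
 have int: "integrable lborel (\<lambda>y. (b \<bullet> sgn y)^2 * indicator (pball :: (real^'n) set) y)" for b :: "real^'n"
 proof (rule integrable_on_pball)
  fix y :: "real^'n" assume "y \<in> pball"
  hence "\<bar>b \<bullet> sgn y\<bar> \<le> norm b" using Cauchy_Schwarz_ineq2[of b "sgn y"] sgn_pball[of y] by simp
  from power_mono[OF this, of 2] show "\<bar>(b \<bullet> sgn y)^2\<bar> \<le> (norm b)^2" by simp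
 qed measurable
 have ax: "axis k 1 \<bullet> v = v $ k" for v :: "real^'n" and k by (simp add: inner_axis')
 show ?thesis
 proof (cases "i = j")
  case True
  have "(\<Sum>k\<in>UNIV. J (axis k 1)) = (LINT y|lborel. (\<Sum>k\<in>UNIV. (axis k 1 \<bullet> sgn y)^2 * indicator (pball :: (real^'n) set) y))"
   unfolding J_def by (rule Bochner_Integration.integral_sum[symmetric]) (rule int)
  also have "\<dots> = (LINT y|lborel. indicator (pball :: (real^'n) set) y)"
  proof (rule Bochner_Integration.integral_cong[OF refl])
   fix y :: "real^'n"
   have "(\<Sum>k\<in>UNIV. (sgn y $ k)^2) = (norm (sgn y))^2"
    unfolding norm_vec_def L2_set_def by (simp add: sum_nonneg)
   thus "(\<Sum>k\<in>UNIV. (axis k 1 \<bullet> sgn y)^2 * indicator pball y) = (indicator pball y :: real)"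
    by (cases "y \<in> pball") (simp_all add: ax sgn_pball)
  qed
  also have "\<dots> = measure lborel (ball 0 1 :: (real^'n) set)" by (simp add: measure_pball)
  also have "(\<Sum>k\<in>UNIV. J (axis k 1)) = (\<Sum>k\<in>(UNIV :: 'n set). J (axis i 1))"
   unfolding J_def by (intro sum.cong refl sphere_second_moment_rotation) simp_all
  finally have "real CARD('n) * J (axis i 1) = measure lborel (ball 0 1 :: (real^'n) set)" by simp
  thus ?thesis using True by (simp add: J_def ax power2_eq_square field_simps)
 next
  case False
  define b where "b s = (1 / sqrt 2) *R (axis i 1 + s *R axis j 1 :: real^'n)" for s :: real
  have n: "norm (b s) = 1" if "s^2 = 1" for s
  proof -
   have "(axis i 1 + s *R axis j 1) \<bullet> (axis i 1 + s *R axis j 1 :: real^'n) = 1 + s^2"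
    using False by (simp add: inner_add_left inner_add_right inner_axis_axis power2_eq_square)
   hence "b s \<bullet> b s = (1 / sqrt 2) * ((1 / sqrt 2) * (1 + s^2))"
    unfolding b_def by (simp only: inner_scaleR_left inner_scaleR_right)
   also have "\<dots> = (1 + s^2) / 2" by simp
   finally have "(norm (b s))^2 = (1 + s^2) / 2" by (simp only: power2_norm_eq_inner)
   with that have "(norm (b s))^2 = 1^2" by simp
   thus ?thesis using power2_eq_iff_nonneg[of "norm (b s)" 1] by simp
  qed
  have e: "sgn y $ i * sgn y $ j * c = ((b 1 \<bullet> sgn y)^2 * c - (b (-1) \<bullet> sgn y)^2 * c) / 2" for y c
  proof -
   have "b s \<bullet> sgn y = (sgn y $ i + s * sgn y $ j) / sqrt 2" for s by (simp add: b_def inner_add_left ax)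
   hence sq: "(b s \<bullet> sgn y)^2 = (sgn y $ i + s * sgn y $ j)^2 / 2" for s by (simp add: power_divide)
   show ?thesis unfolding sq by (simp add: power2_eq_square field_simps)
  qed
  have "(LINT y|lborel. sgn y $ i * sgn y $ j * indicator (pball :: (real^'n) set) y) =
   (LINT y|lborel. ((b 1 \<bullet> sgn y)^2 * indicator pball y - (b (-1) \<bullet> sgn y)^2 * indicator pball y) / 2)"
   by (rule Bochner_Integration.integral_cong[OF refl e])
  also have "\<dots> = (J (b 1) - J (b (-1))) / 2"
   by (simp add: J_def Bochner_Integration.integral_diff[OF int int])
  also have "J (b 1) = J (b (-1))" unfolding J_def by (intro sphere_second_moment_rotation n) simp_all
  finally show ?thesis using False by simp
 qed
qed

text \<open>The spherical average of a quadratic form is its trace over the dimension; this is where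
  \<open>R / n\<close> comes from. The constant \<open>C\<close> makes the integrand nonnegative, so
  that the result can be stated for extended nonnegative integrals.\<close>

lemma nn_integral_quadratic_form:
 fixes N :: "real^'n^'n"
 assumes "\<And>y. 0 \<le> C * (y \<bullet> y) + form N y y"
 shows "(LBNN y. ennreal (C + sgn y \<bullet> (N *v sgn y)) * indicator pball y) =
  ennreal (measure lborel (ball 0 1 :: (real^'n) set) * (C + trace N / real CARD('n)))"
proof -
 let ?m = "measure lborel (ball 0 1 :: (real^'n) set)"
 have int: "integrable lborel (\<lambda>y. sgn y $ i * sgn y $ j * indicator (pball :: (real^'n) set) y)" for i j
 proof (rule integrable_on_pball)
  fix y :: "real^'n" assume "y \<in> pball"
  hence "\<bar>sgn y $ i\<bar> \<le> 1" "\<bar>sgn y $ j\<bar> \<le> 1" using component_le_norm_cart[of "sgn y"] sgn_pball by metis+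
  thus "\<bar>sgn y $ i * sgn y $ j\<bar> \<le> 1" by (simp add: abs_mult mult_le_one)
 qed measurable
 note int0 = integrable_pball
 have e: "(C + sgn y \<bullet> (N *v sgn y)) * indicator pball y = C * indicator pball y +
   (\<Sum>i\<in>UNIV. \<Sum>j\<in>UNIV. N $ i $ j * (sgn y $ i * sgn y $ j * indicator (pball :: (real^'n) set) y))" for y
  by (simp add: form_entries algebra_simps sum_distrib_left)
 have I: "integrable lborel (\<lambda>y. (C + sgn y \<bullet> (N *v sgn y)) * indicator pball y)"
  unfolding e using int int0 by (intro Bochner_Integration.integrable_add integrable_mult_right Bochner_Integration.integrable_sum) auto
 let ?f = "\<lambda>i j y. N $ i $ j * (sgn y $ i * sgn y $ j * indicator (pball :: (real^'n) set) y)"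
 let ?d = "\<lambda>i j. N $ i $ j * (if i = j then ?m / real CARD('n) else 0)"
 have int1: "integrable lborel (?f i j)" for i j by (rule integrable_mult_right[OF int])
 have int2: "integrable lborel (\<lambda>y. \<Sum>j\<in>UNIV. ?f i j y)" for i by (rule Bochner_Integration.integrable_sum[OF int1])
 have int3: "integrable lborel (\<lambda>y. \<Sum>i\<in>UNIV. \<Sum>j\<in>UNIV. ?f i j y)" by (rule Bochner_Integration.integrable_sum[OF int2])
 have "(LINT y|lborel. (\<Sum>i\<in>UNIV. \<Sum>j\<in>UNIV. ?f i j y)) = (\<Sum>i\<in>UNIV. LINT y|lborel. (\<Sum>j\<in>UNIV. ?f i j y))"
  by (rule Bochner_Integration.integral_sum[OF int2])
 also have "\<dots> = (\<Sum>i\<in>UNIV. \<Sum>j\<in>UNIV. LINT y|lborel. ?f i j y)"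
  by (intro sum.cong refl Bochner_Integration.integral_sum int1)
 also have "\<dots> = (\<Sum>i\<in>UNIV. \<Sum>j\<in>UNIV. ?d i j)"
  by (simp only: integral_mult_right_zero sphere_second_moment)
 finally have S: "(LINT y|lborel. (\<Sum>i\<in>UNIV. \<Sum>j\<in>UNIV. ?f i j y)) = (\<Sum>i\<in>UNIV. \<Sum>j\<in>UNIV. ?d i j)" .
 have "(LINT y|lborel. (C + sgn y \<bullet> (N *v sgn y)) * indicator pball y) =
   (LINT y|lborel. C * indicator (pball :: (real^'n) set) y) + (LINT y|lborel. (\<Sum>i\<in>UNIV. \<Sum>j\<in>UNIV. ?f i j y))"
  unfolding e by (rule Bochner_Integration.integral_add[OF integrable_mult_right[OF int0] int3])
 also have "\<dots> = C * ?m + (\<Sum>i\<in>UNIV. \<Sum>j\<in>UNIV. ?d i j)" unfolding S by (simp add: measure_pball)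
 also have "\<dots> = ?m * (C + trace N / real CARD('n))"
  by (simp add: if_distrib trace_def sum_distrib_left sum_divide_distrib algebra_simps cong: if_cong)
 finally have L: "(LINT y|lborel. (C + sgn y \<bullet> (N *v sgn y)) * indicator pball y) = \<dots>" .
 have "0 \<le> C + sgn y \<bullet> (N *v sgn y)" if "y \<in> pball" for y
  using assms[of "sgn y"] sgn_pball[OF that] by (simp add: dot_square_norm)
 hence "(LBNN y. ennreal ((C + sgn y \<bullet> (N *v sgn y)) * indicator pball y)) =
  ennreal (LINT y|lborel. (C + sgn y \<bullet> (N *v sgn y)) * indicator pball y)"
  by (intro nn_integral_eq_integral I AE_I2) (auto simp: indicator_def)
 moreover have "ennreal ((C + sgn y \<bullet> (N *v sgn y)) * indicator pball y) = ennreal (C + sgn y \<bullet> (N *v sgn y)) * indicator pball y" for y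
  by (simp add: indicator_def)
 ultimately show ?thesis by (simp only: L)
qed

context complete_manifold
begin

lemma frame_matrix:
 assumes "c \<in> A" "p \<in> fst c"
 shows "matrix_inv (gmat c (snd c p)) =
   matrix (\<lambda>y. frm p y c) ** transpose (matrix (\<lambda>y. frm p y c))"
  and "matrix (\<lambda>y. frm p y c) *v y = frm p y c"
proof -
 define F where "F = matrix (\<lambda>y. frm p y c)"
 define K where "K = gmat c (snd c p)"
 show F: "matrix (\<lambda>y. frm p y c) *v y = frm p y c" for y
  by (rule matrix_works) (simp add: frame_linear linear_matrix_vector_mul_eq)
 have "transpose F ** K ** F = mat 1"
 proof -
  have "form (transpose F ** K ** F) a b = form (mat 1) a b" for a b
  proof -
   have "form (transpose F ** K ** F) a b = form (transpose F) a (K *v (F *v b))"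
    by (simp only: matrix_vector_mul_assoc[symmetric])
   also have "\<dots> = form K (F *v a) (F *v b)" by (metis dot_lmul_matrix inner_commute transpose_matrix_vector)
   also have "\<dots> = g p (frm p a) (frm p b)"
    unfolding F_def F K_def by (rule g_chart[OF assms frame_in frame_in, symmetric])
   finally show ?thesis by (simp add: frame_isometry)
  qed
  thus ?thesis unfolding matrix_eq by (metis inner_commute vector_eq_rdot)
 qed
 hence "F ** (transpose F ** K) = mat 1" using matrix_left_right_inverse by blast
 hence inv: "(F ** transpose F) ** K = mat 1" by (simp add: matrix_mul_assoc)
 hence "invertible K" using matrix_left_right_inverse unfolding invertible_def by blast
 hence "matrix_inv K = ((F ** transpose F) ** K) ** matrix_inv K" by (simp add: inv)
 also have "\<dots> = F ** transpose F" using \<open>invertible K\<close> by (simp add: matrix_mul_assoc[symmetric] matrix_inv_inverse)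
 finally show "matrix_inv (gmat c (snd c p)) =
   matrix (\<lambda>y. frm p y c) ** transpose (matrix (\<lambda>y. frm p y c))" by (simp add: F_def K_def)
qed

text \<open>By \<open>frame_matrix\<close> the inverse metric is \<open>F\<close> times its
  transpose. Contracting the Ricci tensor with it is therefore, by cyclicity, the trace of the Ricci
  form in the frame.\<close>

lemma ric_frame_form:
 obtains N where "\<And>y. ric p (frm p y) = form N y y" "scal p = trace N"
proof -
 define c where "c = (SOME c. c \<in> A \<and> p \<in> fst c)"
 have "\<exists>c. c \<in> A \<and> p \<in> fst c" using chart_exists by blast
 from someI_ex[OF this] have c: "c \<in> A" "p \<in> fst c" unfolding c_def by blast+
 define F where "F = matrix (\<lambda>y. frm p y c)"
 define R where "R = (\<chi> j k. ricci A g c j k (snd c p))"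
 define N where "N = transpose F ** R ** F"
 have "ric p (frm p y) = form N y y" for y
 proof -
  have "ric p (frm p y) = form R (F *v y) (F *v y)"
   unfolding ric_chart[OF c frame_in] ricq_ricci F_def frame_matrix(2)[OF c] form_entries
   by (simp add: R_def mult_ac)
  also have "\<dots> = form (transpose F) y (R *v (F *v y))" by (metis dot_lmul_matrix inner_commute transpose_matrix_vector)
  finally show ?thesis by (simp only: N_def matrix_vector_mul_assoc matrix_mul_assoc)
 qed
 moreover have "scal p = trace N"
 proof -
  have "scal p = (\<Sum>j\<in>UNIV. \<Sum>k\<in>UNIV. matrix_inv (gmat c (snd c p)) $ j $ k * R $ j $ k)"
   by (simp add: scalar_curvature_def Let_def R_def c_def[symmetric])
  also have "\<dots> = trace (transpose (matrix_inv (gmat c (snd c p))) ** R)"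
  proof -
   have "(\<Sum>j\<in>UNIV. \<Sum>k\<in>UNIV. M $ j $ k * R $ j $ k) = trace (transpose M ** R)" for M
    unfolding trace_def matrix_matrix_mult_def transpose_def by (simp, rule sum.swap)
   thus ?thesis .
  qed
  also have "\<dots> = trace (transpose (F ** transpose F) ** R)"
   unfolding frame_matrix(1)[OF c] F_def[symmetric] ..
  also have "\<dots> = trace (F ** (transpose F ** R))" by (simp add: matrix_transpose_mul transpose_transpose matrix_mul_assoc)
  also have "\<dots> = trace N" unfolding N_def by (rule trace_mul_sym)
  finally show ?thesis .
 qed
 ultimately show ?thesis by (rule that)
qed

end

context closed_manifold
begin

text \<open>Over a compact ball of a chart the quotient of the Ricci form by the metric is
  continuous on unit coordinate vectors, hence bounded. Homogeneity of degree 2 covers all vectors,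
  and compactness of the manifold gives one constant.\<close>

lemma ric_bounded: "\<exists>C\<ge>0. \<forall>p. \<forall>V\<in>TS p. \<bar>ric p V\<bar> \<le> C * g p V V"
proof -
 let ?ok = "\<lambda>S C. \<forall>q\<in>S. \<forall>V\<in>TS q. \<bar>ric q V\<bar> \<le> C * g q V V"
 have "\<exists>C\<ge>0. ?ok (UNIV :: 'a set) C"
 proof (rule compact_UNIV_local[OF compact_UNIV, where P = "\<lambda>S. \<exists>C\<ge>0. ?ok S C"])
  fix p
  obtain c where c: "c \<in> A" "p \<in> fst c" using chart_exists by blast
  obtain e where e: "e > 0" "cball (snd c p) e \<subseteq> Om c" "open (chart_inv c ` ball (snd c p) e)" "p \<in> chart_inv c ` ball (snd c p) e"
   using chart_neighbourhood[OF c continuous_on_const[of _ 0]] by metis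
  let ?G = "gmat c"
  let ?K = "cball (snd c p) e \<times> sphere (0 :: real^'n) 1"
  define f where "f z = ricq ?G (fst z) (snd z) / (snd z \<bullet> (?G (fst z) *v snd z))" for z
  have pos: "form (?G x) v v > 0" if "x \<in> Om c" "v \<noteq> 0" for x v
   using posdef_pos[OF posdef_metric_matrix[OF c(1) that(1)] that(2)] .
  have "continuous_on ?K f"
  proof -
   have "continuous_on (Om c \<times> UNIV) (\<lambda>z. ricq ?G (fst z) (snd z))"
    using continuous_on_ricq[OF metric_on_chart[OF c(1)]] by (simp add: split_beta')
   hence 1: "continuous_on ?K (\<lambda>z. ricq ?G (fst z) (snd z))"
    by (rule continuous_on_subset) (use e(2) in auto)
   have "continuous_on ?K (\<lambda>z. ?G (fst z))"
    by (rule continuous_on_compose2[OF continuous_metric_matrix[OF c(1)] continuous_on_fst[OF continuous_on_id]]) (use e(2) in auto)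
   hence 2: "continuous_on ?K (\<lambda>z. snd z \<bullet> (?G (fst z) *v snd z))"
    unfolding form_entries by (intro continuous_intros)
   have nz: "\<forall>z\<in>?K. snd z \<bullet> (?G (fst z) *v snd z) \<noteq> 0"
   proof
    fix z assume "z \<in> ?K"
    hence "fst z \<in> Om c" "snd z \<noteq> 0" using e(2) by auto
    from pos[OF this] show "snd z \<bullet> (?G (fst z) *v snd z) \<noteq> 0" by simp
   qed
   show ?thesis unfolding f_def[abs_def] by (rule continuous_on_divide[OF 1 2 nz])
  qed
  moreover have "compact ?K" by (intro compact_Times compact_cball compact_sphere)
  ultimately have "compact (f ` ?K)" by (rule compact_continuous_image)
  then obtain b where b: "b > 0" "\<And>z. z \<in> ?K ==> \<bar>f z\<bar> \<le> b" using compact_imp_bounded bounded_pos by (metis image_eqI real_norm_def)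
  have "\<bar>ric q V\<bar> \<le> b * g q V V" if q: "q \<in> chart_inv c ` ball (snd c p) e" and V: "V \<in> TS q" for q V
  proof -
   obtain x where x: "x \<in> ball (snd c p) e" "q = chart_inv c x" using q by blast
   have xO: "x \<in> Om c" using x(1) e(2) ball_subset_cball by blast
   have qc: "q \<in> fst c" "snd c q = x" using chart_inv_in[OF c(1) xO] chart_chart_inv[OF c(1) xO] x(2) by simp_all
   let ?m = "norm (V c)"
   have r: "ric q V = ricq ?G x (V c)" using ric_chart[OF c(1) qc(1) V] by (simp add: qc(2))
   have G: "g q V V = V c \<bullet> (?G x *v V c)" using g_chart[OF c(1) qc(1) V V] by (simp add: qc(2))
   show ?thesis
   proof (cases "V c = 0")
    case True
    thus ?thesis using ricq_scale[of ?G x 0 0] by (simp add: r G)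
   next
    case False
    have s: "V c = ?m *R sgn (V c)" using False by (simp add: sgn_div_norm)
    have nz: "sgn (V c) \<noteq> 0" using False by (simp add: sgn_zero_iff)
    have "\<bar>f (x, sgn (V c))\<bar> \<le> b" by (rule b(2)) (use x(1) False in \<open>simp add: norm_sgn\<close>)
    hence "\<bar>ricq ?G x (sgn (V c))\<bar> \<le> b * (sgn (V c) \<bullet> (?G x *v sgn (V c)))"
     by (simp only: f_def fst_conv snd_conv abs_divide abs_of_pos[OF pos[OF xO nz]] pos_divide_le_eq[OF pos[OF xO nz]])
    hence "?m^2 * \<bar>ricq ?G x (sgn (V c))\<bar> \<le> ?m^2 * (b * (sgn (V c) \<bullet> (?G x *v sgn (V c))))"
     by (rule mult_left_mono) simp
    moreover have "ric q V = ?m^2 * ricq ?G x (sgn (V c))"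
     unfolding r using ricq_scale[of ?G x ?m "sgn (V c)"] by (simp only: s[symmetric])
    moreover have "g q V V = ?m^2 * (sgn (V c) \<bullet> (?G x *v sgn (V c)))"
    proof -
     have "form (?G x) (?m *R sgn (V c)) (?m *R sgn (V c)) =
      ?m^2 * (sgn (V c) \<bullet> (?G x *v sgn (V c)))"
      by (simp only: form_scale power2_eq_square mult.assoc)
     thus ?thesis unfolding G s[symmetric] .
    qed
    ultimately show ?thesis by (simp add: abs_mult mult_ac)
   qed
  qed
  hence "\<exists>C\<ge>0. ?ok (chart_inv c ` ball (snd c p) e) C"
   using b(1) by (intro exI[of _ b]) simp
  thus "\<exists>N. open N \<and> p \<in> N \<and> (\<exists>C\<ge>0. ?ok N C)"
   using e(3,4) by (intro exI[of _ "chart_inv c ` ball (snd c p) e"]) simp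
 next
  fix S T
  assume "\<exists>C\<ge>0. ?ok S C" "\<exists>C\<ge>0. ?ok T C"
  then obtain C D where C: "C \<ge> 0" "?ok S C"
   and D: "D \<ge> 0" "?ok T D" by metis
  have nn: "g p V V \<ge> 0" if "V \<in> TS p" for p V
   using frame_surj[OF that] frame_isometry[of p] by (metis inner_ge_zero)
  have "\<bar>ric p V\<bar> \<le> max C D * g p V V" if p: "p \<in> S \<union> T" and V: "V \<in> TS p" for p V
  proof -
   have "C * g p V V \<le> max C D * g p V V" "D * g p V V \<le> max C D * g p V V"
    by (rule mult_right_mono; simp add: nn[OF V])+
   moreover have "\<bar>ric p V\<bar> \<le> C * g p V V \<or> \<bar>ric p V\<bar> \<le> D * g p V V" using p V C(2) D(2) by blast
   ultimately show ?thesis by linarith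
  qed
  thus "\<exists>C\<ge>0. ?ok (S \<union> T) C"
   using C(1) by (intro exI[of _ "max C D"]) auto
 qed auto
 thus ?thesis by simp
qed

end

section \<open>The measure of the unit sphere bundle\<close>

lemma emeasure_unit_sphere_measure:
 fixes X :: "(real^'n) set"
 assumes X: "X \<in> sets borel" "X \<subseteq> sphere 0 1"
 shows "emeasure unit_sphere_measure X = of_nat CARD('n) * (LBNN y. indicator X (sgn y) * indicator pball y)"
proof -
 let ?R = "restrict_space lborel (pball :: (real^'n) set)"
 have "(sgn :: real^'n => real^'n) \<in> borel_measurable ?R"
  by (rule measurable_restrict_space1) simp
 hence m: "sgn \<in> ?R \<rightarrow>\<^sub>M restrict_space borel (sphere (0 :: real^'n) 1)"
  by (rule measurable_restrict_space2[rotated]) (auto simp: space_restrict_space norm_sgn)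
 have XR: "X \<in> sets (restrict_space borel (sphere (0 :: real^'n) 1))"
  using X by (simp add: sets_restrict_space_iff)
 have "emeasure unit_sphere_measure X = of_nat CARD('n) * emeasure ?R (sgn -` X \<inter> space ?R)"
  unfolding unit_sphere_measure_def by (simp add: emeasure_distr[OF m XR])
 also have "emeasure ?R (sgn -` X \<inter> space ?R) = emeasure lborel (sgn -` X \<inter> pball)"
  by (subst emeasure_restrict_space) (auto simp: space_restrict_space)
 also have "\<dots> = (LBNN y. indicator (sgn -` X \<inter> pball) y)"
 proof -
  have "(sgn :: real^'n => real^'n) -` X \<in> sets borel" using measurable_sets[OF borel_measurable_sgn, of X] X(1) by simp
  thus ?thesis by (subst nn_integral_indicator) auto
 qed
 also have "\<dots> = (LBNN y. indicator X (sgn y) * indicator pball y)"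
  by (intro nn_integral_cong) (auto simp: indicator_def)
 finally show ?thesis .
qed

context closed_manifold
begin

abbreviation SB :: "('a \<times> ('a, 'n) tangent_vector) set" where "SB \<equiv> unit_sphere_bundle A g"

definition gens :: "('a \<times> ('a, 'n) tangent_vector) set set" where
 "gens = {{(p, v) \<in> SB. p \<in> fst c \<and> (snd c p, v c) \<in> W} | c W. c \<in> A \<and> open (W :: ((real^'n) \<times> (real^'n)) set)}"

definition Sig :: "('a \<times> ('a, 'n) tangent_vector) measure" where "Sig = sigma SB gens"

lemma gens_sub: "gens \<subseteq> Pow SB"
 unfolding gens_def by blast

lemma space_Sig: "space Sig = SB" and sets_Sig: "sets Sig = sigma_sets SB gens"
 using gens_sub by (simp_all add: Sig_def)

lemma gens_sets: "c \<in> A ==> open W ==> {(p, v) \<in> SB. p \<in> fst c \<and> (snd c p, v c) \<in> W} \<in> sets Sig"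
 unfolding sets_Sig by (rule sigma_sets.Basic) (unfold gens_def, blast)

text \<open>A nonzero default at 0, so that \<open>Psi\<close> maps into the sphere bundle without
  exception; \<open>sb_density\<close> gives the zero vector no weight.\<close>

definition un :: "real^'n => real^'n" where "un u = (if u = 0 then axis undefined 1 else u)"

definition Psi :: "'a \<times> (real^'n) => 'a \<times> ('a, 'n) tangent_vector" where
 "Psi z = (fst z, tv (fst z) ((1 / norm (fr (fst z) (un (snd z)))) *R un (snd z)))"

lemma fr_eq_0: "fr p u = 0 \<longleftrightarrow> u = 0"
 using bij_is_inj[OF bij_fr] linear_0[OF linear_fr] by (metis injD)

lemma norm_fr: "norm (fr p u) = sqrt (form (kap p) u u)"
 by (simp add: fr_form[symmetric] norm_eq_sqrt_inner)

lemma un_nz: "un u \<noteq> 0"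
 by (simp add: un_def axis_eq_0_iff)

lemma Psi_in: "Psi z \<in> SB"
proof -
 let ?p = "fst z" and ?u = "un (snd z)"
 have n: "norm (fr ?p ?u) \<noteq> 0" using un_nz fr_eq_0 by simp
 have "g ?p (snd (Psi z)) (snd (Psi z)) = (norm (fr ?p ((1 / norm (fr ?p ?u)) *R ?u)))^2"
  by (simp only: Psi_def snd_conv tv_form fr_form[symmetric] power2_norm_eq_inner)
 also have "\<dots> = 1" using n by (simp add: linear_scale[OF linear_fr])
 finally show ?thesis by (simp add: unit_sphere_bundle_def Psi_def tv_in)
qed

lemma measurable_norm_fr: "(\<lambda>z. norm (fr (fst z) (snd z))) \<in> borel_measurable borel"
proof -
 have [measurable]: "(\<lambda>z :: 'a \<times> (real^'n). kap (fst z) $ i $ j) \<in> borel_measurable borel" for i j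
  by (rule measurable_compose[OF borel_measurable_continuous_onI[OF continuous_on_fst[OF continuous_on_id]] measurable_kap])
 have [measurable]: "(snd :: 'a \<times> (real^'n) => _) \<in> borel_measurable borel"
  by (intro borel_measurable_continuous_onI continuous_intros)
 show ?thesis unfolding norm_fr form_entries by measurable
qed

definition tvc :: "('a, 'n) chart => 'a => real^'n => real^'n" where
 "tvc c p u = (if p \<in> fst c then tv p u c else 0)"

lemma measurable_tvc:
 assumes c: "c \<in> A"
 shows "(\<lambda>z. tvc c (fst z) (snd z)) \<in> borel_measurable borel"
proof -
 define O' where "O' d = {x \<in> Om d. chart_inv d x \<in> fst c} \<times> (UNIV :: (real^'n) set)" for d :: "('a, 'n) chart"
 define T where "T d z = (if z \<in> O' d then dd (\<lambda>z. snd c (chart_inv d z)) (fst z) (snd z) else 0)" for d :: "('a, 'n) chart" and z :: "(real^'n) \<times> (real^'n)"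
 note [measurable] = sets_ch
 have [measurable]: "(snd :: 'a \<times> (real^'n) => _) \<in> borel_measurable borel" "(fst :: 'a \<times> (real^'n) => _) \<in> borel_measurable borel"
  by (intro borel_measurable_continuous_onI continuous_intros)+
 have T: "T d \<in> borel_measurable borel" if d: "d \<in> A" for d
  unfolding T_def[abs_def]
 proof (rule borel_measurable_open_extension)
  let ?O = "{x \<in> Om d. chart_inv d x \<in> fst c}" and ?f = "\<lambda>z. snd c (chart_inv d z)"
  have o: "open ?O" by (rule param_open_dom[OF open_Om[OF d] continuous_chart_inv[OF d] c])
  thus "open (O' d)" unfolding O'_def by (intro open_Times) auto
  have sm: "smooth_on ?O ?f" by (rule transition_smooth[OF d c])
  have "continuous_on (O' d) (\<lambda>z. dd ?f (fst z) (axis i 1))" for i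
   by (rule continuous_on_compose2[OF smooth_on_continuous_on[OF smooth_on_dd[OF sm, of "axis i 1"]] continuous_on_fst[OF continuous_on_id]])
    (auto simp: O'_def)
  hence "continuous_on (O' d) (\<lambda>z. \<Sum>i\<in>UNIV. snd z $ i *R dd ?f (fst z) (axis i 1))"
   by (intro continuous_intros)
  moreover have "dd ?f (fst z) (snd z) = (\<Sum>i\<in>UNIV. snd z $ i *R dd ?f (fst z) (axis i 1))" if "z \<in> O' d" for z
   by (rule linear_axis_expand[OF smooth_on_linear_dd[OF sm]]) (use that in \<open>auto simp: O'_def\<close>)
  ultimately show "continuous_on (O' d) (\<lambda>z. dd ?f (fst z) (snd z))"
   by (rule continuous_on_cong[THEN iffD2, OF refl, rotated])
 qed
 have [measurable]: "(\<lambda>z. T d (coord_of d (fst z), snd z)) \<in> borel_measurable (borel :: ('a \<times> (real^'n)) measure)" if d: "d \<in> range ch" for d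
 proof -
  note [measurable] = measurable_coord_of[OF range_ch[OF d]]
  have "(\<lambda>z. (coord_of d (fst z), snd z)) \<in> (borel :: ('a \<times> (real^'n)) measure) \<rightarrow>\<^sub>M borel" by measurable
  from measurable_compose[OF this T[OF range_ch[OF d]]] show ?thesis .
 qed
 have "(\<lambda>z :: 'a \<times> (real^'n). \<Sum>d\<in>range ch. indicator {p. ch p = d} (fst z) *R T d (coord_of d (fst z), snd z)) \<in> borel_measurable borel"
  by (intro borel_measurable_sum borel_measurable_scaleR) measurable
 moreover have "(\<Sum>d\<in>range ch. indicator {p. ch p = d} (fst z) *R T d (coord_of d (fst z), snd z)) = tvc c (fst z) (snd z)" for z
 proof -
  obtain p u where z: "z = (p, u)" by (cases z)
  have "(\<Sum>d\<in>range ch. indicator {p. ch p = d} p *R T d (coord_of d p, u)) = (\<Sum>d\<in>range ch. if d = ch p then T d (coord_of d p, u) else 0)"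
   by (intro sum.cong refl) auto
  also have "\<dots> = T (ch p) (snd (ch p) p, u)" using finite_ch by (simp add: coord_of_def in_ch)
  also have "\<dots> = tvc c p u"
   using ch_coord(1)[of p] ch_coord(2)[of p] c
   by (simp add: T_def O'_def tvc_def tv_def coord_vector_def tangent_map_apply)
  finally show ?thesis by (simp add: z)
 qed
 ultimately show ?thesis by simp
qed

lemma measurable_Psi: "Psi \<in> borel \<rightarrow>\<^sub>M Sig"
 unfolding Sig_def
proof (rule measurable_measure_of[OF gens_sub])
 show "Psi \<in> space borel \<rightarrow> SB" using Psi_in by simp
 fix G assume "G \<in> gens"
 then obtain c W where c: "c \<in> A" and W: "open W" and G: "G = {(p, v) \<in> SB. p \<in> fst c \<and> (snd c p, v c) \<in> W}"
  unfolding gens_def by blast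
 have [measurable]: "(snd :: 'a \<times> (real^'n) => _) \<in> borel_measurable borel" "(fst :: 'a \<times> (real^'n) => _) \<in> borel_measurable borel"
  by (intro borel_measurable_continuous_onI continuous_intros)+
 have [measurable]: "un \<in> borel_measurable borel" unfolding un_def[abs_def] by measurable
 note [measurable] = measurable_coord_of[OF c]
 have pair: "(\<lambda>z. (fst z, un (snd z))) \<in> (borel :: ('a \<times> (real^'n)) measure) \<rightarrow>\<^sub>M borel" by measurable
 have [measurable]: "(\<lambda>z. norm (fr (fst z) (un (snd z)))) \<in> borel_measurable borel"
  using measurable_compose[OF pair measurable_norm_fr] by simp
 define w where "w z = (1 / norm (fr (fst z) (un (snd z)))) *R un (snd z)" for z :: "'a \<times> (real^'n)"
 have [measurable]: "w \<in> borel_measurable borel" unfolding w_def[abs_def] by measurable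
 have "(\<lambda>z. (fst z, w z)) \<in> (borel :: ('a \<times> (real^'n)) measure) \<rightarrow>\<^sub>M borel" by measurable
 from measurable_compose[OF this measurable_tvc[OF c]]
 have [measurable]: "(\<lambda>z. tvc c (fst z) (w z)) \<in> borel_measurable borel" by simp
 have m: "(\<lambda>z. (coord_of c (fst z), tvc c (fst z) (w z))) \<in> (borel :: ('a \<times> (real^'n)) measure) \<rightarrow>\<^sub>M borel" by measurable
 have "Psi -` G \<inter> space borel = (fst -` fst c \<inter> space borel) \<inter> ((\<lambda>z. (coord_of c (fst z), tvc c (fst z) (w z))) -` W \<inter> space borel)"
  using Psi_in unfolding G by (auto simp: Psi_def w_def tvc_def coord_of_def)
 also have "\<dots> \<in> sets (borel :: ('a \<times> (real^'n)) measure)"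
  by (intro sets.Int measurable_sets[OF m] measurable_sets[of fst borel borel]) (use W open_dom[OF c] in auto)
 finally show "Psi -` G \<inter> space borel \<in> sets borel" .
qed

section \<open>Measurable coordinates and integration on the sphere bundle\<close>

lemma measurable_SB_base: "fst \<in> Sig \<rightarrow>\<^sub>M borel"
proof (rule borel_measurableI)
 fix S :: "'a set" assume S: "open S"
 have "{(p, v) \<in> SB. p \<in> S \<inter> fst c} \<in> sets Sig" if c: "c \<in> A" for c
 proof -
  have e: "p \<in> S \<inter> fst c \<longleftrightarrow> p \<in> fst c \<and> snd c p \<in> Om c \<inter> chart_inv c -` S" for p
   using chart_inv_chart[OF c, of p] by auto
  have "open (Om c \<inter> chart_inv c -` S)"
   by (rule continuous_open_preimage[OF continuous_chart_inv[OF c] open_Om[OF c] S])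
  hence "open ((Om c \<inter> chart_inv c -` S) \<times> (UNIV :: (real^'n) set))" by (intro open_Times) auto
  from gens_sets[OF c this] show ?thesis unfolding e by (simp add: conj_ac)
 qed
 hence "(\<Union>c\<in>range ch. {(p, v) \<in> SB. p \<in> S \<inter> fst c}) \<in> sets Sig"
  using finite_ch range_ch by (intro sets.finite_UN) auto
 moreover have "(\<Union>c\<in>range ch. {(p, v) \<in> SB. p \<in> S \<inter> fst c}) = fst -` S \<inter> space Sig"
  by (auto simp: space_Sig intro: in_ch)
 ultimately show "fst -` S \<inter> space Sig \<in> sets Sig" by simp
qed

lemma SB_coordinate_0: "(p, v) \<in> SB ==> p \<notin> fst d ==> v d = 0"
 using tangent_space_outside unfolding unit_sphere_bundle_def by blast

lemma measurable_SB_coordinate: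
 assumes d: "d \<in> A"
 shows "(\<lambda>z. snd z d) \<in> borel_measurable Sig"
proof (rule borel_measurableI)
 fix W :: "(real^'n) set" assume W: "open W"
 have "open (UNIV \<times> W :: ((real^'n) \<times> (real^'n)) set)" using W by (intro open_Times) auto
 from gens_sets[OF d this] have 1: "{(p, v) \<in> SB. p \<in> fst d \<and> v d \<in> W} \<in> sets Sig" by simp
 have 2: "{z \<in> space Sig. fst z \<notin> fst d} \<in> sets Sig"
 proof -
  have "fst -` (- fst d) \<inter> space Sig \<in> sets Sig"
   by (rule measurable_sets[OF measurable_SB_base]) (use open_dom[OF d] in auto)
  moreover have "fst -` (- fst d) \<inter> space Sig = {z \<in> space Sig. fst z \<notin> fst d}" by blast
  ultimately show ?thesis by simp
 qed
 have "(\<lambda>z. snd z d) -` W \<inter> space Sig = {(p, v) \<in> SB. p \<in> fst d \<and> v d \<in> W} \<union> (if 0 \<in> W then {z \<in> space Sig. fst z \<notin> fst d} else {})"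
  using SB_coordinate_0[of _ _ d] by (auto simp: space_Sig split: if_splits) (metis)+
 thus "(\<lambda>z. snd z d) -` W \<inter> space Sig \<in> sets Sig" using 1 2 by simp
qed

lemma measurable_SB_coords: "(\<lambda>z. (fst z, snd z (ch (fst z)))) \<in> Sig \<rightarrow>\<^sub>M borel"
proof -
 note [measurable] = sets_ch measurable_SB_base
 have "(\<lambda>z. \<Sum>d\<in>range ch. indicator {p. ch p = d} (fst z) *R snd z d) \<in> borel_measurable Sig"
  by (intro borel_measurable_sum borel_measurable_scaleR measurable_SB_coordinate range_ch) measurable
 moreover have "(\<Sum>d\<in>range ch. indicator {p. ch p = d} (fst z) *R snd z d) = snd z (ch (fst z))" for z :: "'a \<times> ('a, 'n) tangent_vector"
 proof -
  have "(\<Sum>d\<in>range ch. indicator {p. ch p = d} (fst z) *R snd z d) = (\<Sum>d\<in>range ch. if d = ch (fst z) then snd z d else 0)"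
   by (intro sum.cong refl) auto
  thus ?thesis using finite_ch by simp
 qed
 ultimately have [measurable]: "(\<lambda>z. snd z (ch (fst z))) \<in> borel_measurable Sig" by simp
 show ?thesis by measurable
qed

text \<open>On each tangent space, in chart coordinates, this is \<open>n\<close> times the Lebesgue
  measure of the metric on the punctured unit ball, in accordance with the cone description in
  \<open>unit_sphere_measure\<close>. The lengths and \<open>kap\<close> are independent of the
  frame, hence Borel.\<close>

definition sb_density :: "'a \<times> (real^'n) => ennreal" where
 "sb_density z = of_nat CARD('n) * ennreal (sqrt (det (kap (fst z)))) * indicator {0<..<1} (norm (fr (fst z) (snd z)))"

lemma sets_vol_lborel: "sets (vol \<Otimes>\<^sub>M lborel) = sets (borel :: ('a \<times> (real^'n)) measure)"
proof -
 have "sets (vol \<Otimes>\<^sub>M (lborel :: (real^'n) measure)) = sets (borel \<Otimes>\<^sub>M borel)" by (intro sets_pair_measure_cong) auto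
 thus ?thesis by (simp only: borel_prod)
qed

lemma measurable_vol_lborel: "measurable (vol \<Otimes>\<^sub>M lborel) M = measurable (borel :: ('a \<times> (real^'n)) measure) M"
 by (rule measurable_cong_sets[OF sets_vol_lborel refl])

lemma measurable_sb_density: "sb_density \<in> borel_measurable borel"
proof -
 note [measurable] = measurable_norm_fr
 have [measurable]: "(\<lambda>z :: 'a \<times> (real^'n). det (kap (fst z))) \<in> borel_measurable borel"
  by (rule measurable_compose[OF borel_measurable_continuous_onI[OF continuous_on_fst[OF continuous_on_id]] measurable_det_kap])
 show ?thesis unfolding sb_density_def[abs_def] by measurable
qed

text \<open>As an image of a density on a product space this measure has its integrals computed by
  Tonelli; agreement with the defining set function is
  \<open>sphere_bundle_measure_eq\<close>.\<close>

definition SBM :: "('a \<times> ('a, 'n) tangent_vector) measure" where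
 "SBM = distr (density (vol \<Otimes>\<^sub>M lborel) sb_density) Sig Psi"

lemma sets_SBM: "sets SBM = sets Sig" and space_SBM: "space SBM = SB"
 by (simp_all add: SBM_def space_Sig)

lemma Psi_frame:
 assumes "y \<noteq> 0"
 shows "Psi (p, frm p y (ch p)) = (p, frm p (sgn y))"
proof -
 let ?u = "frm p y (ch p)"
 have u: "fr p ?u = y" by (rule fr_frame)
 hence "?u \<noteq> 0" using fr_eq_0[of p ?u] assms by simp
 hence "un ?u = ?u" by (simp add: un_def)
 hence "Psi (p, ?u) = (p, frm p (fr p ((1 / norm y) *R ?u)))"
  by (simp add: Psi_def u frame_fr)
 also have "fr p ((1 / norm y) *R ?u) = sgn y"
  by (simp add: linear_scale[OF linear_fr] u sgn_div_norm inverse_eq_divide)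
 finally show ?thesis .
qed

lemma measurable_frame_coords:
 assumes F: "F \<in> borel_measurable Sig"
 shows "(\<lambda>y. F (Psi (p, frm p y (ch p)))) \<in> borel_measurable borel"
proof -
 have "continuous_on UNIV (\<lambda>y. frm p y (ch p))"
  by (rule linear_continuous_on[OF linear_conv_bounded_linear[THEN iffD1, OF frame_linear]])
 hence "(\<lambda>y. (p, frm p y (ch p))) \<in> borel \<rightarrow>\<^sub>M borel"
  by (intro borel_measurable_continuous_onI continuous_on_Pair continuous_on_const)
 from measurable_compose[OF measurable_compose[OF this measurable_Psi] F] show ?thesis .
qed

lemma measurable_density_Psi:
 assumes F: "F \<in> borel_measurable Sig"
 shows "(\<lambda>z. sb_density z * F (Psi z)) \<in> borel_measurable (vol \<Otimes>\<^sub>M lborel)"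
 unfolding measurable_vol_lborel using measurable_sb_density measurable_compose[OF measurable_Psi F] by simp

lemma nn_integral_sb_fiber:
 assumes F: "F \<in> borel_measurable Sig"
 shows "(LBNN u. sb_density (p, u) * F (Psi (p, u))) =
  of_nat CARD('n) * (LBNN y. F (p, frm p (sgn y)) * indicator pball y)"
proof -
 define f where "f y = of_nat CARD('n) * (F (Psi (p, frm p y (ch p))) * indicator pball y)" for y
 note [measurable] = measurable_frame_coords[OF F, of p]
 have fm: "f \<in> borel_measurable borel" unfolding f_def[abs_def] by measurable
 have "(LBNN u. sb_density (p, u) * F (Psi (p, u))) = (LBNN u. f (fr p u) * ennreal (sqrt (det (kap p))))"
 proof (intro nn_integral_cong)
  fix u
  have "indicator {0<..<1} (norm (fr p u)) = (indicator pball (fr p u) :: ennreal)" by (auto simp: indicator_def)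
  thus "sb_density (p, u) * F (Psi (p, u)) = f (fr p u) * ennreal (sqrt (det (kap p)))"
   by (simp add: sb_density_def f_def frame_fr tv_ch mult_ac)
 qed
 also have "\<dots> = (LBNN y. f y)" by (rule nn_integral_fr[OF fm, symmetric])
 also have "\<dots> = of_nat CARD('n) * (LBNN y. F (Psi (p, frm p y (ch p))) * indicator pball y)"
  unfolding f_def by (rule nn_integral_cmult) measurable
 also have "(LBNN y. F (Psi (p, frm p y (ch p))) * indicator pball y) =
   (LBNN y. F (p, frm p (sgn y)) * indicator pball y)"
  by (intro nn_integral_cong) (simp add: indicator_def Psi_frame)
 finally show ?thesis .
qed

lemma measurable_sb_fiber:
 assumes F: "F \<in> borel_measurable Sig"
 shows "(\<lambda>p. of_nat CARD('n) * (LBNN y. F (p, frm p (sgn y)) * indicator pball y)) \<in> borel_measurable vol"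
 using lborel.borel_measurable_nn_integral_fst[OF measurable_density_Psi[OF F]] by (simp only: nn_integral_sb_fiber[OF F])

lemma nn_integral_SBM:
 assumes F: "F \<in> borel_measurable Sig"
 shows "(\<integral>\<^sup>+z. F z \<partial>SBM) = (\<integral>\<^sup>+p. of_nat CARD('n) * (LBNN y. F (p, frm p (sgn y)) * indicator pball y) \<partial>vol)"
proof -
 have m: "Psi \<in> density (vol \<Otimes>\<^sub>M lborel) sb_density \<rightarrow>\<^sub>M Sig"
  using measurable_Psi by (simp add: measurable_vol_lborel)
 have FP: "(\<lambda>z. F (Psi z)) \<in> borel_measurable borel" by (rule measurable_compose[OF measurable_Psi F])
 have "(\<integral>\<^sup>+z. F z \<partial>SBM) = (\<integral>\<^sup>+z. sb_density z * F (Psi z) \<partial>(vol \<Otimes>\<^sub>M lborel))"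
  unfolding SBM_def using measurable_sb_density FP
  by (subst nn_integral_distr[OF m]) (use F in \<open>simp_all add: nn_integral_density measurable_vol_lborel\<close>)
 also have "\<dots> = (\<integral>\<^sup>+p. (LBNN u. sb_density (p, u) * F (Psi (p, u))) \<partial>vol)"
  by (rule lborel.nn_integral_fst[OF measurable_density_Psi[OF F], symmetric])
 finally show ?thesis by (simp only: nn_integral_sb_fiber[OF F])
qed

text \<open>\<open>measure_of\<close> returns the intended measure only for a set function that is
  countably additive on the generated sigma-algebra. The fibrewise set function inherits this from
  \<open>SBM\<close>, with which it agrees there.\<close>

lemma sphere_bundle_measure_eq: "sphere_bundle_measure A g = SBM"
proof -
 define \<mu> where "\<mu> E = (\<integral>\<^sup>+p. emeasure unit_sphere_measure {x \<in> sphere 0 1. (p, frm p x) \<in> E} \<partial>vol)" for E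
 have \<mu>: "\<mu> E = emeasure SBM E" if E: "E \<in> sigma_sets SB gens" for E
 proof -
  have ES: "E \<in> sets Sig" using E by (simp add: sets_Sig)
  have I: "(indicator E :: _ => ennreal) \<in> borel_measurable Sig" using ES by simp
  have "emeasure SBM E = (\<integral>\<^sup>+z. indicator E z \<partial>SBM)" using ES by (simp add: sets_SBM)
  also have "\<dots> = (\<integral>\<^sup>+p. of_nat CARD('n) * (LBNN y. indicator E (p, frm p (sgn y)) * indicator pball y) \<partial>vol)"
   by (rule nn_integral_SBM[OF I])
  also have "\<dots> = \<mu> E"
   unfolding \<mu>_def
  proof (intro nn_integral_cong)
   fix p
   let ?X = "{x \<in> sphere 0 1. (p, frm p x) \<in> E}"
   have "?X = sphere 0 1 \<inter> (\<lambda>y. indicator E (Psi (p, frm p y (ch p)))) -` {1 :: ennreal}"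
   proof (intro set_eqI iffI)
    fix x assume "x \<in> ?X"
    hence "norm x = 1" "(p, frm p x) \<in> E" by simp_all
    moreover from this(1) have "x \<noteq> 0" "sgn x = x" by (auto simp: sgn_div_norm)
    ultimately show "x \<in> sphere 0 1 \<inter> (\<lambda>y. indicator E (Psi (p, frm p y (ch p)))) -` {1 :: ennreal}"
     by (simp add: Psi_frame)
   next
    fix x assume x: "x \<in> sphere 0 1 \<inter> (\<lambda>y. indicator E (Psi (p, frm p y (ch p)))) -` {1 :: ennreal}"
    hence "norm x = 1" by simp
    hence "x \<noteq> 0" "sgn x = x" by (auto simp: sgn_div_norm)
    with x show "x \<in> ?X" by (simp add: Psi_frame indicator_eq_1_iff)
   qed
   moreover have "(\<lambda>y. indicator E (Psi (p, frm p y (ch p)))) -` {1 :: ennreal} \<in> sets (borel :: (real^'n) measure)"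
    using measurable_sets[OF measurable_frame_coords[OF I, of p], of "{1}"] by simp
   ultimately have X: "?X \<in> sets borel" by simp
   have "emeasure unit_sphere_measure ?X = of_nat CARD('n) * (LBNN y. indicator ?X (sgn y) * indicator pball y)"
    by (rule emeasure_unit_sphere_measure[OF X]) blast
   also have "(LBNN y. indicator ?X (sgn y) * indicator pball y) =
     (LBNN y. indicator E (p, frm p (sgn y)) * indicator pball y)"
    by (intro nn_integral_cong) (simp add: indicator_def norm_sgn)
   finally show "of_nat CARD('n) * (LBNN y. indicator E (p, frm p (sgn y)) * indicator pball y) =
    emeasure unit_sphere_measure ?X" ..
  qed
  finally show ?thesis ..
 qed
 have "sphere_bundle_measure A g = measure_of SB gens \<mu>"
  unfolding sphere_bundle_measure_def gens_def \<mu>_def volume_measure_eq ..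
 also have "\<dots> = measure_of SB gens (emeasure SBM)"
  by (rule measure_of_eq[OF gens_sub \<mu>])
 also have "\<dots> = SBM"
 proof (rule measure_eqI)
  let ?M = "measure_of SB gens (emeasure SBM)"
  show s: "sets ?M = sets SBM" using gens_sub by (simp add: sets_SBM sets_Sig)
  show "emeasure ?M X = emeasure SBM X" if "X \<in> sets ?M" for X
   by (rule emeasure_measure_of[OF refl gens_sub _ _ that])
    (simp_all only: s emeasure_positive emeasure_countably_additive)
 qed
 finally show ?thesis .
qed

lemma emeasure_SBM_space:
 "emeasure SBM SB = ennreal (real CARD('n) * measure lborel (ball 0 1 :: (real^'n) set) * measure vol UNIV)"
proof -
 interpret finite_measure vol by (rule finite_measure_vol)
 have "emeasure SBM SB = (\<integral>\<^sup>+z. 1 \<partial>SBM)" by (simp add: space_SBM)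
 also have "\<dots> = (\<integral>\<^sup>+p. of_nat CARD('n) * (LBNN y. 1 * indicator (pball :: (real^'n) set) y) \<partial>vol)"
  by (rule nn_integral_SBM) simp
 also have "\<dots> = (\<integral>\<^sup>+p. of_nat CARD('n) * ennreal (measure lborel (ball 0 1 :: (real^'n) set)) \<partial>vol)"
  by (simp add: emeasure_pball)
 also have "\<dots> = of_nat CARD('n) * ennreal (measure lborel (ball 0 1 :: (real^'n) set)) * ennreal (measure vol UNIV)"
  by (simp add: emeasure_eq_measure)
 finally show ?thesis by (simp add: ennreal_mult' ennreal_of_nat_eq_real_of_nat)
qed

end

section \<open>Invariance of the Liouville measure\<close>

text \<open>An open set is a countable union of compact boxes. The images of the boxes are closed
  and the inverse is continuous on each of them, which makes it Borel on their union.\<close>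

lemma borel_measurable_inv_extension:
 fixes f :: "'x::euclidean_space => 'y::t2_space" and G :: "'x => ennreal"
 assumes S: "open S" "continuous_on S f" "inj_on f S" and G: "G \<in> borel_measurable borel"
 shows "(\<lambda>y. if y \<in> f ` S then G (inv_into S f y) else 0) \<in> borel_measurable borel"
proof -
 obtain D where D: "countable D" "D \<subseteq> Pow S" "\<And>X. X \<in> D ==> \<exists>a b. X = cbox a b" "\<Union>D = S"
  using open_countable_Union_open_cbox[OF S(1)] by metis
 have K: "compact X" "X \<subseteq> S" if "X \<in> D" for X using D(2,3) that compact_cbox by blast+
 have cont: "continuous_on X f" if "X \<in> D" for X using S(2) K(2)[OF that] by (rule continuous_on_subset)
 have cl: "closed (f ` X)" if "X \<in> D" for X
  by (rule compact_imp_closed[OF compact_continuous_image[OF cont[OF that] K(1)[OF that]]])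
 have fS: "f ` S = (\<Union>X\<in>D. f ` X)" using D(4) by blast
 have "f ` S \<in> sets borel"
  unfolding fS by (rule sets.countable_UN'[OF D(1)]) (use cl in auto)
 show ?thesis
 proof (rule measurable_piecewise_restrict)
  let ?C = "insert (- f ` S) ((`) f ` D)"
  show "countable ?C" using D(1) by simp
  show "space borel \<subseteq> \<Union>?C" using fS by blast
  fix Y assume "Y \<in> ?C"
  then consider "Y = - f ` S" | X where "X \<in> D" "Y = f ` X" by blast
  thus "Y \<inter> space borel \<in> sets borel"
  proof cases
   case 1 thus ?thesis using \<open>f ` S \<in> sets borel\<close> by auto
  next
   case 2 thus ?thesis using cl by simp
  qed
  show "(\<lambda>y. if y \<in> f ` S then G (inv_into S f y) else 0) \<in> borel_measurable (restrict_space borel Y)"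
   using \<open>Y \<in> ?C\<close>
  proof (elim insertE imageE)
   assume Y: "Y = - f ` S"
   have "(\<lambda>y. 0 :: ennreal) \<in> borel_measurable (restrict_space borel Y)" by simp
   thus ?thesis by (rule measurable_cong[THEN iffD1, rotated]) (simp add: Y space_restrict_space)
  next
   fix X assume X: "Y = f ` X" "X \<in> D"
   have "continuous_on (f ` X) (inv_into S f)"
    by (rule continuous_on_inv[OF cont[OF X(2)] K(1)[OF X(2)]]) (use K(2)[OF X(2)] S(3) in \<open>auto simp: inv_into_f_f subset_iff\<close>)
   hence "inv_into S f \<in> borel_measurable (restrict_space borel Y)"
    unfolding X(1) by (rule borel_measurable_continuous_on_restrict)
   from measurable_compose[OF this G] have "(\<lambda>y. G (inv_into S f y)) \<in> borel_measurable (restrict_space borel Y)" .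
   thus ?thesis
    by (rule measurable_cong[THEN iffD1, rotated]) (use K(2)[OF X(2)] in \<open>auto simp: X(1) space_restrict_space\<close>)
  qed
 qed
qed

lemma (in riemannian_manifold) param_subset:
 assumes "param U ps" "V \<subseteq> U" "open V"
 shows "param V ps"
 unfolding param_def
proof (intro conjI ballI impI)
 show "continuous_on V ps" using assms continuous_on_subset by (auto simp: param_def)
 show "smooth_on {x \<in> V. ps x \<in> fst c} (\<lambda>x. snd c (ps x))" if "c \<in> A" for c
  by (rule smooth_on_subset[OF param_smooth(2)[OF assms(1) that]]) (use assms(2) in blast)
 show "inj (dd (\<lambda>x. snd c (ps x)) x)" if "c \<in> A" "x \<in> V" "ps x \<in> fst c" for c x
  using assms(1,2) that unfolding param_def by blast
qed (rule assms(3))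

text \<open>Invariance of domain, applied in charts.\<close>

lemma (in riemannian_manifold) param_open_image:
 assumes "param U ps" "inj_on ps U"
 shows "open (ps ` U)"
proof -
 have "\<exists>T. open T \<and> ps x \<in> T \<and> T \<subseteq> ps ` U" if x: "x \<in> U" for x
 proof -
  obtain c where c: "c \<in> A" "ps x \<in> fst c" using chart_exists by blast
  define V where "V = {x\<in>U. ps x \<in> fst c}"
  have V: "open V" "smooth_on V (\<lambda>x. snd c (ps x))" unfolding V_def by (rule param_smooth[OF assms(1) c(1)])+
  have "inj_on (\<lambda>x. snd c (ps x)) V"
  proof (rule inj_onI)
   fix x y assume "x \<in> V" "y \<in> V" "snd c (ps x) = snd c (ps y)"
   thus "x = y" using inj_onD[OF assms(2)] inj_onD[OF inj_on_chart[OF c(1)]] unfolding V_def by simp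
  qed
  hence o: "open ((\<lambda>x. snd c (ps x)) ` V)"
   by (rule invariance_of_domain[OF smooth_on_continuous_on[OF V(2)] V(1)])
  let ?T = "fst c \<inter> snd c -` ((\<lambda>x. snd c (ps x)) ` V)"
  have "open ?T" by (rule continuous_open_preimage[OF continuous_chart[OF c(1)] open_dom[OF c(1)] o])
  moreover have "ps x \<in> ?T" using x c(2) by (simp add: V_def)
  moreover have "?T \<subseteq> ps ` U"
  proof
   fix q assume q: "q \<in> ?T"
   then obtain y where y: "y \<in> V" "snd c q = snd c (ps y)" by blast
   hence "q = ps y" using q inj_onD[OF inj_on_chart[OF c(1)]] unfolding V_def by simp
   thus "q \<in> ps ` U" using y(1) by (simp add: V_def)
  qed
  ultimately show ?thesis by (intro exI[of _ ?T] conjI)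
 qed
 thus ?thesis by (subst open_subopen) blast
qed

text \<open>The gap between \<open>r\<close> and \<open>r'\<close> is the room that
  \<open>tau_lower_bound\<close> works in. The radii of the exponential balls may vary with the
  point; the bound \<open>r'\<close> below them is uniform.\<close>

locale closed_manifold_radius = closed_manifold A g
 for A :: "('a::{t2_space,second_countable_topology}, 'n::finite) chart set" and g :: "('a, 'n) metric_tensor" +
 fixes r r' :: real
 assumes r: "0 < r" "r < r'" and diffeo: "\<And>p. \<exists>rh>r'. diffeo p rh"
begin

definition rh :: "'a => real" where "rh p = (SOME rh. rh > r' \<and> diffeo p rh)"

lemma rh_gt: "rh p > r'" and rh: "diffeo p (rh p)" and rh_pos: "rh p > 0"
 using someI_ex[OF diffeo[of p]] r unfolding rh_def by auto

lemma normal_coords_p: "normal_coords (ball 0 (rh p)) (hE p)"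
 by (rule normal_coords_hE[OF rh rh_pos])

lemma metric_hE: "metric_on (ball 0 (rh p)) (hE p)"
 using pull_metric_on[OF exp_diffeo_param(1)[OF rh]] by (simp add: hE_def)

definition C :: real where "C = (SOME C. C \<ge> 0 \<and> (\<forall>p. \<forall>V\<in>TS p. \<bar>ric p V\<bar> \<le> C * g p V V))"

lemma C: "C \<ge> 0" "V \<in> TS p ==> \<bar>ric p V\<bar> \<le> C * g p V V"
proof -
 have "\<exists>C. C \<ge> 0 \<and> (\<forall>p. \<forall>V\<in>TS p. \<bar>ric p V\<bar> \<le> C * g p V V)" using ric_bounded by blast
 from someI_ex[OF this] show "C \<ge> 0" "V \<in> TS p ==> \<bar>ric p V\<bar> \<le> C * g p V V"
  unfolding C_def by blast+
qed

text \<open>Ricci curvature at the start and at the end of the geodesic with initial vector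
  \<open>v\<close>, shifted by the bound \<open>C\<close> to be nonnegative. The quadratic scaling
  in \<open>v\<close> provides the factor \<open>s^2\<close> of the integrated Riccati
  equation.\<close>

definition R0 :: "'a => real^'n => real" where "R0 p v = C * (v \<bullet> v) + ric p (frm p v)"
definition R1 :: "'a => real^'n => real" where "R1 p v = C * (v \<bullet> v) + ricq (hE p) v v"

lemma R0_nonneg: "R0 p v \<ge> 0"
 using C(2)[OF frame_in[of p v]] by (simp add: R0_def frame_isometry)

lemma ricq_hE: "v \<in> ball 0 (rh p) ==> ricq (hE p) v u = ric (Ex p v) (Tmap (Ex p) v u)"
 unfolding hE_def by (rule ric_param[OF exp_diffeo_param(1)[OF rh], symmetric])

lemma R1_nonneg: "v \<in> ball 0 (rh p) ==> R1 p v \<ge> 0"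
proof -
 assume v: "v \<in> ball 0 (rh p)"
 have "\<bar>ric (Ex p v) (Tmap (Ex p) v v)\<bar> \<le> C * (v \<bullet> v)"
  using C(2)[OF param_tangent_map_in[OF exp_diffeo_param(1)[OF rh] v], of v]
   hE_form[OF rh rh_pos v, of v v] hE_gauss[OF rh rh_pos v] by simp
 thus ?thesis by (simp add: R1_def ricq_hE[OF v])
qed

abbreviation B :: "(real^'n) set" where "B \<equiv> ball 0 r - {0}"

lemma B_ball: "v \<in> B ==> v \<in> ball 0 (rh p)"
 using rh_gt[of p] r by simp

lemma param_B: "param B (Ex p)" and inj_B: "inj_on (Ex p) B" and open_B: "open (Ex p ` B)"
proof -
 have sub: "B \<subseteq> ball 0 (rh p)" using B_ball by blast
 show "param B (Ex p)" by (rule param_subset[OF exp_diffeo_param(1)[OF rh] sub]) (simp add: open_Diff)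
 moreover show "inj_on (Ex p) B" by (rule inj_on_subset[OF exp_diffeo_param(2)[OF rh] sub])
 ultimately show "open (Ex p ` B)" by (rule param_open_image)
qed

text \<open>The inverse of the radial factor of polar coordinates: integrals over \<open>B\<close>
  become integrals over directions and arc length.\<close>

definition wt :: "real^'n => real" where "wt v = 1 / norm v ^ (CARD('n) - 1)"

text \<open>Dividing by the volume density of normal coordinates makes the integral against
  \<open>vol\<close> a Lebesgue integral over vectors (\<open>nn_integral_kern\<close>). The
  punctured ball avoids the singularity of \<open>wt\<close>.\<close>

definition kern :: "('a => real^'n => real) => 'a => 'a => ennreal" where
 "kern R p q = (if q \<in> Ex p ` B then
  (let v = inv_into B (Ex p) q in ennreal (wt v * R p v) * ennreal (1 / sqrt (det (hE p v)))) else 0)"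

lemma kern_Ex: "v \<in> B ==> kern R p (Ex p v) = ennreal (wt v * R p v) * ennreal (1 / sqrt (det (hE p v)))"
 by (simp add: kern_def inv_into_f_f[OF inj_B])

lemma det_hE_pos: "v \<in> B ==> det (hE p v) > 0"
 using posdef_det_pos metric_hE B_ball unfolding metric_on_def by metis

lemma nn_integral_kern:
 assumes "kern R p \<in> borel_measurable borel"
 shows "(\<integral>\<^sup>+q. kern R p q \<partial>vol) = (LBNN v. ennreal (wt v * R p v) * indicator B v)"
proof -
 have "(\<integral>\<^sup>+q. kern R p q \<partial>vol) = (\<integral>\<^sup>+q. kern R p q * indicator (Ex p ` B) q \<partial>vol)"
  by (intro nn_integral_cong) (simp add: kern_def indicator_def)
 also have "\<dots> = (LBNN v. kern R p (Ex p v) * ennreal (sqrt (det (pull_metric (Ex p) v))) * indicator B v)"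
  by (rule vol_param[OF param_B inj_B open_B assms, symmetric])
 also have "\<dots> = (LBNN v. ennreal (wt v * R p v) * indicator B v)"
 proof (intro nn_integral_cong)
  fix v
  show "kern R p (Ex p v) * ennreal (sqrt (det (pull_metric (Ex p) v))) * indicator B v = ennreal (wt v * R p v) * indicator B v"
  proof (cases "v \<in> B")
   case True
   have d: "sqrt (det (hE p v)) > 0" using det_hE_pos[OF True] by simp
   have "ennreal (1 / sqrt (det (hE p v))) * ennreal (sqrt (det (hE p v))) = 1"
    using d by (simp add: ennreal_mult'[symmetric])
   thus ?thesis using True unfolding kern_Ex[OF True] by (simp add: hE_def mult.assoc)
  qed simp
 qed
 finally show ?thesis .
qed

text \<open>\<open>reverse_geodesic\<close> exchanges the end points: lengths, hence weights, and
  volume densities agree, and the Ricci value at the end of one vector is that at the start of the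
  other. This is the flow invariance of the bundle measure in the form used here.\<close>

lemma kern_reverse: "kern R1 p q = kern R0 q p"
proof -
 have rev: "p \<in> Ex q ` B \<and> kern R1 p q = kern R0 q p" if q: "q \<in> Ex p ` B" for p q
 proof -
  obtain v where v: "v \<in> B" "q = Ex p v" using q by blast
  have nv: "norm v < rh p" "norm v < rh q" using v(1) rh_gt[of p] rh_gt[of q] r by simp_all
  obtain w where w: "norm w = norm v" "Ex q w = p" "det (hE q w) = det (hE p v)"
   "ric q (frm q w) = ric q (Tmap (Ex p) v v)"
   using reverse_geodesic[OF rh rh nv v(2)] by metis
  have "w \<noteq> 0" using w(1) v(1) by (metis DiffD2 insertI1 norm_eq_zero)
  hence wB: "w \<in> B" using w(1) v(1) by simp
  have "R1 p v = R0 q w"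
   using w(1,4) unfolding R1_def R0_def ricq_hE[OF B_ball[OF v(1)]] v(2)[symmetric] by (simp add: dot_square_norm)
  hence eq: "kern R1 p (Ex p v) = kern R0 q (Ex q w)"
   unfolding kern_Ex[OF v(1)] kern_Ex[OF wB] by (simp add: w(1,3) wt_def)
  have "p \<in> Ex q ` B" using imageI[OF wB, of "Ex q"] by (simp only: w(2))
  moreover have "kern R1 p q = kern R0 q p" using eq by (simp only: w(2) v(2)[symmetric])
  ultimately show ?thesis by (rule conjI)
 qed
 show ?thesis
 proof (cases "q \<in> Ex p ` B")
  case True
  from rev[OF this] show ?thesis by (rule conjunct2)
 next
  case False
  hence "p \<notin> Ex q ` B" using conjunct1[OF rev, of p q] by blast
  with False show ?thesis by (simp add: kern_def)
 qed
qed

text \<open>The kernel as a function of the base point and of chart coordinates of the vector,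
  assembled from pieces already known to be Borel.\<close>

definition kern_val :: "'a \<times> (real^'n) => ennreal" where
 "kern_val z = ennreal (1 / norm (fr (fst z) (snd z)) ^ (CARD('n) - 1) *
   (C * (norm (fr (fst z) (snd z)))^2 + ric (fst z) (tv (fst z) (snd z)))) * ennreal (1 / sqrt (detE (fst z) (snd z)))"

lemma measurable_kern_val: "kern_val \<in> borel_measurable borel"
proof -
 note [measurable] = measurable_norm_fr
 have [measurable]: "(\<lambda>z. ric (fst z) (tv (fst z) (snd z))) \<in> borel_measurable borel" "(\<lambda>z. detE (fst z) (snd z)) \<in> borel_measurable borel"
  using measurable_ric_tv measurable_detE by (simp_all add: split_beta')
 show ?thesis unfolding kern_val_def[abs_def] by measurable
qed

lemma kern_val_eq:
 assumes "fr p u \<in> B"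
 shows "kern_val (p, u) = kern R0 p (E p u)"
 unfolding E_fr kern_Ex[OF assms]
 using detE_eq[OF rh, of p u] B_ball[OF assms, of p]
 by (simp add: kern_val_def wt_def R0_def frame_fr dot_square_norm)

text \<open>Tonelli requires measurability in both points jointly. In a chart, the map
  \<open>\<Phi>\<close> from a vector to its base point and its exponential image is injective and
  continuous on vectors of length between 0 and \<open>r\<close>. Its inverse is handled by
  \<open>borel_measurable_inv_extension\<close>, and the kernel is \<open>kern_val\<close> composed
  with it.\<close>

lemma measurable_kern: "(\<lambda>z. kern R0 (fst z) (snd z)) \<in> borel_measurable (borel :: ('a \<times> 'a) measure)"
proof -
 note [measurable] = sets_ch
 have [measurable]: "(fst :: 'a \<times> 'a => _) \<in> borel_measurable borel"
  by (intro borel_measurable_continuous_onI continuous_intros)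
 \<comment> \<open>Coordinate vectors of length strictly between 0 and \<open>r\<close>; in frame
   coordinates they fill the punctured ball \<open>B\<close>.\<close>
 define S where "S c = {z \<in> Om c \<times> (UNIV :: (real^'n) set). snd z \<bullet> (gmat c (fst z) *v snd z) \<in> {0<..<r^2}}" for c
 define \<Phi> where "\<Phi> c z = (chart_inv c (fst z), expm (chart_inv c (fst z)) (cvec c (fst z) (snd z)))"
  for c :: "('a, 'n) chart" and z :: "(real^'n) \<times> (real^'n)"
 define G where "G c z = kern_val (chinv c (fst z), snd z)" for c and z :: "(real^'n) \<times> (real^'n)"
 define L where "L c y = (if y \<in> \<Phi> c ` S c then G c (inv_into (S c) (\<Phi> c) y) else 0)" for c y
 have frame_rep: "\<exists>v\<in>B. frm (chart_inv c (fst z)) v = cvec c (fst z) (snd z)" if c: "c \<in> A" and z: "z \<in> S c" for c z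
 proof -
  have x: "fst z \<in> Om c" using z by (auto simp: S_def)
  obtain v where v: "frm (chart_inv c (fst z)) v = cvec c (fst z) (snd z)"
   using frame_surj[OF coord_vector_in[OF c x]] by blast
  have "v \<bullet> v = snd z \<bullet> (gmat c (fst z) *v snd z)"
   using frame_isometry[of "chart_inv c (fst z)" v v] metric_matrix_form[OF c x] by (simp add: v)
  hence n: "v \<bullet> v > 0" "v \<bullet> v < r^2" using z by (auto simp: S_def)
  have "norm v < r" using n(2) r(1) by (simp add: dot_square_norm power2_less_imp_less)
  moreover have "v \<noteq> 0" using n(1) by auto
  ultimately show ?thesis using v by (intro bexI[of _ v]) simp_all
 qed
 have inj: "inj_on (\<Phi> c) (S c)" if c: "c \<in> A" for c
 proof (rule inj_onI)
  fix z z' assume z: "z \<in> S c" "z' \<in> S c" and eq: "\<Phi> c z = \<Phi> c z'"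
  have x: "fst z \<in> Om c" "fst z' \<in> Om c" using z by (auto simp: S_def)
  have 1: "fst z = fst z'" using eq x inj_onD[OF inj_on_chart_inv[OF c]] by (simp add: \<Phi>_def)
  obtain v where v: "v \<in> B" "frm (chart_inv c (fst z)) v = cvec c (fst z) (snd z)"
   using frame_rep[OF c z(1)] by blast
  obtain v' where v': "v' \<in> B" "frm (chart_inv c (fst z')) v' = cvec c (fst z') (snd z')"
   using frame_rep[OF c z(2)] by blast
  have "Ex (chart_inv c (fst z)) v = Ex (chart_inv c (fst z)) v'" using eq v(2) v'(2) 1 by (simp add: \<Phi>_def)
  hence "v = v'" using inj_onD[OF inj_B] v(1) v'(1) by blast
  hence "cvec c (fst z) (snd z) = cvec c (fst z) (snd z')" using v(2) v'(2) 1 by simp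
  hence "snd z = snd z'" using coord_vector_apply[OF c x(1)] by metis
  with 1 show "z = z'" by (simp add: prod_eq_iff)
 qed
 have "L c \<in> borel_measurable borel" if c: "c \<in> A" for c
  unfolding L_def[abs_def]
 proof (rule borel_measurable_inv_extension[OF _ _ inj[OF c]])
  have km: "continuous_on (Om c \<times> (UNIV :: (real^'n) set)) (\<lambda>z. snd z \<bullet> (gmat c (fst z) *v snd z))"
  proof -
   have "continuous_on (Om c \<times> (UNIV :: (real^'n) set)) (\<lambda>z. gmat c (fst z))"
    by (rule continuous_on_compose2[OF continuous_metric_matrix[OF c] continuous_on_fst[OF continuous_on_id]]) auto
   thus ?thesis unfolding form_entries by (intro continuous_intros)
  qed
  have "S c = (Om c \<times> UNIV) \<inter> (\<lambda>z. snd z \<bullet> (gmat c (fst z) *v snd z)) -` {0<..<r^2}" by (auto simp: S_def)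
  thus "open (S c)"
   using continuous_open_preimage[OF km open_Times[OF open_Om[OF c] open_UNIV], of "{0<..<r^2}"] by simp
  have sub: "S c \<subseteq> Om c \<times> UNIV" by (auto simp: S_def)
  have "continuous_on (S c) (\<lambda>z. chart_inv c (fst z))"
   by (rule continuous_on_compose2[OF continuous_chart_inv[OF c] continuous_on_fst[OF continuous_on_id]]) (use sub in auto)
  moreover have "continuous_on (S c) (\<lambda>z. expm (chart_inv c (fst z)) (cvec c (fst z) (snd z)))"
   using continuous_on_subset[OF continuous_exp_map[OF c] sub] by (simp add: split_beta')
  ultimately show "continuous_on (S c) (\<Phi> c)" unfolding \<Phi>_def[abs_def] by (rule continuous_on_Pair)
  have [measurable]: "(fst :: (real^'n) \<times> (real^'n) => _) \<in> borel_measurable borel" "(snd :: (real^'n) \<times> (real^'n) => _) \<in> borel_measurable borel"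
   by (intro borel_measurable_continuous_onI continuous_intros)+
  note [measurable] = measurable_chinv[OF c]
  have "(\<lambda>z :: (real^'n) \<times> (real^'n). (chinv c (fst z), snd z)) \<in> borel \<rightarrow>\<^sub>M borel" by measurable
  from measurable_compose[OF this measurable_kern_val] show "G c \<in> borel_measurable borel" by (simp add: G_def[abs_def])
 qed
 hence Lm: "L c \<in> borel_measurable borel" if "c \<in> range ch" for c using range_ch[OF that] by blast
 have im: "(\<lambda>z :: 'a \<times> 'a. indicator {p. ch p = c} (fst z) :: ennreal) \<in> borel_measurable borel" for c
  by (rule measurable_compose[OF _ borel_measurable_indicator[OF sets_ch]]) simp
 have "(\<lambda>z. \<Sum>c\<in>range ch. indicator {p. ch p = c} (fst z) * L c z) \<in> borel_measurable borel"
  by (intro borel_measurable_sum borel_measurable_times_ennreal im Lm)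
 moreover have "(\<Sum>c\<in>range ch. indicator {p. ch p = c} (fst z) * L c z) = kern R0 (fst z) (snd z)" for z
 proof -
  obtain p q where z: "z = (p, q)" by (cases z)
  let ?c = "ch p" and ?x = "snd (ch p) p"
  have "(\<Sum>c\<in>range ch. indicator {p. ch p = c} p * L c (p, q)) = (\<Sum>c\<in>range ch. if c = ?c then L c (p, q) else 0)"
   by (intro sum.cong refl) auto
  also have "\<dots> = L ?c (p, q)" using finite_ch by simp
  also have "\<dots> = kern R0 p q"
  proof (cases "(p, q) \<in> \<Phi> ?c ` S ?c")
   case True
   then obtain x u where xu: "(x, u) \<in> S ?c" "(p, q) = \<Phi> ?c (x, u)" by (auto simp: image_iff)
   have xO: "x \<in> Om ?c" using xu(1) by (auto simp: S_def)
   have x: "x = ?x" using xu(2) chart_chart_inv[OF ch_in xO] by (simp add: \<Phi>_def)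
   have qE: "q = E p u" using xu(2) ch_coord(2)[of p] by (simp add: \<Phi>_def x E_def tv_def)
   obtain v where v: "v \<in> B" "frm p v = tv p u"
   proof (rule bexE)
    show "\<exists>v\<in>B. frm p v = tv p u"
     using frame_rep[OF ch_in xu(1)] unfolding fst_conv snd_conv x ch_coord(2) tv_def .
   qed
   have fv: "fr p u = v" by (simp add: fr_def v(2)[symmetric] inv_frame)
   have "L ?c (p, q) = G ?c (x, u)" using True inv_into_f_f[OF inj[OF ch_in] xu(1)] xu(2) by (simp add: L_def)
   also have "\<dots> = kern_val (p, u)" using xO ch_coord(2)[of p] by (simp add: G_def chinv_def x)
   also have "\<dots> = kern R0 p q" unfolding qE by (rule kern_val_eq) (use v(1) fv in simp)
   finally show ?thesis .
  next
   case False
   have "q \<notin> Ex p ` B"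
   proof
    assume "q \<in> Ex p ` B"
    then obtain v where v: "v \<in> B" "q = Ex p v" by blast
    let ?u = "frm p v ?c"
    have fv: "tv p ?u = frm p v" by (rule tv_of[OF frame_in])
    have "form (kap p) ?u ?u = v \<bullet> v" using tv_form[of p ?u ?u] by (simp add: fv frame_isometry)
    moreover have "0 < v \<bullet> v" "v \<bullet> v < r^2" using v(1) by (auto simp: dot_square_norm intro!: power_strict_mono)
    ultimately have "(?x, ?u) \<in> S ?c" using ch_coord(1)[of p] by (simp add: S_def kap_def)
    moreover have "\<Phi> ?c (?x, ?u) = (p, q)" using fv ch_coord(2)[of p] by (simp add: \<Phi>_def v(2) tv_def)
    ultimately show False using False by (metis imageI)
   qed
   with False show ?thesis by (simp add: L_def kern_def)
  qed
  finally show ?thesis by (simp add: z)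
 qed
 ultimately show ?thesis by simp
qed

lemma measurable_vol_vol: "measurable (vol \<Otimes>\<^sub>M vol) M = measurable (borel :: ('a \<times> 'a) measure) M"
proof (rule measurable_cong_sets[OF _ refl])
 have "sets (vol \<Otimes>\<^sub>M vol) = sets (borel \<Otimes>\<^sub>M borel)" by (intro sets_pair_measure_cong) auto
 thus "sets (vol \<Otimes>\<^sub>M vol) = sets (borel :: ('a \<times> 'a) measure)" by (simp only: borel_prod)
qed

lemma measurable_kern_pair: "case_prod (\<lambda>p q. kern R0 p q) \<in> borel_measurable (vol \<Otimes>\<^sub>M vol)"
 unfolding measurable_vol_vol split_beta' by (rule measurable_kern)

lemma measurable_kern0: "kern R0 p \<in> borel_measurable borel" and measurable_kern1: "kern R1 p \<in> borel_measurable borel"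
proof -
 have "(\<lambda>q. (p, q)) \<in> borel_measurable borel" "(\<lambda>q. (q, p)) \<in> borel_measurable borel"
  by (intro borel_measurable_continuous_onI continuous_intros)+
 from measurable_compose[OF this(1) measurable_kern] measurable_compose[OF this(2) measurable_kern]
 have "kern R0 p \<in> borel_measurable borel" "(\<lambda>q. kern R0 q p) \<in> borel_measurable borel" by simp_all
 moreover have "kern R1 p = (\<lambda>q. kern R0 q p)" by (rule ext) (rule kern_reverse)
 ultimately show "kern R0 p \<in> borel_measurable borel" "kern R1 p \<in> borel_measurable borel" by simp_all
qed

text \<open>By \<open>kern_reverse\<close> both sides integrate one kernel over pairs of points, in
  the two orders.\<close>

theorem liouville:
 "(\<integral>\<^sup>+p. (LBNN v. ennreal (wt v * R1 p v) * indicator B v) \<partial>vol) =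
  (\<integral>\<^sup>+p. (LBNN v. ennreal (wt v * R0 p v) * indicator B v) \<partial>vol)"
proof -
 interpret finite_measure vol by (rule finite_measure_vol)
 interpret pair_sigma_finite vol vol ..
 have "(\<integral>\<^sup>+p. (LBNN v. ennreal (wt v * R1 p v) * indicator B v) \<partial>vol) = (\<integral>\<^sup>+p. \<integral>\<^sup>+q. kern R0 q p \<partial>vol \<partial>vol)"
  by (simp add: nn_integral_kern[OF measurable_kern1, symmetric] kern_reverse)
 also have "\<dots> = (\<integral>\<^sup>+q. \<integral>\<^sup>+p. kern R0 q p \<partial>vol \<partial>vol)"
  by (rule Fubini'[OF measurable_kern_pair])
 also have "\<dots> = (\<integral>\<^sup>+p. (LBNN v. ennreal (wt v * R0 p v) * indicator B v) \<partial>vol)"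
  by (simp add: nn_integral_kern[OF measurable_kern0])
 finally show ?thesis .
qed

lemma measurable_liouville: "(\<lambda>p. (LBNN v. ennreal (wt v * R1 p v) * indicator B v)) \<in> borel_measurable borel"
proof -
 interpret finite_measure vol by (rule finite_measure_vol)
 have sw: "(\<lambda>z :: 'a \<times> 'a. (snd z, fst z)) \<in> borel_measurable borel"
  by (intro borel_measurable_continuous_onI continuous_intros)
 have "(\<lambda>z. kern R0 (snd z) (fst z)) \<in> borel_measurable (vol \<Otimes>\<^sub>M vol)"
  using measurable_compose[OF sw measurable_kern] by (simp add: measurable_vol_vol)
 from borel_measurable_nn_integral_fst[OF this]
 have "(\<lambda>p. \<integral>\<^sup>+q. kern R0 q p \<partial>vol) \<in> borel_measurable vol" by simp
 hence "(\<lambda>p. \<integral>\<^sup>+q. kern R1 p q \<partial>vol) \<in> borel_measurable borel"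
  unfolding kern_reverse measurable_cong_sets[OF sets_vol refl] .
 thus ?thesis by (simp add: nn_integral_kern[OF measurable_kern1])
qed

end

section \<open>Integration over geodesic rays\<close>

lemma riemv_antisym: "riemv h x u v w = - riemv h x v u w"
proof -
 have a: "riem h l i j k x = - riem h l j i k x" for l i j k
  by (simp add: riem_def sum_negf[symmetric])
 have "riemv h x u v w $ l = - riemv h x v u w $ l" for l
 proof -
  have "riemv h x u v w $ l = (\<Sum>j\<in>UNIV. \<Sum>i\<in>UNIV. \<Sum>k\<in>UNIV. riem h l i j k x * u $ i * v $ j * w $ k)"
   unfolding riemv_def vec_lambda_beta by (rule sum.swap)
  also have "\<dots> = (\<Sum>j\<in>UNIV. \<Sum>i\<in>UNIV. \<Sum>k\<in>UNIV. - (riem h l j i k x * v $ j * u $ i * w $ k))"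
   by (intro sum.cong refl) (subst a, simp)
  finally show ?thesis by (simp add: riemv_def sum_negf)
 qed
 thus ?thesis by (simp add: vec_eq_iff)
qed

text \<open>Symmetry of the connection makes the derivative terms and the quadratic terms of
  \<open>riemv_formula\<close> cancel in pairs.\<close>

lemma riemv_bianchi:
 assumes "metric_on U h" "x \<in> U"
 shows "riemv h x u v w + riemv h x v w u + riemv h x w u v = 0"
proof -
 have o: "open U" using assms by (simp add: metric_on_def)
 have c: "chrv h y a b = chrv h y b a" if "y \<in> U" for y a b by (rule chrv_commute[OF assms(1) that])
 have d: "dd (\<lambda>y. chrv h y a b) x = dd (\<lambda>y. chrv h y b a) x" for a b
  by (rule dd_cong_open[OF o assms(2)]) (rule c)
 show ?thesis
  unfolding riemv_formula[OF assms] d[of v w] d[of u w] d[of v u]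
  using c[OF assms(2), of v w] c[OF assms(2), of u w] c[OF assms(2), of v u] by simp
qed

text \<open>Polarising the hypothesis gives antisymmetry in the last two arguments. With
  antisymmetry in the first two, cyclic permutations leave the curvature unchanged, and Bianchi's
  identity becomes \<open>3 R = 0\<close>.\<close>

lemma riemv_eq_0_of_radial:
 assumes "metric_on U h" "x \<in> U" and rad: "\<And>w y. riemv h x w y y = 0"
 shows "riemv h x u v w = 0"
proof -
 have pol: "riemv h x a b c = - riemv h x a c b" for a b c
  using rad[of a "b + c"] rad[of a b] rad[of a c] by (simp add: riemv_add eq_neg_iff_add_eq_0 add.commute)
 have "riemv h x w u v = riemv h x u v w"
  using pol[of u v w] riemv_antisym[of h x u w v] by simp
 moreover have "riemv h x v w u = riemv h x u v w"
  using pol[of v w u] riemv_antisym[of h x v u w] by simp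
 ultimately have "riemv h x u v w + riemv h x u v w + riemv h x u v w = 0"
  using riemv_bianchi[OF assms(1,2), of u v w] by simp
 moreover have "(1 + 1 + 1) *R riemv h x u v w = riemv h x u v w + riemv h x u v w + riemv h x u v w"
  by (simp only: scaleR_add_left scaleR_one)
 ultimately have "(1 + 1 + 1) *R riemv h x u v w = 0" by simp
 thus ?thesis by simp
qed

lemma nn_integral_eq_imp_AE:
 fixes f h :: "'a => ennreal"
 assumes m: "f \<in> borel_measurable M" "h \<in> borel_measurable M" and le: "\<And>x. f x \<le> h x"
  and eq: "(\<integral>\<^sup>+x. f x \<partial>M) = (\<integral>\<^sup>+x. h x \<partial>M)" and fin: "(\<integral>\<^sup>+x. f x \<partial>M) < \<infinity>"
 shows "AE x in M. f x = h x"
proof -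
 have "(\<integral>\<^sup>+x. h x - f x \<partial>M) = (\<integral>\<^sup>+x. h x \<partial>M) - (\<integral>\<^sup>+x. f x \<partial>M)"
  by (rule nn_integral_diff[OF m(2,1)]) (use fin le in auto)
 also have "\<dots> = 0" using eq fin by simp
 finally have "AE x in M. h x - f x = 0"
  using nn_integral_0_iff_AE[of "\<lambda>x. h x - f x" M] m by simp
 thus ?thesis
  by (elim eventually_mono) (metis le antisym diff_eq_0_iff_ennreal ennreal_minus_eq_0)
qed

lemma nn_integral_Ioo:
 fixes f :: "real => real"
 assumes "0 < r" "continuous_on {0..r} f" "\<And>s. 0 < s ==> s < r ==> 0 \<le> f s"
 shows "(LBNN s. ennreal (f s) * indicator {0<..<r} s) = ennreal (integral {0..r} f)"
proof -
 have "(f has_integral integral {0..r} f) {0..r}"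
  by (rule integrable_integral[OF integrable_continuous_interval[OF assms(2)]])
 hence "(f has_integral integral {0..r} f) {0<..<r}" by (simp add: has_integral_Icc_iff_Ioo)
 from nn_integral_has_integral_lebesgue[OF _ this]
 have "(LBNN s. ennreal (indicator {0<..<r} s * f s)) = ennreal (integral {0..r} f)" using assms(3) by simp
 moreover have "ennreal (f s) * indicator {0<..<r} s = ennreal (indicator {0<..<r} s * f s)" for s
  by (simp add: indicator_def)
 ultimately show ?thesis by simp
qed

context closed_manifold_radius
begin

lemma hE_radial:
 assumes "norm x = 1" "0 \<le> t" "t < rh p"
 shows "hE p (t *R x) *v x = x"
proof (cases "t = 0")
 case True
 thus ?thesis using hE_0[OF rh rh_pos] by simp
next
 case False
 have "hE p (t *R x) *v (t *R x) = t *R x"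
  by (rule hE_gauss[OF rh rh_pos]) (use assms in simp)
 thus ?thesis using False by (simp add: mv_scaleR)
qed

lemma ricq_radial_bound:
 assumes x: "norm x = 1" "0 \<le> t" "t < rh p"
 shows "\<bar>ricq (hE p) (t *R x) x\<bar> \<le> C"
proof -
 have v: "t *R x \<in> ball 0 (rh p)" using x by simp
 have "g (Ex p (t *R x)) (Tmap (Ex p) (t *R x) x) (Tmap (Ex p) (t *R x) x) = 1"
  using hE_form[OF rh rh_pos v, of x x] hE_radial[OF x] x(1) by (simp add: dot_square_norm)
 thus ?thesis
  using C(2)[OF param_tangent_map_in[OF exp_diffeo_param(1)[OF rh] v], of x] by (simp add: ricq_hE[OF v])
qed

lemma R1_ray: "norm x = 1 ==> R1 p (s *R x) = s^2 * (C + ricq (hE p) (s *R x) x)"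
 by (simp add: R1_def ricq_scale dot_square_norm power2_eq_square algebra_simps)

lemma R0_ray: "norm x = 1 ==> R0 p (s *R x) = s^2 * (C + ric p (frm p x))"
proof -
 assume x: "norm x = 1"
 obtain N where N: "\<And>y. ric p (frm p y) = form N y y" using ric_frame_form by metis
 show ?thesis using x by (simp add: R0_def N form_scale dot_square_norm power2_eq_square algebra_simps)
qed

lemma continuous_R0: "continuous_on UNIV (R0 p)"
proof -
 obtain N where N: "\<And>y. ric p (frm p y) = form N y y" using ric_frame_form by metis
 show ?thesis unfolding R0_def[abs_def] N form_entries by (intro continuous_intros)
qed

lemma continuous_R1: "continuous_on (ball 0 (rh p)) (R1 p)"
proof -
 have "continuous_on (ball 0 (rh p)) (\<lambda>v. (\<lambda>(x, u). ricq (hE p) x u) (v, v))"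
  by (rule continuous_on_compose2[OF continuous_on_ricq[OF metric_hE]]) (auto intro!: continuous_intros)
 thus ?thesis unfolding R1_def[abs_def] by (auto intro!: continuous_intros)
qed

text \<open>The weight \<open>wt\<close> cancels the radial factor in
  \<open>nn_integral_polar\<close>, so that each ray is integrated in arc length.\<close>

lemma kernel_polar:
 assumes R: "continuous_on B (R p)"
 shows "(LBNN v. ennreal (wt v * R p v) * indicator B v) = of_nat CARD('n) *
   (LBNN y. (LBNN s. ennreal (R p (s *R sgn y)) * indicator {0<..<r} s) * indicator pball y)"
  and "(\<lambda>y. (LBNN s. ennreal (R p (s *R sgn y)) * indicator {0<..<r} s) * indicator pball y) \<in> borel_measurable borel"
proof -
 define k where "k v = ennreal (if v \<in> B then wt v * R p v else 0)" for v
 have "continuous_on B (\<lambda>v. wt v * R p v)"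
  unfolding wt_def by (intro continuous_intros R) auto
 hence "(\<lambda>v. if v \<in> B then wt v * R p v else 0) \<in> borel_measurable borel"
  by (intro borel_measurable_open_extension open_Diff) auto
 hence k[measurable]: "k \<in> borel_measurable borel" unfolding k_def[abs_def] by measurable
 have e: "(LBNN s. ennreal (s ^ (CARD('n) - 1)) * k (s *R sgn y) * indicator {0<..<r} s) * indicator pball y =
   (LBNN s. ennreal (R p (s *R sgn y)) * indicator {0<..<r} s) * indicator pball y" for y
 proof (cases "y \<in> pball")
  case True
  hence y: "norm (sgn y) = 1" by (rule sgn_pball)
  have "ennreal (s ^ (CARD('n) - 1)) * k (s *R sgn y) * indicator {0<..<r} s = ennreal (R p (s *R sgn y)) * indicator {0<..<r} s" for s
  proof (cases "s \<in> {0<..<r}")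
   case True
   hence s: "s *R sgn y \<in> B" "norm (s *R sgn y) = s" using y by (auto simp: sgn_zero_iff)
   have "ennreal (s ^ (CARD('n) - 1)) * k (s *R sgn y) = ennreal (s ^ (CARD('n) - 1) * (wt (s *R sgn y) * R p (s *R sgn y)))"
    using True s(1) by (simp only: k_def if_True) (simp add: ennreal_mult')
   also have "s ^ (CARD('n) - 1) * (wt (s *R sgn y) * R p (s *R sgn y)) = R p (s *R sgn y)"
    using True s(2) by (simp add: wt_def)
   finally show ?thesis by simp
  qed simp
  thus ?thesis by simp
 qed simp
 have "(LBNN v. ennreal (wt v * R p v) * indicator B v) = (LBNN v. k v * indicator B v)"
  by (intro nn_integral_cong) (simp add: k_def indicator_def)
 also have "\<dots> = of_nat CARD('n) *
   (LBNN y. (LBNN s. ennreal (s ^ (CARD('n) - 1)) * k (s *R sgn y) * indicator {0<..<r} s) * indicator pball y)"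
  using nn_integral_polar[OF k r(1)] by simp
 finally show "(LBNN v. ennreal (wt v * R p v) * indicator B v) = of_nat CARD('n) *
   (LBNN y. (LBNN s. ennreal (R p (s *R sgn y)) * indicator {0<..<r} s) * indicator pball y)"
  by (simp only: e)
 have "(\<lambda>y. (LBNN s. ennreal (s ^ (CARD('n) - 1)) * k (s *R sgn y) * indicator {0<..<r} s) * indicator pball y) \<in> borel_measurable borel"
  by measurable
 thus "(\<lambda>y. (LBNN s. ennreal (R p (s *R sgn y)) * indicator {0<..<r} s) * indicator pball y) \<in> borel_measurable borel"
  by (simp only: e)
qed

definition ray_ric :: "'a => real^'n => real" where
 "ray_ric p x = integral {0..r} (\<lambda>s. s^2 * ricq (hE p) (s *R x) x)"

lemma ray_in: "norm x = 1 ==> 0 \<le> t ==> t \<le> r' ==> t *R x \<in> ball 0 (rh p)"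
 using rh_gt[of p] by simp

lemma integral_square: "integral {0..r} (\<lambda>s. s^2 * c) = r ^ 3 / 3 * (c :: real)"
proof -
 have "((\<lambda>s. s^2 * c) has_integral (r ^ 3 / 3 * c - 0 ^ 3 / 3 * c)) {0..r}"
  by (rule fundamental_theorem_of_calculus)
   (use r(1) in \<open>auto intro!: derivative_eq_intros simp: has_real_derivative_iff_has_vector_derivative[symmetric]\<close>)
 from integral_unique[OF this] show ?thesis by (simp only: power_eq_0_iff) simp
qed

lemma ray_R1:
 assumes x: "norm x = 1"
 shows "(LBNN s. ennreal (R1 p (s *R x)) * indicator {0<..<r} s) = ennreal (C * r ^ 3 / 3 + ray_ric p x)"
  and "0 \<le> C * r ^ 3 / 3 + ray_ric p x"
proof -
 interpret nc: normal_coords "ball 0 (rh p)" "hE p" by (rule normal_coords_p)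
 have c: "continuous_on {0..r} (\<lambda>s. ricq (hE p) (s *R x) x)"
  by (rule nc.continuous_ray[OF smooth_on_ricq[OF metric_hE]]) (use ray_in[OF x] r in simp)
 hence c1: "continuous_on {0..r} (\<lambda>s. R1 p (s *R x))"
  unfolding R1_ray[OF x] by (intro continuous_intros)
 have nn: "0 \<le> R1 p (s *R x)" if "0 \<le> s" "s \<le> r" for s
  using R1_nonneg[OF ray_in[OF x]] that r by simp
 have I: "integral {0..r} (\<lambda>s. R1 p (s *R x)) = C * r ^ 3 / 3 + ray_ric p x"
 proof -
  have "integral {0..r} (\<lambda>s. R1 p (s *R x)) = integral {0..r} (\<lambda>s. s^2 * C + s^2 * ricq (hE p) (s *R x) x)"
   unfolding R1_ray[OF x] by (simp add: distrib_left)
  also have "\<dots> = integral {0..r} (\<lambda>s. s^2 * C) + ray_ric p x"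
   unfolding ray_ric_def by (intro integral_add integrable_continuous_interval continuous_intros c)
  finally show ?thesis unfolding integral_square by simp
 qed
 show "(LBNN s. ennreal (R1 p (s *R x)) * indicator {0<..<r} s) = ennreal (C * r ^ 3 / 3 + ray_ric p x)"
  unfolding I[symmetric] by (rule nn_integral_Ioo[OF r(1) c1]) (use nn in simp)
 show "0 \<le> C * r ^ 3 / 3 + ray_ric p x"
  unfolding I[symmetric] by (rule integral_nonneg[OF integrable_continuous_interval[OF c1]]) (use nn in simp)
qed

lemma ray_R0:
 assumes x: "norm x = 1"
 shows "(LBNN s. ennreal (R0 p (s *R x)) * indicator {0<..<r} s) = ennreal (r ^ 3 / 3 * (C + ric p (frm p x)))"
proof -
 have "0 \<le> R0 p (s *R x)" for s by (rule R0_nonneg)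
 thus ?thesis
  unfolding R0_ray[OF x] integral_square[symmetric] by (intro nn_integral_Ioo r(1) continuous_intros) simp
qed

lemma kern1_polar:
 "(LBNN v. ennreal (wt v * R1 p v) * indicator B v) = of_nat CARD('n) *
   (LBNN y. ennreal (C * r ^ 3 / 3 + ray_ric p (sgn y)) * indicator pball y)"
 "(\<lambda>y. ennreal (C * r ^ 3 / 3 + ray_ric p (sgn y)) * indicator pball y) \<in> borel_measurable borel"
proof -
 have c: "continuous_on B (R1 p)" by (rule continuous_on_subset[OF continuous_R1]) (use B_ball in blast)
 have e: "(LBNN s. ennreal (R1 p (s *R sgn y)) * indicator {0<..<r} s) * indicator pball y =
  ennreal (C * r ^ 3 / 3 + ray_ric p (sgn y)) * indicator pball y" for y
  using ray_R1(1)[OF sgn_pball, of y p] by (cases "y \<in> pball") simp_all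
 show "(LBNN v. ennreal (wt v * R1 p v) * indicator B v) = of_nat CARD('n) *
   (LBNN y. ennreal (C * r ^ 3 / 3 + ray_ric p (sgn y)) * indicator pball y)"
  using kernel_polar(1)[of R1 p, OF c] by (simp only: e)
 show "(\<lambda>y. ennreal (C * r ^ 3 / 3 + ray_ric p (sgn y)) * indicator pball y) \<in> borel_measurable borel"
  using kernel_polar(2)[of R1 p, OF c] by (simp only: e)
qed

text \<open>At the starting point the integrand is \<open>s^2\<close> times a quadratic form in the
  direction: the radial integral gives \<open>r ^ 3 / 3\<close>, the spherical one the trace, that
  is, the scalar curvature. The second claim bounds each diagonal entry by \<open>C\<close>.\<close>

lemma kern0_polar:
 "(LBNN v. ennreal (wt v * R0 p v) * indicator B v) =
  ennreal (r ^ 3 / 3 * measure lborel (ball 0 1 :: (real^'n) set) * (real CARD('n) * C + scal p))"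
 "\<bar>scal p\<bar> \<le> real CARD('n) * C"
proof -
 obtain N where N: "\<And>y. ric p (frm p y) = form N y y" and tr: "scal p = trace N" using ric_frame_form by metis
 have c: "continuous_on B (R0 p)" by (rule continuous_on_subset[OF continuous_R0]) simp
 have nn: "0 \<le> C * (y \<bullet> y) + form N y y" for y using R0_nonneg[of p y] by (simp add: R0_def N)
 have e: "(LBNN s. ennreal (R0 p (s *R sgn y)) * indicator {0<..<r} s) * indicator pball y =
  ennreal (r ^ 3 / 3) * (ennreal (C + sgn y \<bullet> (N *v sgn y)) * indicator pball y)" for y
 proof (cases "y \<in> pball")
  case True
  have "0 \<le> C + sgn y \<bullet> (N *v sgn y)" using nn[of "sgn y"] sgn_pball[OF True] by (simp add: dot_square_norm)
  hence "ennreal (r ^ 3 / 3 * (C + sgn y \<bullet> (N *v sgn y))) = ennreal (r ^ 3 / 3) * ennreal (C + sgn y \<bullet> (N *v sgn y))"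
   using r(1) by (intro ennreal_mult) simp_all
  thus ?thesis using True by (simp only: ray_R0[OF sgn_pball[OF True]] N) simp
 qed simp
 have "(LBNN v. ennreal (wt v * R0 p v) * indicator B v) =
   of_nat CARD('n) * (LBNN y. ennreal (r ^ 3 / 3) * (ennreal (C + sgn y \<bullet> (N *v sgn y)) * indicator pball y))"
  using kernel_polar(1)[of R0 p, OF c] by (simp only: e)
 also have "\<dots> = of_nat CARD('n) * (ennreal (r ^ 3 / 3) * ennreal (measure lborel (ball 0 1 :: (real^'n) set) * (C + trace N / real CARD('n))))"
 proof -
  have "(\<lambda>y :: real^'n. ennreal (C + sgn y \<bullet> (N *v sgn y)) * indicator pball y) \<in> borel_measurable borel"
   unfolding form_entries by measurable
  thus ?thesis by (simp add: nn_integral_cmult nn_integral_quadratic_form[OF nn])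
 qed
 also have "\<dots> = ennreal (real CARD('n) * (r ^ 3 / 3 * (measure lborel (ball 0 1 :: (real^'n) set) * (C + trace N / real CARD('n)))))"
  using r(1) by (simp add: ennreal_mult'[symmetric] ennreal_of_nat_eq_real_of_nat)
 also have "real CARD('n) * (r ^ 3 / 3 * (measure lborel (ball 0 1 :: (real^'n) set) * (C + trace N / real CARD('n)))) =
   r ^ 3 / 3 * measure lborel (ball 0 1 :: (real^'n) set) * (real CARD('n) * C + scal p)"
  by (simp add: tr field_simps)
 finally show "(LBNN v. ennreal (wt v * R0 p v) * indicator B v) =
  ennreal (r ^ 3 / 3 * measure lborel (ball 0 1 :: (real^'n) set) * (real CARD('n) * C + scal p))" .
 have "\<bar>N $ i $ i\<bar> \<le> C" for i
 proof -
  have "N $ i $ i = ric p (frm p (axis i 1))"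
   by (simp add: N matrix_vector_mult_basis column_def inner_axis')
  thus ?thesis using C(2)[OF frame_in[of p "axis i 1"]] by (simp add: frame_isometry)
 qed
 hence "(\<Sum>i\<in>UNIV. \<bar>N $ i $ i\<bar>) \<le> (\<Sum>i\<in>(UNIV :: 'n set). C)" by (intro sum_mono)
 thus "\<bar>scal p\<bar> \<le> real CARD('n) * C"
  unfolding tr trace_def using order_trans[OF sum_abs[of "\<lambda>i. N $ i $ i" UNIV]] by simp
qed

end

section \<open>The average mean curvature\<close>

context closed_manifold_radius
begin

text \<open>Up to a constant this is \<open>- r^2 H\<close>, in Borel terms
  (\<open>mean_curvature_bE\<close>). The shift is the integral of \<open>s^2 * C\<close>, which
  makes the function nonnegative.\<close>

definition bE :: "'a \<times> ('a, 'n) tangent_vector => real" where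
 "bE z = C * r ^ 3 / 3 - r * tauE (fst z) (r *R snd z (ch (fst z)))"

lemma measurable_bE: "bE \<in> borel_measurable Sig"
proof -
 have "(\<lambda>z :: 'a \<times> (real^'n). (fst z, r *R snd z)) \<in> borel \<rightarrow>\<^sub>M borel"
  by (intro borel_measurable_continuous_onI continuous_intros)
 from measurable_compose[OF measurable_compose[OF measurable_SB_coords this] measurable_tauE]
 have [measurable]: "(\<lambda>z. tauE (fst z) (r *R snd z (ch (fst z)))) \<in> borel_measurable Sig" by simp
 show ?thesis unfolding bE_def[abs_def] by measurable
qed

lemma bE_frame:
 assumes x: "norm x = 1"
 shows "bE (p, frm p x) = C * r ^ 3 / 3 - r * trace (shp (hE p) (r *R x))"
proof -
 let ?u = "frm p x (ch p)"
 have u: "fr p (r *R ?u) = r *R x" by (simp add: linear_scale[OF linear_fr] fr_frame)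
 have "tauE p (r *R ?u) = trace (shp (hE p) (r *R x))"
  using tauE_eq[OF rh, of p "r *R ?u"] u x r rh_gt[of p] by simp
 thus ?thesis by (simp add: bE_def)
qed

text \<open>The shift of \<open>bE\<close> plus the bound of \<open>tau_lower_bound\<close> for
  \<open>K = C\<close>, divided by \<open>r' - r\<close>.\<close>

definition D :: real where "D = C * r ^ 3 / 3 + (real CARD('n) * r'^2 + C * r' ^ 4) / (r' - r)"

text \<open>The lower bound is the inequality of the theorem on a single ray, before averaging. The
  upper one ensures that the mean curvature is integrable.\<close>

lemma bE_bounds:
 assumes x: "norm x = 1"
 shows "C * r ^ 3 / 3 + ray_ric p x \<le> bE (p, frm p x)" "bE (p, frm p x) \<le> D"
proof -
 interpret nc: normal_coords "ball 0 (rh p)" "hE p" by (rule normal_coords_p)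
 let ?t = "trace (shp (hE p) (r *R x))"
 have "r * ?t \<le> - ray_ric p x"
  unfolding ray_ric_def using nc.tau_upper_bound[OF r(1), of x] ray_in[OF x, of _ p] r by (simp add: nc.tau_def)
 thus "C * r ^ 3 / 3 + ray_ric p x \<le> bE (p, frm p x)" by (simp add: bE_frame[OF x])
 have "- (r' - r) * (r * ?t) \<le> real CARD('n) * r'^2 + C * r' ^ 4"
  unfolding nc.tau_def[symmetric]
 proof (rule nc.tau_lower_bound[OF r])
  show "t *R x \<in> ball 0 (rh p)" if "0 \<le> t" "t \<le> r'" for t by (rule ray_in[OF x that])
  show "- ricq (hE p) (t *R x) x \<le> C" if "0 \<le> t" "t \<le> r'" for t
   using ricq_radial_bound[OF x that(1), of p] that(2) rh_gt[of p] by simp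
 qed (rule C(1))
 hence "- (r * ?t) \<le> (real CARD('n) * r'^2 + C * r' ^ 4) / (r' - r)"
  using r by (simp add: pos_le_divide_eq algebra_simps)
 thus "bE (p, frm p x) \<le> D" by (simp add: bE_frame[OF x] D_def)
qed

lemma SB_cases:
 assumes "z \<in> SB"
 obtains p x where "norm x = 1" "z = (p, frm p x)"
proof -
 obtain p v where z: "z = (p, v)" "v \<in> TS p" "g p v v = 1"
  using assms by (auto simp: unit_sphere_bundle_def)
 obtain x where x: "frm p x = v" using frame_surj[OF z(2)] by blast
 have "x \<bullet> x = 1" using frame_isometry[of p x x] z(3) by (simp add: x)
 hence "norm x = 1" by (simp add: norm_eq_sqrt_inner)
 thus ?thesis using that x z(1) by blast
qed

lemma bE_SB:
 assumes "z \<in> SB"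
 shows "0 \<le> bE z" "bE z \<le> D"
proof -
 obtain p x where x: "norm x = 1" and z: "z = (p, frm p x)" by (rule SB_cases[OF assms])
 show "0 \<le> bE z" unfolding z by (rule order_trans[OF ray_R1(2)[OF x] bE_bounds(1)[OF x]])
 show "bE z \<le> D" unfolding z by (rule bE_bounds(2)[OF x])
qed

lemma mean_curvature_bE:
 assumes "(p, v) \<in> SB"
 shows "mean_curvature A g p r v = (real CARD('n) - 1) / r + C * r / 3 - bE (p, v) / r^2"
proof -
 obtain x where x: "norm x = 1" "v = frm p x" by (rule SB_cases[OF assms]) simp
 have "r < rh p" using r rh_gt[of p] by simp
 hence "mean_curvature A g p r v = (real CARD('n) - 1) / r + trace (shp (hE p) (r *R x)) / r"
  unfolding x(2) by (intro mean_curvature_formula[OF rh rh_pos r(1) _ x(1)])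
 also have "\<dots> = (real CARD('n) - 1) / r + C * r / 3 - bE (p, v) / r^2"
  using r(1) by (simp add: bE_frame[OF x(1)] x(2) field_simps power2_eq_square power3_eq_cube)
 finally show ?thesis .
qed

lemma finite_measure_SBM: "finite_measure SBM"
 by (rule finite_measureI) (simp add: space_SBM emeasure_SBM_space)

lemma measure_SBM: "measure SBM SB = real CARD('n) * measure lborel (ball 0 1 :: (real^'n) set) * measure vol UNIV"
 by (simp add: measure_def emeasure_SBM_space)

lemma measure_vol_pos: "measure vol UNIV > 0"
proof -
 interpret finite_measure vol by (rule finite_measure_vol)
 show ?thesis using emeasure_vol_open_pos[OF open_UNIV UNIV_I] by (simp add: emeasure_eq_measure)
qed

lemma integrable_bE: "integrable SBM bE"
proof -
 interpret finite_measure SBM by (rule finite_measure_SBM)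
 show ?thesis
 proof (rule integrable_const_bound)
  show "AE z in SBM. norm (bE z) \<le> D"
   by (rule AE_I2) (use bE_SB in \<open>simp add: space_SBM\<close>)
  show "bE \<in> borel_measurable SBM" using measurable_bE by (simp only: measurable_cong_sets[OF sets_SBM refl])
 qed
qed

text \<open>Fibre integrals at \<open>p\<close>: \<open>\<beta>\<close> carries the mean curvature,
  \<open>\<alpha>\<close> below the Ricci curvature along the geodesics from \<open>p\<close>. They
  are compared fibre by fibre, whereas the explicit value of \<open>\<alpha>\<close> is found for
  its total, through \<open>liouville\<close>.\<close>

definition \<beta> :: "'a => ennreal" where
 "\<beta> p = of_nat CARD('n) * (LBNN y. ennreal (bE (p, frm p (sgn y))) * indicator pball y)"

definition \<alpha> :: "'a => ennreal" where
 "\<alpha> p = (LBNN v. ennreal (wt v * R1 p v) * indicator B v)"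

lemma nn_integral_\<beta>: "(\<integral>\<^sup>+p. \<beta> p \<partial>vol) = ennreal (LINT z|SBM. bE z)"
proof -
 have "(\<lambda>z. ennreal (bE z)) \<in> borel_measurable Sig" using measurable_bE by simp
 from nn_integral_SBM[OF this]
 have "(\<integral>\<^sup>+p. \<beta> p \<partial>vol) = (\<integral>\<^sup>+z. ennreal (bE z) \<partial>SBM)" by (simp add: \<beta>_def)
 also have "\<dots> = ennreal (LINT z|SBM. bE z)"
  by (rule nn_integral_eq_integral[OF integrable_bE AE_I2]) (use bE_SB in \<open>simp add: space_SBM\<close>)
 finally show ?thesis .
qed

lemma measurable_\<beta>: "\<beta> \<in> borel_measurable vol"
 unfolding \<beta>_def[abs_def] using measurable_bE by (intro measurable_sb_fiber) simp

lemma measurable_\<alpha>: "\<alpha> \<in> borel_measurable vol"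
 unfolding \<alpha>_def[abs_def] measurable_cong_sets[OF sets_vol refl] by (rule measurable_liouville)

lemma \<alpha>_le_\<beta>: "\<alpha> p \<le> \<beta> p"
 unfolding \<alpha>_def \<beta>_def kern1_polar(1)
proof (intro mult_left_mono nn_integral_mono)
 fix y :: "real^'n"
 show "ennreal (C * r ^ 3 / 3 + ray_ric p (sgn y)) * indicator pball y \<le> ennreal (bE (p, frm p (sgn y))) * indicator pball y"
  using bE_bounds(1)[OF sgn_pball, of y p] by (cases "y \<in> pball") (simp_all add: ennreal_leI)
qed simp

text \<open>The scalar curvature is defined with a chart chosen by \<open>SOME\<close>. Its
  measurability is recovered from the fibre integrals of the kernel, of which it is an affine
  function.\<close>

lemma integrable_scalar_curvature: "integrable vol (scal)"
proof -
 interpret finite_measure vol by (rule finite_measure_vol)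
 let ?c = "r ^ 3 / 3 * measure lborel (ball 0 1 :: (real^'n) set)"
 have c: "?c > 0" using r(1) measure_ball_pos[where 'n = 'n] by simp
 have nn: "0 \<le> real CARD('n) * C + scal p" for p using kern0_polar(2)[of p] by linarith
 have "(\<lambda>p. \<integral>\<^sup>+q. kern R0 p q \<partial>vol) \<in> borel_measurable vol"
  by (rule borel_measurable_nn_integral[OF measurable_kern_pair])
 hence "(\<lambda>p. enn2real (\<integral>\<^sup>+q. kern R0 p q \<partial>vol) / ?c - real CARD('n) * C) \<in> borel_measurable vol" by measurable
 moreover have "enn2real (\<integral>\<^sup>+q. kern R0 p q \<partial>vol) / ?c - real CARD('n) * C = scal p" for p
 proof -
  have "(\<integral>\<^sup>+q. kern R0 p q \<partial>vol) = ennreal (?c * (real CARD('n) * C + scal p))"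
   unfolding nn_integral_kern[OF measurable_kern0] by (rule kern0_polar(1))
  hence "enn2real (\<integral>\<^sup>+q. kern R0 p q \<partial>vol) = ?c * (real CARD('n) * C + scal p)"
   using c nn[of p] by (simp only: enn2real_ennreal mult_nonneg_nonneg less_imp_le)
  moreover have "?c \<noteq> 0" using c by linarith
  moreover have "e / a - b = s" if "e = a * (b + s)" "a \<noteq> 0" for e a b s :: real using that by simp
  ultimately show ?thesis by blast
 qed
 ultimately have "scal \<in> borel_measurable vol" by simp
 thus ?thesis
  by (rule integrable_const_bound[OF AE_I2, rotated]) (use kern0_polar(2) in simp)
qed

text \<open>Here \<open>liouville\<close> replaces the Ricci curvature along the geodesics by that
  at their starting points, whose fibre integrals are explicit in
  \<open>kern0_polar\<close>.\<close>

lemma nn_integral_\<alpha>: "(\<integral>\<^sup>+p. \<alpha> p \<partial>vol) = ennreal (r ^ 3 / 3 * measure lborel (ball 0 1 :: (real^'n) set) *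
  (real CARD('n) * C * measure vol UNIV + (LINT p|vol. scal p)))"
proof -
 interpret finite_measure vol by (rule finite_measure_vol)
 let ?c = "r ^ 3 / 3 * measure lborel (ball 0 1 :: (real^'n) set)"
 let ?f = "\<lambda>p. ?c * (real CARD('n) * C + scal p)"
 have c: "?c \<ge> 0" using r(1) by simp
 have i: "integrable vol (\<lambda>p. real CARD('n) * C + scal p)"
  by (intro Bochner_Integration.integrable_add integrable_scalar_curvature) simp
 have "(\<integral>\<^sup>+p. \<alpha> p \<partial>vol) = (\<integral>\<^sup>+p. ennreal (?f p) \<partial>vol)"
  unfolding \<alpha>_def liouville kern0_polar(1) ..
 also have "\<dots> = ennreal (LINT p|vol. ?f p)"
 proof (rule nn_integral_eq_integral[OF integrable_mult_right[OF i] AE_I2])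
  fix p
  have "0 \<le> real CARD('n) * C + scal p" using kern0_polar(2)[of p] by linarith
  thus "0 \<le> ?f p" using c by (rule mult_nonneg_nonneg[rotated])
 qed
 also have "(LINT p|vol. ?f p) = ?c * (LINT p|vol. real CARD('n) * C + scal p)" by (rule integral_mult_right_zero)
 also have "(LINT p|vol. real CARD('n) * C + scal p) = real CARD('n) * C * measure vol UNIV + (LINT p|vol. scal p)"
  by (subst Bochner_Integration.integral_add[OF _ integrable_scalar_curvature]) simp_all
 finally show ?thesis .
qed

text \<open>The total of \<open>\<beta>\<close> minus the total of \<open>\<alpha>\<close>, as real
  numbers. The contributions of the artificial constant \<open>C\<close> to the two totals
  cancel.\<close>

definition defect :: real where
 "defect = (LINT z|SBM. bE z) - r ^ 3 / 3 * measure lborel (ball 0 1 :: (real^'n) set) *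
  (real CARD('n) * C * measure vol UNIV + (LINT p|vol. scal p))"

lemma average_mean_curvature_defect:
 "average_mean_curvature A g r = (real CARD('n) - 1) / r - average_scalar_curvature A g / (3 * real CARD('n)) * r
  - defect / (r^2 * measure SBM SB)"
proof -
 interpret finite_measure SBM by (rule finite_measure_SBM)
 define m where "m = measure lborel (ball 0 1 :: (real^'n) set)"
 define V where "V = measure vol UNIV"
 define N where "N = real CARD('n)"
 define S where "S = (LINT p|vol. scal p)"
 define I where "I = (LINT z|SBM. bE z)"
 have pos: "m > 0" "V > 0" "N > 0" "r > 0"
  using measure_ball_pos[where 'n = 'n] measure_vol_pos r(1) by (simp_all add: m_def V_def N_def)
 have M: "measure SBM SB = N * m * V" by (simp add: measure_SBM N_def m_def V_def)
 have "(LINT (p, v)|SBM. mean_curvature A g p r v) = (LINT z|SBM. ((N - 1) / r + C * r / 3) - bE z / r^2)"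
  by (rule Bochner_Integration.integral_cong[OF refl]) (auto simp: space_SBM mean_curvature_bE N_def)
 also have "\<dots> = ((N - 1) / r + C * r / 3) * measure SBM SB - I / r^2"
  unfolding I_def using integrable_bE by (subst Bochner_Integration.integral_diff) (simp_all add: space_SBM)
 finally have "average_mean_curvature A g r = 1 / (N * m * V) * (((N - 1) / r + C * r / 3) * (N * m * V) - I / r^2)"
  unfolding average_mean_curvature_def sphere_bundle_measure_eq M by simp
 also have "\<dots> = (N - 1) / r - S / V / (3 * N) * r - (I - r ^ 3 / 3 * m * (N * C * V + S)) / (r^2 * (N * m * V))"
  using pos by (simp add: field_simps power2_eq_square power3_eq_cube)
 finally show ?thesis
  unfolding M defect_def average_scalar_curvature_def volume_measure_eq by (simp add: N_def m_def V_def S_def I_def)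
qed

lemma defect_nonneg: "defect \<ge> 0"
proof -
 have "(LINT z|SBM. bE z) \<ge> 0" by (rule Bochner_Integration.integral_nonneg_AE[OF AE_I2]) (use bE_SB in \<open>simp add: space_SBM\<close>)
 moreover have "(\<integral>\<^sup>+p. \<alpha> p \<partial>vol) \<le> (\<integral>\<^sup>+p. \<beta> p \<partial>vol)" by (intro nn_integral_mono \<alpha>_le_\<beta>)
 ultimately show ?thesis unfolding nn_integral_\<alpha> nn_integral_\<beta> defect_def by (simp add: ennreal_le_iff)
qed

lemma measure_SBM_pos: "measure SBM SB > 0"
 unfolding measure_SBM using measure_ball_pos[where 'n = 'n] measure_vol_pos by simp

theorem average_mean_curvature_le:
 "average_mean_curvature A g r \<le> (real CARD('n) - 1) / r - average_scalar_curvature A g / (3 * real CARD('n)) * r"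
proof -
 have "0 \<le> defect / (r^2 * measure SBM SB)"
  using defect_nonneg measure_SBM_pos by (intro divide_nonneg_nonneg mult_nonneg_nonneg) simp_all
 thus ?thesis unfolding average_mean_curvature_defect by linarith
qed

section \<open>The case of equality\<close>

lemma continuous_riemv: "continuous_on UNIV (\<lambda>y. riemv h x w y y)"
 unfolding riemv_def by (intro continuous_intros continuous_on_vec_lambda)

lemma riemv_quadratic: "riemv h x w (t *R y) (t *R y) = t^2 *R riemv h x w y y"
 by (simp add: riemv_scale power2_eq_square)

text \<open>Equal fibre integrals force equality on almost every ray, where
  \<open>tau_equality\<close> at \<open>t = 0\<close> gives vanishing radial curvature at the
  centre. The set of bad directions is null and, by continuity, open, hence empty; homogeneity
  reaches the vectors outside the unit ball.\<close>

lemma radial_curvature_0: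
 assumes eq: "\<alpha> p = \<beta> p"
 shows "riemv (hE p) 0 w y y = 0"
proof -
 interpret nc: normal_coords "ball 0 (rh p)" "hE p" by (rule normal_coords_p)
 define a where "a y = ennreal (C * r ^ 3 / 3 + ray_ric p (sgn y)) * indicator pball y" for y
 define b where "b y = ennreal (bE (p, frm p (sgn y))) * indicator pball y" for y
 have am: "a \<in> borel_measurable lborel" unfolding a_def[abs_def] using kern1_polar(2) by simp
 have bm: "b \<in> borel_measurable lborel"
 proof -
  have "(\<lambda>z. ennreal (bE z)) \<in> borel_measurable Sig" using measurable_bE by simp
  note [measurable] = measurable_frame_coords[OF this, of p]
  have "(\<lambda>y. ennreal (bE (Psi (p, frm p y (ch p)))) * indicator pball y) \<in> borel_measurable lborel" by measurable
  moreover have "ennreal (bE (Psi (p, frm p y (ch p)))) * indicator pball y = b y" for y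
   by (cases "y \<in> pball") (simp_all add: Psi_frame b_def)
  ultimately show ?thesis by simp
 qed
 have le: "a y \<le> b y" for y
  unfolding a_def b_def using bE_bounds(1)[OF sgn_pball, of y p] by (cases "y \<in> pball") (simp_all add: ennreal_leI)
 have "of_nat CARD('n) * (LBNN y. a y) = of_nat CARD('n) * (LBNN y. b y)"
  using eq unfolding \<alpha>_def \<beta>_def kern1_polar(1) a_def b_def .
 hence ab: "(LBNN y. a y) = (LBNN y. b y)"
  by (simp add: ennreal_mult_cancel_left)
 \<comment> \<open>Equality almost everywhere follows from equal integrals only if these are finite,
   which the pointwise bound \<open>D\<close> provides.\<close>
 have "(LBNN y. b y) \<le> (LBNN y. ennreal D * indicator (pball :: (real^'n) set) y)"
  unfolding b_def using bE_bounds(2)[OF sgn_pball, of _ p] by (intro nn_integral_mono) (auto simp: indicator_def intro: ennreal_leI)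
 also have "\<dots> = ennreal D * emeasure lborel (pball :: (real^'n) set)" by (simp add: nn_integral_cmult_indicator)
 also have "\<dots> < \<infinity>" by (simp add: emeasure_pball ennreal_mult_less_top)
 finally have fin: "(LBNN y. a y) < \<infinity>" by (simp only: ab)
 have "AE y in lborel. a y = b y" by (rule nn_integral_eq_imp_AE[OF am bm le ab fin])
 hence AE: "AE y in lborel. y \<in> pball \<longrightarrow> riemv (hE p) 0 w y y = 0"
 proof (elim eventually_mono, intro impI)
  fix y assume ab: "a y = b y" and y: "y \<in> pball"
  let ?x = "sgn y"
  have x: "norm ?x = 1" by (rule sgn_pball[OF y])
  have "C * r ^ 3 / 3 + ray_ric p ?x = bE (p, frm p ?x)"
  proof -
   have nn: "0 \<le> C * r ^ 3 / 3 + ray_ric p ?x" by (rule ray_R1(2)[OF x])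
   hence "0 \<le> bE (p, frm p ?x)" using bE_bounds(1)[OF x] by (rule order_trans)
   with nn show ?thesis using ab y by (simp add: a_def b_def)
  qed
  hence e: "r * nc.tau (r *R ?x) = - integral {0..r} (\<lambda>t. t^2 * ricq (hE p) (t *R ?x) ?x)"
   by (simp add: bE_frame[OF x] ray_ric_def nc.tau_def)
  have "riemv (hE p) (0 *R ?x) w ?x ?x = 0"
   by (rule nc.tau_equality[OF r(1) _ e]) (use ray_in[OF x] r in simp_all)
  hence "riemv (hE p) 0 w (norm y *R ?x) (norm y *R ?x) = 0" by (simp add: riemv_quadratic)
  thus "riemv (hE p) 0 w y y = 0" using y by (simp add: sgn_div_norm)
 qed
 let ?Z = "{y \<in> pball. riemv (hE p) 0 w y y \<noteq> 0}"
 have "?Z = pball \<inter> (\<lambda>y. riemv (hE p) 0 w y y) -` (- {0})" by auto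
 moreover have "open (pball \<inter> (\<lambda>y. riemv (hE p) 0 w y y) -` (- {0}))"
  by (rule continuous_open_preimage[OF continuous_on_subset[OF continuous_riemv]]) auto
 ultimately have oZ: "open ?Z" by simp
 have "AE y in lborel. y \<notin> ?Z" using AE by (elim eventually_mono) blast
 hence "?Z \<in> null_sets lborel" using borel_open[OF oZ] by (subst AE_iff_null_sets) simp_all
 hence "negligible ?Z" by (simp add: negligible_iff_null_sets null_sets_completionI)
 hence Z: "?Z = {}" using open_not_negligible[OF oZ] by blast
 show ?thesis
 proof (cases "y = 0")
  case True
  thus ?thesis using riemv_quadratic[of "hE p" 0 w 0 y] by simp
 next
  case False
  let ?t = "1 / (2 * norm y)"
  have "?t *R y \<in> pball" using False by simp
  hence "riemv (hE p) 0 w (?t *R y) (?t *R y) = 0" using Z by blast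
  thus ?thesis using False unfolding riemv_quadratic by simp
 qed
qed

lemma curvature_0:
 assumes "\<alpha> p = \<beta> p" "c \<in> A" "p \<in> fst c"
 shows "riemv (gmat c) (snd c p) u v w = 0"
proof -
 let ?U = "{x \<in> ball 0 (rh p). Ex p x \<in> fst c}" and ?ph = "\<lambda>x. snd c (Ex p x)"
 interpret mp: metric_pullback ?U "Om c" "pull_metric (Ex p)" "gmat c" ?ph
  by (rule param_pullback[OF exp_diffeo_param(1)[OF rh] assms(2)])
 have E0: "Ex p 0 = p" by (rule exp_pull_metric_0(1)[OF frame_in frame_linear exp_diffeo_param(1)[OF rh]]) (use rh_pos in simp)
 have U0: "0 \<in> ?U" using E0 assms(3) rh_pos by simp
 have z: "riemv (pull_metric (Ex p)) 0 a b c = 0" for a b c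
  by (rule riemv_eq_0_of_radial[OF metric_hE[unfolded hE_def]])
   (use radial_curvature_0[OF assms(1), unfolded hE_def] rh_pos in simp_all)
 obtain a b d where abd: "u = dd ?ph 0 a" "v = dd ?ph 0 b" "w = dd ?ph 0 d"
  using surjD[OF mp.surj_D[OF U0], of u] surjD[OF mp.surj_D[OF U0], of v] surjD[OF mp.surj_D[OF U0], of w] by (elim exE)
 have "riemv (gmat c) (?ph 0) u v w = dd ?ph 0 (riemv (pull_metric (Ex p)) 0 a b d)"
  unfolding abd by (rule mp.riemv_transform[OF U0, symmetric])
 also have "\<dots> = 0" unfolding z by (rule linear_0[OF mp.linear_D[OF U0]])
 finally show ?thesis by (simp add: E0)
qed

text \<open>Equal totals give equal fibre integrals at almost every \<open>p\<close>, and there the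
  whole curvature tensor vanishes. A nonzero curvature component would persist on an open set, which
  has positive volume.\<close>

theorem flat_of_equality:
 assumes "average_mean_curvature A g r = (real CARD('n) - 1) / r - average_scalar_curvature A g / (3 * real CARD('n)) * r"
 shows "flat A g"
proof -
 have "defect = 0" using assms measure_SBM_pos r(1) unfolding average_mean_curvature_defect by simp
 hence e: "(LINT z|SBM. bE z) = r ^ 3 / 3 * measure lborel (ball 0 1 :: (real^'n) set) *
  (real CARD('n) * C * measure vol UNIV + (LINT p|vol. scal p))"
  unfolding defect_def by (rule eq_iff_diff_eq_0[THEN iffD2])
 have eq: "(\<integral>\<^sup>+p. \<alpha> p \<partial>vol) = (\<integral>\<^sup>+p. \<beta> p \<partial>vol)" unfolding nn_integral_\<alpha> nn_integral_\<beta> e ..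
 have "AE p in vol. \<alpha> p = \<beta> p"
  by (rule nn_integral_eq_imp_AE[OF measurable_\<alpha> measurable_\<beta> \<alpha>_le_\<beta> eq]) (simp add: nn_integral_\<alpha>)
 hence AE: "AE p in vol. \<forall>c\<in>A. p \<in> fst c \<longrightarrow> (\<forall>u v w. riemv (gmat c) (snd c p) u v w = 0)"
  by (elim eventually_mono) (intro ballI impI allI curvature_0)
 show ?thesis
  unfolding flat_def
 proof (intro ballI allI)
  fix c x l i j k assume c: "c \<in> A" and x: "x \<in> Om c"
  show "riemann A g c l i j k x = 0"
  proof (rule ccontr)
   assume nz: "riemann A g c l i j k x \<noteq> 0"
   let ?f = "\<lambda>x. riemv (gmat c) x (axis i 1) (axis j 1) (axis k 1) $ l"
   have f: "riemann A g c l i j k y = ?f y" for y by (simp add: riemann_eq_riem riem_eq_riemv)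
   have "continuous_on (Om c) ?f"
    by (intro continuous_intros smooth_on_continuous_on[OF smooth_on_riemv[OF metric_on_chart[OF c]]])
   hence "open (Om c \<inter> ?f -` (- {0}))" by (rule continuous_open_preimage[OF _ open_Om[OF c]]) auto
   from continuous_open_preimage[OF continuous_chart[OF c] open_dom[OF c] this]
   have oT: "open (fst c \<inter> snd c -` (Om c \<inter> ?f -` (- {0})))" .
   let ?T = "fst c \<inter> snd c -` (Om c \<inter> ?f -` (- {0}))"
   have "chart_inv c x \<in> ?T"
    using nz x chart_inv_in[OF c x] chart_chart_inv[OF c x] by (simp add: f)
   hence "emeasure vol ?T > 0" by (rule emeasure_vol_open_pos[OF oT])
   moreover have "AE p in vol. p \<notin> ?T" using AE by (elim eventually_mono) (use c in auto)
   hence "?T \<in> null_sets vol" using borel_open[OF oT] by (subst AE_iff_null_sets) simp_all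
   ultimately show False by (simp add: null_sets_def)
  qed
 qed
qed

end

theorem theorem5:
 fixes A :: "('a::{t2_space,second_countable_topology}, 'n::finite) chart set"
  and g :: "('a, 'n) metric_tensor"
 assumes "oriented_smooth_atlas A"
  and "riemannian_metric A g"
  and "geodesically_complete A g"
  and "compact (UNIV :: 'a set)"
 shows "(\<forall>r>0. ereal r < injectivity_radius A g \<longrightarrow>
      average_mean_curvature A g r \<le>
       (real CARD('n) - 1) / r - average_scalar_curvature A g / (3 * real CARD('n)) * r) \<and>
     ((\<exists>r>0. ereal r < injectivity_radius A g \<and>
      average_mean_curvature A g r =
       (real CARD('n) - 1) / r - average_scalar_curvature A g / (3 * real CARD('n)) * r)
     \<longrightarrow> flat A g)"
proof -
 interpret closed_manifold A g by unfold_locales (fact assms)+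
 have rad: "\<exists>r'. closed_manifold_radius A g r r'" if r: "r > 0" "ereal r < injectivity_radius A g" for r
 proof -
  \<comment> \<open>Density of the reals leaves room strictly between \<open>r\<close> and the
    infimum, so that at every point some exponential ball has radius beyond
    \<open>r'\<close>.\<close>
  obtain r' where r': "ereal r < ereal r'" "ereal r' < injectivity_radius A g" using ereal_dense2[OF r(2)] by (elim exE conjE)
  have "\<exists>\<rho>>r'. exp_diffeomorphism A g p \<rho>" for p
  proof -
   have "ereal r' < Sup {ereal \<rho> | \<rho>. \<rho> > 0 \<and> exp_diffeomorphism A g p \<rho>}"
    using r'(2) unfolding injectivity_radius_def by (rule order_less_le_trans) (rule INF_lower, simp)
   then show ?thesis unfolding less_Sup_iff by auto
  qed
  then have "closed_manifold_radius A g r r'" by unfold_locales (use r r' in auto)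
  then show ?thesis ..
 qed
 show ?thesis
  using closed_manifold_radius.average_mean_curvature_le closed_manifold_radius.flat_of_equality rad by metis
qed

end
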